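(* Let $n,k\ge1$. Then as $\mathfrak S_{k(n-1)+1}$-modules, $\rho_{n,k}\cong\beta_{n,k}\oplus\gamma_{n,k}$ for some $\mathfrak S_{k(n-1)+1}$-module $\gamma_{n,k}$ all of whose irreducible constituents $S^\lambda$ have Young diagrams with at most $k-1$ columns (i.e. $\lambda_1\le k-1$).
   Context: All vector spaces are over $\mathbb C$. For $n\ge 2$, a Filippov $n$-algebra is a vector space $L$ with an $n$-linear map $[\cdot,\dots,\cdot]:L^n\to L$ satisfying $[x_1,\dots,x_n]=\mathrm{sgn}(\sigma)[x_{\sigma(1)},\dots,x_{\sigma(n)}]$ for all $\sigma\in\mathfrak S_n$, and $[[x_1,\dots,x_n],x_{n+1},\dots,x_{2n-1}]=\sum_{i=1}^n[x_1,\dots,x_{i-1},[x_i,x_{n+1},\dots,x_{2n-1}],x_{i+1},\dots,x_n]$. The free Filippov $n$-algebra on a set $X$ is the vector space generated by all $n$-ary bracketings of elements of $X$, subject only to the relations that follow from $n$-linearity, antisymmetry and the generalized Jacobi identity. For $n\ge2$, $k\ge1$, $\rho_{n,k}$ is the multilinear component of the free Filippov $n$-algebra on $X=[k(n-1)+1]$ (the span of $n$-bracketed words in which each element of $X$ appears exactly once; these have $k$ brackets), an $\mathfrak S_{k(n-1)+1}$-module via permuting letters. By convention $\rho_{1,k}=S^1$. $S^\lambda$ is the Specht module indexed by $\lambda$. Define $\beta_{1,k}=S^1$, and for $n\ge2$ let $\beta_{n,k}$ be the $\mathfrak S_{k(n-1)+1}$-module whose decomposition into irreducibles is obtained from that of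 $\rho_{n-1,k}$ by adding a row of length $k$ to the top of each Young diagram (i.e. $S^\lambda\mapsto S^{(k,\lambda_1,\lambda_2,\dots)}$, multiplicities preserved). *)

theory Defs
  imports
    "HOL-Algebra.Module"
    "HOL-Algebra.AbelCoset"
    "HOL-Algebra.Group_Action"
    "HOL-Algebra.Sym_Groups"
    "HOL-Combinatorics.Combinatorics"
    "HOL-Decision_Procs.Algebra_Aux"
begin

section \<open>Complex representations of symmetric groups\<close>

text \<open>
  \<^term>\<open>sym_group m\<close> is the group of permutations of \<open>{1..m}\<close>, multiplied by composition, so the
  actions below are left actions.  The fields \<open>mult\<close> and \<open>one\<close> that a module record inherits from
  the ring record carry no meaning for modules and are left undefined.
\<close>

abbreviation complex_field :: "complex ring"
  where "complex_field \<equiv> cring_class_ops"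

record 'v sym_rep = "(complex, 'v) module" +
  act :: "(nat \<Rightarrow> nat) \<Rightarrow> 'v \<Rightarrow> 'v"

definition sym_module :: "nat \<Rightarrow> 'v sym_rep \<Rightarrow> bool"
  where "sym_module m V \<longleftrightarrow>
    Module.module complex_field V \<and>
    group_action (sym_group m) (carrier V) (\<lambda>p. restrict (act V p) (carrier V)) \<and>
    (\<forall>p\<in>carrier (sym_group m). \<forall>x\<in>carrier V. \<forall>y\<in>carrier V. \<forall>c.
      act V p (x \<oplus>\<^bsub>V\<^esub> y) = act V p x \<oplus>\<^bsub>V\<^esub> act V p y \<and>
      act V p (c \<odot>\<^bsub>V\<^esub> x) = c \<odot>\<^bsub>V\<^esub> act V p x)"

definition sym_iso :: "nat \<Rightarrow> 'v sym_rep \<Rightarrow> 'w sym_rep \<Rightarrow> bool"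
  where "sym_iso m V W \<longleftrightarrow> sym_module m V \<and> sym_module m W \<and>
    (\<exists>f. bij_betw f (carrier V) (carrier W) \<and>
      (\<forall>x\<in>carrier V. \<forall>y\<in>carrier V. f (x \<oplus>\<^bsub>V\<^esub> y) = f x \<oplus>\<^bsub>W\<^esub> f y) \<and>
      (\<forall>c. \<forall>x\<in>carrier V. f (c \<odot>\<^bsub>V\<^esub> x) = c \<odot>\<^bsub>W\<^esub> f x) \<and>
      (\<forall>p\<in>carrier (sym_group m). \<forall>x\<in>carrier V. f (act V p x) = act W p (f x)))"

definition rep_sum2 :: "'v sym_rep \<Rightarrow> 'w sym_rep \<Rightarrow> ('v \<times> 'w) sym_rep"
  where "rep_sum2 V W =
    \<lparr>carrier = carrier V \<times> carrier W, monoid.mult = undefined, one = undefined,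
     ring.zero = (\<zero>\<^bsub>V\<^esub>, \<zero>\<^bsub>W\<^esub>),
     ring.add = (\<lambda>x y. (fst x \<oplus>\<^bsub>V\<^esub> fst y, snd x \<oplus>\<^bsub>W\<^esub> snd y)),
     module.smult = (\<lambda>c x. (c \<odot>\<^bsub>V\<^esub> fst x, c \<odot>\<^bsub>W\<^esub> snd x)),
     act = (\<lambda>p x. (act V p (fst x), act W p (snd x)))\<rparr>"

text \<open>The direct sum of a list of representations (the zero module for the empty list).\<close>

definition rep_sum :: "'v sym_rep list \<Rightarrow> (nat \<Rightarrow> 'v) sym_rep"
  where "rep_sum Vs = (let I = {..<length Vs} in
    \<lparr>carrier = (\<Pi>\<^sub>E i\<in>I. carrier (Vs ! i)), monoid.mult = undefined, one = undefined,
     ring.zero = (\<lambda>i\<in>I. \<zero>\<^bsub>Vs ! i\<^esub>),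
     ring.add = (\<lambda>x y. \<lambda>i\<in>I. x i \<oplus>\<^bsub>Vs ! i\<^esub> y i),
     module.smult = (\<lambda>c x. \<lambda>i\<in>I. c \<odot>\<^bsub>Vs ! i\<^esub> x i),
     act = (\<lambda>p x. \<lambda>i\<in>I. act (Vs ! i) p (x i))\<rparr>)"

text \<open>
  A space \<open>C\<close> of functions on a basis \<open>'b\<close>, i.e. of formal linear combinations of elements of
  \<open>'b\<close>.  If \<open>a p\<close> is the action of \<open>p\<close> on basis elements, then sending each basis element \<open>b\<close> to
  \<open>a p b\<close> sends the coefficient function \<open>v\<close> to \<open>v \<circ> a (inv p)\<close>.
\<close>

definition fun_rep ::
    "((nat \<Rightarrow> nat) \<Rightarrow> 'b \<Rightarrow> 'b) \<Rightarrow> ('b \<Rightarrow> complex) set \<Rightarrow> ('b \<Rightarrow> complex) sym_rep"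
  where "fun_rep a C =
    \<lparr>carrier = C, monoid.mult = undefined, one = undefined,
     ring.zero = (\<lambda>_. 0),
     ring.add = (\<lambda>u v b. u b + v b),
     module.smult = (\<lambda>c v b. c * v b),
     act = (\<lambda>p v b. v (a (inv' p) b))\<rparr>"

definition rep_quotient :: "'v sym_rep \<Rightarrow> 'v set \<Rightarrow> 'v set sym_rep"
  where "rep_quotient V I =
    \<lparr>carrier = a_rcosets\<^bsub>V\<^esub> I, monoid.mult = undefined, one = undefined,
     ring.zero = I,
     ring.add = set_add V,
     module.smult = (\<lambda>c A. \<Union>x\<in>A. I +>\<^bsub>V\<^esub> (c \<odot>\<^bsub>V\<^esub> x)),
     act = (\<lambda>p A. act V p ` A)\<rparr>"


section \<open>Specht modules\<close>

text \<open>A partition is the weakly decreasing list of its parts, that is, of the row lengths of its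
  Young diagram.\<close>

definition partition_of :: "nat \<Rightarrow> nat list \<Rightarrow> bool"
  where "partition_of m l \<longleftrightarrow> sorted_wrt (\<ge>) l \<and> 0 \<notin> set l \<and> sum_list l = m"

definition cells :: "nat list \<Rightarrow> (nat \<times> nat) set"
  where "cells l = {(i, j). i < length l \<and> j < l ! i}"

definition tableaux :: "nat list \<Rightarrow> (nat \<times> nat \<Rightarrow> nat) set"
  where "tableaux l = {t \<in> extensional (cells l). bij_betw t (cells l) {1..sum_list l}}"

text \<open>A tabloid (class of tableaux up to reordering each row) is the list of its sets of row
  entries.\<close>

definition tabloid :: "nat list \<Rightarrow> (nat \<times> nat \<Rightarrow> nat) \<Rightarrow> nat set list"
  where "tabloid l t = map (\<lambda>i. (\<lambda>j. t (i, j)) ` {..<l ! i}) [0..<length l]"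

definition column_stabilizer :: "nat list \<Rightarrow> (nat \<times> nat \<Rightarrow> nat) \<Rightarrow> (nat \<Rightarrow> nat) set"
  where "column_stabilizer l t = {p. p permutes {1..sum_list l} \<and>
    (\<forall>(i, j)\<in>cells l. \<exists>i'. (i', j) \<in> cells l \<and> p (t (i, j)) = t (i', j))}"

definition polytabloid :: "nat list \<Rightarrow> (nat \<times> nat \<Rightarrow> nat) \<Rightarrow> nat set list \<Rightarrow> complex"
  where "polytabloid l t = (\<lambda>T. \<Sum>p\<in>column_stabilizer l t.
    if T = tabloid l (p \<circ> t) then of_int (sign p) else 0)"

text \<open>The span of the polytabloids, so that \<open>[m]\<close> gives the trivial representation.  For a partition
  of \<open>m\<close> these are, up to isomorphism, exactly the irreducible complex representations of the
  symmetric group on \<open>m\<close> letters.\<close>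

definition specht :: "nat list \<Rightarrow> (nat set list \<Rightarrow> complex) sym_rep"
  where "specht l = fun_rep (\<lambda>p. map (image p))
    {(\<lambda>T. \<Sum>t\<in>tableaux l. c t * polytabloid l t T) | c. True}"

type_synonym specht_sum_rep = "(nat \<Rightarrow> nat set list \<Rightarrow> complex) sym_rep"

definition specht_sum :: "nat list list \<Rightarrow> specht_sum_rep"
  where "specht_sum ls = rep_sum (map specht ls)"

text \<open>\<open>ls\<close> indexes the irreducible constituents of \<open>V\<close>, each repeated according to its
  multiplicity; it is unique up to reordering.\<close>

definition decomposition :: "nat \<Rightarrow> 'v sym_rep \<Rightarrow> nat list list \<Rightarrow> bool"
  where "decomposition m V ls \<longleftrightarrow>
    (\<forall>l\<in>set ls. partition_of m l) \<and> sym_iso m V (specht_sum ls)"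


section \<open>Free Filippov algebras\<close>

datatype 'a word = Letter 'a | Bracket "'a word list"

inductive_set words :: "nat \<Rightarrow> 'a set \<Rightarrow> 'a word set" for n X
  where
    "x \<in> X \<Longrightarrow> Letter x \<in> words n X"
  | "length ws = n \<Longrightarrow> (\<And>w. w \<in> set ws \<Longrightarrow> w \<in> words n X) \<Longrightarrow> Bracket ws \<in> words n X"

text \<open>The vector space with basis \<^term>\<open>words n X\<close>, as finitely supported functions.\<close>

definition free_space :: "nat \<Rightarrow> 'a set \<Rightarrow> ('a word \<Rightarrow> complex) set"
  where "free_space n X = {v. finite {w. v w \<noteq> 0} \<and> {w. v w \<noteq> 0} \<subseteq> words n X}"

text \<open>The multilinear extension of the bracketing of words.\<close>

definition bracket :: "('a word \<Rightarrow> complex) list \<Rightarrow> 'a word \<Rightarrow> complex"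
  where "bracket vs = (\<lambda>w. case w of
      Letter x \<Rightarrow> 0
    | Bracket ws \<Rightarrow> if length ws = length vs then \<Prod>i<length vs. (vs ! i) (ws ! i) else 0)"

text \<open>The ideal generated by antisymmetry and the generalized Jacobi identity.\<close>

inductive_set filippov_ideal :: "nat \<Rightarrow> 'a set \<Rightarrow> ('a word \<Rightarrow> complex) set" for n X
  where
    antisymmetry: "length xs = n \<Longrightarrow> set xs \<subseteq> free_space n X \<Longrightarrow> p permutes {..<n} \<Longrightarrow>
      (\<lambda>w. bracket xs w - of_int (sign p) * bracket (permute_list p xs) w)
        \<in> filippov_ideal n X"
  | jacobi: "length xs = n \<Longrightarrow> length ys = n - 1 \<Longrightarrow>
      set xs \<subseteq> free_space n X \<Longrightarrow> set ys \<subseteq> free_space n X \<Longrightarrow>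
      (\<lambda>w. bracket (bracket xs # ys) w - (\<Sum>i<n. bracket (xs[i := bracket (xs ! i # ys)]) w))
        \<in> filippov_ideal n X"
  | bracket: "length xs = n \<Longrightarrow> set xs \<subseteq> free_space n X \<Longrightarrow> i < n \<Longrightarrow>
      v \<in> filippov_ideal n X \<Longrightarrow> bracket (xs[i := v]) \<in> filippov_ideal n X"
  | zero: "(\<lambda>w. 0) \<in> filippov_ideal n X"
  | add: "u \<in> filippov_ideal n X \<Longrightarrow> v \<in> filippov_ideal n X \<Longrightarrow>
      (\<lambda>w. u w + v w) \<in> filippov_ideal n X"
  | scale: "v \<in> filippov_ideal n X \<Longrightarrow> (\<lambda>w. c * v w) \<in> filippov_ideal n X"

definition free_filippov :: "nat \<Rightarrow> nat set \<Rightarrow> (nat word \<Rightarrow> complex) set sym_rep"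
  where "free_filippov n X =
    rep_quotient (fun_rep map_word (free_space n X)) (filippov_ideal n X)"

primrec letters :: "'a word \<Rightarrow> 'a list"
  where
    "letters (Letter x) = [x]"
  | "letters (Bracket ws) = concat (map letters ws)"

definition multilinear_space :: "nat \<Rightarrow> 'a set \<Rightarrow> ('a word \<Rightarrow> complex) set"
  where "multilinear_space n X = {v \<in> free_space n X.
    \<forall>w. v w \<noteq> 0 \<longrightarrow> distinct (letters w) \<and> set (letters w) = X}"

text \<open>The image of the multilinear words' span in the free Filippov algebra on \<open>X\<close>.\<close>

definition multilinear_component :: "nat \<Rightarrow> nat set \<Rightarrow> (nat word \<Rightarrow> complex) set sym_rep"
  where "multilinear_component n X = (free_filippov n X)
    \<lparr>carrier := {filippov_ideal n X +>\<^bsub>fun_rep map_word (free_space n X)\<^esub> v | v.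
      v \<in> multilinear_space n X}\<rparr>"


section \<open>The modules $\rho_{n,k}$ and $\beta_{n,k}$\<close>

text \<open>The number of letters in a multilinear word with \<open>k\<close> brackets.\<close>

definition num_letters :: "nat \<Rightarrow> nat \<Rightarrow> nat"
  where "num_letters n k = k * (n - 1) + 1"

text \<open>\<open>V\<close> is isomorphic to $\rho_{n,k}$.  This is a predicate on \<open>V\<close> because the convention for
  \<open>n = 1\<close> and the construction for \<open>n \<ge> 2\<close> yield modules of different types.\<close>

definition is_rho :: "nat \<Rightarrow> nat \<Rightarrow> 'v sym_rep \<Rightarrow> bool"
  where "is_rho n k V \<longleftrightarrow>
    (if n = 1 then sym_iso (num_letters n k) V (specht [1])
     else sym_iso (num_letters n k) V (multilinear_component n {1..num_letters n k}))"

text \<open>\<open>V\<close> is isomorphic to $\beta_{n,k}$.  Adding a row of length \<open>k\<close> on top of the diagram of \<open>l\<close>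
  makes sense only if \<open>hd l \<le> k\<close>, so \<^term>\<open>partition_of (num_letters n k) (k # l)\<close>, which is part
  of the second decomposition, belongs to the well-definedness of $\beta_{n,k}$.\<close>

definition is_beta :: "nat \<Rightarrow> nat \<Rightarrow> 'v sym_rep \<Rightarrow> bool"
  where "is_beta n k V \<longleftrightarrow>
    (if n = 1 then sym_iso (num_letters n k) V (specht [1])
     else \<exists>ls. (\<forall>l\<in>set ls. partition_of (num_letters (n - 1) k) l) \<and>
       is_rho (n - 1) k (specht_sum ls) \<and>
       decomposition (num_letters n k) V (map ((#) k) ls))"

end

theory Submission
  imports Defs
begin

text \<open>
  In the span of the multilinear words, $\rho_{n,k}$ is the orthogonal complement of the ideal.
  A word with \<open>k\<close> brackets has two of any \<open>k + 1\<close> given letters as entries of one bracket, so by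
  antisymmetry the symmetrization over \<open>k + 1\<close> letters vanishes on $\rho_{n,k}$, and its constituents
  have at most \<open>k\<close> columns.  In a module with this property the constituents with exactly \<open>k\<close> columns
  can be read off the invariants of the symmetric group on the set \<open>K\<close> of the last \<open>k\<close> letters:
  each $S^{(k,\lambda)}$ contributes $S^\lambda$, and nothing else contributes.  This is seen by mapping the module to functions on
  tabloids with first row of length \<open>k\<close> and comparing with Specht modules through the values on the
  tabloids with first row \<open>K\<close>.  The invariants of $\rho_{n,k}$ are $\rho_{n-1,k}$: in an invariant
  every bracket contains one letter of \<open>K\<close>, and erasing these letters is inverse, up to the factor
  \<open>k!\<close>, to inserting them in all possible ways.
\<close>

section \<open>Modules over symmetric groups\<close>

text \<open>Neither characters nor the classification of irreducibles is assumed: that each module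
  here is a sum of Specht modules is itself a consequence of row removal. On a module over
  \<open>m\<close> letters, symmetrization over \<open>m + 1\<close> letters vanishes vacuously.
  Lowering this bound one by one, each step splits off the constituents with first row exactly
  \<open>k\<close>; their lower rows come from decomposing the invariants of \<open>K\<close>, a
  module over only \<open>m - k\<close> letters. So there is an induction on \<open>m\<close> with
  an inner induction on the bound.

  All modules are realized by functions on a finite permuted set. The standard Hermitian product is
  then invariant and supplies every complement and a canonical representative of every class modulo
  the ideal.

  The obstacle is that erasing the letters of \<open>K\<close> must respect the ideal. It does
  because it comes from a homomorphism into an algebra with one extra basis vector, to which all
  letters of \<open>K\<close> are sent. Inserting respects the ideal because a Filippov algebra with
  one entry fixed is a Filippov algebra of arity one less. The factor \<open>k!\<close> counts the
  ways to place the \<open>k\<close> letters of \<open>K\<close> in the \<open>k\<close>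
  brackets.\<close>

lemma sym_moduleI:
  fixes V (structure)
  assumes add: "\<And>x y. x \<in> carrier V \<Longrightarrow> y \<in> carrier V \<Longrightarrow> x \<oplus> y \<in> carrier V"
    and zero: "\<zero> \<in> carrier V"
    and assoc: "\<And>x y z. x \<in> carrier V \<Longrightarrow> y \<in> carrier V \<Longrightarrow> z \<in> carrier V \<Longrightarrow>
      (x \<oplus> y) \<oplus> z = x \<oplus> (y \<oplus> z)"
    and comm: "\<And>x y. x \<in> carrier V \<Longrightarrow> y \<in> carrier V \<Longrightarrow> x \<oplus> y = y \<oplus> x"
    and l_zero: "\<And>x. x \<in> carrier V \<Longrightarrow> \<zero> \<oplus> x = x"
    and l_inv: "\<And>x. x \<in> carrier V \<Longrightarrow> \<exists>y\<in>carrier V. y \<oplus> x = \<zero>"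
    and smult: "\<And>c x. x \<in> carrier V \<Longrightarrow> c \<odot> x \<in> carrier V"
    and l_distr: "\<And>c d x. x \<in> carrier V \<Longrightarrow> (c + d) \<odot> x = c \<odot> x \<oplus> d \<odot> x"
    and r_distr: "\<And>c x y. x \<in> carrier V \<Longrightarrow> y \<in> carrier V \<Longrightarrow>
      c \<odot> (x \<oplus> y) = c \<odot> x \<oplus> c \<odot> y"
    and smult_assoc: "\<And>c d x. x \<in> carrier V \<Longrightarrow> (c * d) \<odot> x = c \<odot> (d \<odot> x)"
    and smult_one: "\<And>x. x \<in> carrier V \<Longrightarrow> 1 \<odot> x = x"
    and act: "\<And>p x. p permutes {1..m} \<Longrightarrow> x \<in> carrier V \<Longrightarrow> act V p x \<in> carrier V"
    and act_id: "\<And>x. x \<in> carrier V \<Longrightarrow> act V id x = x"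
    and act_comp: "\<And>p q x. p permutes {1..m} \<Longrightarrow> q permutes {1..m} \<Longrightarrow> x \<in> carrier V \<Longrightarrow>
      act V (p \<circ> q) x = act V p (act V q x)"
    and act_add: "\<And>p x y. p permutes {1..m} \<Longrightarrow> x \<in> carrier V \<Longrightarrow> y \<in> carrier V \<Longrightarrow>
      act V p (x \<oplus> y) = act V p x \<oplus> act V p y"
    and act_smult: "\<And>p c x. p permutes {1..m} \<Longrightarrow> x \<in> carrier V \<Longrightarrow>
      act V p (c \<odot> x) = c \<odot> act V p x"
  shows "sym_module m V"
proof -
  have "abelian_group V"
    by (rule abelian_groupI) (use add zero assoc comm l_zero l_inv in auto)
  then have "Module.module complex_field V"
    by (intro moduleI cring_class) (use smult l_distr r_distr smult_assoc smult_one in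
        \<open>auto simp: class_simps cring_class_ops_def\<close>)
  moreover have "group_action (sym_group m) (carrier V) (\<lambda>p. restrict (act V p) (carrier V))"
  proof -
    have bij: "restrict (act V p) (carrier V) \<in> Bij (carrier V)" if "p permutes {1..m}" for p
    proof -
      have "bij_betw (act V p) (carrier V) (carrier V)"
      proof (rule bij_betw_byWitness[where f' = "act V (inv' p)"])
        show "\<forall>x\<in>carrier V. act V (inv' p) (act V p x) = x"
          using that act_comp[of "inv' p" p] act_id
          by (metis permutes_inv permutes_inv_o(2))
        show "\<forall>x\<in>carrier V. act V p (act V (inv' p) x) = x"
          using that act_comp[of p "inv' p"] act_id
          by (metis permutes_inv permutes_inv_o(1))
      qed (use that act permutes_inv in blast)+
      then show ?thesis
        by (simp add: Bij_def cong: bij_betw_cong)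
    qed
    have "(\<lambda>p. restrict (act V p) (carrier V)) \<in> hom (sym_group m) (BijGroup (carrier V))"
    proof (rule homI)
      fix p q assume pq: "p \<in> carrier (sym_group m)" "q \<in> carrier (sym_group m)"
      then show "restrict (act V (p \<otimes>\<^bsub>sym_group m\<^esub> q)) (carrier V) =
        restrict (act V p) (carrier V) \<otimes>\<^bsub>BijGroup (carrier V)\<^esub> restrict (act V q) (carrier V)"
        using bij[of p] bij[of q] act_comp act
        by (auto simp: BijGroup_def sym_group_def compose_def fun_eq_iff)
    qed (use bij in \<open>simp add: BijGroup_def sym_group_def\<close>)
    then show ?thesis
      by (auto simp: group_action_def group_hom_def group_hom_axioms_def
          group_BijGroup sym_group_is_group)
  qed
  ultimately show ?thesis
    using act_add act_smult by (simp add: sym_module_def sym_group_carrier)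
qed

context
  fixes m and V (structure)
  assumes V: "sym_module m V"
begin

interpretation VM: Module.module complex_field V
  using V by (simp add: sym_module_def)

interpretation VA: group_action "sym_group m" "carrier V" "\<lambda>p. restrict (act V p) (carrier V)"
  using V by (simp add: sym_module_def)

lemma sym_module_act_closed:
  "p permutes {1..m} \<Longrightarrow> x \<in> carrier V \<Longrightarrow> act V p x \<in> carrier V"
  using VA.element_image[of p x] by (simp add: sym_group_carrier)

lemma sym_module_act_comp:
  "p permutes {1..m} \<Longrightarrow> q permutes {1..m} \<Longrightarrow> x \<in> carrier V \<Longrightarrow>
    act V (p \<circ> q) x = act V p (act V q x)"
  using VA.composition_rule[of x p q] sym_module_act_closed[of q x]
  by (simp add: sym_group_carrier sym_group_mult)

lemma sym_module_act_id: "x \<in> carrier V \<Longrightarrow> act V id x = x"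
  using VA.id_eq_one by (metis restrict_apply sym_group_one)

lemma sym_module_act_linear:
  assumes "p permutes {1..m}" "x \<in> carrier V"
  shows "y \<in> carrier V \<Longrightarrow> act V p (x \<oplus> y) = act V p x \<oplus> act V p y"
    and "act V p (c \<odot> x) = c \<odot> act V p x"
  using assms V by (auto simp: sym_module_def sym_group_carrier)

lemma sym_module_closed:
  "\<zero> \<in> carrier V"
  "x \<in> carrier V \<Longrightarrow> y \<in> carrier V \<Longrightarrow> x \<oplus> y \<in> carrier V"
  "x \<in> carrier V \<Longrightarrow> c \<odot> x \<in> carrier V"
  using VM.smult_closed by (auto simp: class_simps)

lemma sym_module_laws:
  "x \<in> carrier V \<Longrightarrow> y \<in> carrier V \<Longrightarrow> z \<in> carrier V \<Longrightarrow> (x \<oplus> y) \<oplus> z = x \<oplus> (y \<oplus> z)"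
  "x \<in> carrier V \<Longrightarrow> y \<in> carrier V \<Longrightarrow> x \<oplus> y = y \<oplus> x"
  "x \<in> carrier V \<Longrightarrow> \<zero> \<oplus> x = x"
  "x \<in> carrier V \<Longrightarrow> \<exists>y\<in>carrier V. y \<oplus> x = \<zero>"
  "x \<in> carrier V \<Longrightarrow> (c + d) \<odot> x = c \<odot> x \<oplus> d \<odot> x"
  "x \<in> carrier V \<Longrightarrow> y \<in> carrier V \<Longrightarrow> c \<odot> (x \<oplus> y) = c \<odot> x \<oplus> c \<odot> y"
  "x \<in> carrier V \<Longrightarrow> (c * d) \<odot> x = c \<odot> (d \<odot> x)"
  "x \<in> carrier V \<Longrightarrow> 1 \<odot> x = x"
  using VM.smult_l_distr[of c d x] VM.smult_r_distr[of c x y] VM.smult_assoc1[of c d x]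
    VM.smult_one[of x] VM.M.add.m_assoc VM.M.add.m_comm VM.M.l_zero
    VM.M.add.l_inv_ex
  by (auto simp: class_simps)

lemma sym_module_zero_smult: "x \<in> carrier V \<Longrightarrow> 0 \<odot> x = \<zero>"
  using VM.smult_l_null[of x] by (simp add: class_simps)

end

text \<open>The module axioms of \<open>W\<close> are transported along \<open>f\<close>, so only
  \<open>V\<close> has to be a module beforehand. Zeros are a separate condition because the zero of
  \<open>W\<close> is a mere record field until \<open>W\<close> is known to be a module.\<close>

lemma sym_isoI:
  assumes V: "sym_module m V"
    and bij: "bij_betw f (carrier V) (carrier W)"
    and zero: "f \<zero>\<^bsub>V\<^esub> = \<zero>\<^bsub>W\<^esub>"
    and add: "\<And>x y. x \<in> carrier V \<Longrightarrow> y \<in> carrier V \<Longrightarrow> f (x \<oplus>\<^bsub>V\<^esub> y) = f x \<oplus>\<^bsub>W\<^esub> f y"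
    and smult: "\<And>c x. x \<in> carrier V \<Longrightarrow> f (c \<odot>\<^bsub>V\<^esub> x) = c \<odot>\<^bsub>W\<^esub> f x"
    and act: "\<And>p x. p permutes {1..m} \<Longrightarrow> x \<in> carrier V \<Longrightarrow> f (act V p x) = act W p (f x)"
  shows "sym_iso m V W"
proof -
  note cl = sym_module_closed[OF V] sym_module_act_closed[OF V]
  note laws = sym_module_laws[OF V]
  have im: "\<exists>x\<in>carrier V. y = f x" if "y \<in> carrier W" for y
    using that bij by (auto simp: bij_betw_def)
  have f: "f x \<in> carrier W" if "x \<in> carrier V" for x
    using that bij by (auto simp: bij_betw_def)
  have "sym_module m W"
  proof (rule sym_moduleI)
    fix x y z c d p q assume x: "x \<in> carrier W" and y: "y \<in> carrier W" and z: "z \<in> carrier W"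
    obtain x' y' z' where eq: "x = f x'" "y = f y'" "z = f z'"
      and in_V: "x' \<in> carrier V" "y' \<in> carrier V" "z' \<in> carrier V"
      using im x y z by meson
    show "x \<oplus>\<^bsub>W\<^esub> y \<in> carrier W" "x \<oplus>\<^bsub>W\<^esub> y \<oplus>\<^bsub>W\<^esub> z = x \<oplus>\<^bsub>W\<^esub> (y \<oplus>\<^bsub>W\<^esub> z)"
      using in_V by (simp_all add: eq add[symmetric] cl f laws(1))
    show "x \<oplus>\<^bsub>W\<^esub> y = y \<oplus>\<^bsub>W\<^esub> x"
      using in_V laws(2)[of x' y'] by (metis eq(1,2) add)
    show "\<zero>\<^bsub>W\<^esub> \<oplus>\<^bsub>W\<^esub> x = x"
      using in_V by (simp add: eq zero[symmetric] add[symmetric] cl laws(3))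
    show "\<exists>y\<in>carrier W. y \<oplus>\<^bsub>W\<^esub> x = \<zero>\<^bsub>W\<^esub>"
      using in_V laws(4)[of x'] f by (metis eq(1) zero add)
    show "c \<odot>\<^bsub>W\<^esub> x \<in> carrier W" "(c + d) \<odot>\<^bsub>W\<^esub> x = c \<odot>\<^bsub>W\<^esub> x \<oplus>\<^bsub>W\<^esub> d \<odot>\<^bsub>W\<^esub> x"
      "c \<odot>\<^bsub>W\<^esub> (x \<oplus>\<^bsub>W\<^esub> y) = c \<odot>\<^bsub>W\<^esub> x \<oplus>\<^bsub>W\<^esub> c \<odot>\<^bsub>W\<^esub> y"
      "(c * d) \<odot>\<^bsub>W\<^esub> x = c \<odot>\<^bsub>W\<^esub> (d \<odot>\<^bsub>W\<^esub> x)" "1 \<odot>\<^bsub>W\<^esub> x = x"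
      using in_V by (simp_all add: eq add[symmetric] smult[symmetric] cl f laws(5-))
    show "act W id x = x"
      using in_V act[of id x'] sym_module_act_id[OF V] by (simp add: eq permutes_id)
    assume p: "p permutes {1..m}"
    then show "act W p x \<in> carrier W" "act W p (x \<oplus>\<^bsub>W\<^esub> y) = act W p x \<oplus>\<^bsub>W\<^esub> act W p y"
      "act W p (c \<odot>\<^bsub>W\<^esub> x) = c \<odot>\<^bsub>W\<^esub> act W p x"
      using in_V by (simp_all add: eq add[symmetric] smult[symmetric] act[symmetric] cl f
          sym_module_act_linear[OF V])
    assume "q permutes {1..m}"
    then show "act W (p \<circ> q) x = act W p (act W q x)"
      using p in_V by (simp add: eq act[symmetric] permutes_compose cl sym_module_act_comp[OF V])
  qed (use cl f zero in metis)
  then show ?thesis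
    unfolding sym_iso_def using V bij add smult act by (auto simp: sym_group_carrier)
qed

lemma sym_isoE:
  assumes "sym_iso m V W"
  obtains f where "bij_betw f (carrier V) (carrier W)" "f \<zero>\<^bsub>V\<^esub> = \<zero>\<^bsub>W\<^esub>"
    "\<And>x y. x \<in> carrier V \<Longrightarrow> y \<in> carrier V \<Longrightarrow> f (x \<oplus>\<^bsub>V\<^esub> y) = f x \<oplus>\<^bsub>W\<^esub> f y"
    "\<And>c x. x \<in> carrier V \<Longrightarrow> f (c \<odot>\<^bsub>V\<^esub> x) = c \<odot>\<^bsub>W\<^esub> f x"
    "\<And>p x. p permutes {1..m} \<Longrightarrow> x \<in> carrier V \<Longrightarrow> f (act V p x) = act W p (f x)"
proof -
  from assms obtain f where f: "bij_betw f (carrier V) (carrier W)"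
    "\<And>x y. x \<in> carrier V \<Longrightarrow> y \<in> carrier V \<Longrightarrow> f (x \<oplus>\<^bsub>V\<^esub> y) = f x \<oplus>\<^bsub>W\<^esub> f y"
    "\<And>c x. x \<in> carrier V \<Longrightarrow> f (c \<odot>\<^bsub>V\<^esub> x) = c \<odot>\<^bsub>W\<^esub> f x"
    "\<And>p x. p permutes {1..m} \<Longrightarrow> x \<in> carrier V \<Longrightarrow> f (act V p x) = act W p (f x)"
    unfolding sym_iso_def Ball_def sym_group_carrier by blast
  have V: "sym_module m V" and W: "sym_module m W"
    using assms by (auto simp: sym_iso_def)
  have "f \<zero>\<^bsub>V\<^esub> = f (0 \<odot>\<^bsub>V\<^esub> \<zero>\<^bsub>V\<^esub>)"
    by (simp add: sym_module_zero_smult[OF V] sym_module_closed[OF V])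
  also have "\<dots> = \<zero>\<^bsub>W\<^esub>"
    using f(1) by (simp add: f(3) sym_module_closed[OF V] sym_module_zero_smult[OF W] bij_betw_apply)
  finally show thesis using that f by blast
qed

lemma sym_iso_modules: "sym_iso m V W \<Longrightarrow> sym_module m V" "sym_iso m V W \<Longrightarrow> sym_module m W"
  by (auto simp: sym_iso_def)

lemma sym_iso_refl: "sym_module m V \<Longrightarrow> sym_iso m V V"
  by (rule sym_isoI[where f = id]) auto

lemma sym_iso_sym:
  assumes "sym_iso m V W"
  shows "sym_iso m W V"
proof -
  note V = sym_iso_modules(1)[OF assms] and W = sym_iso_modules(2)[OF assms]
  obtain f where f: "bij_betw f (carrier V) (carrier W)" "f \<zero>\<^bsub>V\<^esub> = \<zero>\<^bsub>W\<^esub>"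
    "\<And>x y. x \<in> carrier V \<Longrightarrow> y \<in> carrier V \<Longrightarrow> f (x \<oplus>\<^bsub>V\<^esub> y) = f x \<oplus>\<^bsub>W\<^esub> f y"
    "\<And>c x. x \<in> carrier V \<Longrightarrow> f (c \<odot>\<^bsub>V\<^esub> x) = c \<odot>\<^bsub>W\<^esub> f x"
    "\<And>p x. p permutes {1..m} \<Longrightarrow> x \<in> carrier V \<Longrightarrow> f (act V p x) = act W p (f x)"
    using sym_isoE[OF assms] by blast
  define g where "g = inv_into (carrier V) f"
  have gf: "g (f x) = x" if "x \<in> carrier V" for x
    using that f(1) by (simp add: g_def bij_betw_def)
  have fg: "\<exists>x'\<in>carrier V. x = f x'" if "x \<in> carrier W" for x
    using that f(1) by (auto simp: bij_betw_def)
  note cl = sym_module_closed[OF V] sym_module_act_closed[OF V]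
  show ?thesis
  proof (rule sym_isoI[OF W, where f = g])
    show "bij_betw g (carrier W) (carrier V)"
      using f(1) by (simp add: g_def bij_betw_inv_into)
    show "g \<zero>\<^bsub>W\<^esub> = \<zero>\<^bsub>V\<^esub>"
      by (metis f(2) gf cl(1))
  next
    fix x y assume "x \<in> carrier W" "y \<in> carrier W"
    then show "g (x \<oplus>\<^bsub>W\<^esub> y) = g x \<oplus>\<^bsub>V\<^esub> g y"
      by (metis f(3) gf fg cl(2))
  next
    fix c x assume "x \<in> carrier W"
    then show "g (c \<odot>\<^bsub>W\<^esub> x) = c \<odot>\<^bsub>V\<^esub> g x"
      by (metis f(4) gf fg cl(3))
  next
    fix p x assume "p permutes {1..m}" "x \<in> carrier W"
    then show "g (act W p x) = act V p (g x)"
      by (metis f(5) gf fg cl(4))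
  qed
qed

lemma sym_iso_trans:
  assumes "sym_iso m U V" "sym_iso m V W"
  shows "sym_iso m U W"
proof -
  obtain f where f: "bij_betw f (carrier U) (carrier V)" "f \<zero>\<^bsub>U\<^esub> = \<zero>\<^bsub>V\<^esub>"
    "\<And>x y. x \<in> carrier U \<Longrightarrow> y \<in> carrier U \<Longrightarrow> f (x \<oplus>\<^bsub>U\<^esub> y) = f x \<oplus>\<^bsub>V\<^esub> f y"
    "\<And>c x. x \<in> carrier U \<Longrightarrow> f (c \<odot>\<^bsub>U\<^esub> x) = c \<odot>\<^bsub>V\<^esub> f x"
    "\<And>p x. p permutes {1..m} \<Longrightarrow> x \<in> carrier U \<Longrightarrow> f (act U p x) = act V p (f x)"
    using sym_isoE[OF assms(1)] by blast
  obtain g where g: "bij_betw g (carrier V) (carrier W)" "g \<zero>\<^bsub>V\<^esub> = \<zero>\<^bsub>W\<^esub>"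
    "\<And>x y. x \<in> carrier V \<Longrightarrow> y \<in> carrier V \<Longrightarrow> g (x \<oplus>\<^bsub>V\<^esub> y) = g x \<oplus>\<^bsub>W\<^esub> g y"
    "\<And>c x. x \<in> carrier V \<Longrightarrow> g (c \<odot>\<^bsub>V\<^esub> x) = c \<odot>\<^bsub>W\<^esub> g x"
    "\<And>p x. p permutes {1..m} \<Longrightarrow> x \<in> carrier V \<Longrightarrow> g (act V p x) = act W p (g x)"
    using sym_isoE[OF assms(2)] by blast
  have fV: "f x \<in> carrier V" if "x \<in> carrier U" for x
    using that f(1) by (auto simp: bij_betw_def)
  show ?thesis
    by (rule sym_isoI[OF sym_iso_modules(1)[OF assms(1)], where f = "g \<circ> f"])
      (use bij_betw_trans[OF f(1) g(1)] f g fV in auto)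
qed

section \<open>Direct sums\<close>

lemma sym_module_rep_sum2:
  assumes V: "sym_module m V" and W: "sym_module m W"
  shows "sym_module m (rep_sum2 V W)"
proof (rule sym_moduleI, goal_cases)
  case (6 x)
  then show ?case
    using sym_module_laws(4)[OF V, of "fst x"] sym_module_laws(4)[OF W, of "snd x"]
    by (fastforce simp: rep_sum2_def)
qed (auto simp: rep_sum2_def sym_module_closed[OF V] sym_module_closed[OF W]
    sym_module_laws(1,3,5-8)[OF V] sym_module_laws(1,3,5-8)[OF W] sym_module_act_closed[OF V] sym_module_act_closed[OF W]
    sym_module_act_id[OF V] sym_module_act_id[OF W] sym_module_act_comp[OF V]
    sym_module_act_comp[OF W] sym_module_act_linear[OF V] sym_module_act_linear[OF W]
    intro: sym_module_laws(2)[OF V] sym_module_laws(2)[OF W])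

lemma sym_iso_rep_sum2:
  assumes "sym_iso m V V'" "sym_iso m W W'"
  shows "sym_iso m (rep_sum2 V W) (rep_sum2 V' W')"
proof -
  obtain f where f: "bij_betw f (carrier V) (carrier V')" "f \<zero>\<^bsub>V\<^esub> = \<zero>\<^bsub>V'\<^esub>"
    "\<And>x y. x \<in> carrier V \<Longrightarrow> y \<in> carrier V \<Longrightarrow> f (x \<oplus>\<^bsub>V\<^esub> y) = f x \<oplus>\<^bsub>V'\<^esub> f y"
    "\<And>c x. x \<in> carrier V \<Longrightarrow> f (c \<odot>\<^bsub>V\<^esub> x) = c \<odot>\<^bsub>V'\<^esub> f x"
    "\<And>p x. p permutes {1..m} \<Longrightarrow> x \<in> carrier V \<Longrightarrow> f (act V p x) = act V' p (f x)"
    using sym_isoE[OF assms(1)] by blast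
  obtain g where g: "bij_betw g (carrier W) (carrier W')" "g \<zero>\<^bsub>W\<^esub> = \<zero>\<^bsub>W'\<^esub>"
    "\<And>x y. x \<in> carrier W \<Longrightarrow> y \<in> carrier W \<Longrightarrow> g (x \<oplus>\<^bsub>W\<^esub> y) = g x \<oplus>\<^bsub>W'\<^esub> g y"
    "\<And>c x. x \<in> carrier W \<Longrightarrow> g (c \<odot>\<^bsub>W\<^esub> x) = c \<odot>\<^bsub>W'\<^esub> g x"
    "\<And>p x. p permutes {1..m} \<Longrightarrow> x \<in> carrier W \<Longrightarrow> g (act W p x) = act W' p (g x)"
    using sym_isoE[OF assms(2)] by blast
  show ?thesis
  proof (rule sym_isoI[where f = "map_prod f g"])
    show "sym_module m (rep_sum2 V W)"
      by (intro sym_module_rep_sum2 sym_iso_modules(1)[OF assms(1)] sym_iso_modules(1)[OF assms(2)])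
    show "bij_betw (map_prod f g) (carrier (rep_sum2 V W)) (carrier (rep_sum2 V' W'))"
      using f(1) g(1) by (auto simp: rep_sum2_def bij_betw_def map_prod_inj_on map_prod_surj_on)
  qed (use f g in \<open>auto simp: rep_sum2_def\<close>)
qed

lemma carrier_rep_sum_iff:
  "x \<in> carrier (rep_sum Vs) \<longleftrightarrow>
    (\<forall>i<length Vs. x i \<in> carrier (Vs ! i)) \<and> (\<forall>i. \<not> i < length Vs \<longrightarrow> x i = undefined)"
  by (auto simp: rep_sum_def Let_def PiE_iff extensional_def)

lemma rep_sum_apply:
  "\<zero>\<^bsub>rep_sum Vs\<^esub> i = (if i < length Vs then \<zero>\<^bsub>Vs ! i\<^esub> else undefined)"
  "(x \<oplus>\<^bsub>rep_sum Vs\<^esub> y) i = (if i < length Vs then x i \<oplus>\<^bsub>Vs ! i\<^esub> y i else undefined)"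
  "(c \<odot>\<^bsub>rep_sum Vs\<^esub> x) i = (if i < length Vs then c \<odot>\<^bsub>Vs ! i\<^esub> x i else undefined)"
  "act (rep_sum Vs) p x i = (if i < length Vs then act (Vs ! i) p (x i) else undefined)"
  by (auto simp: rep_sum_def Let_def)

lemma sym_module_rep_sum:
  assumes "\<And>V. V \<in> set Vs \<Longrightarrow> sym_module m V"
  shows "sym_module m (rep_sum Vs)"
proof -
  have V: "sym_module m (Vs ! i)" if "i < length Vs" for i
    using assms that by simp
  note cl = sym_module_closed[OF V] sym_module_act_closed[OF V]
  note laws = sym_module_laws[OF V] sym_module_act_id[OF V] sym_module_act_comp[OF V]
    sym_module_act_linear[OF V]
  show ?thesis
  proof (rule sym_moduleI, goal_cases)
    case (6 x)
    then have "\<forall>i. \<exists>y. i < length Vs \<longrightarrow> y \<in> carrier (Vs ! i) \<and> y \<oplus>\<^bsub>Vs ! i\<^esub> x i = \<zero>\<^bsub>Vs ! i\<^esub>"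
      using laws(4) by (meson carrier_rep_sum_iff)
    then obtain y where
      "\<forall>i. i < length Vs \<longrightarrow> y i \<in> carrier (Vs ! i) \<and> y i \<oplus>\<^bsub>Vs ! i\<^esub> x i = \<zero>\<^bsub>Vs ! i\<^esub>"
      by metis
    then show ?case
      by (intro bexI[of _ "restrict y {..<length Vs}"])
        (auto simp: carrier_rep_sum_iff rep_sum_apply fun_eq_iff)
  next
    case (4 x y)
    then show ?case
      using laws(2) by (auto simp: rep_sum_apply fun_eq_iff carrier_rep_sum_iff)
  qed (simp_all add: carrier_rep_sum_iff rep_sum_apply fun_eq_iff cl laws(1,3,5-))
qed

lemma sym_iso_rep_sum_append:
  assumes "\<And>V. V \<in> set Vs \<union> set Ws \<Longrightarrow> sym_module m V"
  shows "sym_iso m (rep_sum2 (rep_sum Vs) (rep_sum Ws)) (rep_sum (Vs @ Ws))"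
proof (rule sym_isoI)
  let ?n = "length Vs" and ?l = "length Vs + length Ws"
  let ?f = "\<lambda>x. \<lambda>i\<in>{..<?l}. if i < ?n then fst x i else snd x (i - ?n)"
  let ?g = "\<lambda>x. (restrict x {..<?n}, \<lambda>i\<in>{..<length Ws}. x (i + ?n))"
  let ?V = "carrier (rep_sum Vs)" and ?W = "carrier (rep_sum Ws)"
  show "sym_module m (rep_sum2 (rep_sum Vs) (rep_sum Ws))"
    using assms by (intro sym_module_rep_sum2 sym_module_rep_sum) auto
  have carrier: "carrier (rep_sum2 (rep_sum Vs) (rep_sum Ws)) = ?V \<times> ?W"
    by (simp add: rep_sum2_def)
  show "bij_betw ?f (carrier (rep_sum2 (rep_sum Vs) (rep_sum Ws))) (carrier (rep_sum (Vs @ Ws)))"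
    unfolding carrier
  proof (rule bij_betw_byWitness[where f' = ?g])
    have "restrict (?f (u, w)) {..<?n} = u" "(\<lambda>i\<in>{..<length Ws}. ?f (u, w) (i + ?n)) = w"
      if "u \<in> ?V" "w \<in> ?W" for u w
      using that unfolding carrier_rep_sum_iff by (auto intro!: ext)
    then show "\<forall>x\<in>?V \<times> ?W. ?g (?f x) = x"
      by auto
    have "?f (?g x) = x" if "x \<in> carrier (rep_sum (Vs @ Ws))" for x
      using that unfolding carrier_rep_sum_iff by (auto intro!: ext)
    then show "\<forall>x\<in>carrier (rep_sum (Vs @ Ws)). ?f (?g x) = x"
      by blast
    have "?f x \<in> carrier (rep_sum (Vs @ Ws))" if "x \<in> ?V \<times> ?W" for x
      using that unfolding mem_Times_iff carrier_rep_sum_iff by (auto simp: nth_append)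
    then show "?f ` (?V \<times> ?W) \<subseteq> carrier (rep_sum (Vs @ Ws))"
      by blast
    have "x i \<in> carrier (Vs ! i)" if "x \<in> carrier (rep_sum (Vs @ Ws))" "i < ?n" for x i
      using that by (auto simp: carrier_rep_sum_iff nth_append dest: spec[of _ i])
    moreover have "x (i + ?n) \<in> carrier (Ws ! i)"
      if "x \<in> carrier (rep_sum (Vs @ Ws))" "i < length Ws" for x i
      using that by (auto simp: carrier_rep_sum_iff nth_append dest: spec[of _ "i + ?n"])
    ultimately have "?g x \<in> ?V \<times> ?W" if "x \<in> carrier (rep_sum (Vs @ Ws))" for x
      using that unfolding mem_Times_iff carrier_rep_sum_iff[of _ Vs] carrier_rep_sum_iff[of _ Ws]
      by simp
    then show "?g ` carrier (rep_sum (Vs @ Ws)) \<subseteq> ?V \<times> ?W"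
      by blast
  qed
qed (auto simp: fun_eq_iff rep_sum_apply rep_sum2_def nth_append)

section \<open>Invariant spaces of functions\<close>

definition lin_space :: "('b \<Rightarrow> complex) set \<Rightarrow> bool"
  where "lin_space U \<longleftrightarrow> (\<lambda>_. 0) \<in> U \<and> (\<forall>u\<in>U. \<forall>v\<in>U. (\<lambda>b. u b + v b) \<in> U) \<and>
    (\<forall>c. \<forall>u\<in>U. (\<lambda>b. c * u b) \<in> U)"

lemma lin_space_zero: "lin_space U \<Longrightarrow> (\<lambda>_. 0) \<in> U"
  and lin_space_add: "lin_space U \<Longrightarrow> u \<in> U \<Longrightarrow> v \<in> U \<Longrightarrow> (\<lambda>b. u b + v b) \<in> U"
  and lin_space_scale: "lin_space U \<Longrightarrow> u \<in> U \<Longrightarrow> (\<lambda>b. c * u b) \<in> U"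
  by (auto simp: lin_space_def)

lemma lin_space_diff: "lin_space U \<Longrightarrow> u \<in> U \<Longrightarrow> v \<in> U \<Longrightarrow> (\<lambda>b. u b - v b) \<in> U"
  using lin_space_add[of U u "\<lambda>b. (-1) * v b"] lin_space_scale[of U v "-1"] by simp

lemma lin_space_sum:
  assumes "lin_space U" "\<And>i. i \<in> I \<Longrightarrow> f i \<in> U"
  shows "(\<lambda>b. \<Sum>i\<in>I. f i b) \<in> U"
  using assms(2)
proof (induction I rule: infinite_finite_induct)
  case (insert i I)
  then show ?case
    using lin_space_add[OF assms(1), of "f i" "\<lambda>b. \<Sum>i\<in>I. f i b"] by simp
qed (use lin_space_zero[OF assms(1)] in simp_all)

lemma lin_space_lincomb:
  assumes "lin_space U" "\<And>i. i \<in> I \<Longrightarrow> f i \<in> U"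
  shows "(\<lambda>b. \<Sum>i\<in>I. c i * f i b) \<in> U"
  using lin_space_sum[of U I "\<lambda>i b. c i * f i b"] lin_space_scale[of U] assms by blast

section \<open>The Hermitian product and orthogonal projection\<close>

definition ip :: "'b set \<Rightarrow> ('b \<Rightarrow> complex) \<Rightarrow> ('b \<Rightarrow> complex) \<Rightarrow> complex"
  where "ip P u v = (\<Sum>b\<in>P. u b * cnj (v b))"

lemma ip_linear:
  "ip P (\<lambda>_. 0) v = 0"
  "ip P (\<lambda>b. u b + u' b) v = ip P u v + ip P u' v"
  "ip P (\<lambda>b. u b - u' b) v = ip P u v - ip P u' v"
  "ip P (\<lambda>b. c * u b) v = c * ip P u v"
  "ip P v (\<lambda>_. 0) = 0"
  "ip P v (\<lambda>b. u b + u' b) = ip P v u + ip P v u'"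
  "ip P v (\<lambda>b. u b - u' b) = ip P v u - ip P v u'"
  "ip P v (\<lambda>b. c * u b) = cnj c * ip P v u"
  by (simp_all add: ip_def ring_distribs sum.distrib sum_subtractf sum_distrib_left mult_ac)

lemma ip_self_eq_0:
  assumes "finite P" "ip P u u = 0" "b \<in> P"
  shows "u b = 0"
proof -
  have "ip P u u = (\<Sum>b\<in>P. of_real ((cmod (u b))\<^sup>2))"
    unfolding ip_def by (intro sum.cong refl) (rule complex_norm_square[symmetric])
  also have "\<dots> = of_real (\<Sum>b\<in>P. (cmod (u b))\<^sup>2)"
    by simp
  finally have "(\<Sum>b\<in>P. (cmod (u b))\<^sup>2) = 0"
    using assms(2) by (metis of_real_eq_0_iff)
  then have "(cmod (u b))\<^sup>2 = 0"
    using assms by (simp add: sum_nonneg_eq_0_iff)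
  then show ?thesis
    by simp
qed

definition supported :: "'b set \<Rightarrow> ('b \<Rightarrow> complex) set \<Rightarrow> bool"
  where "supported P U \<longleftrightarrow> (\<forall>u\<in>U. \<forall>b. b \<notin> P \<longrightarrow> u b = 0)"

text \<open>Gram-Schmidt without a basis. The induction is on the set \<open>Q\<close> of
  coordinates where \<open>U\<close> may be nonzero, while the product stays that of
  \<open>P\<close>. If \<open>U\<close> does not vanish at \<open>b\<close>, the elements vanishing
  at \<open>b\<close> form a subspace of codimension one, and one more orthogonal vector
  suffices.\<close>

lemma orthogonal_projection:
  assumes "finite P" "lin_space U" "supported P U"
  shows "\<exists>y\<in>U. \<forall>u\<in>U. ip P (\<lambda>b. x b - y b) u = 0"
proof -
  have "\<exists>y\<in>U. \<forall>u\<in>U. ip P (\<lambda>b. x b - y b) u = 0"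
    if "finite Q" "Q \<subseteq> P" "lin_space U" "supported Q U" for Q U x
    using that
  proof (induction Q arbitrary: U x rule: finite_induct)
    case empty
    then have "u = (\<lambda>_. 0)" if "u \<in> U" for u
      using that by (auto simp: supported_def)
    then show ?case
      using lin_space_zero[OF empty(2)] ip_linear(5) by metis
  next
    case (insert b Q)
    show ?case
    proof (cases "\<forall>u\<in>U. u b = 0")
      case True
      then have "supported Q U"
        using insert.prems(3) unfolding supported_def by (metis insertE)
      then show ?thesis
        using insert.IH insert.prems by blast
    next
      case False
      then obtain u0 where u0: "u0 \<in> U" "u0 b \<noteq> 0"
        by blast
      note U = insert.prems(2)
      define U' where "U' = {u \<in> U. u b = 0}"
      have "lin_space U'"
        using U by (auto simp: U'_def lin_space_def)
      moreover have "supported Q U'"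
        using insert.prems(3) by (auto simp: supported_def U'_def)
      ultimately have IH: "\<exists>y\<in>U'. \<forall>u\<in>U'. ip P (\<lambda>b. x b - y b) u = 0" for x
        using insert by blast
      obtain y0 where y0: "y0 \<in> U'" "\<forall>u\<in>U'. ip P (\<lambda>b. u0 b - y0 b) u = 0"
        using IH by blast
      obtain y1 where y1: "y1 \<in> U'" "\<forall>u\<in>U'. ip P (\<lambda>b. x b - y1 b) u = 0"
        using IH by blast
      \<comment> \<open>\<open>w\<close> is orthogonal to \<open>U'\<close>, and
        \<open>w b = u0 b\<close> because \<open>y0\<close> lies in \<open>U'\<close>.\<close>
      define w where "w = (\<lambda>b. u0 b - y0 b)"
      have w: "w \<in> U" "w b \<noteq> 0"
        using u0 y0 lin_space_diff[OF U] by (auto simp: w_def U'_def)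
      have ww: "ip P w w \<noteq> 0"
        using ip_self_eq_0[OF assms(1), of w b] w insert.prems(1) by auto
      define z where "z = (\<lambda>b. x b - y1 b)"
      define c where "c = ip P z w / ip P w w"
      define y where "y = (\<lambda>b. y1 b + c * w b)"
      have x_y: "(\<lambda>b. x b - y b) = (\<lambda>b. z b - c * w b)"
        by (auto simp: y_def z_def)
      have "ip P (\<lambda>b. x b - y b) u = 0" if u: "u \<in> U" for u
      proof -
        \<comment> \<open>Chosen so that \<open>u - d * w\<close> vanishes at \<open>b\<close>: thus
          \<open>U\<close> is spanned by \<open>U'\<close> and \<open>w\<close>.\<close>
        define d where "d = u b / w b"
        define u' where "u' = (\<lambda>b. u b - d * w b)"
        have "u' \<in> U'"
          using u w lin_space_diff[OF U u lin_space_scale[OF U w(1), of d]]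
          by (auto simp: U'_def u'_def d_def)
        then have "ip P (\<lambda>b. x b - y b) u' = 0"
          using y1(2) y0(2) unfolding x_y ip_linear(3,4) z_def[symmetric] w_def[symmetric] by simp
        moreover have "ip P (\<lambda>b. x b - y b) w = 0"
          unfolding x_y ip_linear(3,4) using ww by (simp add: c_def)
        moreover have "u = (\<lambda>b. u' b + d * w b)"
          by (auto simp: u'_def)
        ultimately show ?thesis
          by (simp add: ip_linear)
      qed
      moreover have "y \<in> U"
        using y1 w lin_space_add[OF U _ lin_space_scale[OF U]] by (auto simp: y_def U'_def)
      ultimately show ?thesis
        by blast
    qed
  qed
  then show ?thesis
    using assms by blast
qed

text \<open>Demanded for all maps of numbers, not only for permutations of \<open>{1..m}\<close>:
  relabelling words and taking images of sets satisfy it, and then no range has to be tracked when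
  permutations are composed.\<close>

definition functorial :: "((nat \<Rightarrow> nat) \<Rightarrow> 'b \<Rightarrow> 'b) \<Rightarrow> bool"
  where "functorial a \<longleftrightarrow> a id = id \<and> (\<forall>p q. a (p \<circ> q) = a p \<circ> a q)"

definition pact :: "((nat \<Rightarrow> nat) \<Rightarrow> 'b \<Rightarrow> 'b) \<Rightarrow> (nat \<Rightarrow> nat) \<Rightarrow> ('b \<Rightarrow> complex) \<Rightarrow> 'b \<Rightarrow> complex"
  where "pact a p u = (\<lambda>b. u (a (inv' p) b))"

lemma functorial_cancel:
  assumes "functorial a" "bij p"
  shows "a p (a (inv' p) b) = b" "a (inv' p) (a p b) = b"
proof -
  have "a p \<circ> a (inv' p) = id" "a (inv' p) \<circ> a p = id"
    using assms by (metis functorial_def bij_is_surj bij_is_inj surj_iff inj_iff)+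
  then show "a p (a (inv' p) b) = b" "a (inv' p) (a p b) = b"
    by (metis comp_apply id_apply)+
qed

lemma pact_id: "functorial a \<Longrightarrow> pact a id u = u"
  by (simp add: pact_def functorial_def inv_id)

lemma pact_comp: "functorial a \<Longrightarrow> bij p \<Longrightarrow> bij q \<Longrightarrow> pact a (p \<circ> q) u = pact a p (pact a q u)"
  by (simp add: pact_def o_inv_distrib functorial_def)

lemma pact_inv:
  assumes "functorial a" "bij p"
  shows "pact a p (pact a (inv' p) u) = u" "pact a (inv' p) (pact a p u) = u"
  using functorial_cancel[OF assms] assms(2) by (auto simp: pact_def inv_inv_eq)

lemma pact_linear:
  "pact a p (\<lambda>_. 0) = (\<lambda>_. 0)"
  "pact a p (\<lambda>b. u b + v b) = (\<lambda>b. pact a p u b + pact a p v b)"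
  "pact a p (\<lambda>b. u b - v b) = (\<lambda>b. pact a p u b - pact a p v b)"
  "pact a p (\<lambda>b. c * u b) = (\<lambda>b. c * pact a p u b)"
  "pact a p (\<lambda>b. \<Sum>i\<in>I. f i b) = (\<lambda>b. \<Sum>i\<in>I. pact a p (f i) b)"
  by (simp_all add: pact_def)

text \<open>The finite permuted set \<open>P\<close> makes the Hermitian product available and
  invariant, so that invariant subspaces have invariant complements.\<close>

definition rep_space ::
    "nat \<Rightarrow> ((nat \<Rightarrow> nat) \<Rightarrow> 'b \<Rightarrow> 'b) \<Rightarrow> 'b set \<Rightarrow> ('b \<Rightarrow> complex) set \<Rightarrow> bool"
  where "rep_space m a P U \<longleftrightarrow> functorial a \<and> finite P \<and>
    (\<forall>p. p permutes {1..m} \<longrightarrow> a p ` P \<subseteq> P) \<and> lin_space U \<and> supported P U \<and>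
    (\<forall>p. p permutes {1..m} \<longrightarrow> (\<forall>u\<in>U. pact a p u \<in> U))"

lemma rep_space_pact: "rep_space m a P U \<Longrightarrow> p permutes {1..m} \<Longrightarrow> u \<in> U \<Longrightarrow> pact a p u \<in> U"
  by (auto simp: rep_space_def)

lemma sym_module_fun_rep:
  assumes "functorial a" "lin_space U"
    and "\<And>p u. p permutes {1..m} \<Longrightarrow> u \<in> U \<Longrightarrow> pact a p u \<in> U"
  shows "sym_module m (fun_rep a U)"
proof (rule sym_moduleI, goal_cases)
  case (6 x)
  then show ?case
    using lin_space_scale[OF assms(2), of x "-1"]
    by (intro bexI[of _ "\<lambda>b. - 1 * x b"]) (auto simp: fun_rep_def)
next
  case (13 x)
  then show ?case
    using pact_id[OF assms(1), of x] by (simp add: fun_rep_def pact_def)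
next
  case (14 p q x)
  then show ?case
    using pact_comp[OF assms(1), of p q x] by (simp add: fun_rep_def pact_def permutes_bij)
qed (use assms in \<open>auto simp: fun_rep_def ring_distribs add_ac pact_def
    intro!: lin_space_add lin_space_scale lin_space_zero\<close>)

lemma rep_space_sym_module: "rep_space m a P U \<Longrightarrow> sym_module m (fun_rep a U)"
  by (rule sym_module_fun_rep) (auto simp: rep_space_def)

lemma fun_rep_sel:
  "carrier (fun_rep a U) = U" "\<zero>\<^bsub>fun_rep a U\<^esub> = (\<lambda>_. 0)"
  "u \<oplus>\<^bsub>fun_rep a U\<^esub> v = (\<lambda>b. u b + v b)" "c \<odot>\<^bsub>fun_rep a U\<^esub> u = (\<lambda>b. c * u b)"
  "act (fun_rep a U) p u = pact a p u"
  by (simp_all add: fun_rep_def pact_def)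

lemma ip_pact:
  assumes "functorial a" "bij p" "a p ` P \<subseteq> P" "a (inv' p) ` P \<subseteq> P"
  shows "ip P (pact a p u) (pact a p v) = ip P u v"
  unfolding ip_def pact_def
  by (rule sum.reindex_bij_witness[of _ "a p" "a (inv' p)"])
    (use assms functorial_cancel[OF assms(1,2)] in auto)

lemma rep_space_ip_pact:
  assumes "rep_space m a P U" "p permutes {1..m}"
  shows "ip P (pact a p u) v = ip P u (pact a (inv' p) v)"
proof -
  have a: "functorial a" "bij p" "bij (inv' p)" "inv' (inv' p) = p"
    using assms permutes_bij[OF permutes_inv[OF assms(2)]]
    by (auto simp: rep_space_def permutes_bij inv_inv_eq)
  have "ip P (pact a (inv' p) (pact a p u)) (pact a (inv' p) v) = ip P (pact a p u) v"
    using assms a by (intro ip_pact) (auto simp: rep_space_def permutes_inv)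
  then show ?thesis
    using a by (simp add: pact_inv)
qed

definition orth :: "'b set \<Rightarrow> ('b \<Rightarrow> complex) set \<Rightarrow> ('b \<Rightarrow> complex) set \<Rightarrow> ('b \<Rightarrow> complex) set"
  where "orth P U U' = {u \<in> U. \<forall>v\<in>U'. ip P u v = 0}"

lemma rep_space_orth:
  assumes "rep_space m a P U" "rep_space m a P U'"
  shows "rep_space m a P (orth P U U')"
proof -
  have "pact a p u \<in> orth P U U'" if "p permutes {1..m}" "u \<in> orth P U U'" for p u
    using that rep_space_pact[OF assms(1), of p u] rep_space_ip_pact[OF assms(1)]
      rep_space_pact[OF assms(2), of "inv' p"]
    by (auto simp: orth_def permutes_inv)
  moreover have "lin_space (orth P U U')"
    using assms(1) by (auto simp: rep_space_def orth_def ip_linear lin_space_def)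
  ultimately show ?thesis
    using assms(1) by (auto simp: rep_space_def supported_def orth_def)
qed

lemma orth_decomposition:
  assumes "rep_space m a P U" "rep_space m a P U'" "U' \<subseteq> U" "u \<in> U"
  obtains v w where "v \<in> U'" "w \<in> orth P U U'" "u = (\<lambda>b. v b + w b)"
proof -
  obtain v where v: "v \<in> U'" "\<forall>w\<in>U'. ip P (\<lambda>b. u b - v b) w = 0"
    using orthogonal_projection[of P U' u] assms(2) by (auto simp: rep_space_def)
  have "(\<lambda>b. u b - v b) \<in> U"
    using v assms lin_space_diff by (metis rep_space_def subsetD)
  then show thesis
    using v by (intro that[of v "\<lambda>b. u b - v b"]) (auto simp: orth_def)
qed

lemma orth_disjoint:
  assumes "rep_space m a P U" "u \<in> U" "u \<in> orth P V U"
  shows "u = (\<lambda>_. 0)"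
proof
  fix b
  have "ip P u u = 0"
    using assms by (auto simp: orth_def)
  then show "u b = 0"
    using assms(1,2) ip_self_eq_0[of P u b] by (cases "b \<in> P") (auto simp: rep_space_def supported_def)
qed

lemma sym_iso_orth:
  assumes U: "rep_space m a P U" and U': "rep_space m a P U'" and "U' \<subseteq> U"
  shows "sym_iso m (rep_sum2 (fun_rep a (orth P U U')) (fun_rep a U')) (fun_rep a U)"
proof (rule sym_isoI[where f = "\<lambda>x b. fst x b + snd x b"])
  have lin: "lin_space U" "lin_space U'" "lin_space (orth P U U')"
    using U U' rep_space_orth[OF U U'] by (auto simp: rep_space_def)
  have eq: "v = v' \<and> w = w'" if "v \<in> orth P U U'" "v' \<in> orth P U U'" "w \<in> U'" "w' \<in> U'"
    "(\<lambda>b. v b + w b) = (\<lambda>b. v' b + w' b)" for v v' w w'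
  proof -
    have "(\<lambda>b. v b - v' b) = (\<lambda>b. w' b - w b)"
      using that(5) by (auto simp: fun_eq_iff algebra_simps)
    then have "(\<lambda>b. v b - v' b) \<in> U'"
      using lin_space_diff[OF lin(2) that(4,3)] by simp
    then have "(\<lambda>b. v b - v' b) = (\<lambda>_. 0)"
      by (rule orth_disjoint[OF U' _ lin_space_diff[OF lin(3) that(1,2)]])
    then show ?thesis
      using that(5) unfolding fun_eq_iff by (metis add_left_cancel eq_iff_diff_eq_0)
  qed
  show "bij_betw (\<lambda>x b. fst x b + snd x b) (carrier (rep_sum2 (fun_rep a (orth P U U')) (fun_rep a U')))
     (carrier (fun_rep a U))"
    unfolding bij_betw_def
  proof (intro conjI inj_onI subset_antisym)
    show "(\<lambda>x b. fst x b + snd x b) ` carrier (rep_sum2 (fun_rep a (orth P U U')) (fun_rep a U'))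
      \<subseteq> carrier (fun_rep a U)"
      using assms(3) lin_space_add[OF lin(1)] by (auto simp: rep_sum2_def fun_rep_def orth_def)
    show "carrier (fun_rep a U) \<subseteq> (\<lambda>x b. fst x b + snd x b) `
        carrier (rep_sum2 (fun_rep a (orth P U U')) (fun_rep a U'))"
    proof
      fix u assume "u \<in> carrier (fun_rep a U)"
      then obtain v w where "v \<in> U'" "w \<in> orth P U U'" "u = (\<lambda>b. v b + w b)"
        using orth_decomposition[OF assms] by (metis fun_rep_sel(1))
      then show "u \<in> (\<lambda>x b. fst x b + snd x b) `
        carrier (rep_sum2 (fun_rep a (orth P U U')) (fun_rep a U'))"
        by (intro image_eqI[of _ _ "(w, v)"]) (auto simp: rep_sum2_def fun_rep_def add.commute)
    qed
    fix x y assume "x \<in> carrier (rep_sum2 (fun_rep a (orth P U U')) (fun_rep a U'))"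
      "y \<in> carrier (rep_sum2 (fun_rep a (orth P U U')) (fun_rep a U'))"
      "(\<lambda>b. fst x b + snd x b) = (\<lambda>b. fst y b + snd y b)"
    then show "x = y"
      using eq[of "fst x" "fst y" "snd x" "snd y"] by (simp add: rep_sum2_def fun_rep_def mem_Times_iff prod_eq_iff)
  qed
  show "sym_module m (rep_sum2 (fun_rep a (orth P U U')) (fun_rep a U'))"
    by (intro sym_module_rep_sum2 rep_space_sym_module[OF U']
        rep_space_sym_module[OF rep_space_orth[OF U U']])
qed (auto simp: rep_sum2_def fun_rep_def algebra_simps)

section \<open>Symmetrization\<close>

text \<open>The sum is not divided by the number of permutations; on invariants it is multiplication
  by the factorial of the size of a finite \<open>A\<close>.\<close>

definition symm :: "((nat \<Rightarrow> nat) \<Rightarrow> 'b \<Rightarrow> 'b) \<Rightarrow> nat set \<Rightarrow> ('b \<Rightarrow> complex) \<Rightarrow> 'b \<Rightarrow> complex"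
  where "symm a A u = (\<lambda>b. \<Sum>p | p permutes A. pact a p u b)"

lemma symm_linear:
  "symm a A (\<lambda>_. 0) = (\<lambda>_. 0)"
  "symm a A (\<lambda>b. u b + v b) = (\<lambda>b. symm a A u b + symm a A v b)"
  "symm a A (\<lambda>b. u b - v b) = (\<lambda>b. symm a A u b - symm a A v b)"
  "symm a A (\<lambda>b. c * u b) = (\<lambda>b. c * symm a A u b)"
  "symm a A (\<lambda>b. \<Sum>i\<in>I. f i b) = (\<lambda>b. \<Sum>i\<in>I. symm a A (f i) b)"
  by (auto simp: symm_def pact_linear sum.distrib sum_subtractf sum_distrib_left sum.swap[of _ I])

lemma symm_in_space:
  assumes "rep_space m a P U" "A \<subseteq> {1..m}" "u \<in> U"
  shows "symm a A u \<in> U"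
  unfolding symm_def using assms rep_space_pact[OF assms(1)]
  by (intro lin_space_sum) (auto simp: rep_space_def dest: permutes_subset)

lemma symm_pact:
  assumes "functorial a" "q permutes A"
  shows "symm a A (pact a q u) = symm a A u"
  unfolding symm_def
  using assms pact_comp[OF assms(1)]
  by (intro ext sum.reindex_bij_witness[of _ "\<lambda>p. p \<circ> inv' q" "\<lambda>p. p \<circ> q"])
    (auto simp: permutes_compose permutes_inv permutes_bij comp_assoc permutes_inv_o)

text \<open>Conjugation by \<open>q\<close> matches the permutations of \<open>A\<close> with those
  of its image. This carries statements about the fixed set \<open>K\<close> over to every set of
  the same size.\<close>

lemma pact_symm_conj:
  assumes "functorial a" "bij q"
  shows "pact a q (symm a A u) = symm a (q ` A) (pact a q u)"
proof -
  have qi: "q (inv' q x) = x" "inv' q (q x) = x" for x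
    using assms(2) by (simp_all add: bij_is_surj bij_is_inj surj_f_inv_f)
  have q: "bij (inv' q)" "inv' q ` q ` A = A"
    using assms(2) by (auto simp: bij_imp_bij_inv qi image_image)
  have conj: "r \<circ> p \<circ> inv' r permutes r ` A" if "p permutes A" "bij r" for p A and r :: "nat \<Rightarrow> nat"
  proof (rule bij_imp_permutes)
    have ri: "r (inv' r x) = x" "inv' r (r x) = x" for x
      using that by (simp_all add: bij_is_surj bij_is_inj surj_f_inv_f)
    have "bij_betw (inv' r) (r ` A) A"
      by (rule bij_betw_byWitness[where f' = r]) (auto simp: ri)
    moreover have "bij_betw r A (r ` A)"
      using that(2) by (auto simp: bij_betw_def intro: inj_on_subset)
    ultimately show "bij_betw (r \<circ> p \<circ> inv' r) (r ` A) (r ` A)"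
      using permutes_imp_bij[OF that(1)] by (intro bij_betw_trans)
    fix x assume "x \<notin> r ` A"
    then have "inv' r x \<notin> A"
      using ri by (metis imageI)
    then show "(r \<circ> p \<circ> inv' r) x = x"
      using ri permutes_not_in[OF that(1)] by simp
  qed
  show ?thesis
    unfolding symm_def pact_linear
  proof (rule ext, rule sum.reindex_bij_witness[of _ "\<lambda>p. inv' q \<circ> p \<circ> q" "\<lambda>p. q \<circ> p \<circ> inv' q"])
    fix b p assume "p \<in> {p. p permutes A}"
    then have p: "p permutes A" "bij p"
      by (auto simp: permutes_bij)
    show "inv' q \<circ> (q \<circ> p \<circ> inv' q) \<circ> q = p"
      by (simp add: fun_eq_iff qi)
    show "q \<circ> p \<circ> inv' q \<in> {p. p permutes q ` A}"
      using conj[OF p(1) assms(2)] by simp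
    have "pact a (q \<circ> p \<circ> inv' q) (pact a q u) = pact a (q \<circ> p \<circ> inv' q \<circ> q) u"
      using p q assms by (intro pact_comp[symmetric]) (auto intro: bij_comp)
    also have "q \<circ> p \<circ> inv' q \<circ> q = q \<circ> p"
      by (simp add: fun_eq_iff qi)
    also have "pact a (q \<circ> p) u = pact a q (pact a p u)"
      by (rule pact_comp[OF assms p(2)])
    finally show "pact a (q \<circ> p \<circ> inv' q) (pact a q u) b = pact a q (pact a p u) b"
      by (rule fun_cong)
  next
    fix p assume "p \<in> {p. p permutes q ` A}"
    then have "inv' q \<circ> p \<circ> inv' (inv' q) permutes inv' q ` q ` A"
      using q by (intro conj) auto
    then show "inv' q \<circ> p \<circ> q \<in> {p. p permutes A}"
      using assms(2) q by (simp add: inv_inv_eq)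
    show "q \<circ> (inv' q \<circ> p \<circ> q) \<circ> inv' q = p"
      by (simp add: fun_eq_iff qi)
  qed
qed

lemma pact_symm:
  assumes "functorial a" "q permutes A"
  shows "pact a q (symm a A u) = symm a A u"
  using pact_symm_conj[OF assms(1) permutes_bij[OF assms(2)], of A u] symm_pact[OF assms]
  by (simp add: permutes_image[OF assms(2)])

lemma symm_invariant:
  assumes "finite A" "\<And>p. p permutes A \<Longrightarrow> pact a p u = u"
  shows "symm a A u = (\<lambda>b. fact (card A) * u b)"
proof
  fix b
  have "symm a A u b = (\<Sum>p | p permutes A. u b)"
    unfolding symm_def using assms(2) by (intro sum.cong) auto
  then show "symm a A u b = fact (card A) * u b"
    using card_permutations[OF refl assms(1)] by simp
qed

section \<open>Tabloids and polytabloids\<close>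

text \<open>Ordered set partitions of \<open>X\<close> with block sizes \<open>l\<close>. The
  recursion over an arbitrary entry set fits the removal of the first row, after which the entries
  are no longer an initial segment.\<close>

fun tabs :: "nat list \<Rightarrow> nat set \<Rightarrow> nat set list set"
  where
    "tabs [] X = (if X = {} then {[]} else {})"
  | "tabs (k # l) X = {A # T |A T. A \<subseteq> X \<and> card A = k \<and> T \<in> tabs l (X - A)}"

lemma finite_tabs: "finite X \<Longrightarrow> finite (tabs l X)"
proof (induction l arbitrary: X)
  case (Cons k l)
  have "tabs (k # l) X \<subseteq> (\<lambda>(A, T). A # T) ` (Pow X \<times> (\<Union>A\<in>Pow X. tabs l (X - A)))"
    by auto
  moreover have "finite \<dots>"
    using Cons by (intro finite_imageI finite_cartesian_product) auto
  ultimately show ?case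
    by (rule finite_subset)
qed simp

lemma tabs_image:
  assumes "bij p" "T \<in> tabs l X"
  shows "map (image p) T \<in> tabs l (p ` X)"
  using assms(2)
proof (induction l arbitrary: X T)
  case (Cons k l)
  then obtain A T' where *: "T = A # T'" "A \<subseteq> X" "card A = k" "T' \<in> tabs l (X - A)"
    by auto
  then have "map (image p) T' \<in> tabs l (p ` X - p ` A)"
    using Cons.IH[of T' "X - A"] image_set_diff[OF bij_is_inj[OF assms(1)]] by metis
  moreover have "card (p ` A) = k"
    using * assms(1) by (metis bij_is_inj card_image inj_on_subset subset_UNIV)
  ultimately show ?case
    using * by auto
qed (auto split: if_splits)

lemma tabs_subset: "T \<in> tabs l X \<Longrightarrow> A \<in> set T \<Longrightarrow> A \<subseteq> X"
proof (induction l arbitrary: X T)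
  case (Cons k l)
  from Cons.prems(1) obtain B T' where *: "T = B # T'" "B \<subseteq> X" "T' \<in> tabs l (X - B)"
    by auto
  show ?case
  proof (cases "A = B")
    case False
    then have "A \<in> set T'"
      using Cons.prems(2) *(1) by simp
    then show ?thesis
      using Cons.IH[OF *(3)] by blast
  qed (use * in simp)
qed (auto split: if_splits)

lemma functorial_map_image: "functorial (\<lambda>p. map (image p))"
  by (simp add: functorial_def fun_eq_iff image_comp)

section \<open>Cells, tableaux and column stabilizers\<close>

lemma cells_Nil: "cells [] = {}"
  by (simp add: cells_def)

lemma cells_Cons: "cells (k # l) = Pair 0 ` {..<k} \<union> (\<lambda>(i, j). (Suc i, j)) ` cells l"
proof -
  have "(i, j) \<in> cells (k # l) \<longleftrightarrow> (i, j) \<in> Pair 0 ` {..<k} \<union> (\<lambda>(i, j). (Suc i, j)) ` cells l" for i j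
    by (cases i) (auto simp: cells_def image_iff)
  then show ?thesis
    by auto
qed

lemma Suc_mem_cells [simp]: "(Suc i, j) \<in> cells (k # l) \<longleftrightarrow> (i, j) \<in> cells l"
  and zero_mem_cells [simp]: "(0, j) \<in> cells (k # l) \<longleftrightarrow> j < k"
  by (auto simp: cells_def)

lemma finite_cells [simp]: "finite (cells l)"
  by (induction l) (simp_all add: cells_Nil cells_Cons)

lemma card_cells: "card (cells l) = sum_list l"
proof (induction l)
  case (Cons k l)
  have "card (Pair (0::nat) ` {..<k} \<union> (\<lambda>(i, j). (Suc i, j)) ` cells l) =
      card (Pair (0::nat) ` {..<k}) + card ((\<lambda>(i, j). (Suc i, j)) ` cells l)"
    by (intro card_Un_disjoint) auto
  also have "\<dots> = k + card (cells l)"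
    by (subst (1 2) card_image) (auto simp: inj_on_def)
  finally show ?case
    by (simp add: cells_Cons Cons)
qed (simp add: cells_Nil)

lemma tabloid_Nil: "tabloid [] t = []"
  by (simp add: tabloid_def)

lemma tabloid_Cons:
  "tabloid (k # l) t = (\<lambda>j. t (0, j)) ` {..<k} # tabloid l (\<lambda>(i, j). t (Suc i, j))"
  by (simp add: tabloid_def upt_conv_Cons map_Suc_upt[symmetric] del: upt_Suc)

lemma tabloid_cong: "(\<And>x. x \<in> cells l \<Longrightarrow> t x = s x) \<Longrightarrow> tabloid l t = tabloid l s"
  by (auto simp: tabloid_def cells_def)

lemma tabloid_comp: "tabloid l (p \<circ> t) = map (image p) (tabloid l t)"
  by (auto simp: tabloid_def image_image)

lemma tabloid_in_tabs:
  "inj_on t (cells l) \<Longrightarrow> tabloid l t \<in> tabs l (t ` cells l)"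
proof (induction l arbitrary: t)
  case (Cons k l)
  define s where "s = (\<lambda>(i, j). t (Suc i, j))"
  define A where "A = (\<lambda>j. t (0, j)) ` {..<k}"
  have inj: "inj_on s (cells l)" "inj_on (\<lambda>j. t (0, j)) {..<k}"
  proof (rule inj_onI, goal_cases)
    case (1 x y)
    then show ?case
      using inj_onD[OF Cons.prems, of "(Suc (fst x), snd x)" "(Suc (fst y), snd y)"]
      by (simp add: s_def split_beta prod_eq_iff)
  next
    case 2
    show ?case
      using inj_onD[OF Cons.prems, of "(0, _)" "(0, _)"] by (simp add: inj_on_def)
  qed
  have "t (0, j) \<noteq> t (Suc i, j')" if "j < k" "(i, j') \<in> cells l" for i j j'
    using inj_onD[OF Cons.prems, of "(0, j)" "(Suc i, j')"] that by auto
  then have "A \<inter> s ` cells l = {}"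
    by (auto simp: s_def A_def)
  moreover have im: "t ` cells (k # l) = A \<union> s ` cells l"
    by (auto simp: s_def A_def cells_Cons image_Un image_image split_def)
  ultimately have "t ` cells (k # l) - A = s ` cells l"
    by auto
  then show ?case
    using Cons.IH[OF inj(1)] im inj(2)
    by (auto simp: tabloid_Cons s_def[symmetric] A_def[symmetric]) (auto simp: A_def card_image)
qed (simp add: tabloid_Nil cells_Nil)

lemma finite_tableaux: "finite (tableaux l)"
proof (rule finite_subset)
  show "tableaux l \<subseteq> PiE (cells l) (\<lambda>_. {1..sum_list l})"
    by (auto simp: tableaux_def PiE_def bij_betw_def)
  show "finite (PiE (cells l) (\<lambda>_. {1..sum_list l}))"
    by (intro finite_PiE) auto
qed

lemma tableauxD:
  assumes "t \<in> tableaux l"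
  shows "inj_on t (cells l)" "t ` cells l = {1..sum_list l}"
  using assms by (auto simp: tableaux_def bij_betw_def)

lemma tableaux_nonempty: "tableaux l \<noteq> {}"
proof -
  obtain t where "bij_betw t (cells l) {1..sum_list l}"
    using finite_same_card_bij[of "cells l" "{1..sum_list l}"] by (auto simp: card_cells)
  then have "restrict t (cells l) \<in> tableaux l"
    by (auto simp: tableaux_def cong: bij_betw_cong)
  then show ?thesis
    by blast
qed

lemma restrict_comp_tableaux:
  assumes "t \<in> tableaux l" "p permutes {1..sum_list l}"
  shows "restrict (p \<circ> t) (cells l) \<in> tableaux l"
proof -
  have "bij_betw (p \<circ> t) (cells l) {1..sum_list l}"
    using assms by (auto simp: tableaux_def permutes_imp_bij intro: bij_betw_trans)
  then show ?thesis
    by (auto simp: tableaux_def cong: bij_betw_cong)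
qed

lemma column_stabilizer_iff:
  "p \<in> column_stabilizer l t \<longleftrightarrow> p permutes {1..sum_list l} \<and>
    (\<forall>i j. (i, j) \<in> cells l \<longrightarrow> (\<exists>i'. (i', j) \<in> cells l \<and> p (t (i, j)) = t (i', j)))"
  by (auto simp: column_stabilizer_def)

lemma finite_column_stabilizer: "finite (column_stabilizer l t)"
  by (rule finite_subset[of _ "{p. p permutes {1..sum_list l}}"])
    (auto simp: column_stabilizer_iff finite_permutations)

lemma column_stabilizer_cong:
  assumes "\<And>x. x \<in> cells l \<Longrightarrow> t x = s x"
  shows "column_stabilizer l t = column_stabilizer l s"
  by (simp add: set_eq_iff column_stabilizer_iff assms cong: conj_cong imp_cong)

lemma column_stabilizer_comp:
  assumes "p \<in> column_stabilizer l t" "q \<in> column_stabilizer l t"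
  shows "p \<circ> q \<in> column_stabilizer l t"
  unfolding column_stabilizer_iff
proof (intro conjI allI impI)
  show "p \<circ> q permutes {1..sum_list l}"
    using assms by (intro permutes_compose) (auto simp: column_stabilizer_iff)
  fix i j assume "(i, j) \<in> cells l"
  then obtain i' where i': "(i', j) \<in> cells l" "q (t (i, j)) = t (i', j)"
    using assms(2) by (auto simp: column_stabilizer_iff)
  then obtain i'' where "(i'', j) \<in> cells l" "p (t (i', j)) = t (i'', j)"
    using assms(1) by (auto simp: column_stabilizer_iff)
  then show "\<exists>i'. (i', j) \<in> cells l \<and> (p \<circ> q) (t (i, j)) = t (i', j)"
    using i' by auto
qed

text \<open>The definition only asks that \<open>p\<close> map each column into itself. Columns are
  finite and \<open>p\<close> is injective, so each is mapped onto itself and the inverse preserves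
  it too.\<close>

lemma column_stabilizer_inv:
  assumes "p \<in> column_stabilizer l t"
  shows "inv' p \<in> column_stabilizer l t"
  unfolding column_stabilizer_iff
proof (intro conjI allI impI)
  have p: "p permutes {1..sum_list l}"
    using assms by (simp add: column_stabilizer_iff)
  then show "inv' p permutes {1..sum_list l}"
    by (rule permutes_inv)
  fix i j assume ij: "(i, j) \<in> cells l"
  define S where "S = t ` {(i', j') \<in> cells l. j' = j}"
  have "finite S"
    unfolding S_def by (intro finite_imageI) (auto intro: finite_subset[OF _ finite_cells[of l]])
  moreover have "p ` S \<subseteq> S"
    using assms by (fastforce simp: S_def column_stabilizer_iff)
  moreover have "inj_on p S"
    using p by (metis permutes_inj inj_on_subset subset_UNIV)
  ultimately have "p ` S = S"
    by (rule endo_inj_surj)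
  moreover have "t (i, j) \<in> S"
    using ij by (auto simp: S_def)
  ultimately obtain y where "y \<in> S" "p y = t (i, j)"
    by (metis imageE)
  then show "\<exists>i'. (i', j) \<in> cells l \<and> inv' p (t (i, j)) = t (i', j)"
    using permutes_inverses(2)[OF p, of y] by (auto simp: S_def)
qed

lemma column_stabilizer_conj:
  assumes "q \<in> column_stabilizer l t" "p permutes {1..sum_list l}"
  shows "p \<circ> q \<circ> inv' p \<in> column_stabilizer l (p \<circ> t)"
proof -
  have "p \<circ> q \<circ> inv' p permutes {1..sum_list l}"
    using assms by (intro permutes_compose permutes_inv) (auto simp: column_stabilizer_iff)
  then show ?thesis
    using assms(1) permutes_inverses(2)[OF assms(2)]
    by (simp add: column_stabilizer_iff) metis
qed

lemma pact_polytabloid_eq: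
  assumes "bij p"
  shows "pact (\<lambda>p. map (image p)) p (polytabloid l t) =
    (\<lambda>T. \<Sum>q\<in>column_stabilizer l t. if T = tabloid l (p \<circ> q \<circ> t) then of_int (sign q) else 0)"
proof -
  have "map (image (inv' p)) T = tabloid l (q \<circ> t) \<longleftrightarrow> T = tabloid l (p \<circ> q \<circ> t)" for T q
  proof -
    have "map (image (inv' p)) T = X \<longleftrightarrow> T = map (image p) X" for X
      using functorial_cancel[OF functorial_map_image assms] by metis
    then show ?thesis
      by (simp add: tabloid_comp comp_assoc)
  qed
  then show ?thesis
    by (simp add: pact_def polytabloid_def)
qed

text \<open>Conjugation by \<open>p\<close> carries the column stabilizer of \<open>t\<close> to
  that of \<open>p \<circ> t\<close> and preserves signs. The restriction makes the permuted tableau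
  extensional again, as \<open>tableaux\<close> requires.\<close>

lemma pact_polytabloid:
  assumes "p permutes {1..sum_list l}"
  shows "pact (\<lambda>p. map (image p)) p (polytabloid l t) =
    polytabloid l (restrict (p \<circ> t) (cells l))"
proof -
  have bij: "bij p"
    using assms by (rule permutes_bij)
  have stab: "column_stabilizer l (restrict (p \<circ> t) (cells l)) = column_stabilizer l (p \<circ> t)"
    by (rule column_stabilizer_cong) simp
  have tab: "tabloid l (q \<circ> restrict (p \<circ> t) (cells l)) = tabloid l (q \<circ> (p \<circ> t))" for q
    by (rule tabloid_cong) simp
  have p: "p (inv' p x) = x" "inv' p (p x) = x" for x
    using assms by (simp_all add: permutes_inverses)
  have perm: "permutation q" if "q permutes {1..sum_list l}" for q
    using that by (auto simp: permutation_permutes)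
  show ?thesis
    unfolding pact_polytabloid_eq[OF bij] unfolding polytabloid_def stab tab
  proof (rule ext, rule sum.reindex_bij_witness[of _ "\<lambda>q. inv' p \<circ> q \<circ> p" "\<lambda>q. p \<circ> q \<circ> inv' p"])
    fix T q assume q: "q \<in> column_stabilizer l t"
    then show "p \<circ> q \<circ> inv' p \<in> column_stabilizer l (p \<circ> t)"
      by (rule column_stabilizer_conj[OF _ assms])
    show "inv' p \<circ> (p \<circ> q \<circ> inv' p) \<circ> p = q"
      by (simp add: fun_eq_iff p)
    have "p \<circ> q \<circ> inv' p \<circ> (p \<circ> t) = p \<circ> q \<circ> t"
      by (simp add: fun_eq_iff p)
    moreover have "sign (p \<circ> q \<circ> inv' p) = sign p * sign q * sign (inv' p)"
      using q assms by (simp add: sign_compose perm permutes_inv permutation_compose column_stabilizer_iff)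
    ultimately show "(if T = tabloid l (p \<circ> q \<circ> inv' p \<circ> (p \<circ> t))
        then complex_of_int (sign (p \<circ> q \<circ> inv' p)) else 0) =
      (if T = tabloid l (p \<circ> q \<circ> t) then complex_of_int (sign q) else 0)"
      using sign_inverse[OF perm[OF assms]] sign_idempotent[of p] by (simp add: mult.commute)
  next
    fix q assume q: "q \<in> column_stabilizer l (p \<circ> t)"
    have "inv' p \<circ> (p \<circ> t) = t"
      by (simp add: fun_eq_iff p)
    then show "inv' p \<circ> q \<circ> p \<in> column_stabilizer l t"
      using column_stabilizer_conj[OF q permutes_inv[OF assms]]
      by (simp add: inv_inv_eq[OF bij])
    show "p \<circ> (inv' p \<circ> q \<circ> p) \<circ> inv' p = q"
      by (simp add: fun_eq_iff p)
  qed
qed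

lemma pact_column_stabilizer:
  assumes c: "c \<in> column_stabilizer l t"
  shows "pact (\<lambda>p. map (image p)) c (polytabloid l t) =
    (\<lambda>T. of_int (sign c) * polytabloid l t T)"
proof -
  have perm: "permutation q" if "q \<in> column_stabilizer l t" for q
    using that by (auto simp: permutation_permutes column_stabilizer_iff)
  have bij: "bij c"
    using c by (auto simp: column_stabilizer_iff permutes_bij)
  have ci: "c (inv' c x) = x" "inv' c (c x) = x" for x
    using bij by (simp_all add: bij_is_surj bij_is_inj surj_f_inv_f)
  show ?thesis
    unfolding pact_polytabloid_eq[OF bij] unfolding polytabloid_def sum_distrib_left
  proof (rule ext, rule sum.reindex_bij_witness[of _ "\<lambda>q. inv' c \<circ> q" "\<lambda>q. c \<circ> q"])
    fix T q assume q: "q \<in> column_stabilizer l t"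
    then show "c \<circ> q \<in> column_stabilizer l t" "inv' c \<circ> q \<in> column_stabilizer l t"
      using column_stabilizer_comp[OF c] column_stabilizer_comp[OF column_stabilizer_inv[OF c]] by auto
    show "inv' c \<circ> (c \<circ> q) = q" "c \<circ> (inv' c \<circ> q) = q"
      by (simp_all add: fun_eq_iff ci)
    show "complex_of_int (sign c) * (if T = tabloid l (c \<circ> q \<circ> t)
        then complex_of_int (sign (c \<circ> q)) else 0) =
      (if T = tabloid l (c \<circ> q \<circ> t) then complex_of_int (sign q) else 0)"
    proof -
      have "complex_of_int (sign c) * complex_of_int (sign (c \<circ> q)) = complex_of_int (sign q)"
        unfolding sign_compose[OF perm[OF c] perm[OF q]] by (simp add: sign_def)
      then show ?thesis
        by simp
    qed
  qed
qed

lemma polytabloid_support: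
  assumes "t \<in> tableaux l" "polytabloid l t T \<noteq> 0"
  shows "T \<in> tabs l {1..sum_list l}"
proof -
  have "\<exists>p\<in>column_stabilizer l t. T = tabloid l (p \<circ> t)"
  proof (rule ccontr)
    assume "\<not> ?thesis"
    then have "polytabloid l t T = 0"
      unfolding polytabloid_def by (intro sum.neutral) auto
    then show False
      using assms(2) by simp
  qed
  then obtain p where p: "p \<in> column_stabilizer l t" "T = tabloid l (p \<circ> t)"
    by blast
  then have "restrict (p \<circ> t) (cells l) \<in> tableaux l"
    using restrict_comp_tableaux[OF assms(1)] by (simp add: column_stabilizer_iff)
  then have "tabloid l (restrict (p \<circ> t) (cells l)) \<in> tabs l {1..sum_list l}"
    using tabloid_in_tabs tableauxD by metis
  then show ?thesis
    using p(2) tabloid_cong[of l "restrict (p \<circ> t) (cells l)" "p \<circ> t"] by simp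
qed

text \<open>An entry that stays both in its row and in its column stays in its cell.\<close>

lemma column_stabilizer_fixes_rows:
  assumes t: "t \<in> tableaux l" and c: "c \<in> column_stabilizer l t"
    and "tabloid l (c \<circ> t) = tabloid l t"
  shows "c = id"
proof
  fix x
  show "c x = id x"
  proof (cases "x \<in> {1..sum_list l}")
    case True
    then obtain i j where ij: "(i, j) \<in> cells l" "x = t (i, j)"
      using tableauxD(2)[OF t] by (metis imageE old.prod.exhaust)
    then obtain i' where i': "(i', j) \<in> cells l" "c x = t (i', j)"
      using c by (auto simp: column_stabilizer_iff)
    have i: "i < length l" "j < l ! i"
      using ij by (auto simp: cells_def)
    have "tabloid l (c \<circ> t) ! i = tabloid l t ! i"
      using assms(3) by simp
    then have "c x \<in> (\<lambda>j. t (i, j)) ` {..<l ! i}"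
      using i ij by (auto simp: tabloid_def)
    then obtain j' where "(i, j') \<in> cells l" "c x = t (i, j')"
      using i by (auto simp: cells_def)
    then have "i' = i"
      using i' tableauxD(1)[OF t] by (metis inj_onD prod.inject)
    then show ?thesis
      using i' ij by simp
  next
    case False
    then show ?thesis
      using c unfolding column_stabilizer_iff by (metis id_apply permutes_not_in)
  qed
qed

lemma polytabloid_self:
  assumes "t \<in> tableaux l"
  shows "polytabloid l t (tabloid l t) = 1"
proof -
  have id: "id \<in> column_stabilizer l t"
    by (auto simp: column_stabilizer_iff permutes_id)
  have "polytabloid l t (tabloid l t) =
      (\<Sum>p\<in>column_stabilizer l t. if p = id then 1 else 0)"
    unfolding polytabloid_def using column_stabilizer_fixes_rows[OF assms]
    by (intro sum.cong) (auto simp: sign_id)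
  then show ?thesis
    using id by (simp add: finite_column_stabilizer)
qed

text \<open>Pigeonhole: all columns are among the first \<open>k\<close>, so two of the more than
  \<open>k\<close> entries in \<open>A\<close> share a column. Their transposition negates the
  polytabloid but leaves its symmetrization over \<open>A\<close> unchanged.\<close>

lemma symm_polytabloid_eq_0:
  assumes t: "t \<in> tableaux l" and A: "A \<subseteq> {1..sum_list l}" "card A > k"
    and l: "\<And>x. x \<in> set l \<Longrightarrow> x \<le> k"
  shows "symm (\<lambda>p. map (image p)) A (polytabloid l t) = (\<lambda>_. 0)"
proof -
  define f where "f = inv_into (cells l) t"
  have f: "f x \<in> cells l" "t (f x) = x" if "x \<in> A" for x
    using that A(1) tableauxD(2)[OF t] by (auto simp: f_def inv_into_into f_inv_into_f)
  have "snd (f x) < k" if "x \<in> A" for x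
    using f(1)[OF that] l[of "l ! fst (f x)"] by (cases "f x") (auto simp: cells_def)
  then have "(snd \<circ> f) ` A \<subseteq> {..<k}"
    by auto
  then have "card ((snd \<circ> f) ` A) \<le> k"
    by (metis card_lessThan card_mono finite_lessThan)
  then have "\<not> inj_on (snd \<circ> f) A"
    using A(2) card_image by fastforce
  then obtain a b where ab: "a \<in> A" "b \<in> A" "a \<noteq> b" "snd (f a) = snd (f b)"
    by (auto simp: inj_on_def)
  define \<tau> where "\<tau> = Transposition.transpose a b"
  have \<tau>: "\<tau> permutes A"
    using ab by (simp add: \<tau>_def permutes_swap_id)
  obtain i i' j where fab: "f a = (i, j)" "f b = (i', j)"
    using ab(4) by (metis prod.collapse)
  have "\<tau> \<in> column_stabilizer l t"
    unfolding column_stabilizer_iff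
  proof (intro conjI allI impI)
    show "\<tau> permutes {1..sum_list l}"
      using permutes_subset[OF \<tau> A(1)] .
    fix i1 j1 assume ij: "(i1, j1) \<in> cells l"
    have inj: "t x = t y \<longleftrightarrow> x = y" if "x \<in> cells l" "y \<in> cells l" for x y
      using tableauxD(1)[OF t] that by (metis inj_onD)
    have tab: "a = t (i, j)" "b = t (i', j)" "(i, j) \<in> cells l" "(i', j) \<in> cells l"
      using f ab fab by metis+
    consider "t (i1, j1) = a" | "t (i1, j1) = b" | "t (i1, j1) \<noteq> a" "t (i1, j1) \<noteq> b"
      by blast
    then show "\<exists>i'. (i', j1) \<in> cells l \<and> \<tau> (t (i1, j1)) = t (i', j1)"
    proof cases
      case 1
      then have "j1 = j" using inj ij tab by auto
      then show ?thesis using 1 tab by (auto simp: \<tau>_def)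
    next
      case 2
      then have "j1 = j" using inj ij tab by auto
      then show ?thesis using 2 tab by (auto simp: \<tau>_def)
    next
      case 3
      then show ?thesis using ij by (auto simp: \<tau>_def transpose_def)
    qed
  qed
  moreover have "sign \<tau> = -1"
    using ab by (simp add: \<tau>_def sign_swap_id)
  ultimately have "pact (\<lambda>p. map (image p)) \<tau> (polytabloid l t) = (\<lambda>T. -1 * polytabloid l t T)"
    using pact_column_stabilizer[of \<tau> l t] by simp
  then have "symm (\<lambda>p. map (image p)) A (polytabloid l t) =
      (\<lambda>T. -1 * symm (\<lambda>p. map (image p)) A (polytabloid l t) T)"
    using symm_pact[OF functorial_map_image \<tau>, of "polytabloid l t"] by (simp only: symm_linear)
  then show ?thesis
    by (auto simp: fun_eq_iff)
qed

section \<open>Specht modules as invariant spaces of functions\<close>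

definition specht_space :: "nat list \<Rightarrow> (nat set list \<Rightarrow> complex) set"
  where "specht_space l = {(\<lambda>T. \<Sum>t\<in>tableaux l. c t * polytabloid l t T) | c. True}"

lemma specht_eq: "specht l = fun_rep (\<lambda>p. map (image p)) (specht_space l)"
  by (simp add: specht_def specht_space_def)

lemma lin_space_specht: "lin_space (specht_space l)"
  unfolding lin_space_def
proof (intro conjI ballI allI)
  show "(\<lambda>_. 0) \<in> specht_space l"
    unfolding specht_space_def by (auto intro!: exI[of _ "\<lambda>_. 0"])
  fix u v c assume "u \<in> specht_space l"
  then obtain x where x: "u = (\<lambda>T. \<Sum>t\<in>tableaux l. x t * polytabloid l t T)"
    by (auto simp: specht_space_def)
  then show "(\<lambda>T. c * u T) \<in> specht_space l"
    unfolding specht_space_def by (auto simp: sum_distrib_left mult.assoc intro!: exI[of _ "\<lambda>t. c * x t"])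
  assume "v \<in> specht_space l"
  then obtain y where "v = (\<lambda>T. \<Sum>t\<in>tableaux l. y t * polytabloid l t T)"
    by (auto simp: specht_space_def)
  then show "(\<lambda>T. u T + v T) \<in> specht_space l"
    unfolding specht_space_def x
    by (auto simp: sum.distrib ring_distribs intro!: exI[of _ "\<lambda>t. x t + y t"])
qed

lemma polytabloid_in_specht_space:
  assumes "t \<in> tableaux l"
  shows "polytabloid l t \<in> specht_space l"
proof -
  have "polytabloid l t = (\<lambda>T. \<Sum>s\<in>tableaux l. (if s = t then 1 else 0) * polytabloid l s T)"
    using assms by (simp add: if_distrib[of "\<lambda>x. x * _"] finite_tableaux cong: if_cong)
  then show ?thesis
    unfolding specht_space_def by (auto intro!: exI[of _ "\<lambda>s. if s = t then 1 else 0"])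
qed

lemma specht_space_subset:
  assumes "lin_space U" "\<And>t. t \<in> tableaux l \<Longrightarrow> polytabloid l t \<in> U"
  shows "specht_space l \<subseteq> U"
  unfolding specht_space_def using lin_space_lincomb[OF assms(1)] assms(2) by blast

lemma rep_space_specht:
  "rep_space (sum_list l) (\<lambda>p. map (image p)) (tabs l {1..sum_list l}) (specht_space l)"
  unfolding rep_space_def
proof (intro conjI allI impI)
  show "supported (tabs l {1..sum_list l}) (specht_space l)"
    using specht_space_subset[of "{u. \<forall>T. T \<notin> tabs l {1..sum_list l} \<longrightarrow> u T = 0}" l]
      polytabloid_support
    by (fastforce simp: supported_def lin_space_def)
  fix p assume p: "p permutes {1..sum_list l}"
  show "map (image p) ` tabs l {1..sum_list l} \<subseteq> tabs l {1..sum_list l}"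
    using tabs_image[OF permutes_bij[OF p]] permutes_image[OF p] by fastforce
  have "specht_space l \<subseteq> {u. pact (\<lambda>p. map (image p)) p u \<in> specht_space l}"
  proof (rule specht_space_subset)
    show "lin_space {u. pact (\<lambda>p. map (image p)) p u \<in> specht_space l}"
      using lin_space_specht[of l] by (simp add: lin_space_def pact_linear)
    show "polytabloid l t \<in> {u. pact (\<lambda>p. map (image p)) p u \<in> specht_space l}"
      if "t \<in> tableaux l" for t
      using restrict_comp_tableaux[OF that p] polytabloid_in_specht_space
      by (simp add: pact_polytabloid[OF p])
  qed
  then show "\<forall>u\<in>specht_space l. pact (\<lambda>p. map (image p)) p u \<in> specht_space l"
    by auto
qed (auto simp: functorial_map_image lin_space_specht finite_tabs)

section \<open>Removing the first row of a Specht module\<close>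

lemma tabloid_Cons_comp:
  "tabloid (k # l) (c \<circ> t) =
    c ` (\<lambda>j. t (0, j)) ` {..<k} # tabloid l (c \<circ> (\<lambda>(i, j). t (Suc i, j)))"
  by (simp add: tabloid_Cons image_image) (simp add: comp_def split_def)

text \<open>When the first row of \<open>t\<close> is \<open>K\<close>, a column permutation
  contributes to the value at \<open>K # T\<close> only if it preserves \<open>K\<close>. Those
  permutations turn out to be the column stabilizer of the tableau without its first row.\<close>

lemma polytabloid_slice_first_row:
  fixes k l
  defines "K \<equiv> {sum_list l + 1..k + sum_list l}"
  assumes t: "t \<in> tableaux (k # l)" and K: "(\<lambda>j. t (0, j)) ` {..<k} = K"
  defines "s \<equiv> \<lambda>x\<in>cells l. t (Suc (fst x), snd x)"
  shows "s \<in> tableaux l" and "(\<lambda>T. polytabloid (k # l) t (K # T)) = polytabloid l s"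
proof -
  let ?Y = "{1..sum_list l}" and ?X = "{1..sum_list (k # l)}"
  have X: "?X = K \<union> ?Y" "K \<inter> ?Y = {}"
    by (auto simp: K_def)
  have inj: "t x = t y \<longleftrightarrow> x = y" if "x \<in> cells (k # l)" "y \<in> cells (k # l)" for x y
    using inj_onD[OF tableauxD(1)[OF t]] that by blast
  have s: "s (i, j) = t (Suc i, j)" if "(i, j) \<in> cells l" for i j
    using that by (simp add: s_def)
  have row: "t (0, j) \<in> K" if "j < k" for j
    using K that by blast
  have row': "\<exists>j<k. x = t (0, j)" if "x \<in> K" for x
    using that unfolding K[symmetric] by auto
  have s_notin: "s x \<notin> K" if "x \<in> cells l" for x
  proof
    obtain i j where x: "x = (i, j)"
      by fastforce
    assume "s x \<in> K"
    then obtain j' where "j' < k" "s x = t (0, j')"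
      using row' by blast
    then show False
      using that x inj[of "(Suc i, j)" "(0, j')"] s[of i j] by simp
  qed
  have "inj_on s (cells l)"
  proof (rule inj_onI)
    fix x y assume "x \<in> cells l" "y \<in> cells l" "s x = s y"
    then show "x = y"
      using inj[of "(Suc (fst x), snd x)" "(Suc (fst y), snd y)"] by (simp add: s_def prod_eq_iff)
  qed
  moreover have "s ` cells l = ?Y"
  proof (intro equalityI subsetI)
    fix x assume "x \<in> s ` cells l"
    then obtain i j where ij: "(i, j) \<in> cells l" "x = s (i, j)"
      by auto
    then have "t (Suc i, j) \<in> t ` cells (k # l)"
      by (intro imageI) simp
    then have "x \<in> ?X"
      unfolding tableauxD(2)[OF t] using ij s by simp
    moreover have "x \<notin> K"
      using s_notin ij by simp
    ultimately show "x \<in> ?Y"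
      unfolding X(1) by blast
  next
    fix x assume x: "x \<in> ?Y"
    then have "x \<in> t ` cells (k # l)"
      unfolding tableauxD(2)[OF t] X(1) by blast
    then obtain y where y: "y \<in> cells (k # l)" "x = t y"
      by blast
    then obtain i j where ij: "y = (i, j)"
      by fastforce
    have "i \<noteq> 0"
    proof
      assume "i = 0"
      then have "x \<in> K"
        using row y ij by simp
      then show False
        using x X(2) by blast
    qed
    then obtain i' where "i = Suc i'"
      by (cases i) auto
    then show "x \<in> s ` cells l"
      using y ij s by (auto intro!: image_eqI[of _ _ "(i', j)"])
  qed
  ultimately show s_tab: "s \<in> tableaux l"
    by (simp add: tableaux_def bij_betw_def s_def)
  \<comment> \<open>A column permutation preserving \<open>K\<close> keeps every entry of the first
    row in its row and in its column, hence fixes it; what remains acts on the lower rows.\<close>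
  have stab: "column_stabilizer l s = {c \<in> column_stabilizer (k # l) t. c ` K = K}"
  proof (intro equalityI subsetI)
    fix c assume c: "c \<in> column_stabilizer l s"
    then have cY: "c permutes ?Y"
      by (simp add: column_stabilizer_iff)
    have cK: "c x = x" if "x \<in> K" for x
      using that X(2) permutes_not_in[OF cY] by blast
    have "c permutes ?X"
      using permutes_subset[OF cY] X(1) by blast
    moreover have "\<exists>i'. (i', j) \<in> cells (k # l) \<and> c (t (i, j)) = t (i', j)"
      if ij: "(i, j) \<in> cells (k # l)" for i j
    proof (cases i)
      case 0
      then show ?thesis
        using ij cK[OF row[of j]] by (intro exI[of _ 0]) auto
    next
      case (Suc i1)
      then obtain i2 where "(i2, j) \<in> cells l" "c (s (i1, j)) = s (i2, j)"
        using c ij by (auto simp: column_stabilizer_iff)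
      then show ?thesis
        using Suc ij s by (intro exI[of _ "Suc i2"]) auto
    qed
    ultimately show "c \<in> {c \<in> column_stabilizer (k # l) t. c ` K = K}"
      using cK by (auto simp: column_stabilizer_iff)
  next
    fix c assume "c \<in> {c \<in> column_stabilizer (k # l) t. c ` K = K}"
    then have c: "c \<in> column_stabilizer (k # l) t" and cK: "c ` K = K"
      by auto
    then have cX: "c permutes ?X"
      by (simp add: column_stabilizer_iff)
    have fix_K: "c x = x" if x: "x \<in> K" for x
    proof -
      obtain j where j: "j < k" "x = t (0, j)"
        using row'[OF x] by blast
      then have "(0, j) \<in> cells (k # l)"
        by simp
      then obtain i' where i': "(i', j) \<in> cells (k # l)" "c x = t (i', j)"
        using c j(2) unfolding column_stabilizer_iff by blast
      have "c x \<in> K"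
        using cK x by blast
      then obtain j' where "j' < k" "c x = t (0, j')"
        using row' by blast
      then show ?thesis
        using i' inj j by auto
    qed
    have "c permutes ?Y"
      using fix_K X(1) by (intro permutes_superset[OF cX]) auto
    moreover have "\<exists>i'. (i', j) \<in> cells l \<and> c (s (i, j)) = s (i', j)" if ij: "(i, j) \<in> cells l" for i j
    proof -
      have "(Suc i, j) \<in> cells (k # l)"
        using ij by simp
      then obtain i' where i': "(i', j) \<in> cells (k # l)" "c (t (Suc i, j)) = t (i', j)"
        using c unfolding column_stabilizer_iff by blast
      have "i' \<noteq> 0"
      proof
        assume "i' = 0"
        then have "c (s (i, j)) \<in> c ` K"
          using i' row[of j] s ij cK by auto
        then show False
          using s_notin[OF ij] permutes_inj[OF cX] by (simp add: inj_image_mem_iff)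
      qed
      then obtain i2 where "i' = Suc i2"
        by (cases i') auto
      then show ?thesis
        using i' s ij by auto
    qed
    ultimately show "c \<in> column_stabilizer l s"
      by (simp add: column_stabilizer_iff)
  qed
  have tab: "K # T = tabloid (k # l) (c \<circ> t) \<longleftrightarrow> c ` K = K \<and> T = tabloid l (c \<circ> s)" for c T
  proof -
    have "tabloid l (c \<circ> (\<lambda>(i, j). t (Suc i, j))) = tabloid l (c \<circ> s)"
      by (rule tabloid_cong) (auto simp: s)
    then show ?thesis
      unfolding tabloid_Cons_comp K by auto
  qed
  show "(\<lambda>T. polytabloid (k # l) t (K # T)) = polytabloid l s"
  proof
    fix T
    show "polytabloid (k # l) t (K # T) = polytabloid l s T"
      unfolding polytabloid_def stab tab
      using finite_column_stabilizer[of "k # l" t]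
      by (intro sum.mono_neutral_cong_right) auto
  qed
qed

text \<open>Either no column permutation brings the first row of \<open>t\<close> to
  \<open>K\<close>, and the slice of its polytabloid is zero, or \<open>t\<close> may be replaced by
  such a rearrangement at the cost of a sign, and \<open>polytabloid_slice_first_row\<close>
  applies.\<close>

lemma slice_specht_space:
  fixes k l
  defines "K \<equiv> {sum_list l + 1..k + sum_list l}"
  assumes F: "F \<in> specht_space (k # l)"
  shows "(\<lambda>T. F (K # T)) \<in> specht_space l"
proof -
  have "specht_space (k # l) \<subseteq> {F. (\<lambda>T. F (K # T)) \<in> specht_space l}"
  proof (rule specht_space_subset)
    show "lin_space {F. (\<lambda>T. F (K # T)) \<in> specht_space l}"
      using lin_space_specht[of l] by (simp add: lin_space_def)
    fix t assume t: "t \<in> tableaux (k # l)"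
    show "polytabloid (k # l) t \<in> {F. (\<lambda>T. F (K # T)) \<in> specht_space l}"
    proof (cases "\<exists>c\<in>column_stabilizer (k # l) t. c ` (\<lambda>j. t (0, j)) ` {..<k} = K")
      case True
      then obtain c where c: "c \<in> column_stabilizer (k # l) t" "c ` (\<lambda>j. t (0, j)) ` {..<k} = K"
        by blast
      then have cX: "c permutes {1..sum_list (k # l)}"
        by (simp add: column_stabilizer_iff)
      define t' where "t' = restrict (c \<circ> t) (cells (k # l))"
      have t': "t' \<in> tableaux (k # l)"
        unfolding t'_def by (rule restrict_comp_tableaux[OF t cX])
      have "(\<lambda>j. t' (0, j)) ` {..<k} = K"
        using c(2) by (auto simp: t'_def image_image)
      note s = polytabloid_slice_first_row[OF t' this[unfolded K_def], folded K_def]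
      have "(\<lambda>T. polytabloid (k # l) t' (K # T)) \<in> specht_space l"
        unfolding s(2) by (rule polytabloid_in_specht_space[OF s(1)])
      then have "(\<lambda>T. of_int (sign c) * polytabloid (k # l) t' (K # T)) \<in> specht_space l"
        by (rule lin_space_scale[OF lin_space_specht])
      moreover have "polytabloid (k # l) t' = (\<lambda>T. of_int (sign c) * polytabloid (k # l) t T)"
        using pact_polytabloid[OF cX, of t] pact_column_stabilizer[OF c(1)] by (simp add: t'_def)
      ultimately show ?thesis
        by (simp add: sign_def split: if_splits)
    next
      case False
      then have "polytabloid (k # l) t (K # T) = 0" for T
        unfolding polytabloid_def tabloid_Cons_comp by (intro sum.neutral) auto
      then show ?thesis
        using lin_space_zero[OF lin_space_specht[of l]] by simp
    qed
  qed
  then show ?thesis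
    using F by blast
qed

text \<open>Placing the letters of \<open>K\<close> as a new first row over a tableau of shape
  \<open>l\<close> gives a polytabloid whose slice is the given polytabloid.\<close>

lemma slice_specht_space_surj:
  fixes k l
  defines "K \<equiv> {sum_list l + 1..k + sum_list l}"
  assumes G: "G \<in> specht_space l"
  shows "\<exists>F\<in>specht_space (k # l). (\<lambda>T. F (K # T)) = G"
proof -
  have "specht_space l \<subseteq> {G. \<exists>F\<in>specht_space (k # l). (\<lambda>T. F (K # T)) = G}"
  proof (rule specht_space_subset)
    note lin = lin_space_specht[of "k # l"]
    show "lin_space {G. \<exists>F\<in>specht_space (k # l). (\<lambda>T. F (K # T)) = G}"
      unfolding lin_space_def
    proof (intro conjI ballI allI)
      show "(\<lambda>_. 0) \<in> {G. \<exists>F\<in>specht_space (k # l). (\<lambda>T. F (K # T)) = G}"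
        using lin_space_zero[OF lin] by auto
    next
      fix G G' assume "G \<in> {G. \<exists>F\<in>specht_space (k # l). (\<lambda>T. F (K # T)) = G}"
        "G' \<in> {G. \<exists>F\<in>specht_space (k # l). (\<lambda>T. F (K # T)) = G}"
      then obtain F F' where "F \<in> specht_space (k # l)" "(\<lambda>T. F (K # T)) = G"
        "F' \<in> specht_space (k # l)" "(\<lambda>T. F' (K # T)) = G'"
        by blast
      then show "(\<lambda>b. G b + G' b) \<in> {G. \<exists>F\<in>specht_space (k # l). (\<lambda>T. F (K # T)) = G}"
        using lin_space_add[OF lin, of F F'] by (auto intro!: bexI[of _ "\<lambda>T. F T + F' T"])
    next
      fix c G assume "G \<in> {G. \<exists>F\<in>specht_space (k # l). (\<lambda>T. F (K # T)) = G}"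
      then obtain F where "F \<in> specht_space (k # l)" "(\<lambda>T. F (K # T)) = G"
        by blast
      then show "(\<lambda>b. c * G b) \<in> {G. \<exists>F\<in>specht_space (k # l). (\<lambda>T. F (K # T)) = G}"
        using lin_space_scale[OF lin, of F] by (auto intro!: bexI[of _ "\<lambda>T. c * F T"])
    qed
    fix s assume s: "s \<in> tableaux l"
    define t where "t = (\<lambda>x\<in>cells (k # l).
      case fst x of 0 \<Rightarrow> sum_list l + 1 + snd x | Suc i \<Rightarrow> s (i, snd x))"
    have t0: "t (0, j) = sum_list l + 1 + j" if "j < k" for j
      using that by (simp add: t_def)
    have tS: "t (Suc i, j) = s (i, j)" if "(i, j) \<in> cells l" for i j
      using that by (simp add: t_def)
    have row: "(\<lambda>j. t (0, j)) ` {..<k} = K"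
    proof -
      have "(\<lambda>j. t (0, j)) ` {..<k} = (+) (sum_list l + 1) ` {0..<k}"
        using t0 by (auto simp: image_iff)
      also have "\<dots> = K"
        by (simp only: image_add_atLeastLessThan) (auto simp: K_def)
      finally show ?thesis .
    qed
    have low: "(\<lambda>(i, j). t (Suc i, j)) ` cells l = {1..sum_list l}"
    proof -
      have "(\<lambda>(i, j). t (Suc i, j)) ` cells l = s ` cells l"
        by (rule image_cong) (auto simp: tS)
      then show ?thesis
        by (simp only: tableauxD(2)[OF s])
    qed
    have im: "t ` cells (k # l) = {1..sum_list (k # l)}"
    proof -
      have "t ` cells (k # l) = (\<lambda>j. t (0, j)) ` {..<k} \<union> (\<lambda>(i, j). t (Suc i, j)) ` cells l"
        by (simp add: cells_Cons image_Un image_image split_def)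
      also have "\<dots> = {1..sum_list (k # l)}"
        unfolding row low by (auto simp: K_def)
      finally show ?thesis .
    qed
    have "inj_on t (cells (k # l))"
      by (rule eq_card_imp_inj_on) (simp_all only: finite_cells im card_cells card_atLeastAtMost)
    then have "t \<in> tableaux (k # l)"
      using im by (simp add: tableaux_def bij_betw_def t_def)
    note slice = polytabloid_slice_first_row[OF this row[unfolded K_def], folded K_def]
    have "(\<lambda>x\<in>cells l. t (Suc (fst x), snd x)) = s"
      using s by (auto simp: tS tableaux_def extensional_def fun_eq_iff)
    then show "polytabloid l s \<in> {G. \<exists>F\<in>specht_space (k # l). (\<lambda>T. F (K # T)) = G}"
      using slice(2) polytabloid_in_specht_space[OF \<open>t \<in> tableaux (k # l)\<close>] by auto
  qed
  then show ?thesis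
    using G by blast
qed

lemma permutes_extension:
  assumes "finite S" "A \<subseteq> S" "B \<subseteq> S" "card A = card B"
  obtains \<sigma> where "\<sigma> permutes S" "\<sigma> ` A = B"
proof -
  obtain f where f: "bij_betw f A B"
    using assms finite_same_card_bij by (metis finite_subset)
  have "card (S - A) = card (S - B)"
    using assms by (simp add: card_Diff_subset finite_subset)
  then obtain h where h: "bij_betw h (S - A) (S - B)"
    using assms(1) finite_same_card_bij by (metis finite_Diff)
  define \<sigma> where "\<sigma> x = (if x \<in> A then f x else if x \<in> S then h x else x)" for x
  have A: "bij_betw \<sigma> A B"
    using f by (rule bij_betw_cong[THEN iffD1, rotated]) (simp add: \<sigma>_def)
  have "bij_betw \<sigma> (S - A) (S - B)"
    using h by (rule bij_betw_cong[THEN iffD1, rotated]) (simp add: \<sigma>_def)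
  then have "bij_betw \<sigma> (A \<union> (S - A)) (B \<union> (S - B))"
    using A by (intro bij_betw_combine) auto
  then have "bij_betw \<sigma> S S"
    using assms by (simp add: Un_absorb1)
  then have "\<sigma> permutes S"
    using assms(2) by (intro bij_imp_permutes) (auto simp: \<sigma>_def)
  then show thesis
    using A that by (simp add: bij_betw_def)
qed

text \<open>The relation \<open>symm B f = 0\<close> for \<open>card B = Suc k\<close> expresses \<open>f T\<close> through
  tabloids whose first row is closer to \<open>K\<close>.\<close>

lemma slice_injective:
  fixes f :: "nat set list \<Rightarrow> complex"
  assumes X: "finite X" and K: "K \<subseteq> X" "card K = k"
    and supp: "\<And>T. T \<notin> tabs (k # l) X \<Longrightarrow> f T = 0"
    and inv: "\<And>p. p permutes K \<Longrightarrow> pact (\<lambda>p. map (image p)) p f = f"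
    and symm: "\<And>A. A \<subseteq> X \<Longrightarrow> card A = Suc k \<Longrightarrow> symm (\<lambda>p. map (image p)) A f = (\<lambda>_. 0)"
    and slice: "\<And>T. f (K # T) = 0"
  shows "f = (\<lambda>_. 0)"
proof -
  have "f (A # T) = 0" if "A # T \<in> tabs (k # l) X" "card (A - K) = r" for A T r
    using that
  proof (induction r arbitrary: A T)
    case 0
    then have A: "A \<subseteq> X" "card A = k"
      by auto
    then have "finite (A - K)"
      using X by (auto dest: finite_subset)
    then have "A \<subseteq> K"
      using 0 by simp
    then have "A = K"
      using A K X by (intro card_subset_eq) (auto dest: finite_subset)
    then show ?case
      using slice by simp
  next
    case (Suc r)
    then have A: "A \<subseteq> X" "card A = k" and T: "T \<in> tabs l (X - A)"
      by auto
    have fin: "finite A" "finite K"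
      using A K X by (auto dest: finite_subset)
    have "\<not> K \<subseteq> A"
      using card_subset_eq[OF fin(1), of K] A K Suc.prems(2) by auto
    then obtain b where b: "b \<in> K" "b \<notin> A"
      by blast
    define B where "B = insert b A"
    have B: "B \<subseteq> X" "card B = Suc k" "finite B"
      using b A K fin by (auto simp: B_def)
    \<comment> \<open>On \<open>A # T\<close>, a permutation of \<open>B\<close> contributes as the
      transposition of \<open>b\<close> with \<open>y = inv' p b\<close> does. If \<open>y\<close>
      is in \<open>K\<close>, invariance returns \<open>f (A # T)\<close>. Otherwise
      \<open>b\<close> replaces \<open>y\<close> in the first row, which is then one element closer
      to \<open>K\<close>, and the induction hypothesis gives 0.\<close>
    define good where "good = {p. p permutes B \<and> inv' p b \<in> K}"
    have summand: "pact (\<lambda>p. map (image p)) p f (A # T) = (if p \<in> good then f (A # T) else 0)"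
      if p: "p permutes B" for p
    proof -
      define c where "c = inv' p"
      define y where "y = c b"
      define \<tau> where "\<tau> = Transposition.transpose b y"
      have c: "c permutes B"
        unfolding c_def by (rule permutes_inv[OF p])
      have y: "y \<in> B"
        using permutes_in_image[OF c, of b] by (simp add: y_def B_def)
      have \<tau>: "\<tau> permutes B"
        using y by (simp add: \<tau>_def B_def permutes_swap_id)
      have agree: "c x = \<tau> x" if "x \<in> X - A" for x
        using that permutes_not_in[OF c, of x] permutes_not_in[OF \<tau>, of x]
        by (cases "x = b") (auto simp: y_def \<tau>_def B_def)
      have "map (image c) T = map (image \<tau>) T"
        using tabs_subset[OF T] agree by (intro map_cong image_cong refl) blast
      moreover have "c ` A = \<tau> ` A"
      proof -
        have "c ` B - c ` {b} = \<tau> ` B - \<tau> ` {b}"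
          using permutes_image[OF c] permutes_image[OF \<tau>] by (simp add: y_def \<tau>_def)
        moreover have "A = B - {b}"
          using b by (auto simp: B_def)
        ultimately show ?thesis
          using permutes_inj[OF c] permutes_inj[OF \<tau>] by (simp add: image_set_diff)
      qed
      ultimately have val: "pact (\<lambda>p. map (image p)) p f (A # T) = f (map (image \<tau>) (A # T))"
        by (simp only: pact_def c_def[symmetric] list.map)
      show ?thesis
      proof (cases "y \<in> K")
        case True
        then have "\<tau> permutes K"
          using b by (simp add: \<tau>_def permutes_swap_id)
        moreover have "inv' \<tau> = \<tau>"
          by (simp add: \<tau>_def)
        ultimately have "f (map (image \<tau>) (A # T)) = f (A # T)"
          using inv[of \<tau>] by (metis pact_def)
        then show ?thesis
          using val True p by (simp add: good_def y_def c_def)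
      next
        case False
        then have yA: "y \<in> A" "y \<notin> K" "y \<noteq> b"
          using y b by (auto simp: B_def)
        have "\<tau> ` A = insert b (A - {y})"
          using yA b by (auto simp: \<tau>_def transpose_def image_iff)
        then have "\<tau> ` A - K = (A - K) - {y}"
          using b by auto
        then have "card (\<tau> ` A - K) = r"
          using yA Suc.prems(2) fin by simp
        moreover have "map (image \<tau>) (A # T) \<in> tabs (k # l) X"
          using tabs_image[OF permutes_bij[OF \<tau>] Suc.prems(1)]
            permutes_image[OF permutes_subset[OF \<tau> B(1)]] by metis
        ultimately have "f (map (image \<tau>) (A # T)) = 0"
          using Suc.IH[of "\<tau> ` A" "map (image \<tau>) T"] by simp
        then show ?thesis
          using val False by (simp add: good_def y_def c_def)
      qed
    qed
    have "0 = symm (\<lambda>p. map (image p)) B f (A # T)"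
      using symm[OF B(1,2)] by simp
    also have "\<dots> = (\<Sum>p | p permutes B. if p \<in> good then f (A # T) else 0)"
      unfolding symm_def using summand by (intro sum.cong) auto
    also have "\<dots> = of_nat (card good) * f (A # T)"
      using finite_permutations[OF B(3)]
      by (subst sum.inter_filter[symmetric]) (auto simp: good_def)
    finally have "of_nat (card good) * f (A # T) = 0"
      by simp
    \<comment> \<open>The identity is good because \<open>b\<close> is in \<open>K\<close>, so the
      integer factor is positive.\<close>
    moreover have "id \<in> good" "finite good"
      using b finite_permutations[OF B(3)] by (auto simp: good_def permutes_id inv_id)
    ultimately show ?case
      by (auto simp: card_eq_0_iff)
  qed
  then have "f T = 0" for T
    using supp[of T] by (cases "T \<in> tabs (k # l) X") auto
  then show ?thesis
    by blast
qed

section \<open>Splitting off the constituents with a first row of maximal length\<close>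

abbreviation tact :: "(nat \<Rightarrow> nat) \<Rightarrow> nat set list \<Rightarrow> nat set list"
  where "tact \<equiv> \<lambda>p. map (image p)"

definition pair_act :: "(nat \<Rightarrow> nat) \<Rightarrow> nat \<times> nat set list \<Rightarrow> nat \<times> nat set list"
  where "pair_act p = (\<lambda>(i, T). (i, tact p T))"

lemma pair_act_simp [simp]: "pair_act p (i, T) = (i, tact p T)"
  by (simp add: pair_act_def)

lemma functorial_pair_act: "functorial pair_act"
  by (auto simp: functorial_def fun_eq_iff pair_act_def image_comp)

lemma pact_pair_act: "pact pair_act p F (i, T) = pact tact p (\<lambda>T. F (i, T)) T"
  by (simp add: pact_def)

lemma symm_pair_act: "symm pair_act A F (i, T) = symm tact A (\<lambda>T. F (i, T)) T"
  by (simp add: symm_def pact_pair_act)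

lemma ip_sum: "ip P (\<lambda>b. \<Sum>i\<in>I. f i b) u = (\<Sum>i\<in>I. ip P (f i) u)"
  by (simp add: ip_def sum_distrib_right sum.swap[of _ I])

lemma symm_in_orth:
  assumes "rep_space m a P S" "rep_space m a P U" "A \<subseteq> {1..m}"
    and "\<And>u. u \<in> S \<Longrightarrow> ip P z u = 0" "u \<in> S"
  shows "ip P (symm a A z) u = 0"
proof -
  have "ip P (pact a p z) u = 0" if "p permutes A" for p
  proof -
    have p: "p permutes {1..m}"
      using permutes_subset[OF that assms(3)] .
    then show ?thesis
      using rep_space_ip_pact[OF assms(1) p] rep_space_pact[OF assms(1) permutes_inv[OF p] assms(5)]
        assms(4) by simp
  qed
  then show ?thesis
    unfolding symm_def ip_sum by simp
qed

lemma additive_sum: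
  fixes \<phi> :: "('b \<Rightarrow> complex) \<Rightarrow> complex"
  assumes U: "lin_space U" and add: "\<And>u v. u \<in> U \<Longrightarrow> v \<in> U \<Longrightarrow> \<phi> (\<lambda>b. u b + v b) = \<phi> u + \<phi> v"
    and f: "\<And>i. i \<in> I \<Longrightarrow> f i \<in> U"
  shows "\<phi> (\<lambda>b. \<Sum>i\<in>I. f i b) = (\<Sum>i\<in>I. \<phi> (f i))"
  using f
proof (induction I rule: infinite_finite_induct)
  case (insert i I)
  then show ?case
    using add[of "f i" "\<lambda>b. \<Sum>i\<in>I. f i b"] lin_space_sum[OF U, of I f] by simp
qed (use add[OF lin_space_zero[OF U] lin_space_zero[OF U]] in simp_all)

text \<open>Tabloids tagged with the index of their summand, so that a direct sum of permutation
  modules is again a space of functions on one finite permuted set.\<close>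

definition pair_tabs :: "nat \<Rightarrow> nat \<Rightarrow> nat list list \<Rightarrow> (nat \<times> nat set list) set"
  where "pair_tabs m k ls = {(i, T). i < length ls \<and> T \<in> tabs (k # ls ! i) {1..m}}"

lemma finite_pair_tabs: "finite (pair_tabs m k ls)"
proof -
  have "pair_tabs m k ls = (\<Union>i<length ls. Pair i ` tabs (k # ls ! i) {1..m})"
    unfolding pair_tabs_def by blast
  also have "finite \<dots>"
    by (intro finite_UN_I finite_imageI finite_tabs) auto
  finally show ?thesis .
qed

lemma pair_act_pair_tabs:
  assumes "p permutes {1..m}"
  shows "pair_act p b \<in> pair_tabs m k ls \<longleftrightarrow> b \<in> pair_tabs m k ls"
proof -
  have "pair_act q b \<in> pair_tabs m k ls" if q: "q permutes {1..m}" and bin: "b \<in> pair_tabs m k ls" for q b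
  proof -
    obtain i T where b: "b = (i, T)" "i < length ls" "T \<in> tabs (k # ls ! i) {1..m}"
      using bin unfolding pair_tabs_def by blast
    have "tact q T \<in> tabs (k # ls ! i) {1..m}"
      using tabs_image[OF permutes_bij[OF q] b(3)] permutes_image[OF q] by simp
    then show ?thesis
      using b by (simp add: pair_tabs_def del: tabs.simps)
  qed
  then show ?thesis
    using assms permutes_inv[OF assms] functorial_cancel[OF functorial_pair_act permutes_bij[OF assms]]
    by metis
qed

text \<open>Two invariant spaces are compared through their values at first row \<open>K\<close>
  alone. Equal slices force equal symmetrizations over \<open>K\<close> by
  \<open>slice_injective\<close>, conjugation extends this to every set of \<open>k\<close> letters,
  and an element is determined by these symmetrizations.\<close>

lemma rep_space_subset_slices:
  fixes m k ls
  defines "K \<equiv> {m - k + 1..m}"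
  assumes S: "rep_space m pair_act (pair_tabs m k ls) S"
    and S': "rep_space m pair_act (pair_tabs m k ls) S'" and k: "k \<le> m"
    and symm: "\<And>F A. F \<in> S \<union> S' \<Longrightarrow> A \<subseteq> {1..m} \<Longrightarrow> card A = Suc k \<Longrightarrow> symm pair_act A F = (\<lambda>_. 0)"
    and slices: "\<And>F. F \<in> S \<Longrightarrow> \<exists>F'\<in>S'. \<forall>i T. F (i, K # T) = F' (i, K # T)"
  shows "S \<subseteq> S'"
proof
  note pair = functorial_pair_act
  have K: "K \<subseteq> {1..m}" "card K = k" "finite K"
    using k by (auto simp: K_def)
  have lin: "lin_space S" "lin_space S'"
    using S S' by (auto simp: rep_space_def)
  have supp: "F b = 0" if "F \<in> S \<union> S'" "b \<notin> pair_tabs m k ls" for F b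
    using S S' that unfolding rep_space_def supported_def by blast
  \<comment> \<open>Permutations of \<open>A\<close> do not change a tabloid with first row
    \<open>A\<close>.\<close>
  have symm_slice: "symm pair_act A F (i, A # T) = fact k * F (i, A # T)"
    if A: "A \<subseteq> {1..m}" "card A = k" and F: "\<And>b. b \<notin> pair_tabs m k ls \<Longrightarrow> F b = 0" for F A i T
  proof -
    have fin: "finite A"
      using A(1) by (auto dest: finite_subset)
    have "pact pair_act p F (i, A # T) = F (i, A # T)" if p: "p permutes A" for p
    proof (cases "(i, A # T) \<in> pair_tabs m k ls")
      case True
      then have T: "T \<in> tabs (ls ! i) ({1..m} - A)"
        by (auto simp: pair_tabs_def)
      have "map (image (inv' p)) T = map (image id) T"
        using tabs_subset[OF T] permutes_not_in[OF permutes_inv[OF p]]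
        by (intro map_cong image_cong refl) (simp, blast)
      then show ?thesis
        by (simp add: pact_def permutes_image[OF permutes_inv[OF p]])
    next
      case False
      have "inv' p permutes {1..m}"
        using permutes_subset[OF permutes_inv[OF p] A(1)] .
      then have "pair_act (inv' p) (i, A # T) \<notin> pair_tabs m k ls"
        using False pair_act_pair_tabs by blast
      then show ?thesis
        using False F by (simp add: pact_def)
    qed
    then have "symm pair_act A F (i, A # T) = (\<Sum>p | p permutes A. F (i, A # T))"
      unfolding symm_def by (intro sum.cong) auto
    then show ?thesis
      using card_permutations[OF A(2) fin] by simp
  qed
  have symm_K: "symm pair_act K F \<in> S'" if F: "F \<in> S" for F
  proof -
    obtain F' where F': "F' \<in> S'" "\<And>i T. F (i, K # T) = F' (i, K # T)"
      using slices[OF F] by blast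
    \<comment> \<open>Both symmetrizations are invariant under \<open>K\<close> and have the same
      slices, so \<open>slice_injective\<close> makes every component of \<open>D\<close>
      vanish.\<close>
    define D where "D = (\<lambda>b. symm pair_act K F b - symm pair_act K F' b)"
    have D_supp: "D b = 0" if "b \<notin> pair_tabs m k ls" for b
      using supp[OF _ that(1), of "symm pair_act K F"] supp[OF _ that(1), of "symm pair_act K F'"]
        symm_in_space[OF S K(1) F] symm_in_space[OF S' K(1) F'(1)] by (simp add: D_def)
    have D_inv: "pact pair_act p D = D" if "p permutes K" for p
      unfolding D_def pact_linear pact_symm[OF pair that] ..
    have D_symm: "symm pair_act A D = (\<lambda>_. 0)" if "A \<subseteq> {1..m}" "card A = Suc k" for A
      unfolding D_def symm_linear
      using symm[OF _ that, of "symm pair_act K F"] symm[OF _ that, of "symm pair_act K F'"]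
        symm_in_space[OF S K(1) F] symm_in_space[OF S' K(1) F'(1)] by simp
    have D_slice: "D (i, K # T) = 0" for i T
      unfolding D_def using symm_slice[OF K(1,2), of F i T] symm_slice[OF K(1,2), of F' i T] F F' supp
      by simp
    have "(\<lambda>T. D (i, T)) = (\<lambda>_. 0)" for i
    proof (cases "i < length ls")
      case True
      show ?thesis
      proof (rule slice_injective[where X = "{1..m}" and l = "ls ! i"])
        show "D (i, T) = 0" if "T \<notin> tabs (k # ls ! i) {1..m}" for T
          using that by (intro D_supp) (simp add: pair_tabs_def del: tabs.simps)
        show "pact tact p (\<lambda>T. D (i, T)) = (\<lambda>T. D (i, T))" if "p permutes K" for p
          using fun_cong[OF D_inv[OF that], of "(i, _)"] by (intro ext) (simp add: pact_pair_act)
        show "symm tact A (\<lambda>T. D (i, T)) = (\<lambda>_. 0)" if "A \<subseteq> {1..m}" "card A = Suc k" for A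
          using fun_cong[OF D_symm[OF that], of "(i, _)"] by (intro ext) (simp add: symm_pair_act)
      qed (use K D_slice in auto)
    next
      case False
      then show ?thesis
        using D_supp by (auto simp: pair_tabs_def)
    qed
    then have "symm pair_act K F = symm pair_act K F'"
      by (auto simp: D_def fun_eq_iff)
    then show ?thesis
      using symm_in_space[OF S' K(1) F'(1)] by simp
  qed
  have symm_A: "symm pair_act A F \<in> S'" if F: "F \<in> S" and A: "A \<subseteq> {1..m}" "card A = k" for F A
  proof -
    obtain \<sigma> where \<sigma>: "\<sigma> permutes {1..m}" "\<sigma> ` K = A"
      using permutes_extension[of "{1..m}" K A] K A by auto
    have "pact pair_act \<sigma> (symm pair_act K (pact pair_act (inv' \<sigma>) F)) = symm pair_act A F"
      using pact_symm_conj[OF pair permutes_bij[OF \<sigma>(1)]] \<sigma>(2)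
      by (simp add: pact_inv[OF pair permutes_bij[OF \<sigma>(1)]])
    then show ?thesis
      using rep_space_pact[OF S' \<sigma>(1) symm_K[OF rep_space_pact[OF S permutes_inv[OF \<sigma>(1)] F]]]
      by simp
  qed
  fix x assume x: "x \<in> S"
  obtain y where y: "y \<in> S'" "\<And>u. u \<in> S' \<Longrightarrow> ip (pair_tabs m k ls) (\<lambda>b. x b - y b) u = 0"
    using orthogonal_projection[of "pair_tabs m k ls" S' x] S' by (auto simp: rep_space_def)
  \<comment> \<open>\<open>z\<close> is the part of \<open>x\<close> orthogonal to
    \<open>S'\<close>. Its symmetrizations over sets of \<open>k\<close> letters lie in
    \<open>S'\<close> and are still orthogonal to \<open>S'\<close>, hence vanish; at first row
    \<open>A\<close> the symmetrization over \<open>A\<close> is \<open>k!\<close> times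
    \<open>z\<close>.\<close>
  define z where "z = (\<lambda>b. x b - y b)"
  have z_supp: "z b = 0" if "b \<notin> pair_tabs m k ls" for b
    using supp[OF _ that, of x] supp[OF _ that, of y] x y(1) by (simp add: z_def)
  have "z (i, A # T) = 0" if "(i, A # T) \<in> pair_tabs m k ls" for i A T
  proof -
    from that have A: "A \<subseteq> {1..m}" "card A = k"
      by (auto simp: pair_tabs_def)
    have "symm pair_act A z \<in> S'"
      unfolding z_def symm_linear
      by (intro lin_space_diff[OF lin(2)] symm_A[OF x A] symm_in_space[OF S' A(1) y(1)])
    moreover have "ip (pair_tabs m k ls) (symm pair_act A z) u = 0" if "u \<in> S'" for u
      using symm_in_orth[OF S' S A(1) _ that] y(2) by (simp add: z_def)
    ultimately have "symm pair_act A z = (\<lambda>_. 0)"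
      by (intro orth_disjoint[OF S', of _ S']) (auto simp: orth_def)
    then show ?thesis
      using symm_slice[OF A, of z i T] z_supp by simp
  qed
  then have "z b = 0" for b
    using z_supp[of b] by (cases "b \<in> pair_tabs m k ls") (auto simp: pair_tabs_def)
  then have "x = y"
    by (auto simp: z_def fun_eq_iff)
  then show "x \<in> S'"
    using y by simp
qed

definition pair_specht :: "nat \<Rightarrow> nat \<Rightarrow> nat list list \<Rightarrow> (nat \<times> nat set list \<Rightarrow> complex) set"
  where "pair_specht m k ls = {F. (\<forall>b. b \<notin> pair_tabs m k ls \<longrightarrow> F b = 0) \<and>
    (\<forall>i<length ls. (\<lambda>T. F (i, T)) \<in> specht_space (k # ls ! i))}"

lemma rep_space_pair_specht:
  assumes "\<And>l. l \<in> set ls \<Longrightarrow> sum_list (k # l) = m"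
  shows "rep_space m pair_act (pair_tabs m k ls) (pair_specht m k ls)"
  unfolding rep_space_def
proof (intro conjI allI impI ballI)
  show "lin_space (pair_specht m k ls)"
    using lin_space_specht unfolding pair_specht_def by (simp add: lin_space_def)
  show "supported (pair_tabs m k ls) (pair_specht m k ls)"
    by (simp add: supported_def pair_specht_def)
  fix p assume p: "p permutes {1..m}"
  show "pair_act p ` pair_tabs m k ls \<subseteq> pair_tabs m k ls"
    using pair_act_pair_tabs[OF p] by blast
  fix F assume F: "F \<in> pair_specht m k ls"
  have "pact pair_act p F b = 0" if "b \<notin> pair_tabs m k ls" for b
    using F that pair_act_pair_tabs[OF permutes_inv[OF p], of b]
    by (simp add: pact_def pair_specht_def del: split_paired_All)
  moreover have "(\<lambda>T. pact pair_act p F (i, T)) \<in> specht_space (k # ls ! i)" if "i < length ls" for i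
  proof -
    have "m = sum_list (k # ls ! i)"
      using assms[of "ls ! i"] that by simp
    then show ?thesis
      using rep_space_pact[OF rep_space_specht, of p "k # ls ! i" "\<lambda>T. F (i, T)"] p F that
      by (simp add: pact_pair_act pair_specht_def)
  qed
  ultimately show "pact pair_act p F \<in> pair_specht m k ls"
    by (simp add: pair_specht_def)
qed (auto simp: functorial_pair_act finite_pair_tabs)

lemma carrier_specht_sum_iff:
  "x \<in> carrier (specht_sum ls) \<longleftrightarrow>
    (\<forall>i<length ls. x i \<in> specht_space (ls ! i)) \<and> (\<forall>i. \<not> i < length ls \<longrightarrow> x i = undefined)"
  by (auto simp: specht_sum_def carrier_rep_sum_iff specht_eq fun_rep_sel)

lemma specht_sum_apply:
  assumes "i < length ls"
  shows "\<zero>\<^bsub>specht_sum ls\<^esub> i = (\<lambda>_. 0)"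
    "(x \<oplus>\<^bsub>specht_sum ls\<^esub> y) i = (\<lambda>T. x i T + y i T)"
    "(c \<odot>\<^bsub>specht_sum ls\<^esub> x) i = (\<lambda>T. c * x i T)"
    "act (specht_sum ls) p x i = pact tact p (x i)"
  using assms by (simp_all add: specht_sum_def rep_sum_apply specht_eq fun_rep_sel)

lemma specht_sum_apply_undefined:
  assumes "\<not> i < length ls"
  shows "\<zero>\<^bsub>specht_sum ls\<^esub> i = undefined"
    "(x \<oplus>\<^bsub>specht_sum ls\<^esub> y) i = undefined"
    "(c \<odot>\<^bsub>specht_sum ls\<^esub> x) i = undefined"
    "act (specht_sum ls) p x i = undefined"
  using assms by (simp_all add: specht_sum_def rep_sum_apply)

lemma sym_module_specht_sum:
  assumes "\<And>l. l \<in> set ls \<Longrightarrow> sum_list l = m"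
  shows "sym_module m (specht_sum ls)"
  unfolding specht_sum_def
proof (rule sym_module_rep_sum)
  fix V assume "V \<in> set (map specht ls)"
  then obtain l where "l \<in> set ls" "V = specht l"
    by auto
  then show "sym_module m V"
    using rep_space_sym_module[OF rep_space_specht[of l]] assms by (simp add: specht_eq)
qed

lemma sym_iso_specht_sum_append:
  assumes "\<And>l. l \<in> set ls \<union> set ls' \<Longrightarrow> sum_list l = m"
  shows "sym_iso m (rep_sum2 (specht_sum ls) (specht_sum ls')) (specht_sum (ls @ ls'))"
  unfolding specht_sum_def map_append
proof (rule sym_iso_rep_sum_append)
  fix V assume "V \<in> set (map specht ls) \<union> set (map specht ls')"
  then obtain l where "l \<in> set ls \<union> set ls'" "V = specht l"
    by auto
  then show "sym_module m V"
    using rep_space_sym_module[OF rep_space_specht[of l]] assms[of l] by (simp add: specht_eq)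
qed

lemma sym_iso_pair_specht:
  assumes "\<And>l. l \<in> set ls \<Longrightarrow> sum_list (k # l) = m"
  shows "sym_iso m (fun_rep pair_act (pair_specht m k ls)) (specht_sum (map ((#) k) ls))"
proof (rule sym_isoI)
  let ?ls = "map ((#) k) ls" and ?n = "length ls"
  let ?f = "\<lambda>F. \<lambda>i\<in>{..<?n}. \<lambda>T. F (i, T)"
  let ?g = "\<lambda>x (i, T). if i < ?n then x i T else (0::complex)"
  show "sym_module m (fun_rep pair_act (pair_specht m k ls))"
    using rep_space_pair_specht[OF assms] by (rule rep_space_sym_module)
  show "bij_betw ?f (carrier (fun_rep pair_act (pair_specht m k ls))) (carrier (specht_sum ?ls))"
    unfolding fun_rep_sel
  proof (rule bij_betw_byWitness[where f' = ?g])
    show "\<forall>F\<in>pair_specht m k ls. ?g (?f F) = F"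
      by (auto simp: fun_eq_iff pair_specht_def pair_tabs_def)
    show "\<forall>x\<in>carrier (specht_sum ?ls). ?f (?g x) = x"
      by (auto simp: fun_eq_iff carrier_specht_sum_iff)
    show "?f ` pair_specht m k ls \<subseteq> carrier (specht_sum ?ls)"
      by (auto simp: carrier_specht_sum_iff pair_specht_def)
    have supp: "T \<in> tabs (k # ls ! i) {1..m}"
      if "x \<in> carrier (specht_sum ?ls)" "i < ?n" "x i T \<noteq> 0" for x i T
    proof -
      have "sum_list (k # ls ! i) = m"
        using assms that(2) by simp
      then show ?thesis
        using rep_space_specht[of "k # ls ! i"] that
        unfolding rep_space_def supported_def carrier_specht_sum_iff by (auto simp del: tabs.simps)
    qed
    have "?g x \<in> pair_specht m k ls" if "x \<in> carrier (specht_sum ?ls)" for x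
      using that supp[OF that] unfolding pair_specht_def carrier_specht_sum_iff
      by (auto simp: pair_tabs_def simp del: tabs.simps)
    then show "?g ` carrier (specht_sum ?ls) \<subseteq> pair_specht m k ls"
      by blast
  qed
qed (rule ext; auto simp: fun_rep_sel specht_sum_apply specht_sum_apply_undefined pact_def restrict_def)+

lemma specht_space_support:
  "f \<in> specht_space l \<Longrightarrow> T \<notin> tabs l {1..sum_list l} \<Longrightarrow> f T = 0"
  using rep_space_specht[of l] unfolding rep_space_def supported_def by blast

lemma permutes_disjoint_commute:
  assumes "p permutes A" "q permutes B" "A \<inter> B = {}"
  shows "p \<circ> q = q \<circ> p"
proof
  fix x
  show "(p \<circ> q) x = (q \<circ> p) x"
    using assms permutes_in_image[OF assms(1)] permutes_in_image[OF assms(2)]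
      permutes_not_in[OF assms(1)] permutes_not_in[OF assms(2)]
    by (metis comp_apply disjoint_iff)
qed

section \<open>Invariants and the map to functions on tabloids\<close>

definition fixed_space ::
    "((nat \<Rightarrow> nat) \<Rightarrow> 'b \<Rightarrow> 'b) \<Rightarrow> nat set \<Rightarrow> ('b \<Rightarrow> complex) set \<Rightarrow> ('b \<Rightarrow> complex) set"
  where "fixed_space a K U = {u \<in> U. \<forall>p. p permutes K \<longrightarrow> pact a p u = u}"

text \<open>Permutations of the first \<open>m - k\<close> letters commute with those of the last
  \<open>k\<close>.\<close>

lemma rep_space_fixed_space:
  assumes U: "rep_space m a P U" and k: "k \<le> m"
  shows "rep_space (m - k) a P (fixed_space a {m - k + 1..m} U)"
proof -
  let ?K = "{m - k + 1..m}"
  have a: "functorial a"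
    using U by (simp add: rep_space_def)
  have m: "p permutes {1..m}" if "p permutes {1..m - k}" for p
    by (rule permutes_subset[OF that]) auto
  have "pact a q (pact a p u) = pact a p u"
    if p: "p permutes {1..m - k}" and q: "q permutes ?K" and u: "pact a q u = u" for p q u
  proof -
    have "q \<circ> p = p \<circ> q"
      using q p by (rule permutes_disjoint_commute) auto
    then show ?thesis
      using pact_comp[OF a permutes_bij[OF p] permutes_bij[OF q], of u]
        pact_comp[OF a permutes_bij[OF q] permutes_bij[OF p], of u] u by simp
  qed
  then have "\<forall>p. p permutes {1..m - k} \<longrightarrow>
      (\<forall>u\<in>fixed_space a ?K U. pact a p u \<in> fixed_space a ?K U)"
    using rep_space_pact[OF U] m by (auto simp: fixed_space_def)
  moreover have "lin_space (fixed_space a ?K U)"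
    using U by (simp add: rep_space_def lin_space_def fixed_space_def pact_linear)
  ultimately show ?thesis
    using U m by (simp add: rep_space_def supported_def fixed_space_def)
qed

text \<open>Row removal relative to one isomorphism \<open>g\<close> of the invariants
  \<open>W\<close> with a sum of Specht modules; it is a parameter because the map \<open>G\<close>
  is built from it.\<close>

locale row_removal =
  fixes m k :: nat and ls :: "nat list list" and a :: "(nat \<Rightarrow> nat) \<Rightarrow> 'b \<Rightarrow> 'b"
    and P :: "'b set" and U :: "('b \<Rightarrow> complex) set"
    and g :: "('b \<Rightarrow> complex) \<Rightarrow> nat \<Rightarrow> nat set list \<Rightarrow> complex"
    and K Y :: "nat set" and W :: "('b \<Rightarrow> complex) set"
  defines "K \<equiv> {m - k + 1..m}" and "Y \<equiv> {1..m - k}" and "W \<equiv> fixed_space a K U"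
  assumes U: "rep_space m a P U"
    and k: "1 \<le> k" "k \<le> m"
    and symm_U: "\<And>A u. A \<subseteq> {1..m} \<Longrightarrow> card A = Suc k \<Longrightarrow> u \<in> U \<Longrightarrow> symm a A u = (\<lambda>_. 0)"
    and ls: "\<And>l. l \<in> set ls \<Longrightarrow> partition_of (m - k) l"
    and g_bij: "bij_betw g W (carrier (specht_sum ls))"
    and g_add: "\<And>u v. u \<in> W \<Longrightarrow> v \<in> W \<Longrightarrow> g (\<lambda>b. u b + v b) = g u \<oplus>\<^bsub>specht_sum ls\<^esub> g v"
    and g_scale: "\<And>c u. u \<in> W \<Longrightarrow> g (\<lambda>b. c * u b) = c \<odot>\<^bsub>specht_sum ls\<^esub> g u"
    and g_act: "\<And>p u. p permutes Y \<Longrightarrow> u \<in> W \<Longrightarrow> g (pact a p u) = act (specht_sum ls) p (g u)"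
begin

lemma a: "functorial a" and lin_U: "lin_space U"
  using U by (auto simp: rep_space_def)

lemma K: "K \<subseteq> {1..m}" "card K = k" "finite K" and KY: "{1..m} = K \<union> Y" "K \<inter> Y = {}"
  using k by (auto simp: K_def Y_def)

lemma W: "rep_space (m - k) a P W"
  unfolding W_def K_def by (rule rep_space_fixed_space[OF U k(2)])

lemma lin_W: "lin_space W" and W_U: "W \<subseteq> U" and W_fixed: "w \<in> W \<Longrightarrow> p permutes K \<Longrightarrow> pact a p w = w"
  using W by (auto simp: rep_space_def W_def fixed_space_def)

lemma sum_ls: "l \<in> set ls \<Longrightarrow> sum_list l = m - k" and sum_k_ls: "l \<in> set ls \<Longrightarrow> sum_list (k # l) = m"
  using ls k by (auto simp: partition_of_def)

lemma g_carrier: "w \<in> W \<Longrightarrow> g w \<in> carrier (specht_sum ls)"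
  using g_bij by (auto simp: bij_betw_def)

lemma g_surj: "x \<in> carrier (specht_sum ls) \<Longrightarrow> \<exists>w\<in>W. g w = x"
  using g_bij by (metis bij_betw_def imageE)

lemma g_apply:
  assumes "i < length ls"
  shows "u \<in> W \<Longrightarrow> v \<in> W \<Longrightarrow> g (\<lambda>b. u b + v b) i T = g u i T + g v i T"
    and "u \<in> W \<Longrightarrow> g (\<lambda>b. c * u b) i T = c * g u i T"
    and "p permutes Y \<Longrightarrow> u \<in> W \<Longrightarrow> g (pact a p u) i T = pact tact p (g u i) T"
    and "g (\<lambda>_. 0) i T = 0"
proof -
  show "u \<in> W \<Longrightarrow> g (\<lambda>b. c * u b) i T = c * g u i T" for c u
    using assms by (simp add: g_scale specht_sum_apply)
  from this[OF lin_space_zero[OF lin_W], of 0] show "g (\<lambda>_. 0) i T = 0"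
    by simp
qed (use assms in \<open>simp_all add: g_add g_act specht_sum_apply\<close>)

lemma symm_K_W: "u \<in> U \<Longrightarrow> symm a K u \<in> W"
  using symm_in_space[OF U K(1)] pact_symm[OF a] by (simp add: W_def fixed_space_def)

lemma symm_W: "w \<in> W \<Longrightarrow> symm a K w = (\<lambda>b. fact k * w b)"
  using symm_invariant[OF K(3), of a w] W_fixed K(2) by simp

text \<open>This makes \<open>k # l\<close> a partition. If the first row were longer than
  \<open>k\<close>, choose \<open>k + 1\<close> of its letters in some tableau. Symmetrization over
  them kills the element of \<open>W\<close> corresponding to the polytabloid, yet these
  permutations fix the tabloid of \<open>t\<close>, so its coefficient becomes
  \<open>(k + 1)!\<close>.\<close>

lemma first_row_le:
  assumes l: "l \<in> set ls" and x: "x \<in> set l"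
  shows "x \<le> k"
proof (rule ccontr)
  assume "\<not> x \<le> k"
  obtain i where i: "i < length ls" "l = ls ! i"
    using l by (auto simp: in_set_conv_nth)
  obtain r l' where r: "l = r # l'"
    using x by (cases l) auto
  have "x \<le> r"
    using ls[OF l] x r by (auto simp: partition_of_def)
  then have "Suc k \<le> r"
    using \<open>\<not> x \<le> k\<close> by simp
  obtain t where t: "t \<in> tableaux l"
    using tableaux_nonempty by blast
  define R where "R = (\<lambda>j. t (0, j)) ` {..<r}"
  have inj: "inj_on (\<lambda>j. t (0, j)) {..<r}"
    using inj_onD[OF tableauxD(1)[OF t], of "(0, _)" "(0, _)"] r by (simp add: inj_on_def)
  have "R \<subseteq> t ` cells l"
    using r by (auto simp: R_def)
  then have R: "R \<subseteq> Y" "finite R" "card R = r"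
    using tableauxD(2)[OF t] sum_ls[OF l] inj by (auto simp: Y_def R_def card_image)
  then obtain A where A: "A \<subseteq> R" "card A = Suc k" "finite A"
    using \<open>Suc k \<le> r\<close> obtain_subset_with_card_n by metis
  define y where "y = (\<lambda>j\<in>{..<length ls}. if j = i then polytabloid l t else (\<lambda>_. 0))"
  have "y \<in> carrier (specht_sum ls)"
    using i polytabloid_in_specht_space[OF t] lin_space_zero[OF lin_space_specht]
    by (auto simp: carrier_specht_sum_iff y_def)
  then obtain w where w: "w \<in> W" "g w = y"
    using g_surj by blast
  have "symm a A w = (\<lambda>_. 0)"
    using symm_U[of A w] A R(1) KY(1) w W_U by blast
  then have "0 = g (symm a A w) i (tabloid l t)"
    using g_apply(4)[OF i(1)] by simp
  also have "\<dots> = (\<Sum>p | p permutes A. g (pact a p w) i (tabloid l t))"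
    unfolding symm_def
  proof (rule additive_sum[OF lin_W])
    show "pact a p w \<in> W" if "p \<in> {p. p permutes A}" for p
    proof -
      have "p permutes Y"
        using that permutes_subset[of p A Y] A(1) R(1) by blast
      then show ?thesis
        unfolding Y_def by (rule rep_space_pact[OF W _ w(1)])
    qed
  qed (rule g_apply(1)[OF i(1)])
  also have "\<dots> = (\<Sum>p | p permutes A. 1)"
  proof (rule sum.cong[OF refl])
    fix p assume "p \<in> {p. p permutes A}"
    then have p: "p permutes A" "inv' p permutes A"
      by (auto simp: permutes_inv)
    have pR: "inv' p permutes R"
      using permutes_subset[OF p(2) A(1)] .
    have "tact (inv' p) (tabloid l t) = tabloid l t"
    proof -
      have T: "tabloid l t \<in> tabs l (t ` cells l)"
        by (rule tabloid_in_tabs[OF tableauxD(1)[OF t]])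
      obtain T' where T': "tabloid l t = R # T'" "T' \<in> tabs l' (t ` cells l - R)"
        using T unfolding r tabloid_Cons R_def by auto
      have "map (image (inv' p)) T' = map (image id) T'"
        using tabs_subset[OF T'(2)] permutes_not_in[OF pR]
        by (intro map_cong image_cong refl) (simp, blast)
      then show ?thesis
        using T'(1) permutes_image[OF pR] by simp
    qed
    moreover have "p permutes Y"
      using permutes_subset[OF p(1)] A(1) R(1) by blast
    ultimately show "g (pact a p w) i (tabloid l t) = 1"
      using g_apply(3)[OF i(1) _ w(1), of p] w(2) i polytabloid_self[OF t]
      by (simp add: y_def pact_def)
  qed
  also have "\<dots> = fact (card A)"
    using card_permutations[OF refl A(3)] by simp
  finally show False
    by simp
qed

lemma partition_k_ls: "l \<in> set ls \<Longrightarrow> partition_of m (k # l)"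
  using ls[of l] first_row_le[of l] k by (auto simp: partition_of_def)

text \<open>The map adjoint to \<open>g\<close> under Frobenius reciprocity: homomorphisms into a
  module induced from the permutations preserving \<open>K\<close> correspond to homomorphisms on
  the invariants of \<open>K\<close>. To evaluate at a tabloid, move its first row back to
  \<open>K\<close>, symmetrize over \<open>K\<close>, and read off the coefficient of
  \<open>g\<close> at the lower rows.\<close>

definition G :: "('b \<Rightarrow> complex) \<Rightarrow> nat \<times> nat set list \<Rightarrow> complex"
  where "G v = (\<lambda>(i, B). if (i, B) \<in> pair_tabs m k ls then
    let \<sigma> = SOME \<sigma>. \<sigma> permutes {1..m} \<and> \<sigma> ` K = hd B
    in g (symm a K (pact a (inv' \<sigma>) v)) i (tact (inv' \<sigma>) (tl B)) else 0)"

lemma image_Y: "\<sigma> permutes {1..m} \<Longrightarrow> \<sigma> ` Y = {1..m} - \<sigma> ` K"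
proof -
  assume \<sigma>: "\<sigma> permutes {1..m}"
  have "Y = {1..m} - K"
    using KY by blast
  then show ?thesis
    using image_set_diff[OF permutes_inj[OF \<sigma>], of "{1..m}" K] permutes_image[OF \<sigma>] by metis
qed

lemma mem_pair_tabs:
  assumes "\<sigma> permutes {1..m}" "i < length ls" "T \<in> tabs (ls ! i) Y"
  shows "(i, tact \<sigma> (K # T)) \<in> pair_tabs m k ls"
proof -
  have "K # T \<in> tabs (k # ls ! i) {1..m}"
    using K assms(3) KY by (auto simp: Un_Diff Diff_triv Int_commute)
  then have "tact \<sigma> (K # T) \<in> tabs (k # ls ! i) (\<sigma> ` {1..m})"
    by (rule tabs_image[OF permutes_bij[OF assms(1)]])
  then show ?thesis
    using assms(2) unfolding pair_tabs_def permutes_image[OF assms(1)] by blast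
qed

lemma pair_tabsE:
  assumes "(i, B) \<in> pair_tabs m k ls"
  obtains \<sigma> T where "\<sigma> permutes {1..m}" "i < length ls" "T \<in> tabs (ls ! i) Y" "B = tact \<sigma> (K # T)"
proof -
  from assms obtain A T' where B: "i < length ls" "B = A # T'" "A \<subseteq> {1..m}" "card A = k"
    "T' \<in> tabs (ls ! i) ({1..m} - A)"
    by (auto simp: pair_tabs_def)
  obtain \<sigma> where \<sigma>: "\<sigma> permutes {1..m}" "\<sigma> ` K = A"
    using permutes_extension[of "{1..m}" K A] K B by auto
  have inv: "bij (inv' \<sigma>)"
    using permutes_bij[OF permutes_inv[OF \<sigma>(1)]] .
  have "inv' \<sigma> ` ({1..m} - A) = Y"
    unfolding \<sigma>(2)[symmetric] image_Y[OF \<sigma>(1), symmetric]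
    by (simp add: image_image permutes_inverses[OF \<sigma>(1)])
  then have "tact (inv' \<sigma>) T' \<in> tabs (ls ! i) Y"
    using tabs_image[OF inv B(5)] by simp
  moreover have "B = tact \<sigma> (K # tact (inv' \<sigma>) T')"
    using B(2) \<sigma>(2) functorial_cancel(1)[OF functorial_map_image permutes_bij[OF \<sigma>(1)], of T'] by simp
  ultimately show thesis
    using that \<sigma>(1) B(1) by blast
qed

lemma pair_eqI:
  fixes F F' :: "nat \<times> nat set list \<Rightarrow> complex"
  assumes "\<And>b. b \<notin> pair_tabs m k ls \<Longrightarrow> F b = F' b"
    and "\<And>\<sigma> i T. \<sigma> permutes {1..m} \<Longrightarrow> i < length ls \<Longrightarrow> T \<in> tabs (ls ! i) Y \<Longrightarrow>
      F (i, tact \<sigma> (K # T)) = F' (i, tact \<sigma> (K # T))"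
  shows "F = F'"
proof
  fix b :: "nat \<times> nat set list"
  obtain i B where b: "b = (i, B)"
    by fastforce
  show "F b = F' b"
  proof (cases "b \<in> pair_tabs m k ls")
    case True
    then show ?thesis
      unfolding b by (elim pair_tabsE) (simp add: assms(2) del: list.map)
  qed (use assms in blast)
qed

lemma G_outside: "b \<notin> pair_tabs m k ls \<Longrightarrow> G v b = 0"
  by (cases b) (simp add: G_def)

text \<open>The choice of \<open>\<sigma>\<close> is immaterial: two choices differ by a permutation
  that preserves \<open>K\<close> and \<open>Y\<close>.\<close>

lemma G_apply:
  assumes v: "v \<in> U" and \<sigma>: "\<sigma> permutes {1..m}" and i: "i < length ls" and T: "T \<in> tabs (ls ! i) Y"
  shows "G v (i, tact \<sigma> (K # T)) = g (symm a K (pact a (inv' \<sigma>) v)) i T"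
proof -
  define \<rho> where "\<rho> = (SOME \<rho>. \<rho> permutes {1..m} \<and> \<rho> ` K = \<sigma> ` K)"
  have \<rho>: "\<rho> permutes {1..m}" "\<rho> ` K = \<sigma> ` K"
    using someI[of "\<lambda>\<rho>. \<rho> permutes {1..m} \<and> \<rho> ` K = \<sigma> ` K" \<sigma>] \<sigma> by (auto simp: \<rho>_def)
  have G: "G v (i, tact \<sigma> (K # T)) =
      g (symm a K (pact a (inv' \<rho>) v)) i (tact (inv' \<rho>) (tact \<sigma> T))"
    using mem_pair_tabs[OF \<sigma> i T] by (simp add: G_def \<rho>_def Let_def)
  define \<tau> where "\<tau> = inv' \<rho> \<circ> \<sigma>"
  have \<tau>: "\<tau> permutes {1..m}"
    unfolding \<tau>_def by (rule permutes_compose[OF \<sigma> permutes_inv[OF \<rho>(1)]])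
  have \<tau>K: "\<tau> ` K = K"
  proof -
    have "\<tau> ` K = inv' \<rho> ` \<rho> ` K"
      unfolding \<tau>_def \<rho>(2) by (simp only: image_comp)
    then show ?thesis
      by (simp add: image_image permutes_inverses[OF \<rho>(1)])
  qed
  have \<tau>Y: "\<tau> ` Y = Y"
    unfolding image_Y[OF \<tau>] \<tau>K using KY by auto
  \<comment> \<open>Splits \<open>\<tau>\<close> into a part on \<open>Y\<close>, with which
    \<open>g\<close> commutes, and a part on \<open>K\<close>, which fixes every element of
    \<open>W\<close>.\<close>
  define \<tau>2 where "\<tau>2 x = (if x \<in> Y then \<tau> x else x)" for x
  have \<tau>2: "\<tau>2 permutes Y"
  proof (rule bij_imp_permutes)
    have "bij_betw \<tau> Y Y"
      using \<tau>Y permutes_inj[OF \<tau>] by (auto simp: bij_betw_def intro: inj_on_subset)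
    then show "bij_betw \<tau>2 Y Y"
      by (rule bij_betw_cong[THEN iffD1, rotated]) (simp add: \<tau>2_def)
  qed (simp add: \<tau>2_def)
  then have \<tau>2m: "\<tau>2 permutes {1..m}"
    using KY(1) by (auto intro: permutes_subset)
  define \<tau>1 where "\<tau>1 = inv' \<tau>2 \<circ> \<tau>"
  have "\<tau>1 permutes {1..m}"
    unfolding \<tau>1_def by (rule permutes_compose[OF \<tau> permutes_inv[OF \<tau>2m]])
  moreover have "\<tau>1 x = x" if "x \<in> {1..m} - K" for x
  proof -
    have "x \<in> Y"
      using that KY(1) by blast
    then have "\<tau> x = \<tau>2 x"
      by (simp add: \<tau>2_def)
    then show ?thesis
      by (simp add: \<tau>1_def permutes_inverses[OF \<tau>2m])
  qed
  ultimately have \<tau>1: "\<tau>1 permutes K"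
    by (rule permutes_superset)
  define w where "w = symm a K (pact a (inv' \<sigma>) v)"
  have w: "w \<in> W"
    unfolding w_def by (intro symm_K_W rep_space_pact[OF U permutes_inv[OF \<sigma>] v])
  have "inv' \<rho> = \<tau> \<circ> inv' \<sigma>"
    by (simp add: \<tau>_def fun_eq_iff permutes_inverses[OF \<sigma>])
  then have "pact a (inv' \<rho>) v = pact a \<tau> (pact a (inv' \<sigma>) v)"
    using pact_comp[OF a permutes_bij[OF \<tau>] permutes_bij[OF permutes_inv[OF \<sigma>]]] by simp
  then have "symm a K (pact a (inv' \<rho>) v) = pact a \<tau> w"
    using pact_symm_conj[OF a permutes_bij[OF \<tau>], of K "pact a (inv' \<sigma>) v"] \<tau>K by (simp add: w_def)
  also have "\<tau> = \<tau>2 \<circ> \<tau>1"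
    by (simp add: \<tau>1_def fun_eq_iff permutes_inverses[OF \<tau>2m])
  also have "pact a (\<tau>2 \<circ> \<tau>1) w = pact a \<tau>2 w"
    using pact_comp[OF a permutes_bij[OF \<tau>2] permutes_bij[OF \<tau>1]] W_fixed[OF w \<tau>1] by simp
  finally have "g (symm a K (pact a (inv' \<rho>) v)) i X = pact tact \<tau>2 (g w i) X" for X
    using g_apply(3)[OF i \<tau>2 w] by simp
  moreover have "tact (inv' \<rho>) (tact \<sigma> T) = tact \<tau>2 T"
  proof -
    have "tact (inv' \<rho>) (tact \<sigma> T) = tact \<tau> T"
      by (simp add: \<tau>_def image_comp)
    also have "\<dots> = tact \<tau>2 T"
      using tabs_subset[OF T] by (intro map_cong image_cong refl) (auto simp: \<tau>2_def)
    finally show ?thesis .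
  qed
  moreover have "pact tact \<tau>2 (g w i) (tact \<tau>2 T) = g w i T"
    unfolding pact_def
    using functorial_cancel(2)[OF functorial_map_image permutes_bij[OF \<tau>2], of T] by simp
  ultimately show ?thesis
    unfolding G by (simp only: w_def)
qed

lemma G_add: "u \<in> U \<Longrightarrow> v \<in> U \<Longrightarrow> G (\<lambda>b. u b + v b) = (\<lambda>b. G u b + G v b)"
proof (rule pair_eqI, goal_cases)
  case (2 \<sigma> i T)
  then show ?case
    using rep_space_pact[OF U permutes_inv[OF 2(3)]] lin_space_add[OF lin_U]
    by (simp add: G_apply pact_linear symm_linear g_apply symm_K_W del: list.map)
qed (simp add: G_outside)

lemma G_scale: "u \<in> U \<Longrightarrow> G (\<lambda>b. c * u b) = (\<lambda>b. c * G u b)"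
proof (rule pair_eqI, goal_cases)
  case (2 \<sigma> i T)
  then show ?case
    using rep_space_pact[OF U permutes_inv[OF 2(2)]] lin_space_scale[OF lin_U]
    by (simp add: G_apply pact_linear symm_linear g_apply symm_K_W del: list.map)
qed (simp add: G_outside)

lemma G_pact:
  assumes u: "u \<in> U" and p: "p permutes {1..m}"
  shows "G (pact a p u) = pact pair_act p (G u)"
proof (rule pair_eqI)
  fix b assume "b \<notin> pair_tabs m k ls"
  then show "G (pact a p u) b = pact pair_act p (G u) b"
    using pair_act_pair_tabs[OF permutes_inv[OF p], of b]
    by (simp add: G_outside pact_def[of pair_act p "G u"])
next
  fix \<sigma> i T assume *: "\<sigma> permutes {1..m}" "i < length ls" "T \<in> tabs (ls ! i) Y"
  have \<sigma>': "inv' p \<circ> \<sigma> permutes {1..m}"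
    by (rule permutes_compose[OF *(1) permutes_inv[OF p]])
  have "pact pair_act p (G u) (i, tact \<sigma> (K # T)) = G u (i, tact (inv' p \<circ> \<sigma>) (K # T))"
    using functorial_map_image by (simp only: pact_def pair_act_simp functorial_def comp_apply)
  also have "\<dots> = g (symm a K (pact a (inv' (inv' p \<circ> \<sigma>)) u)) i T"
    by (rule G_apply[OF u \<sigma>' *(2,3)])
  also have "inv' (inv' p \<circ> \<sigma>) = inv' \<sigma> \<circ> p"
    using permutes_bij[OF p] permutes_bij[OF *(1)] permutes_bij[OF permutes_inv[OF p]]
    by (simp add: o_inv_distrib inv_inv_eq)
  also have "pact a (inv' \<sigma> \<circ> p) u = pact a (inv' \<sigma>) (pact a p u)"
    by (rule pact_comp[OF a permutes_bij[OF permutes_inv[OF *(1)]] permutes_bij[OF p]])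
  finally show "G (pact a p u) (i, tact \<sigma> (K # T)) = pact pair_act p (G u) (i, tact \<sigma> (K # T))"
    using G_apply[OF rep_space_pact[OF U p u] *] by simp
qed

lemma G_zero: "G (\<lambda>_. 0) = (\<lambda>_. 0)"
  using G_scale[OF lin_space_zero[OF lin_U], of 0] by simp

lemma G_symm:
  assumes u: "u \<in> U" and A: "A \<subseteq> {1..m}"
  shows "G (symm a A u) = symm pair_act A (G u)"
proof
  fix b
  have p: "p permutes {1..m}" if "p \<in> {p. p permutes A}" for p
    using that permutes_subset[OF _ A] by blast
  have "G (symm a A u) b = (\<Sum>p | p permutes A. G (pact a p u) b)"
    unfolding symm_def
    by (rule additive_sum[OF lin_U]) (use G_add rep_space_pact[OF U p u] in auto)
  also have "\<dots> = symm pair_act A (G u) b"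
    unfolding symm_def using G_pact[OF u p] by (intro sum.cong) auto
  finally show "G (symm a A u) b = symm pair_act A (G u) b" .
qed

text \<open>With the converse \<open>G_eq_zeroD\<close>, the kernel of \<open>G\<close> consists of
  the elements killed by symmetrization over every set of \<open>k\<close> letters: up to moving
  \<open>A\<close> to \<open>K\<close>, the values at first row \<open>A\<close> are the image under
  \<open>g\<close> of the symmetrization over \<open>A\<close>.\<close>

lemma G_eq_zeroI:
  assumes "u \<in> U" "\<And>A. A \<subseteq> {1..m} \<Longrightarrow> card A = k \<Longrightarrow> symm a A u = (\<lambda>_. 0)"
  shows "G u = (\<lambda>_. 0)"
proof (rule pair_eqI)
  fix \<sigma> i T assume *: "\<sigma> permutes {1..m}" "i < length ls" "T \<in> tabs (ls ! i) Y"
  have inv: "inv' \<sigma> permutes {1..m}" "bij \<sigma>"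
    using * permutes_inv permutes_bij by auto
  have "symm a (\<sigma> ` K) u = (\<lambda>_. 0)"
    using * K permutes_image[OF *(1)] permutes_inj[OF *(1)]
    by (intro assms(2)) (auto simp: card_image inj_on_subset permutes_in_image)
  moreover have "symm a K (pact a (inv' \<sigma>) u) = pact a (inv' \<sigma>) (symm a (\<sigma> ` K) u)"
    using pact_symm_conj[OF a permutes_bij[OF inv(1)], of "\<sigma> ` K" u]
    by (simp add: image_image permutes_inverses[OF *(1)])
  ultimately show "G u (i, tact \<sigma> (K # T)) = 0"
    using G_apply[OF assms(1) *] g_apply(4)[OF *(2)] by (simp add: pact_linear)
qed (simp add: G_outside)

lemma G_eq_zeroD:
  assumes u: "u \<in> U" and "G u = (\<lambda>_. 0)" and A: "A \<subseteq> {1..m}" "card A = k"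
  shows "symm a A u = (\<lambda>_. 0)"
proof -
  obtain \<sigma> where \<sigma>: "\<sigma> permutes {1..m}" "\<sigma> ` K = A"
    using permutes_extension[of "{1..m}" K A] K A by auto
  define w where "w = symm a K (pact a (inv' \<sigma>) u)"
  have w: "w \<in> W"
    unfolding w_def by (intro symm_K_W rep_space_pact[OF U permutes_inv[OF \<sigma>(1)] u])
  \<comment> \<open>Only tabloids over \<open>Y\<close> are visible to \<open>G\<close>; elsewhere
    elements of a Specht space vanish anyway. Hence \<open>g w\<close> is zero and injectivity of
    \<open>g\<close> gives \<open>w = 0\<close>.\<close>
  have inside: "g w i T = g (\<lambda>_. 0) i T" if i: "i < length ls" for i T
  proof (cases "T \<in> tabs (ls ! i) Y")
    case True
    then show ?thesis
      using G_apply[OF u \<sigma>(1) i True] assms(2) g_apply(4)[OF i] by (simp add: w_def)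
  next
    case False
    have sum: "sum_list (ls ! i) = m - k"
      using sum_ls i by simp
    have "g w i \<in> specht_space (ls ! i)"
      using g_carrier[OF w] i unfolding carrier_specht_sum_iff by blast
    then have "g w i T = 0"
      by (rule specht_space_support) (use False in \<open>simp only: sum Y_def not_False_eq_True\<close>)
    then show ?thesis
      using g_apply(4)[OF i] by simp
  qed
  have outside: "g w i = g (\<lambda>_. 0) i" if "\<not> i < length ls" for i
    using that g_carrier[OF w] g_carrier[OF lin_space_zero[OF lin_W]] by (simp add: carrier_specht_sum_iff)
  have "g w = g (\<lambda>_. 0)"
    using inside outside by (intro ext) (metis (full_types))
  then have "w = (\<lambda>_. 0)"
    using g_bij w lin_space_zero[OF lin_W] by (auto simp: bij_betw_def inj_on_def)
  moreover have "pact a \<sigma> w = symm a A u"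
    using pact_symm_conj[OF a permutes_bij[OF \<sigma>(1)]] \<sigma>(2)
    by (simp add: w_def pact_inv[OF a permutes_bij[OF \<sigma>(1)]])
  ultimately show ?thesis
    by (simp add: pact_linear)
qed

lemma G_slice: "v \<in> U \<Longrightarrow> i < length ls \<Longrightarrow> T \<in> tabs (ls ! i) Y \<Longrightarrow> G v (i, K # T) = g (symm a K v) i T"
  using G_apply[of v id i T] by (simp add: permutes_id inv_id pact_id[OF a])

lemma slice_outside:
  assumes "\<not> (i < length ls \<and> T \<in> tabs (ls ! i) Y)"
  shows "(i, K # T) \<notin> pair_tabs m k ls"
proof -
  have "{1..m} - K = Y"
    using KY by auto
  then show ?thesis
    using assms by (auto simp: pair_tabs_def)
qed

lemma rep_space_G_image: "rep_space m pair_act (pair_tabs m k ls) (G ` U)"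
  unfolding rep_space_def
proof (intro conjI allI impI ballI)
  show "lin_space (G ` U)"
    unfolding lin_space_def
  proof (intro conjI ballI allI)
    show "(\<lambda>_. 0) \<in> G ` U"
      using G_zero lin_space_zero[OF lin_U] by (metis imageI)
    fix F F' c assume "F \<in> G ` U"
    then obtain u where u: "u \<in> U" "F = G u"
      by blast
    then show "(\<lambda>b. c * F b) \<in> G ` U"
      using imageI[OF lin_space_scale[OF lin_U u(1), of c], of G] by (simp add: G_scale)
    assume "F' \<in> G ` U"
    then obtain u' where u': "u' \<in> U" "F' = G u'"
      by blast
    then show "(\<lambda>b. F b + F' b) \<in> G ` U"
      using imageI[OF lin_space_add[OF lin_U u(1) u'(1)], of G] u by (simp add: G_add)
  qed
  show "supported (pair_tabs m k ls) (G ` U)"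
    using G_outside by (auto simp: supported_def)
  fix p assume p: "p permutes {1..m}"
  show "pair_act p ` pair_tabs m k ls \<subseteq> pair_tabs m k ls"
    using pair_act_pair_tabs[OF p] by blast
  show "pact pair_act p F \<in> G ` U" if "F \<in> G ` U" for F
  proof -
    obtain u where u: "u \<in> U" "F = G u"
      using \<open>F \<in> G ` U\<close> by blast
    then show ?thesis
      using imageI[OF rep_space_pact[OF U p u(1)], of G] by (simp add: G_pact[OF _ p])
  qed
qed (auto simp: functorial_pair_act finite_pair_tabs)

lemma symm_pair_specht:
  assumes F: "F \<in> pair_specht m k ls" and A: "A \<subseteq> {1..m}" "card A = Suc k"
  shows "symm pair_act A F = (\<lambda>_. 0)"
proof -
  have "symm tact A (\<lambda>T. F (i, T)) = (\<lambda>_. 0)" for i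
  proof (cases "i < length ls")
    case True
    let ?l = "k # ls ! i"
    have l: "sum_list ?l = m" "\<And>x. x \<in> set ?l \<Longrightarrow> x \<le> k"
      using True sum_k_ls[of "ls ! i"] first_row_le[of "ls ! i"] by auto
    have "specht_space ?l \<subseteq> {f. symm tact A f = (\<lambda>_. 0)}"
    proof (rule specht_space_subset)
      show "polytabloid ?l t \<in> {f. symm tact A f = (\<lambda>_. 0)}" if "t \<in> tableaux ?l" for t
        using symm_polytabloid_eq_0[OF that, of A k] A l by simp
    qed (simp add: lin_space_def symm_linear)
    then show ?thesis
      using F True by (auto simp: pair_specht_def)
  next
    case False
    then have "(\<lambda>T. F (i, T)) = (\<lambda>_. 0)"
      using F by (auto simp: pair_specht_def pair_tabs_def)
    then show ?thesis
      by (simp add: symm_linear)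
  qed
  then show ?thesis
    by (auto simp: fun_eq_iff symm_pair_act)
qed

lemma K_eq: "l \<in> set ls \<Longrightarrow> K = {sum_list l + 1..k + sum_list l}"
  using sum_ls k by (simp add: K_def)

text \<open>Both inclusions compare slices at first row \<open>K\<close>. On either side these
  slices range over all families in the Specht spaces of \<open>ls\<close>: for \<open>G\<close>
  because \<open>g\<close> is onto, for the Specht spaces of shapes \<open>k # l\<close> by removal
  of the first row.\<close>

lemma G_image: "G ` U = pair_specht m k ls"
proof (rule subset_antisym)
  have S1: "rep_space m pair_act (pair_tabs m k ls) (pair_specht m k ls)"
    by (rule rep_space_pair_specht[OF sum_k_ls])
  note S2 = rep_space_G_image
  have symm: "symm pair_act A F = (\<lambda>_. 0)"
    if F: "F \<in> pair_specht m k ls \<union> G ` U" and A: "A \<subseteq> {1..m}" "card A = Suc k" for F A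
  proof (cases "F \<in> pair_specht m k ls")
    case False
    then obtain u where "u \<in> U" "F = G u"
      using F by blast
    then show ?thesis
      using G_symm[of u A] symm_U[OF A, of u] G_zero A(1) by simp
  qed (rule symm_pair_specht[OF _ A])
  show "pair_specht m k ls \<subseteq> G ` U"
  proof (rule rep_space_subset_slices[OF S1 S2 k(2)])
    fix F assume F: "F \<in> pair_specht m k ls"
    define x where "x = (\<lambda>i\<in>{..<length ls}. \<lambda>T. F (i, K # T))"
    have "x i \<in> specht_space (ls ! i)" if "i < length ls" for i
      using slice_specht_space[of "\<lambda>T. F (i, T)" k "ls ! i"] F that K_eq[of "ls ! i"]
      by (simp add: x_def pair_specht_def)
    then have "x \<in> carrier (specht_sum ls)"
      by (simp add: carrier_specht_sum_iff x_def)
    then obtain w where w: "w \<in> W" "g w = x"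
      using g_surj by blast
    \<comment> \<open>The factor undoes \<open>symm_W\<close>, so that the symmetrization of
      \<open>v\<close> over \<open>K\<close> is \<open>w\<close>.\<close>
    define v where "v = (\<lambda>b. (1 / fact k) * w b)"
    have v: "v \<in> W"
      unfolding v_def by (rule lin_space_scale[OF lin_W w(1)])
    have "symm a K v = w"
      using symm_W[OF v] by (simp add: v_def)
    then have "F (i, K # T) = G v (i, K # T)" for i T
      using G_slice[of v i T] slice_outside[of i T] v W_U w(2) F G_outside
      by (cases "i < length ls \<and> T \<in> tabs (ls ! i) Y") (auto simp: x_def pair_specht_def)
    then show "\<exists>F'\<in>G ` U. \<forall>i T. F (i, {m - k + 1..m} # T) = F' (i, {m - k + 1..m} # T)"
      using v W_U unfolding K_def by blast
  qed (rule symm; auto)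
  show "G ` U \<subseteq> pair_specht m k ls"
  proof (rule rep_space_subset_slices[OF S2 S1 k(2)])
    fix F assume "F \<in> G ` U"
    then obtain v where v: "v \<in> U" "F = G v"
      by blast
    have x: "g (symm a K v) i \<in> specht_space (ls ! i)" if "i < length ls" for i
      using g_carrier[OF symm_K_W[OF v(1)]] that by (simp add: carrier_specht_sum_iff)
    have "\<exists>f\<in>specht_space (k # ls ! i). (\<lambda>T. f (K # T)) = g (symm a K v) i" if "i < length ls" for i
      using slice_specht_space_surj[OF x[OF that], of k] K_eq[of "ls ! i"] that by simp
    then obtain f where f: "\<And>i. i < length ls \<Longrightarrow> f i \<in> specht_space (k # ls ! i)"
      "\<And>i. i < length ls \<Longrightarrow> (\<lambda>T. f i (K # T)) = g (symm a K v) i"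
      by metis
    \<comment> \<open>Only the values of \<open>f i\<close> at first row \<open>K\<close> are
      controlled, which is all that \<open>rep_space_subset_slices\<close> asks for.\<close>
    define F' where "F' = (\<lambda>(i, B). if i < length ls then f i B else 0)"
    have supp: "f i B = 0" if "i < length ls" "B \<notin> tabs (k # ls ! i) {1..m}" for i B
      using rep_space_specht[of "k # ls ! i"] that f(1)[OF that(1)] sum_k_ls[of "ls ! i"]
      by (auto simp: rep_space_def supported_def simp del: tabs.simps)
    have F': "F' \<in> pair_specht m k ls"
      using f(1) supp by (auto simp: pair_specht_def F'_def pair_tabs_def simp del: tabs.simps)
    have "F (i, K # T) = F' (i, K # T)" for i T
      using G_slice[OF v(1), of i T] slice_outside[of i T] f(2)[of i] F' G_outside v(2)
      by (cases "i < length ls \<and> T \<in> tabs (ls ! i) Y") (auto simp: F'_def pair_specht_def fun_eq_iff)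
    then show "\<exists>F'\<in>pair_specht m k ls. \<forall>i T. F (i, {m - k + 1..m} # T) = F' (i, {m - k + 1..m} # T)"
      using F' unfolding K_def by blast
  qed (rule symm; auto)
qed

text \<open>The kernel of \<open>G\<close>, by \<open>U'_iff\<close>. Its defining condition is the
  symmetrization hypothesis for the bound \<open>k - 1\<close>, so the construction can be iterated
  on it.\<close>

definition U' where "U' = {u \<in> U. \<forall>A. A \<subseteq> {1..m} \<and> card A = k \<longrightarrow> symm a A u = (\<lambda>_. 0)}"

lemma U'_iff: "u \<in> U' \<longleftrightarrow> u \<in> U \<and> G u = (\<lambda>_. 0)"
  using G_eq_zeroI G_eq_zeroD by (auto simp: U'_def)

lemma rep_space_U': "rep_space m a P U'"
proof -
  have "lin_space U'"
    using lin_U unfolding lin_space_def by (simp add: U'_def symm_linear)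
  moreover have "pact a p u \<in> U'" if "p permutes {1..m}" "u \<in> U'" for p u
    using that G_pact[of u p] rep_space_pact[OF U] by (simp add: U'_iff pact_linear)
  ultimately show ?thesis
    using U by (auto simp: rep_space_def supported_def U'_def)
qed

text \<open>On the orthogonal complement of its kernel \<open>U'\<close>, the map \<open>G\<close>
  is an isomorphism onto its image.\<close>

lemma sym_iso_split:
  "sym_iso m (fun_rep a U) (rep_sum2 (specht_sum (map ((#) k) ls)) (fun_rep a U'))"
proof -
  let ?V = "orth P U U'"
  have sub: "U' \<subseteq> U"
    by (auto simp: U'_def)
  have V: "rep_space m a P ?V" "?V \<subseteq> U"
    using rep_space_orth[OF U rep_space_U'] by (auto simp: orth_def)
  have lin_V: "lin_space ?V"
    using V(1) by (simp add: rep_space_def)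
  have "sym_iso m (fun_rep a ?V) (fun_rep pair_act (pair_specht m k ls))"
  proof (rule sym_isoI[where f = G])
    show "sym_module m (fun_rep a ?V)"
      using V(1) by (rule rep_space_sym_module)
    show "bij_betw G (carrier (fun_rep a ?V)) (carrier (fun_rep pair_act (pair_specht m k ls)))"
      unfolding fun_rep_sel bij_betw_def
    proof
      show "inj_on G ?V"
      proof (rule inj_onI)
        fix u v assume uv: "u \<in> ?V" "v \<in> ?V" "G u = G v"
        have "G (\<lambda>b. u b + (-1) * v b) = (\<lambda>_. 0)"
          using uv V(2) lin_space_scale[OF lin_U, of v "-1"]
          by (subst G_add) (auto simp: G_scale[of v "-1", simplified] subset_iff)
        moreover have "(\<lambda>b. u b + (-1) * v b) \<in> ?V"
          using lin_space_diff[OF lin_V uv(1,2)] by simp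
        ultimately have "(\<lambda>b. u b + (-1) * v b) = (\<lambda>_. 0)"
          using V(2) by (intro orth_disjoint[OF rep_space_U', of _ U]) (auto simp: U'_iff)
        then show "u = v"
          by (auto simp: fun_eq_iff)
      qed
      have "G u \<in> G ` ?V" if u: "u \<in> U" for u
      proof -
        obtain u' v where *: "u' \<in> U'" "v \<in> ?V" "u = (\<lambda>b. u' b + v b)"
          using orth_decomposition[OF U rep_space_U' sub u] by blast
        then have "G u = (\<lambda>b. G u' b + G v b)"
          using G_add[of u' v] sub V(2) by blast
        then have "G u = G v"
          using *(1) by (simp add: U'_iff)
        then show ?thesis
          using *(2) by blast
      qed
      then have "G ` U \<subseteq> G ` ?V"
        by blast
      moreover have "G ` ?V \<subseteq> G ` U"
        by (rule image_mono[OF V(2)])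
      ultimately show "G ` ?V = pair_specht m k ls"
        unfolding G_image[symmetric] by blast
    qed
  qed (use V(2) in \<open>auto simp: fun_rep_sel G_zero G_add G_scale G_pact subset_iff\<close>)
  then have "sym_iso m (fun_rep a ?V) (specht_sum (map ((#) k) ls))"
    using sym_iso_trans sym_iso_pair_specht[OF sum_k_ls] by blast
  then have "sym_iso m (rep_sum2 (fun_rep a ?V) (fun_rep a U'))
      (rep_sum2 (specht_sum (map ((#) k) ls)) (fun_rep a U'))"
    by (rule sym_iso_rep_sum2[OF _ sym_iso_refl[OF rep_space_sym_module[OF rep_space_U']]])
  then show ?thesis
    using sym_iso_trans sym_iso_sym sym_iso_orth[OF U rep_space_U' sub] by blast
qed

end

lemma row_removal_split:
  assumes U: "rep_space m a P U" and k: "1 \<le> k" "k \<le> m"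
    and symm: "\<And>A u. A \<subseteq> {1..m} \<Longrightarrow> card A = Suc k \<Longrightarrow> u \<in> U \<Longrightarrow> symm a A u = (\<lambda>_. 0)"
    and ls: "decomposition (m - k) (fun_rep a (fixed_space a {m - k + 1..m} U)) ls"
  obtains U' where "rep_space m a P U'"
    "\<And>A u. A \<subseteq> {1..m} \<Longrightarrow> card A = k \<Longrightarrow> u \<in> U' \<Longrightarrow> symm a A u = (\<lambda>_. 0)"
    "\<And>l. l \<in> set ls \<Longrightarrow> partition_of m (k # l)"
    "sym_iso m (fun_rep a U) (rep_sum2 (specht_sum (map ((#) k) ls)) (fun_rep a U'))"
proof -
  have part: "\<And>l. l \<in> set ls \<Longrightarrow> partition_of (m - k) l"
    and iso: "sym_iso (m - k) (fun_rep a (fixed_space a {m - k + 1..m} U)) (specht_sum ls)"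
    using ls by (auto simp: decomposition_def)
  let ?W = "fixed_space a {m - k + 1..m} U"
  obtain g where g: "bij_betw g ?W (carrier (specht_sum ls))" "g (\<lambda>_. 0) = \<zero>\<^bsub>specht_sum ls\<^esub>"
    "\<And>u v. u \<in> ?W \<Longrightarrow> v \<in> ?W \<Longrightarrow> g (\<lambda>b. u b + v b) = g u \<oplus>\<^bsub>specht_sum ls\<^esub> g v"
    "\<And>c u. u \<in> ?W \<Longrightarrow> g (\<lambda>b. c * u b) = c \<odot>\<^bsub>specht_sum ls\<^esub> g u"
    "\<And>p u. p permutes {1..m - k} \<Longrightarrow> u \<in> ?W \<Longrightarrow> g (pact a p u) = act (specht_sum ls) p (g u)"
  proof (rule sym_isoE[OF iso, unfolded fun_rep_sel], goal_cases)
    case (1 g)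
    show ?case
      by (rule 1(1)) (fact 1)+
  qed
  have rr: "row_removal m k ls a P U g"
    by (rule row_removal.intro) (fact U k symm part g)+
  interpret row_removal m k ls a P U g "{m - k + 1..m}" "{1..m - k}" ?W
    by (rule rr reflexive)+
  show thesis
    using that[OF rep_space_U' _ partition_k_ls sym_iso_split] by (simp add: U'_def)
qed

section \<open>Complete reducibility\<close>

lemma decomposition_iso:
  assumes "decomposition m V ls" "sym_iso m W V"
  shows "decomposition m W ls"
  using assms sym_iso_trans unfolding decomposition_def by blast

lemma decomposition_sum:
  assumes "decomposition m V ls" "decomposition m W ls'"
  shows "decomposition m (rep_sum2 V W) (ls @ ls')"
proof -
  have part: "\<forall>l\<in>set (ls @ ls'). partition_of m l"
    using assms by (auto simp: decomposition_def)
  have "sym_iso m (rep_sum2 V W) (rep_sum2 (specht_sum ls) (specht_sum ls'))"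
    using assms by (intro sym_iso_rep_sum2) (auto simp: decomposition_def)
  moreover have "sym_iso m (rep_sum2 (specht_sum ls) (specht_sum ls')) (specht_sum (ls @ ls'))"
    using part by (intro sym_iso_specht_sum_append) (auto simp: partition_of_def)
  ultimately show ?thesis
    using part sym_iso_trans unfolding decomposition_def by blast
qed

lemma decomposition_specht_sum:
  "(\<And>l. l \<in> set ls \<Longrightarrow> partition_of m l) \<Longrightarrow> decomposition m (specht_sum ls) ls"
  unfolding decomposition_def
  by (auto intro!: sym_iso_refl sym_module_specht_sum simp: partition_of_def)

lemma decomposition_trivial:
  assumes "rep_space m a P U" "U \<subseteq> {\<lambda>_. 0}"
  shows "decomposition m (fun_rep a U) []"
proof -
  have U: "U = {\<lambda>_. 0}"
    using assms lin_space_zero by (auto simp: rep_space_def)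
  have "sym_iso m (fun_rep a U) (specht_sum [])"
  proof (rule sym_isoI[where f = "\<lambda>_ _. undefined"])
    show "bij_betw (\<lambda>_ _. undefined) (carrier (fun_rep a U)) (carrier (specht_sum []))"
      by (auto simp: bij_betw_def U fun_rep_sel carrier_specht_sum_iff image_iff)
  qed (use assms rep_space_sym_module in \<open>auto simp: fun_eq_iff specht_sum_apply_undefined\<close>)
  then show ?thesis
    by (simp add: decomposition_def)
qed

lemma specht_space_Nil: "specht_space [] = {\<lambda>T. if T = [] then c else 0 |c. True}"
proof -
  have tab: "tableaux [] = {\<lambda>_. undefined}"
    by (auto simp: tableaux_def cells_Nil bij_betw_def)
  have "column_stabilizer [] t = {id}" for t
    by (auto simp: column_stabilizer_iff cells_Nil permutes_id)
  then have "polytabloid [] t = (\<lambda>T. if T = [] then 1 else 0)" for t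
    by (auto simp: polytabloid_def tabloid_Nil)
  then show ?thesis
    unfolding specht_space_def tab by (auto simp: fun_eq_iff)
qed

text \<open>Over the trivial group this is the existence of a basis. The induction is on the number
  of coordinates at which \<open>U\<close> does not vanish: passing to the elements vanishing at one
  of them splits off a line.\<close>

lemma decomposition_0_exists:
  assumes "rep_space 0 a P U"
  shows "\<exists>ls. decomposition 0 (fun_rep a U) ls"
  using assms
proof (induction "card {b \<in> P. \<exists>u\<in>U. u b \<noteq> 0}" arbitrary: U rule: less_induct)
  case less
  note U = less.prems
  have fin: "finite P" and a: "functorial a" and lin: "lin_space U"
    using U by (auto simp: rep_space_def)
  have id: "p = id" if "p permutes {1..0::nat}" for p
    using that by simp
  show ?case
  proof (cases "U \<subseteq> {\<lambda>_. 0}")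
    case False
    then obtain u0 b where u0: "u0 \<in> U" "u0 b \<noteq> 0"
      by (auto simp: fun_eq_iff)
    then have b: "b \<in> P"
      using U by (auto simp: rep_space_def supported_def)
    define U' where "U' = {u \<in> U. u b = 0}"
    have "U' \<subseteq> U"
      by (auto simp: U'_def)
    moreover have "lin_space U'"
      using lin by (simp add: U'_def lin_space_def)
    ultimately have U': "rep_space 0 a P U'" "U' \<subseteq> U"
      using U id by (auto simp: rep_space_def supported_def pact_id[OF a])
    have "{c \<in> P. \<exists>u\<in>U'. u c \<noteq> 0} \<subset> {c \<in> P. \<exists>u\<in>U. u c \<noteq> 0}"
      using u0 b by (auto simp: U'_def)
    then have "\<exists>ls. decomposition 0 (fun_rep a U') ls"
      using fin U' by (intro less.hyps psubset_card_mono) auto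
    then obtain ls where ls: "decomposition 0 (fun_rep a U') ls"
      by blast
    define V where "V = orth P U U'"
    have V: "rep_space 0 a P V"
      unfolding V_def by (rule rep_space_orth[OF U U'(1)])
    obtain v' v where v: "v' \<in> U'" "v \<in> V" "u0 = (\<lambda>c. v' c + v c)"
      using orth_decomposition[OF U U' u0(1)] unfolding V_def by blast
    have vb: "v b \<noteq> 0"
      using u0(2) v by (auto simp: U'_def)
    have lin_V: "lin_space V"
      using V by (simp add: rep_space_def)
    \<comment> \<open>Evaluation at \<open>b\<close> is injective on \<open>V\<close>, since an
      element of \<open>V\<close> vanishing at \<open>b\<close> lies in \<open>U'\<close> and is
      orthogonal to it. So \<open>V\<close> is a line, like the Specht module of the empty
      partition.\<close>
    have "sym_iso 0 (fun_rep a V) (specht_sum [[]])"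
    proof (rule sym_isoI[where f = "\<lambda>u. \<lambda>i\<in>{..<1}. \<lambda>T. if T = [] then u b else 0"])
      let ?f = "\<lambda>u. \<lambda>i\<in>{..<1::nat}. \<lambda>T::nat set list. if T = [] then u b else (0::complex)"
      show "sym_module 0 (fun_rep a V)"
        using V by (rule rep_space_sym_module)
      show "bij_betw ?f (carrier (fun_rep a V)) (carrier (specht_sum [[]]))"
        unfolding fun_rep_sel
      proof (rule bij_betw_imageI)
        show "inj_on ?f V"
        proof (rule inj_onI)
          fix u w assume uw: "u \<in> V" "w \<in> V" "?f u = ?f w"
          have "u b = w b"
            using fun_cong[OF fun_cong[OF uw(3), of 0], of "[]"] by simp
          then have "(\<lambda>c. u c - w c) \<in> U'"
            using uw(1,2) lin_space_diff[OF lin] by (auto simp: V_def orth_def U'_def)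
          then have "(\<lambda>c. u c - w c) = (\<lambda>_. 0)"
            using orth_disjoint[OF U'(1)] lin_space_diff[OF lin_V uw(1,2)] unfolding V_def by blast
          then show "u = w"
            by (auto simp: fun_eq_iff)
        qed
        have "x \<in> ?f ` V" if x: "x \<in> carrier (specht_sum [[]])" for x
        proof -
          obtain c where c: "x 0 = (\<lambda>T. if T = [] then c else 0)"
            using x by (auto simp: carrier_specht_sum_iff specht_space_Nil)
          have "x = ?f (\<lambda>d. (c / v b) * v d)"
            using x vb c by (auto simp: carrier_specht_sum_iff fun_eq_iff)
          then show ?thesis
            using lin_space_scale[OF lin_V v(2), of "c / v b"] by (rule image_eqI)
        qed
        then show "?f ` V = carrier (specht_sum [[]])"
          by (auto simp: carrier_specht_sum_iff specht_space_Nil)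
      qed
      fix p u assume p: "p permutes {1..0::nat}"
      show "?f (act (fun_rep a V) p u) = act (specht_sum [[]]) p (?f u)"
        unfolding id[OF p] fun_rep_sel pact_id[OF a]
        by (rule ext) (simp add: specht_sum_apply specht_sum_apply_undefined
            pact_id[OF functorial_map_image])
    qed (auto simp: fun_rep_sel fun_eq_iff specht_sum_apply specht_sum_apply_undefined)
    then have "decomposition 0 (fun_rep a V) [[]]"
      by (simp add: decomposition_def partition_of_def)
    then have "decomposition 0 (rep_sum2 (fun_rep a V) (fun_rep a U')) ([[]] @ ls)"
      using ls by (rule decomposition_sum)
    then show ?thesis
      using decomposition_iso sym_iso_sym[OF sym_iso_orth[OF U U']] unfolding V_def by blast
  qed (use decomposition_trivial[OF U] in blast)
qed

lemma symm_singleton: "functorial a \<Longrightarrow> symm a {x} u = u"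
  by (simp add: symm_def pact_id)

text \<open>Induction on the bound: each step removes the constituents with first row
  \<open>k\<close> and hands the kernel \<open>U'\<close> to the next smaller bound. It ends at
  bound 0, where symmetrization over a single letter, which is the identity, vanishes, so that
  \<open>U\<close> is zero.\<close>

lemma decomposition_bounded:
  assumes IH: "\<And>m' U. m' < m \<Longrightarrow> rep_space m' a P U \<Longrightarrow> \<exists>ls. decomposition m' (fun_rep a U) ls"
    and m: "m \<noteq> 0" and U: "rep_space m a P U"
    and symm: "\<And>A u. A \<subseteq> {1..m} \<Longrightarrow> card A = Suc k \<Longrightarrow> u \<in> U \<Longrightarrow> symm a A u = (\<lambda>_. 0)"
  shows "\<exists>ls. decomposition m (fun_rep a U) ls \<and> (\<forall>l\<in>set ls. hd l \<le> k)"
  using U symm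
proof (induction k arbitrary: U)
  case 0
  have "u = (\<lambda>_. 0)" if "u \<in> U" for u
    using 0(2)[of "{1}" u] that m symm_singleton[of a 1 u] 0(1) by (auto simp: rep_space_def)
  then show ?case
    using decomposition_trivial[OF 0(1)] by fastforce
next
  case (Suc k)
  show ?case
  proof (cases "Suc k \<le> m")
    case True
    have "m - Suc k < m"
      using m by simp
    from IH[OF this rep_space_fixed_space[OF Suc.prems(1) True]]
    obtain ls where ls: "decomposition (m - Suc k) (fun_rep a (fixed_space a {m - Suc k + 1..m} U)) ls"
      by blast
    obtain U' where U': "rep_space m a P U'"
      "\<And>A u. A \<subseteq> {1..m} \<Longrightarrow> card A = Suc k \<Longrightarrow> u \<in> U' \<Longrightarrow> symm a A u = (\<lambda>_. 0)"
      "\<And>l. l \<in> set ls \<Longrightarrow> partition_of m (Suc k # l)"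
      "sym_iso m (fun_rep a U) (rep_sum2 (specht_sum (map ((#) (Suc k)) ls)) (fun_rep a U'))"
      by (rule row_removal_split[OF Suc.prems(1) _ True Suc.prems(2) ls]) auto
    obtain ls' where ls': "decomposition m (fun_rep a U') ls'" "\<forall>l\<in>set ls'. hd l \<le> k"
      using Suc.IH[OF U'(1,2)] by blast
    have "decomposition m (fun_rep a U) (map ((#) (Suc k)) ls @ ls')"
      by (rule decomposition_iso[OF decomposition_sum[OF decomposition_specht_sum ls'(1)] U'(4)])
        (use U'(3) in auto)
    then show ?thesis
      using ls'(2) by (intro exI[of _ "map ((#) (Suc k)) ls @ ls'"]) auto
  next
    case False
    \<comment> \<open>There are fewer than \<open>Suc k\<close> letters, so the hypothesis for the
      smaller bound holds vacuously.\<close>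
    have "card A \<noteq> Suc k" if "A \<subseteq> {1..m}" for A
      using card_mono[OF _ that] False by auto
    then have "\<exists>ls. decomposition m (fun_rep a U) ls \<and> (\<forall>l\<in>set ls. hd l \<le> k)"
      using Suc.IH[OF Suc.prems(1)] by blast
    then show ?thesis
      by (meson le_Suc_eq)
  qed
qed

text \<open>With bound \<open>m\<close> the symmetrization hypothesis is vacuous, so
  \<open>decomposition_bounded\<close> applies to every module.\<close>

lemma decomposition_exists:
  assumes "rep_space m a P U"
  shows "\<exists>ls. decomposition m (fun_rep a U) ls"
  using assms
proof (induction m arbitrary: U rule: less_induct)
  case (less m)
  show ?case
  proof (cases "m = 0")
    case False
    have no: "card A \<noteq> Suc m" if "A \<subseteq> {1..m}" for A
      using card_mono[OF _ that] by auto
    have "\<exists>ls. decomposition m (fun_rep a U) ls \<and> (\<forall>l\<in>set ls. hd l \<le> m)"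
      by (rule decomposition_bounded[OF less.IH False less.prems]) (use no in auto)
    then show ?thesis
      by blast
  qed (use less.prems decomposition_0_exists in auto)
qed

theorem decomposition_row_removal:
  assumes U: "rep_space m a P U" and k: "1 \<le> k" "k \<le> m"
    and symm: "\<And>A u. A \<subseteq> {1..m} \<Longrightarrow> card A = Suc k \<Longrightarrow> u \<in> U \<Longrightarrow> symm a A u = (\<lambda>_. 0)"
    and ls: "decomposition (m - k) (fun_rep a (fixed_space a {m - k + 1..m} U)) ls"
  obtains ls' where "\<forall>l\<in>set ls. partition_of m (k # l)" "\<forall>l\<in>set ls'. partition_of m l \<and> hd l \<le> k - 1"
    "sym_iso m (fun_rep a U) (rep_sum2 (specht_sum (map ((#) k) ls)) (specht_sum ls'))"
proof -
  obtain U' where U': "rep_space m a P U'"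
      "\<And>A u. A \<subseteq> {1..m} \<Longrightarrow> card A = k \<Longrightarrow> u \<in> U' \<Longrightarrow> symm a A u = (\<lambda>_. 0)"
      "\<And>l. l \<in> set ls \<Longrightarrow> partition_of m (k # l)"
      "sym_iso m (fun_rep a U) (rep_sum2 (specht_sum (map ((#) k) ls)) (fun_rep a U'))"
    using row_removal_split[OF assms] by blast
  have "\<exists>ls'. decomposition m (fun_rep a U') ls' \<and> (\<forall>l\<in>set ls'. hd l \<le> k - 1)"
    by (rule decomposition_bounded[OF decomposition_exists _ U'(1)]) (use k U'(2) in auto)
  then obtain ls' where ls': "decomposition m (fun_rep a U') ls'" "\<forall>l\<in>set ls'. hd l \<le> k - 1"
    by blast
  have "sym_iso m (rep_sum2 (specht_sum (map ((#) k) ls)) (fun_rep a U'))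
      (rep_sum2 (specht_sum (map ((#) k) ls)) (specht_sum ls'))"
    using ls'(1) U'(3)
    by (intro sym_iso_rep_sum2 sym_iso_refl sym_module_specht_sum)
      (auto simp: decomposition_def partition_of_def)
  from sym_iso_trans[OF U'(4) this] show thesis
    using ls' U'(3) by (intro that) (auto simp: decomposition_def)
qed

section \<open>The ideal of a free Filippov algebra\<close>

definition delta :: "'b \<Rightarrow> 'b \<Rightarrow> complex"
  where "delta b = (\<lambda>c. if c = b then 1 else 0)"

lemma bracket_Letter [simp]: "bracket vs (Letter x) = 0"
  by (simp add: bracket_def)

lemma bracket_Bracket:
  "bracket vs (Bracket ws) =
    (if length ws = length vs then \<Prod>i<length vs. (vs ! i) (ws ! i) else 0)"
  by (simp add: bracket_def)

lemma bracket_update: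
  assumes "i < length xs"
  shows "bracket (xs[i := u]) (Bracket ws) = (if length ws = length xs then
    u (ws ! i) * (\<Prod>j\<in>{..<length xs} - {i}. (xs ! j) (ws ! j)) else 0)"
proof -
  have "(\<Prod>j<length xs. (xs[i := u] ! j) (ws ! j)) =
      (xs[i := u] ! i) (ws ! i) * (\<Prod>j\<in>{..<length xs} - {i}. (xs[i := u] ! j) (ws ! j))"
    using assms by (intro prod.remove) auto
  also have "(\<Prod>j\<in>{..<length xs} - {i}. (xs[i := u] ! j) (ws ! j)) =
      (\<Prod>j\<in>{..<length xs} - {i}. (xs ! j) (ws ! j))"
    by (intro prod.cong) auto
  finally show ?thesis
    using assms by (simp add: bracket_Bracket)
qed

lemma bracket_linear:
  assumes "i < length xs"
  shows "bracket (xs[i := \<lambda>_. 0]) w = 0"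
    and "bracket (xs[i := \<lambda>w. u w + v w]) w = bracket (xs[i := u]) w + bracket (xs[i := v]) w"
    and "bracket (xs[i := \<lambda>w. u w - v w]) w = bracket (xs[i := u]) w - bracket (xs[i := v]) w"
    and "bracket (xs[i := \<lambda>w. c * u w]) w = c * bracket (xs[i := u]) w"
    and "bracket (xs[i := \<lambda>w. \<Sum>j\<in>J. f j w]) w = (\<Sum>j\<in>J. bracket (xs[i := f j]) w)"
  by (cases w; simp add: bracket_update[OF assms] ring_distribs sum_distrib_right)+

lemma bracket_delta: "bracket (map delta ws) = delta (Bracket ws)"
proof
  fix u
  show "bracket (map delta ws) u = delta (Bracket ws) u"
  proof (cases u)
    case (Bracket us)
    show ?thesis
    proof (cases "us = ws")
      case False
      then have "\<exists>i<length ws. us ! i \<noteq> ws ! i" if "length us = length ws"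
        using that by (metis nth_equalityI)
      then show ?thesis
        using Bracket False by (auto simp: bracket_Bracket delta_def intro!: prod_zero)
    qed (simp add: Bracket bracket_Bracket delta_def)
  qed (simp add: delta_def)
qed

lemma lin_space_free_space: "lin_space (free_space n X)"
  unfolding lin_space_def
proof (intro conjI ballI allI)
  fix u v c assume u: "u \<in> free_space n X"
  have "{w. c * u w \<noteq> 0} \<subseteq> {w. u w \<noteq> 0}"
    by auto
  then show "(\<lambda>w. c * u w) \<in> free_space n X"
    using u finite_subset unfolding free_space_def by auto
  assume v: "v \<in> free_space n X"
  have "{w. u w + v w \<noteq> 0} \<subseteq> {w. u w \<noteq> 0} \<union> {w. v w \<noteq> 0}"
    by auto
  then show "(\<lambda>w. u w + v w) \<in> free_space n X"
    using u v finite_subset unfolding free_space_def by auto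
qed (simp add: free_space_def)

lemma delta_free_space: "w \<in> words n X \<Longrightarrow> delta w \<in> free_space n X"
  by (simp add: free_space_def delta_def)

lemma free_space_subset:
  assumes U: "lin_space U" and "\<And>w. w \<in> words n X \<Longrightarrow> delta w \<in> U"
  shows "free_space n X \<subseteq> U"
proof
  fix v assume v: "v \<in> free_space n X"
  then have "(\<lambda>u. \<Sum>w | v w \<noteq> 0. v w * delta w u) \<in> U"
    by (intro lin_space_lincomb[OF U] assms(2)) (auto simp: free_space_def)
  moreover have "(\<Sum>w | v w \<noteq> 0. v w * delta w u) = v u" for u
  proof -
    have "(\<Sum>w | v w \<noteq> 0. v w * delta w u) = (\<Sum>w | v w \<noteq> 0. if u = w then v w else 0)"
      by (intro sum.cong) (auto simp: delta_def)
    then show ?thesis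
      using v by (simp add: free_space_def)
  qed
  ultimately show "v \<in> U"
    by simp
qed

text \<open>Extension by multilinearity. The slots are freed one at a time: at stage
  \<open>j\<close> the slots before \<open>j\<close> are arbitrary and the others still basis
  words.\<close>

lemma slot_induct:
  assumes "length xs = l" "set xs \<subseteq> free_space n X"
    and delta: "\<And>ws. length ws = l \<Longrightarrow> set ws \<subseteq> words n X \<Longrightarrow> P (map delta ws)"
    and lin: "\<And>xs i. length xs = l \<Longrightarrow> set xs \<subseteq> free_space n X \<Longrightarrow> i < l \<Longrightarrow>
      lin_space {v \<in> free_space n X. P (xs[i := v])}"
  shows "P xs"
proof -
  have "P xs" if "j \<le> l" "length xs = l" "set xs \<subseteq> free_space n X"
    "\<And>i. j \<le> i \<Longrightarrow> i < l \<Longrightarrow> xs ! i \<in> delta ` words n X" for j xs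
    using that
  proof (induction j arbitrary: xs)
    case 0
    then have "\<forall>i<l. \<exists>w\<in>words n X. xs ! i = delta w"
      by auto
    then obtain f where f: "\<And>i. i < l \<Longrightarrow> f i \<in> words n X \<and> xs ! i = delta (f i)"
      by metis
    then have "xs = map delta (map f [0..<l])"
      using 0 by (intro nth_equalityI) auto
    moreover have "P (map delta (map f [0..<l]))"
      by (rule delta) (use f in auto)
    ultimately show ?case
      by simp
  next
    case (Suc j)
    have "free_space n X \<subseteq> {v \<in> free_space n X. P (xs[j := v])}"
    proof (rule free_space_subset)
      fix w assume w: "w \<in> words n X"
      have "P (xs[j := delta w])"
      proof (rule Suc.IH)
        show "set (xs[j := delta w]) \<subseteq> free_space n X"
          using Suc.prems(3) delta_free_space[OF w] set_update_subset_insert by fastforce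
        show "xs[j := delta w] ! i \<in> delta ` words n X" if "j \<le> i" "i < l" for i
          using that Suc.prems w by (cases "i = j") auto
      qed (use Suc.prems in auto)
      then show "delta w \<in> {v \<in> free_space n X. P (xs[j := v])}"
        using delta_free_space[OF w] by simp
    qed (use lin Suc.prems in auto)
    moreover have "xs ! j \<in> free_space n X"
      using Suc.prems by auto
    ultimately show ?case
      by (metis (mono_tags, lifting) list_update_id mem_Collect_eq subsetD)
  qed
  then show ?thesis
    using assms(1,2) by (metis le_refl not_less)
qed

lemma bracket_free_space:
  assumes "length xs = n" "set xs \<subseteq> free_space n X"
  shows "bracket xs \<in> free_space n X"
proof -
  define S where "S = (\<Union>x\<in>set xs. {w. x w \<noteq> 0})"
  have S: "finite S" "S \<subseteq> words n X"
    using assms(2) by (auto simp: S_def free_space_def)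
  have "{w. bracket xs w \<noteq> 0} \<subseteq> Bracket ` {ws. set ws \<subseteq> S \<and> length ws = n}"
  proof
    fix w assume "w \<in> {w. bracket xs w \<noteq> 0}"
    then obtain ws where ws: "w = Bracket ws" "length ws = n" "(\<Prod>i<n. (xs ! i) (ws ! i)) \<noteq> 0"
      using assms(1) by (cases w) (auto simp: bracket_Bracket split: if_splits)
    then have "ws ! i \<in> S" if "i < n" for i
      using that assms(1) by (auto simp: S_def)
    then have "set ws \<subseteq> S"
      using ws(2) by (auto simp: in_set_conv_nth)
    then show "w \<in> Bracket ` {ws. set ws \<subseteq> S \<and> length ws = n}"
      using ws by blast
  qed
  moreover have "finite (Bracket ` {ws. set ws \<subseteq> S \<and> length ws = n})"
    by (intro finite_imageI finite_lists_length_eq S)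
  moreover have "Bracket ` {ws. set ws \<subseteq> S \<and> length ws = n} \<subseteq> words n X"
    using S(2) by (auto intro!: words.intros(2))
  ultimately show ?thesis
    unfolding free_space_def by (auto intro: finite_subset)
qed

section \<open>Working modulo the relations\<close>

lemma lin_space_ideal: "lin_space (filippov_ideal n X)"
  by (auto simp: lin_space_def intro: filippov_ideal.intros)

lemma set_update_free_space:
  "set xs \<subseteq> free_space n X \<Longrightarrow> u \<in> free_space n X \<Longrightarrow> set (xs[i := u]) \<subseteq> free_space n X"
  using set_update_subset_insert by fastforce

lemma ideal_free_space:
  assumes n: "0 < n" and v: "v \<in> filippov_ideal n X"
  shows "v \<in> free_space n X"
proof -
  note lin = lin_space_free_space[of n X]
  show ?thesis
    using v
  proof (induction rule: filippov_ideal.induct)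
    case (antisymmetry xs p)
    then show ?case
      by (intro lin_space_diff[OF lin] lin_space_scale[OF lin] bracket_free_space) auto
  next
    case (jacobi xs ys)
    have "bracket (x # ys) \<in> free_space n X" if "x \<in> free_space n X" for x
      using that jacobi n by (intro bracket_free_space) auto
    moreover have "bracket xs \<in> free_space n X"
      using jacobi by (intro bracket_free_space) auto
    ultimately show ?case
      using jacobi n
      by (intro lin_space_diff[OF lin] lin_space_sum[OF lin] bracket_free_space set_update_free_space)
        auto
  next
    case (bracket xs i v)
    then show ?case
      by (intro bracket_free_space set_update_free_space) auto
  qed (use lin_space_zero[OF lin] lin_space_add[OF lin] lin_space_scale[OF lin] in auto)
qed

lemma permute_list_transpose:
  assumes "i < length xs" "j < length xs"
  shows "permute_list (Transposition.transpose i j) xs = xs[i := xs ! j, j := xs ! i]"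
  using assms
  by (intro nth_equalityI) (auto simp: permute_list_nth permutes_swap_id nth_list_update transpose_def)

lemma ideal_swap:
  assumes "length xs = n" "set xs \<subseteq> free_space n X" "i < n" "j < n" "i \<noteq> j"
  shows "(\<lambda>w. bracket xs w + bracket (xs[i := xs ! j, j := xs ! i]) w) \<in> filippov_ideal n X"
  using filippov_ideal.antisymmetry[OF assms(1,2), of "Transposition.transpose i j"] assms
  by (simp add: permutes_swap_id permute_list_transpose sign_swap_id)

text \<open>Transpositions generate the symmetric group. It is stated for an arbitrary
  \<open>f\<close> because it serves both \<open>semi_bracket\<close> and brackets whose first entry
  is held fixed.\<close>

lemma antisymmetry_from_swaps:
  assumes I: "lin_space I" and p: "p permutes {..<n}"
    and swap: "\<And>xs i j. length xs = n \<Longrightarrow> set xs \<subseteq> S \<Longrightarrow> i < j \<Longrightarrow> j < n \<Longrightarrow>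
      (\<lambda>w. f xs w + f (xs[i := xs ! j, j := xs ! i]) w) \<in> I"
    and xs: "length xs = n" "set xs \<subseteq> S"
  shows "(\<lambda>w. f xs w - of_int (sign p) * f (permute_list p xs) w) \<in> I"
  using p finite_lessThan xs
proof (induction p arbitrary: xs rule: permutes_induct)
  case id
  then show ?case
    using lin_space_zero[OF I] by (simp add: sign_id)
next
  case (swap a b p)
  let ?\<tau> = "Transposition.transpose a b"
  have \<tau>: "?\<tau> permutes {..<n}"
    using swap.hyps by (intro permutes_swap_id) auto
  have perm: "permutation ?\<tau>" "permutation p"
    using swap.hyps \<tau> by (auto simp: permutation_permutes)
  define ys where "ys = permute_list ?\<tau> xs"
  have ys: "length ys = n" "set ys \<subseteq> S"
    using swap.prems \<tau> by (simp_all add: ys_def)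
  have "(\<lambda>w. f xs w + f ys w) \<in> I"
  proof (cases "a < b")
    case True
    then show ?thesis
      using assms(3)[OF swap.prems True] swap.hyps swap.prems
      by (simp add: ys_def permute_list_transpose)
  next
    case False
    then have ba: "b < a"
      using swap.hyps by simp
    show ?thesis
      using assms(3)[OF swap.prems ba] swap.hyps swap.prems
        permute_list_transpose[of b xs a]
      by (simp add: ys_def transpose_commute[of a b])
  qed
  from lin_space_diff[OF I this swap.IH[OF ys]]
  have "(\<lambda>w. f xs w + of_int (sign p) * f (permute_list p ys) w) \<in> I"
    by simp
  moreover have "permute_list (?\<tau> \<circ> p) xs = permute_list p ys"
    using swap.hyps swap.prems by (simp add: ys_def permute_list_compose)
  moreover have "sign (?\<tau> \<circ> p) = - sign p"
    using swap.hyps perm by (simp add: sign_compose sign_swap_id)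
  ultimately show ?case
    by (simp only: of_int_minus mult_minus_left diff_minus_eq_add)
qed

text \<open>A linear map that commutes with brackets maps each relation to a relation. It is applied
  to permutations of the letters and to the substitution of 0 for a letter.\<close>

lemma ideal_hom:
  assumes lin: "h (\<lambda>_. 0) = (\<lambda>_. 0)" "\<And>u v. h (\<lambda>w. u w + v w) = (\<lambda>w. h u w + h v w)"
      "\<And>c u. h (\<lambda>w. c * u w) = (\<lambda>w. c * h u w)"
    and free: "\<And>u. u \<in> free_space n X \<Longrightarrow> h u \<in> free_space n X"
    and hom: "\<And>xs. h (bracket xs) = bracket (map h xs)"
    and v: "v \<in> filippov_ideal n X"
  shows "h v \<in> filippov_ideal n X"
proof -
  have diff: "h (\<lambda>w. u w - v w) = (\<lambda>w. h u w - h v w)" for u v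
    using lin(2)[of u "\<lambda>w. (-1) * v w"] lin(3)[of "-1" v] by simp
  have sum: "h (\<lambda>w. \<Sum>i\<in>I. f i w) = (\<lambda>w. \<Sum>i\<in>I. h (f i) w)" for I :: "nat set" and f
    by (induction I rule: infinite_finite_induct) (simp_all add: lin)
  have map_free: "set (map h xs) \<subseteq> free_space n X" if "set xs \<subseteq> free_space n X" for xs
    using that free by auto
  show ?thesis
    using v
  proof (induction rule: filippov_ideal.induct)
    case (antisymmetry xs p)
    have "(\<lambda>w. bracket (map h xs) w - of_int (sign p) * bracket (permute_list p (map h xs)) w)
        \<in> filippov_ideal n X"
      using antisymmetry map_free by (intro filippov_ideal.antisymmetry) auto
    then show ?case
      using antisymmetry(1,3) by (simp add: diff lin hom permute_list_map)
  next
    case (jacobi xs ys)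
    have "map h (xs[i := bracket (xs ! i # ys)]) =
        (map h xs)[i := bracket (map h xs ! i # map h ys)]" if "i < n" for i
      using that jacobi(1) by (simp add: map_update hom)
    moreover have "(\<lambda>w. bracket (bracket (map h xs) # map h ys) w -
        (\<Sum>i<n. bracket ((map h xs)[i := bracket (map h xs ! i # map h ys)]) w)) \<in> filippov_ideal n X"
      using jacobi map_free by (intro filippov_ideal.jacobi) auto
    ultimately show ?case
      by (simp add: diff sum hom)
  next
    case (bracket xs i v)
    have "bracket ((map h xs)[i := h v]) \<in> filippov_ideal n X"
      using bracket map_free by (intro filippov_ideal.bracket) auto
    then show ?case
      by (simp add: hom map_update)
  qed (auto simp: lin intro: filippov_ideal.intros)
qed

text \<open>The Jacobi identity says that bracketing with fixed further entries is a derivation,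
  with the free entry in first position. Antisymmetry moves the free entry to any slot
  \<open>l\<close>.\<close>

lemma ideal_jacobi_slot:
  assumes us: "length us = n" "set us \<subseteq> free_space n X" and l: "l < n"
    and xs: "length xs = n" "set xs \<subseteq> free_space n X"
  shows "(\<lambda>w. bracket (us[l := bracket xs]) w -
    (\<Sum>i<n. bracket (xs[i := bracket (us[l := xs ! i])]) w)) \<in> filippov_ideal n X"
proof -
  let ?I = "filippov_ideal n X" and ?F = "free_space n X"
  note I = lin_space_ideal[of n X]
  \<comment> \<open>The entry of slot \<open>l\<close> changes places with the first one;
    \<open>s\<close> is the resulting sign, 1 if \<open>l = 0\<close>.\<close>
  have "\<exists>s rest. length rest = n - 1 \<and> set rest \<subseteq> ?F \<and>
    (\<forall>x\<in>?F. (\<lambda>w. bracket (us[l := x]) w - s * bracket (x # rest) w) \<in> ?I)"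
  proof (cases "l = 0")
    case True
    then have "us[l := x] = x # tl us" for x
      using us(1) l by (cases us) auto
    then show ?thesis
      using us lin_space_zero[OF I]
      by (intro exI[of _ 1] exI[of _ "tl us"]) (auto dest: list.set_sel(2)[rotated])
  next
    case False
    obtain u us' where u: "us = u # us'"
      using us(1) l by (cases us) auto
    obtain l' where l': "l = Suc l'"
      using False by (cases l) auto
    have "(\<lambda>w. bracket (us[l := x]) w - (-1) * bracket (x # us'[l' := u]) w) \<in> ?I" if x: "x \<in> ?F" for x
    proof -
      have "(\<lambda>w. bracket (us[l := x]) w + bracket (us[l := x, 0 := us[l := x] ! l, l := us[l := x] ! 0]) w) \<in> ?I"
        using us x l False by (intro ideal_swap set_update_free_space) auto
      moreover have "us[l := x, 0 := us[l := x] ! l, l := us[l := x] ! 0] = x # us'[l' := u]"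
        using us(1) l by (simp add: u l')
      ultimately show ?thesis
        by simp
    qed
    moreover have "set (us'[l' := u]) \<subseteq> ?F"
      using us(2) by (intro set_update_free_space) (auto simp: u)
    ultimately show ?thesis
      using us(1) u by (intro exI[of _ "-1"] exI[of _ "us'[l' := u]"]) auto
  qed
  then obtain s rest where rest: "length rest = n - 1" "set rest \<subseteq> ?F"
    and s: "\<And>x. x \<in> ?F \<Longrightarrow> (\<lambda>w. bracket (us[l := x]) w - s * bracket (x # rest) w) \<in> ?I"
    by blast
  have xi: "xs ! i \<in> ?F" if "i < n" for i
    using that xs by auto
  define d where "d i = (\<lambda>w. bracket (us[l := xs ! i]) w - s * bracket (xs ! i # rest) w)" for i
  have d: "d i \<in> ?I" if "i < n" for i
    unfolding d_def by (rule s[OF xi[OF that]])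
  have "(\<lambda>w. bracket (us[l := bracket xs]) w - s * bracket (bracket xs # rest) w) \<in> ?I"
    by (intro s bracket_free_space xs)
  moreover have "(\<lambda>w. s * (bracket (bracket xs # rest) w -
      (\<Sum>i<n. bracket (xs[i := bracket (xs ! i # rest)]) w))) \<in> ?I"
    by (intro lin_space_scale[OF I] filippov_ideal.jacobi xs rest)
  moreover have "(\<lambda>w. \<Sum>i<n. bracket (xs[i := d i]) w) \<in> ?I"
    by (intro lin_space_sum[OF I] filippov_ideal.bracket xs d) auto
  \<comment> \<open>A combination of three ideal elements in which everything involving
    \<open>rest\<close> cancels.\<close>
  ultimately have "(\<lambda>w. (bracket (us[l := bracket xs]) w - s * bracket (bracket xs # rest) w)
      + s * (bracket (bracket xs # rest) w - (\<Sum>i<n. bracket (xs[i := bracket (xs ! i # rest)]) w))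
      - (\<Sum>i<n. bracket (xs[i := d i]) w)) \<in> ?I"
    using lin_space_diff[OF I lin_space_add[OF I]] by fast
  moreover have "(\<Sum>i<n. bracket (xs[i := d i]) w) =
      (\<Sum>i<n. bracket (xs[i := bracket (us[l := xs ! i])]) w) -
      s * (\<Sum>i<n. bracket (xs[i := bracket (xs ! i # rest)]) w)" for w
    unfolding d_def using xs(1) by (simp add: bracket_linear sum_subtractf sum_distrib_left)
  ultimately show ?thesis
    by (simp add: algebra_simps)
qed

section \<open>Contracting a letter out of every bracket\<close>

text \<open>If \<open>A\<close> is a Filippov \<open>r\<close>-algebra, then \<open>complex \<oplus> A\<close>, with first summand spanned by \<open>x\<close>, is a
  Filippov \<open>Suc r\<close>-algebra under \<open>[x, u\<^sub>1, \<dots>, u\<^sub>r] = [u\<^sub>1, \<dots>, u\<^sub>r]\<close> and \<open>[u\<^sub>0, \<dots>, u\<^sub>r] = 0\<close>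
  for \<open>u\<^sub>i\<close> in \<open>A\<close>.  Brackets have no \<open>x\<close>-component; \<open>semi_bracket cs us\<close> is the \<open>A\<close>-component of the bracket of
  the elements \<open>cs ! i * x + us ! i\<close>.  Contraction is the homomorphism sending every letter of \<open>K\<close> to \<open>x\<close>.\<close>

fun semi_bracket :: "complex list \<Rightarrow> ('a word \<Rightarrow> complex) list \<Rightarrow> 'a word \<Rightarrow> complex"
  where
    "semi_bracket (c # cs) (u # us) = (\<lambda>w. c * bracket us w -
      (\<Sum>i<length us. cs ! i * bracket (us[i := u]) w))"
  | "semi_bracket _ _ = (\<lambda>_. 0)"

text \<open>Linearity in one slot: coefficient and vector vary together, as the two components of
  one element \<open>c * x + u\<close>.\<close>

lemma semi_bracket_linear:
  assumes "length cs = length us" "i < length us"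
  shows "semi_bracket (cs[i := 0]) (us[i := \<lambda>_. 0]) w = 0"
    and "semi_bracket (cs[i := c + d]) (us[i := \<lambda>w. u w + v w]) w =
      semi_bracket (cs[i := c]) (us[i := u]) w + semi_bracket (cs[i := d]) (us[i := v]) w"
    and "semi_bracket (cs[i := e * c]) (us[i := \<lambda>w. e * u w]) w = e * semi_bracket (cs[i := c]) (us[i := u]) w"
proof -
  obtain c0 cs' u0 us' where cons: "cs = c0 # cs'" "us = u0 # us'" "length cs' = length us'"
    using assms by (cases cs; cases us) auto
  show "semi_bracket (cs[i := 0]) (us[i := \<lambda>_. 0]) w = 0"
    "semi_bracket (cs[i := c + d]) (us[i := \<lambda>w. u w + v w]) w =
      semi_bracket (cs[i := c]) (us[i := u]) w + semi_bracket (cs[i := d]) (us[i := v]) w"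
    "semi_bracket (cs[i := e * c]) (us[i := \<lambda>w. e * u w]) w = e * semi_bracket (cs[i := c]) (us[i := u]) w"
  proof (atomize(full), cases i)
    case 0
    then show "semi_bracket (cs[i := 0]) (us[i := \<lambda>_. 0]) w = 0 \<and>
      semi_bracket (cs[i := c + d]) (us[i := \<lambda>w. u w + v w]) w =
        semi_bracket (cs[i := c]) (us[i := u]) w + semi_bracket (cs[i := d]) (us[i := v]) w \<and>
      semi_bracket (cs[i := e * c]) (us[i := \<lambda>w. e * u w]) w = e * semi_bracket (cs[i := c]) (us[i := u]) w"
      by (simp add: cons bracket_linear algebra_simps sum.distrib sum_distrib_left)
  next
    case (Suc j)
    have j: "j < length us'"
      using assms Suc cons by simp
    have expand: "semi_bracket (cs[i := c]) (us[i := v]) w = c0 * bracket (us'[j := v]) w -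
        c * bracket (us'[j := u0]) w -
        (\<Sum>k\<in>{..<length us'} - {j}. cs' ! k * bracket (us'[k := u0, j := v]) w)" for c v
    proof -
      have "(\<Sum>k<length us'. cs'[j := c] ! k * bracket (us'[j := v, k := u0]) w) =
          c * bracket (us'[j := u0]) w +
          (\<Sum>k\<in>{..<length us'} - {j}. cs'[j := c] ! k * bracket (us'[j := v, k := u0]) w)"
        using j cons(3) by (subst sum.remove[of _ j]) auto
      also have "(\<Sum>k\<in>{..<length us'} - {j}. cs'[j := c] ! k * bracket (us'[j := v, k := u0]) w) =
          (\<Sum>k\<in>{..<length us'} - {j}. cs' ! k * bracket (us'[k := u0, j := v]) w)"
        by (intro sum.cong) (auto simp: list_update_swap)
      finally show ?thesis
        by (simp add: cons Suc)
    qed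
    show "semi_bracket (cs[i := 0]) (us[i := \<lambda>_. 0]) w = 0 \<and>
      semi_bracket (cs[i := c + d]) (us[i := \<lambda>w. u w + v w]) w =
        semi_bracket (cs[i := c]) (us[i := u]) w + semi_bracket (cs[i := d]) (us[i := v]) w \<and>
      semi_bracket (cs[i := e * c]) (us[i := \<lambda>w. e * u w]) w = e * semi_bracket (cs[i := c]) (us[i := u]) w"
      unfolding expand using j by (simp add: bracket_linear algebra_simps sum.distrib sum_distrib_left)
  qed
qed

text \<open>The defining formula singles out slot 0. If it takes part in the swap, the terms in
  which \<open>x\<close> comes from one of the two swapped slots cancel exactly and the others pair
  up by antisymmetry in the smaller algebra. Otherwise the sum is reindexed by the
  transposition.\<close>

lemma semi_bracket_swap:
  assumes "length cs = Suc r" "length us = Suc r" "set us \<subseteq> free_space r X" "i < j" "j < Suc r"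
  shows "(\<lambda>w. semi_bracket cs us w +
    semi_bracket (cs[i := cs ! j, j := cs ! i]) (us[i := us ! j, j := us ! i]) w) \<in> filippov_ideal r X"
proof -
  let ?I = "filippov_ideal r X"
  note I = lin_space_ideal[of r X]
  obtain c cs' u us' where cons: "cs = c # cs'" "us = u # us'" "length cs' = r" "length us' = r"
    using assms by (cases cs; cases us) auto
  have free: "set us' \<subseteq> free_space r X" "u \<in> free_space r X"
    using assms(3) cons by auto
  obtain j' where j': "j = Suc j'" "j' < r"
    using assms by (cases j) auto
  show ?thesis
  proof (cases i)
    case 0
    define Q where "Q k = (\<lambda>w. bracket (us'[k := u]) w + bracket (us'[j' := u, k := us' ! j']) w)" for k
    have "Q k \<in> ?I" if "k < r" "k \<noteq> j'" for k
    proof -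
      have "(\<lambda>w. bracket (us'[k := u]) w +
          bracket (us'[k := u, k := us'[k := u] ! j', j' := us'[k := u] ! k]) w) \<in> ?I"
        using that j' cons free by (intro ideal_swap set_update_free_space) auto
      moreover have "us'[k := u, k := us'[k := u] ! j', j' := us'[k := u] ! k] = us'[j' := u, k := us' ! j']"
        using that cons by (simp add: list_update_swap)
      ultimately show ?thesis
        by (simp add: Q_def)
    qed
    then have "(\<lambda>w. \<Sum>k\<in>{..<r} - {j'}. (- cs' ! k) * Q k w) \<in> ?I"
      by (intro lin_space_lincomb[OF I]) auto
    moreover have "semi_bracket cs us w + semi_bracket (cs[i := cs ! j, j := cs ! i]) (us[i := us ! j, j := us ! i]) w =
        (\<Sum>k\<in>{..<r} - {j'}. (- cs' ! k) * Q k w)" for w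
    proof -
      have 1: "(\<Sum>k<r. cs' ! k * bracket (us'[k := u]) w) = cs' ! j' * bracket (us'[j' := u]) w +
          (\<Sum>k\<in>{..<r} - {j'}. cs' ! k * bracket (us'[k := u]) w)"
        using j' by (intro sum.remove) auto
      have "(\<Sum>k<r. cs'[j' := c] ! k * bracket (us'[j' := u, k := us' ! j']) w) =
          cs'[j' := c] ! j' * bracket (us'[j' := u, j' := us' ! j']) w +
          (\<Sum>k\<in>{..<r} - {j'}. cs'[j' := c] ! k * bracket (us'[j' := u, k := us' ! j']) w)"
        using j' by (intro sum.remove) auto
      also have "\<dots> = c * bracket us' w +
          (\<Sum>k\<in>{..<r} - {j'}. cs' ! k * bracket (us'[j' := u, k := us' ! j']) w)"
        using j' cons by (intro arg_cong2[of _ _ _ _ "(+)"] sum.cong) auto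
      finally show ?thesis
        using 1 by (simp add: cons 0 j' Q_def ring_distribs sum.distrib sum_negf sum_subtractf)
    qed
    ultimately show ?thesis
      by simp
  next
    case (Suc i')
    let ?\<tau> = "Transposition.transpose i' j'"
    let ?sw = "\<lambda>xs. xs[i' := xs ! j', j' := xs ! i']"
    have i': "i' < r" "i' \<noteq> j'"
      using assms Suc j' by auto
    define Q where "Q k = (\<lambda>w. bracket (us'[k := u]) w + bracket (?sw (us'[k := u])) w)" for k
    have Q: "Q k \<in> ?I" for k
      unfolding Q_def using cons free i' j' by (intro ideal_swap set_update_free_space) auto
    have "(\<lambda>w. bracket us' w + bracket (?sw us') w) \<in> ?I"
      using cons free i' j' by (intro ideal_swap) auto
    then have "(\<lambda>w. c * (bracket us' w + bracket (?sw us') w) - (\<Sum>k<r. cs' ! k * Q k w)) \<in> ?I"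
      by (intro lin_space_diff[OF I] lin_space_scale[OF I] lin_space_lincomb[OF I] Q)
    moreover have "semi_bracket cs us w + semi_bracket (cs[i := cs ! j, j := cs ! i]) (us[i := us ! j, j := us ! i]) w =
        c * (bracket us' w + bracket (?sw us') w) - (\<Sum>k<r. cs' ! k * Q k w)" for w
    proof -
      have "(\<Sum>k<r. ?sw cs' ! k * bracket ((?sw us')[k := u]) w) =
          (\<Sum>k<r. cs' ! k * bracket (?sw (us'[k := u])) w)"
      proof (rule sum.reindex_bij_witness[of _ ?\<tau> ?\<tau>])
        fix k assume k: "k \<in> {..<r}"
        show \<tau>k: "?\<tau> k \<in> {..<r}"
          using k i' j' by (auto simp: transpose_def)
        have "?sw cs' ! k = cs' ! ?\<tau> k"
          using k i' j' cons by (auto simp: nth_list_update transpose_def)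
        moreover have "(?sw us')[k := u] = ?sw (us'[?\<tau> k := u])"
          using k i' j' cons
          by (intro nth_equalityI) (auto simp: nth_list_update transpose_def split: if_splits)
        ultimately show "cs' ! ?\<tau> k * bracket (?sw (us'[?\<tau> k := u])) w =
            ?sw cs' ! k * bracket ((?sw us')[k := u]) w"
          by simp
      qed (use i' j' in \<open>auto simp: transpose_def\<close>)
      then show ?thesis
        by (simp add: cons Suc j' Q_def ring_distribs sum.distrib)
    qed
    ultimately show ?thesis
      by simp
  qed
qed

lemma semi_bracket_antisymmetry:
  assumes "length cs = Suc r" "length us = Suc r" "set us \<subseteq> free_space r X" "p permutes {..<Suc r}"
  shows "(\<lambda>w. semi_bracket cs us w -
    of_int (sign p) * semi_bracket (permute_list p cs) (permute_list p us) w) \<in> filippov_ideal r X"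
proof -
  \<comment> \<open>Coefficients and vectors are zipped so that a single list is permuted.\<close>
  define f where "f xs = semi_bracket (map fst xs) (map snd xs)" for xs :: "(complex \<times> ('a word \<Rightarrow> complex)) list"
  have "(\<lambda>w. f (zip cs us) w - of_int (sign p) * f (permute_list p (zip cs us)) w) \<in> filippov_ideal r X"
  proof (rule antisymmetry_from_swaps[OF lin_space_ideal assms(4), where S = "UNIV \<times> free_space r X"])
    fix xs and i j :: nat
    assume xs: "length xs = Suc r" "set xs \<subseteq> (UNIV :: complex set) \<times> free_space r X" "i < j" "j < Suc r"
    then have "(\<lambda>w. semi_bracket (map fst xs) (map snd xs) w +
        semi_bracket ((map fst xs)[i := map fst xs ! j, j := map fst xs ! i])
          ((map snd xs)[i := map snd xs ! j, j := map snd xs ! i]) w) \<in> filippov_ideal r X"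
      by (intro semi_bracket_swap) auto
    then show "(\<lambda>w. f xs w + f (xs[i := xs ! j, j := xs ! i]) w) \<in> filippov_ideal r X"
      using xs by (simp add: f_def map_update)
  qed (use assms in \<open>auto dest: set_zip_rightD\<close>)
  moreover have "map fst (permute_list p (zip cs us)) = permute_list p cs"
    "map snd (permute_list p (zip cs us)) = permute_list p us"
    using assms by (simp_all flip: permute_list_map)
  ultimately show ?thesis
    using assms by (simp add: f_def)
qed

text \<open>The bookkeeping of the Jacobi identity for \<open>semi_bracket\<close>, evaluated at one word.\<close>

lemma semi_jacobi_sums:
  fixes c :: complex and r :: nat
  shows "(- (\<Sum>l<r. d l * (c * A l - (\<Sum>j<r. cs j * A' j l)))) -
    (- (\<Sum>j<r. cs j * (c * E j - (\<Sum>l<r. d l * F j l))) +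
      (\<Sum>i<r. c * (cs i * E i - (\<Sum>l<r. d l * H i l)) -
        (\<Sum>j<r. if j = i then 0 else cs j * (cs i * X i j - (\<Sum>l<r. d l * Y i j l))))) =
    (\<Sum>l<r. d l * (- c * (A l - (\<Sum>i<r. H i l)) +
      (\<Sum>j<r. cs j * (A' j l - (\<Sum>i<r. if i = j then F j l else Y i j l))))) +
    (\<Sum>i<r. \<Sum>j<r. if j = i then 0 else cs j * cs i * X i j)"
proof -
  have Y1: "(\<Sum>i<r. \<Sum>j<r. if j = i then 0 else cs j * (cs i * X i j - (\<Sum>l<r. d l * Y i j l))) =
      (\<Sum>i<r. \<Sum>j<r. if j = i then 0 else cs j * cs i * X i j) -
      (\<Sum>l<r. \<Sum>j<r. \<Sum>i<r. d l * (cs j * (if i = j then 0 else Y i j l)))"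
  proof -
    have "(\<Sum>i<r. \<Sum>j<r. if j = i then 0 else cs j * (cs i * X i j - (\<Sum>l<r. d l * Y i j l))) =
      (\<Sum>i<r. \<Sum>j<r. (if j = i then 0 else cs j * cs i * X i j) -
        (\<Sum>l<r. d l * (cs j * (if i = j then 0 else Y i j l))))"
      by (intro sum.cong refl) (auto simp: algebra_simps sum_distrib_left)
    also have "\<dots> = (\<Sum>i<r. \<Sum>j<r. if j = i then 0 else cs j * cs i * X i j) -
      (\<Sum>i<r. \<Sum>j<r. \<Sum>l<r. d l * (cs j * (if i = j then 0 else Y i j l)))"
      by (simp add: sum_subtractf)
    also have "(\<Sum>i<r. \<Sum>j<r. \<Sum>l<r. d l * (cs j * (if i = j then 0 else Y i j l))) =
      (\<Sum>j<r. \<Sum>i<r. \<Sum>l<r. d l * (cs j * (if i = j then 0 else Y i j l)))"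
      by (rule sum.swap)
    also have "\<dots> = (\<Sum>j<r. \<Sum>l<r. \<Sum>i<r. d l * (cs j * (if i = j then 0 else Y i j l)))"
      by (intro sum.cong refl sum.swap)
    also have "\<dots> = (\<Sum>l<r. \<Sum>j<r. \<Sum>i<r. d l * (cs j * (if i = j then 0 else Y i j l)))"
      by (rule sum.swap)
    finally show ?thesis .
  qed
  have FY: "(\<Sum>i<r. if i = j then F j l else Y i j l) = F j l + (\<Sum>i<r. if i = j then 0 else Y i j l)"
    if "j < r" for j l
  proof -
    have "(\<Sum>i<r. if i = j then F j l else Y i j l) =
        (\<Sum>i<r. (if i = j then F j l else 0) + (if i = j then 0 else Y i j l))"
      by (intro sum.cong) auto
    then show ?thesis
      using that by (simp add: sum.distrib)
  qed
  have FY': "(\<Sum>l<r. d l * (\<Sum>j<r. cs j * (A' j l - (\<Sum>i<r. if i = j then F j l else Y i j l)))) =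
      (\<Sum>l<r. \<Sum>j<r. d l * (cs j * A' j l)) - (\<Sum>l<r. \<Sum>j<r. d l * (cs j * F j l)) -
      (\<Sum>l<r. \<Sum>j<r. \<Sum>i<r. d l * (cs j * (if i = j then 0 else Y i j l)))"
  proof -
    have "(\<Sum>l<r. d l * (\<Sum>j<r. cs j * (A' j l - (\<Sum>i<r. if i = j then F j l else Y i j l)))) =
      (\<Sum>l<r. \<Sum>j<r. d l * (cs j * A' j l) - d l * (cs j * F j l) -
        (\<Sum>i<r. d l * (cs j * (if i = j then 0 else Y i j l))))"
      unfolding sum_distrib_left
      by (intro sum.cong refl) (simp add: FY algebra_simps sum_distrib_left)
    then show ?thesis
      by (simp add: sum_subtractf)
  qed
  have F: "(\<Sum>j<r. \<Sum>l<r. d l * (cs j * F j l)) = (\<Sum>l<r. \<Sum>j<r. d l * (cs j * F j l))"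
    by (rule sum.swap)
  have H: "(\<Sum>i<r. \<Sum>l<r. d l * (c * H i l)) = (\<Sum>l<r. \<Sum>i<r. d l * (c * H i l))"
    by (rule sum.swap)
  have L1: "(\<Sum>l<r. d l * (c * A l - (\<Sum>j<r. cs j * A' j l))) =
      (\<Sum>l<r. d l * (c * A l)) - (\<Sum>l<r. \<Sum>j<r. d l * (cs j * A' j l))"
    by (simp add: right_diff_distrib sum_subtractf sum_distrib_left)
  have L2: "(\<Sum>j<r. cs j * (c * E j - (\<Sum>l<r. d l * F j l))) =
      (\<Sum>j<r. c * (cs j * E j)) - (\<Sum>j<r. \<Sum>l<r. d l * (cs j * F j l))"
    by (simp add: right_diff_distrib sum_subtractf sum_distrib_left mult.left_commute)
  have L3: "(\<Sum>i<r. c * (cs i * E i - (\<Sum>l<r. d l * H i l)) -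
        (\<Sum>j<r. if j = i then 0 else cs j * (cs i * X i j - (\<Sum>l<r. d l * Y i j l)))) =
      (\<Sum>j<r. c * (cs j * E j)) - (\<Sum>i<r. \<Sum>l<r. d l * (c * H i l)) -
      (\<Sum>i<r. \<Sum>j<r. if j = i then 0 else cs j * (cs i * X i j - (\<Sum>l<r. d l * Y i j l)))"
    unfolding sum_subtractf right_diff_distrib[of c] sum_distrib_left[of c] by (simp add: mult.left_commute)
  have R: "(\<Sum>l<r. d l * (- c * (A l - (\<Sum>i<r. H i l)) + x l)) =
      - (\<Sum>l<r. d l * (c * A l)) + (\<Sum>l<r. \<Sum>i<r. d l * (c * H i l)) + (\<Sum>l<r. d l * x l)" for x
    by (simp add: algebra_simps sum.distrib sum_subtractf sum_distrib_left sum_negf)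
  show ?thesis
    unfolding R L1 L2 L3 Y1 FY' F H by simp
qed

text \<open>Expanding in the coefficients leaves Jacobi relations of the smaller algebra for
  \<open>us'\<close> and for \<open>us'\<close> with one entry replaced by \<open>u\<close>, and
  terms quadratic in the coefficients of \<open>us'\<close>, which cancel modulo
  antisymmetry.\<close>

lemma semi_bracket_jacobi:
  assumes len: "length cs = Suc r" "length us = Suc r" "length ds = r" "length vs = r"
    and free: "set us \<subseteq> free_space r X" "set vs \<subseteq> free_space r X"
  shows "(\<lambda>w. semi_bracket (0 # ds) (semi_bracket cs us # vs) w -
    (\<Sum>i<Suc r. semi_bracket (cs[i := 0]) (us[i := semi_bracket (cs ! i # ds) (us ! i # vs)]) w))
    \<in> filippov_ideal r X"
proof -
  let ?I = "filippov_ideal r X" and ?F = "free_space r X"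
  note I = lin_space_ideal[of r X]
  obtain c cs' u us' where cons: "cs = c # cs'" "us = u # us'" "length cs' = r" "length us' = r"
    using len by (cases cs; cases us) auto
  have F: "set us' \<subseteq> ?F" "u \<in> ?F" "\<And>i. i < r \<Longrightarrow> us' ! i \<in> ?F"
    using free cons by auto
  \<comment> \<open>The bracket of \<open>x\<close> with \<open>vs\<close>: it replaces the
    \<open>x\<close>-part of whatever entry the derivation hits.\<close>
  define b where "b = bracket vs"
  have bF: "b \<in> ?F"
    unfolding b_def by (rule bracket_free_space[OF len(4) free(2)])
  define Jac where "Jac l L = (\<lambda>w. bracket (vs[l := bracket L]) w -
    (\<Sum>i<r. bracket (L[i := bracket (vs[l := L ! i])]) w))" for l L
  have Jac: "Jac l L \<in> ?I" if "l < r" "length L = r" "set L \<subseteq> ?F" for l L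
    unfolding Jac_def by (rule ideal_jacobi_slot[OF len(4) free(2) that])
  define X' where "X' i j = bracket (us'[i := b, j := u])" for i j
  have X': "(\<lambda>w. X' i j w + X' j i w) \<in> ?I" if "i < r" "j < r" "i \<noteq> j" for i j
  proof -
    have "(\<lambda>w. bracket (us'[i := b, j := u]) w +
        bracket (us'[i := b, j := u, i := us'[i := b, j := u] ! j, j := us'[i := b, j := u] ! i]) w) \<in> ?I"
      using that cons F bF by (intro ideal_swap set_update_free_space) auto
    moreover have "us'[i := b, j := u, i := us'[i := b, j := u] ! j, j := us'[i := b, j := u] ! i] =
        us'[j := b, i := u]"
      using that cons by (intro nth_equalityI) (auto simp: nth_list_update)
    ultimately show ?thesis
      by (simp add: X'_def)
  qed
  \<comment> \<open>The quadratic terms. Exchanging \<open>i\<close> and \<open>j\<close> turns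
    \<open>X' i j\<close> into its negative modulo the ideal while the coefficient is symmetric, so
    twice this sum lies in the ideal.\<close>
  define XX where "XX = (\<lambda>w. \<Sum>i<r. \<Sum>j<r. if j = i then 0 else cs' ! j * cs' ! i * X' i j w)"
  have "XX \<in> ?I"
  proof -
    have "(\<lambda>w. if j = i then 0 else cs' ! j * cs' ! i * (X' i j w + X' j i w)) \<in> ?I"
      if "i < r" "j < r" for i j
      using X'[OF that] lin_space_zero[OF I] lin_space_scale[OF I] by (cases "i = j") auto
    then have "(\<lambda>w. \<Sum>i<r. \<Sum>j<r. if j = i then 0 else cs' ! j * cs' ! i * (X' i j w + X' j i w)) \<in> ?I"
      by (intro lin_space_sum[OF I]) auto
    moreover have "(\<Sum>i<r. \<Sum>j<r. if j = i then 0 else cs' ! j * cs' ! i * (X' i j w + X' j i w)) = 2 * XX w" for w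
    proof -
      have "(\<Sum>i<r. \<Sum>j<r. if j = i then 0 else cs' ! j * cs' ! i * (X' i j w + X' j i w)) =
          XX w + (\<Sum>i<r. \<Sum>j<r. if j = i then 0 else cs' ! j * cs' ! i * X' j i w)"
        unfolding XX_def sum.distrib[symmetric] by (intro sum.cong refl) (auto simp: algebra_simps)
      also have "(\<Sum>i<r. \<Sum>j<r. if j = i then 0 else cs' ! j * cs' ! i * X' j i w) = XX w"
        unfolding XX_def by (subst sum.swap) (intro sum.cong refl, auto simp: mult.commute)
      finally show ?thesis
        by simp
    qed
    ultimately have "(\<lambda>w. 2 * XX w) \<in> ?I"
      by simp
    from lin_space_scale[OF I this, of "1 / 2"]
    have "(\<lambda>w. (1 / 2) * (2 * XX w)) \<in> ?I" .
    moreover have "(\<lambda>w. (1 / 2) * (2 * XX w)) = XX"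
      by auto
    ultimately show ?thesis
      by metis
  qed
  have "(\<lambda>w. (\<Sum>l<r. ds ! l * (- c * Jac l us' w + (\<Sum>j<r. cs' ! j * Jac l (us'[j := u]) w))) + XX w) \<in> ?I"
    using cons F \<open>XX \<in> ?I\<close>
    by (intro lin_space_add[OF I] lin_space_lincomb[OF I] lin_space_scale[OF I] Jac set_update_free_space) auto
  moreover have "semi_bracket (0 # ds) (semi_bracket cs us # vs) w -
    (\<Sum>i<Suc r. semi_bracket (cs[i := 0]) (us[i := semi_bracket (cs ! i # ds) (us ! i # vs)]) w) =
    (\<Sum>l<r. ds ! l * (- c * Jac l us' w + (\<Sum>j<r. cs' ! j * Jac l (us'[j := u]) w))) + XX w" for w
  proof -
    define A where "A l = bracket (vs[l := bracket us']) w" for l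
    define A' where "A' j l = bracket (vs[l := bracket (us'[j := u])]) w" for j l
    define E where "E j = bracket (us'[j := b]) w" for j
    define F where "F j l = bracket (us'[j := bracket (vs[l := u])]) w" for j l
    define H where "H i l = bracket (us'[i := bracket (vs[l := us' ! i])]) w" for i l
    define Y where "Y i j l = bracket (us'[i := bracket (vs[l := us' ! i]), j := u]) w" for i j l
    have lhs: "semi_bracket (0 # ds) (semi_bracket cs us # vs) w =
        - (\<Sum>l<r. ds ! l * (c * A l - (\<Sum>j<r. cs' ! j * A' j l)))"
      using len cons by (simp add: A_def A'_def bracket_linear)
    have Z: "semi_bracket (e # ds) (z # vs) = (\<lambda>w. e * b w - (\<Sum>l<r. ds ! l * bracket (vs[l := z]) w))" for e z
      using len by (simp add: b_def)
    have i0: "semi_bracket (cs[0 := 0]) (us[0 := semi_bracket (cs ! 0 # ds) (us ! 0 # vs)]) w =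
        - (\<Sum>j<r. cs' ! j * (c * E j - (\<Sum>l<r. ds ! l * F j l)))"
      unfolding Z using cons by (simp add: E_def F_def bracket_linear)
    have iS: "semi_bracket (cs[Suc i := 0]) (us[Suc i := semi_bracket (cs ! Suc i # ds) (us ! Suc i # vs)]) w =
        c * (cs' ! i * E i - (\<Sum>l<r. ds ! l * H i l)) -
        (\<Sum>j<r. if j = i then 0 else cs' ! j * (cs' ! i * X' i j w - (\<Sum>l<r. ds ! l * Y i j l)))"
      if i: "i < r" for i
    proof -
      define z where "z = (\<lambda>w. cs' ! i * b w - (\<Sum>l<r. ds ! l * bracket (vs[l := us' ! i]) w))"
      have zi: "bracket (L[i := z]) w = cs' ! i * bracket (L[i := b]) w -
          (\<Sum>l<r. ds ! l * bracket (L[i := bracket (vs[l := us' ! i])]) w)" if "length L = r" for L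
        unfolding z_def using i that by (simp add: bracket_linear)
      have "cs'[i := 0] ! j * bracket (us'[i := z, j := u]) w =
          (if j = i then 0 else cs' ! j * (cs' ! i * X' i j w - (\<Sum>l<r. ds ! l * Y i j l)))" if "j < r" for j
      proof (cases "j = i")
        case False
        then show ?thesis
          using zi[of "us'[j := u]"] cons by (simp add: X'_def Y_def list_update_swap[of i j])
      qed (use i cons in simp)
      then show ?thesis
        unfolding Z using cons i zi[of us'] by (simp add: z_def[symmetric] E_def H_def)
    qed
    have Jac1: "Jac l us' w = A l - (\<Sum>i<r. H i l)" for l
      by (simp add: Jac_def A_def H_def)
    have Jac2: "Jac l (us'[j := u]) w = A' j l - (\<Sum>i<r. if i = j then F j l else Y i j l)" if "j < r" for j l
    proof -
      have "bracket (us'[j := u, i := bracket (vs[l := us'[j := u] ! i])]) w =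
          (if i = j then F j l else Y i j l)" for i
        using that cons by (auto simp: F_def Y_def list_update_swap)
      then show ?thesis
        by (simp add: Jac_def A'_def)
    qed
    have "(\<Sum>i<Suc r. semi_bracket (cs[i := 0]) (us[i := semi_bracket (cs ! i # ds) (us ! i # vs)]) w) =
       - (\<Sum>j<r. cs' ! j * (c * E j - (\<Sum>l<r. ds ! l * F j l))) +
      (\<Sum>i<r. c * (cs' ! i * E i - (\<Sum>l<r. ds ! l * H i l)) -
        (\<Sum>j<r. if j = i then 0 else cs' ! j * (cs' ! i * X' i j w - (\<Sum>l<r. ds ! l * Y i j l))))"
      unfolding sum.lessThan_Suc_shift i0 using iS by simp
    then show ?thesis
      unfolding lhs XX_def Jac1 using semi_jacobi_sums[where r = r and cs = "(!) cs'" and d = "(!) ds"]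
      by (simp add: Jac2 cong: sum.cong_simp)
  qed
  ultimately show ?thesis
    by simp
qed

section \<open>The contraction homomorphism\<close>

definition x_coeff :: "'a set \<Rightarrow> ('a word \<Rightarrow> complex) \<Rightarrow> complex"
  where "x_coeff K v = (\<Sum>a\<in>K. v (Letter a))"

primrec contract_word :: "'a set \<Rightarrow> 'a word \<Rightarrow> 'a word \<Rightarrow> complex"
  where
    "contract_word K (Letter a) = (if a \<in> K then (\<lambda>_. 0) else delta (Letter a))"
  | "contract_word K (Bracket ws) =
      semi_bracket (map (\<lambda>w. x_coeff K (delta w)) ws) (map (contract_word K) ws)"

text \<open>Being a sum over the support, this is additive only on finitely supported functions;
  hence membership in \<open>free_space\<close> accompanies all its linearity rules.\<close>

definition contract :: "'a set \<Rightarrow> ('a word \<Rightarrow> complex) \<Rightarrow> 'a word \<Rightarrow> complex"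
  where "contract K v = (\<lambda>u. \<Sum>w | v w \<noteq> 0. v w * contract_word K w u)"

lemma x_coeff_linear:
  "x_coeff K (\<lambda>_. 0) = 0"
  "x_coeff K (\<lambda>w. u w + v w) = x_coeff K u + x_coeff K v"
  "x_coeff K (\<lambda>w. c * u w) = c * x_coeff K u"
  by (simp_all add: x_coeff_def sum.distrib sum_distrib_left)

lemma x_coeff_bracket [simp]: "x_coeff K (bracket xs) = 0"
  by (simp add: x_coeff_def)

lemma contract_eq_sum:
  assumes "finite S" "{w. v w \<noteq> 0} \<subseteq> S"
  shows "contract K v u = (\<Sum>w\<in>S. v w * contract_word K w u)"
  unfolding contract_def using assms by (intro sum.mono_neutral_left) auto

lemma contract_zero: "contract K (\<lambda>_. 0) = (\<lambda>_. 0)"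
  by (simp add: contract_def)

lemma contract_delta: "contract K (delta w) = contract_word K w"
  by (rule ext, subst contract_eq_sum[of "{w}"]) (auto simp: delta_def)

lemma contract_add:
  assumes "u \<in> free_space n X" "v \<in> free_space n X"
  shows "contract K (\<lambda>w. u w + v w) = (\<lambda>w. contract K u w + contract K v w)"
proof
  fix w
  let ?S = "{w. u w \<noteq> 0} \<union> {w. v w \<noteq> 0}"
  have S: "finite ?S"
    using assms by (simp add: free_space_def)
  have sub: "{w. u w + v w \<noteq> 0} \<subseteq> ?S" "{w. u w \<noteq> 0} \<subseteq> ?S" "{w. v w \<noteq> 0} \<subseteq> ?S"
    by auto
  show "contract K (\<lambda>w. u w + v w) w = contract K u w + contract K v w"
    unfolding contract_eq_sum[OF S sub(1)] contract_eq_sum[OF S sub(2)] contract_eq_sum[OF S sub(3)]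
    by (simp add: ring_distribs sum.distrib)
qed

lemma contract_scale:
  assumes "u \<in> free_space n X"
  shows "contract K (\<lambda>w. c * u w) = (\<lambda>w. c * contract K u w)"
proof
  fix w
  let ?S = "{w. u w \<noteq> 0}"
  have S: "finite ?S"
    using assms by (simp add: free_space_def)
  show "contract K (\<lambda>w. c * u w) w = c * contract K u w"
    using contract_eq_sum[OF S, of "\<lambda>w. c * u w" K w] contract_eq_sum[OF S, of u K w]
    by (auto simp: sum_distrib_left mult.assoc)
qed

lemma contract_diff:
  assumes "u \<in> free_space n X" "v \<in> free_space n X"
  shows "contract K (\<lambda>w. u w - v w) = (\<lambda>w. contract K u w - contract K v w)"
  using contract_add[OF assms(1) lin_space_scale[OF lin_space_free_space assms(2)], of K "-1"]
    contract_scale[OF assms(2), of K "-1"] by simp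

lemma contract_sum:
  assumes "\<And>i. i \<in> I \<Longrightarrow> f i \<in> free_space n X"
  shows "contract K (\<lambda>w. \<Sum>i\<in>I. f i w) = (\<lambda>w. \<Sum>i\<in>I. contract K (f i) w)"
  using assms
proof (induction I rule: infinite_finite_induct)
  case (insert i I)
  then have "(\<lambda>w. \<Sum>i\<in>I. f i w) \<in> free_space n X"
    by (intro lin_space_sum[OF lin_space_free_space]) auto
  then show ?case
    using insert contract_add[of "f i" n X "\<lambda>w. \<Sum>i\<in>I. f i w" K] by simp
qed (simp_all add: contract_zero)

text \<open>On basis words this is the recursion of \<open>contract_word\<close>, and both sides are
  linear in each slot.\<close>

lemma contract_bracket:
  assumes "length xs = n" "set xs \<subseteq> free_space n X"
  shows "contract K (bracket xs) = semi_bracket (map (x_coeff K) xs) (map (contract K) xs)"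
  using assms
proof (rule slot_induct[where l = n and n = n and X = X])
  fix ws :: "'a word list"
  show "contract K (bracket (map delta ws)) =
      semi_bracket (map (x_coeff K) (map delta ws)) (map (contract K) (map delta ws))"
    by (simp add: bracket_delta contract_delta comp_def)
next
  fix xs :: "('a word \<Rightarrow> complex) list" and i
  assume xs: "length xs = n" "set xs \<subseteq> free_space n X" "i < n"
  let ?P = "\<lambda>v. contract K (bracket (xs[i := v])) =
    semi_bracket (map (x_coeff K) (xs[i := v])) (map (contract K) (xs[i := v]))"
  note lin = lin_space_free_space[of n X]
  have br: "bracket (xs[i := v]) \<in> free_space n X" if "v \<in> free_space n X" for v
    using xs that by (intro bracket_free_space set_update_free_space) auto
  have i: "i < length xs" "i < length (map (contract K) xs)"
      "length (map (x_coeff K) xs) = length (map (contract K) xs)"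
    using xs by auto
  show "lin_space {v \<in> free_space n X. ?P v}"
    unfolding lin_space_def
  proof (intro conjI ballI allI)
    have "bracket (xs[i := \<lambda>_. 0]) = (\<lambda>_. 0)"
      by (rule ext) (rule bracket_linear(1)[OF i(1)])
    then show "(\<lambda>_. 0) \<in> {v \<in> free_space n X. ?P v}"
      using lin_space_zero[OF lin] semi_bracket_linear(1)[OF i(3,2)]
      by (auto simp: map_update contract_zero x_coeff_linear)
  next
    fix u v assume uv: "u \<in> {v \<in> free_space n X. ?P v}" "v \<in> {v \<in> free_space n X. ?P v}"
    have "bracket (xs[i := \<lambda>w. u w + v w]) = (\<lambda>w. bracket (xs[i := u]) w + bracket (xs[i := v]) w)"
      by (rule ext) (rule bracket_linear(2)[OF i(1)])
    then show "(\<lambda>w. u w + v w) \<in> {v \<in> free_space n X. ?P v}"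
      using uv br lin_space_add[OF lin] semi_bracket_linear(2)[OF i(3,2)]
      by (auto simp: map_update contract_add[of _ n X] x_coeff_linear)
  next
    fix c v assume v: "v \<in> {v \<in> free_space n X. ?P v}"
    have "bracket (xs[i := \<lambda>w. c * v w]) = (\<lambda>w. c * bracket (xs[i := v]) w)"
      by (rule ext) (rule bracket_linear(4)[OF i(1)])
    then show "(\<lambda>w. c * v w) \<in> {v \<in> free_space n X. ?P v}"
      using v br lin_space_scale[OF lin] semi_bracket_linear(3)[OF i(3,2)]
      by (auto simp: map_update contract_scale[of _ n X] x_coeff_linear)
  qed
qed

lemma semi_bracket_free_space:
  assumes "length us = Suc r" "set us \<subseteq> free_space r X"
  shows "semi_bracket cs us \<in> free_space r X"
proof -
  note lin = lin_space_free_space[of r X]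
  obtain u us' where us: "us = u # us'" "length us' = r" "u \<in> free_space r X" "set us' \<subseteq> free_space r X"
    using assms by (cases us) auto
  show ?thesis
  proof (cases cs)
    case (Cons c cs')
    have "bracket us' \<in> free_space r X" "bracket (us'[i := u]) \<in> free_space r X" for i
      using us by (intro bracket_free_space set_update_free_space; simp)+
    then show ?thesis
      unfolding Cons us(1) semi_bracket.simps us(2)
      by (intro lin_space_diff[OF lin] lin_space_scale[OF lin] lin_space_sum[OF lin])
  qed (simp add: lin_space_zero[OF lin])
qed

lemma contract_word_free_space:
  "w \<in> words (Suc r) (Y \<union> K) \<Longrightarrow> contract_word K w \<in> free_space r Y"
proof (induction rule: words.induct)
  case (1 x)
  then show ?case
    using lin_space_zero[OF lin_space_free_space] by (auto intro: delta_free_space words.intros)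
next
  case (2 ws)
  then show ?case
    by (auto intro!: semi_bracket_free_space)
qed

lemma contract_free_space:
  assumes "v \<in> free_space (Suc r) (Y \<union> K)"
  shows "contract K v \<in> free_space r Y"
  unfolding contract_def using assms
  by (intro lin_space_lincomb[OF lin_space_free_space] contract_word_free_space) (auto simp: free_space_def)

lemma map_contract_free_space:
  "set xs \<subseteq> free_space (Suc r) (Y \<union> K) \<Longrightarrow> set (map (contract K) xs) \<subseteq> free_space r Y"
  by (auto intro: contract_free_space)

lemma ideal_Letter: "v \<in> filippov_ideal n X \<Longrightarrow> v (Letter a) = 0"
  by (induction rule: filippov_ideal.induct) auto

lemma semi_bracket_ideal:
  assumes "length cs = Suc r" "length us = Suc r" "set us \<subseteq> free_space r X" "i < Suc r"
    and v: "v \<in> filippov_ideal r X"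
  shows "semi_bracket (cs[i := 0]) (us[i := v]) \<in> filippov_ideal r X"
proof -
  note I = lin_space_ideal[of r X]
  obtain c cs' u us' where cons: "cs = c # cs'" "us = u # us'" "length cs' = r" "length us' = r"
    using assms by (cases cs; cases us) auto
  have free: "set us' \<subseteq> free_space r X" "u \<in> free_space r X"
    using assms(3) cons by auto
  show ?thesis
  proof (cases i)
    case 0
    have "(\<lambda>w. (\<Sum>j<r. (- cs' ! j) * bracket (us'[j := v]) w)) \<in> filippov_ideal r X"
      using cons free v by (intro lin_space_lincomb[OF I] filippov_ideal.bracket) auto
    then show ?thesis
      by (simp add: 0 cons sum_negf)
  next
    case (Suc j)
    have j: "j < r"
      using assms(4) Suc by simp
    have "(\<lambda>w. cs'[j := 0] ! k * bracket (us'[j := v, k := u]) w) \<in> filippov_ideal r X" if "k < r" for k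
    proof (cases "k = j")
      case True
      then show ?thesis
        using lin_space_zero[OF I] j cons by simp
    next
      case False
      then have eq: "us'[j := v, k := u] = us'[k := u, j := v]"
        by (simp add: list_update_swap)
      have "set (us'[k := u]) \<subseteq> free_space r X"
        by (rule set_update_free_space[OF free])
      then have "bracket (us'[k := u, j := v]) \<in> filippov_ideal r X"
        using cons v j by (intro filippov_ideal.bracket) auto
      then show ?thesis
        unfolding eq by (rule lin_space_scale[OF I])
    qed
    then have "(\<lambda>w. \<Sum>k<r. cs'[j := 0] ! k * bracket (us'[j := v, k := u]) w) \<in> filippov_ideal r X"
      by (intro lin_space_sum[OF I]) auto
    moreover have "bracket (us'[j := v]) \<in> filippov_ideal r X"
      using cons free v j by (intro filippov_ideal.bracket) auto
    ultimately show ?thesis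
      using lin_space_diff[OF I lin_space_scale[OF I, of _ c]] cons by (simp add: Suc)
  qed
qed

text \<open>Contraction is a homomorphism, and the target satisfies antisymmetry and the Jacobi
  identity modulo the smaller ideal; so each generating rule is carried to ideal elements.\<close>

lemma contract_ideal:
  assumes "v \<in> filippov_ideal (Suc r) (Y \<union> K)"
  shows "contract K v \<in> filippov_ideal r Y"
  using assms
proof (induction rule: filippov_ideal.induct)
  case (antisymmetry xs p)
  have br: "bracket xs \<in> free_space (Suc r) (Y \<union> K)" "bracket (permute_list p xs) \<in> free_space (Suc r) (Y \<union> K)"
    using antisymmetry by (auto intro!: bracket_free_space)
  have "(\<lambda>w. semi_bracket (map (x_coeff K) xs) (map (contract K) xs) w - of_int (sign p) *
      semi_bracket (permute_list p (map (x_coeff K) xs)) (permute_list p (map (contract K) xs)) w)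
      \<in> filippov_ideal r Y"
    using antisymmetry by (intro semi_bracket_antisymmetry map_contract_free_space) auto
  then show ?case
    using antisymmetry br
    by (simp add: contract_diff[OF br(1) lin_space_scale[OF lin_space_free_space br(2)]]
        contract_scale[OF br(2)] contract_bracket[of _ "Suc r" "Y \<union> K"] permute_list_map)
next
  case (jacobi xs ys)
  let ?F = "free_space (Suc r) (Y \<union> K)"
  have ys: "length (x # ys) = Suc r" for x :: "'a word \<Rightarrow> complex"
    using jacobi by simp
  have br1: "bracket xs \<in> ?F" "\<And>x. x \<in> ?F \<Longrightarrow> bracket (x # ys) \<in> ?F"
    "\<And>i. i < Suc r \<Longrightarrow> xs ! i \<in> ?F"
    using jacobi by (auto intro!: bracket_free_space)
  have "bracket (xs[i := bracket (xs ! i # ys)]) \<in> ?F" if "i < Suc r" for i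
    using jacobi br1(2)[OF br1(3)[OF that]] br1(3)[OF that] by (intro bracket_free_space set_update_free_space) auto
  note br = br1(1,2) this br1(3)
  \<comment> \<open>A bracket has no \<open>x\<close>-component. This puts coefficient 0 in the slot
    of every inner bracket, as in \<open>semi_bracket_jacobi\<close>.\<close>
  have 1: "contract K (bracket (bracket xs # ys)) = semi_bracket (0 # map (x_coeff K) ys)
      (semi_bracket (map (x_coeff K) xs) (map (contract K) xs) # map (contract K) ys)"
    using contract_bracket[OF ys, of "bracket xs" "Y \<union> K" K] br(1) jacobi contract_bracket[of xs "Suc r" "Y \<union> K" K]
    by simp
  have 2: "contract K (bracket (xs[i := bracket (xs ! i # ys)])) =
      semi_bracket ((map (x_coeff K) xs)[i := 0]) ((map (contract K) xs)[i :=
        semi_bracket (map (x_coeff K) xs ! i # map (x_coeff K) ys)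
          (map (contract K) xs ! i # map (contract K) ys)])" if "i < Suc r" for i
  proof -
    have "contract K (bracket (xs ! i # ys)) = semi_bracket (map (x_coeff K) (xs ! i # ys))
        (map (contract K) (xs ! i # ys))"
      using br(4)[OF that] jacobi by (intro contract_bracket[OF ys]) auto
    moreover have "contract K (bracket (xs[i := bracket (xs ! i # ys)])) =
        semi_bracket (map (x_coeff K) (xs[i := bracket (xs ! i # ys)]))
          (map (contract K) (xs[i := bracket (xs ! i # ys)]))"
      using jacobi br(2)[OF br(4)[OF that]]
      by (intro contract_bracket[of _ "Suc r" "Y \<union> K"] set_update_free_space) auto
    ultimately show ?thesis
      using that jacobi(1) by (simp add: map_update)
  qed
  have 3: "contract K (\<lambda>w. bracket (bracket xs # ys) w - (\<Sum>i<Suc r. bracket (xs[i := bracket (xs ! i # ys)]) w)) =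
      (\<lambda>w. contract K (bracket (bracket xs # ys)) w -
        (\<Sum>i<Suc r. contract K (bracket (xs[i := bracket (xs ! i # ys)])) w))"
    using br by (subst contract_diff[of _ "Suc r" "Y \<union> K"] contract_sum[of _ _ "Suc r" "Y \<union> K"],
        auto intro!: lin_space_sum[OF lin_space_free_space] simp: contract_sum[of _ _ "Suc r" "Y \<union> K"] simp del: sum.lessThan_Suc)+
  have "(\<lambda>w. semi_bracket (0 # map (x_coeff K) ys)
      (semi_bracket (map (x_coeff K) xs) (map (contract K) xs) # map (contract K) ys) w -
    (\<Sum>i<Suc r. semi_bracket ((map (x_coeff K) xs)[i := 0]) ((map (contract K) xs)[i :=
        semi_bracket (map (x_coeff K) xs ! i # map (x_coeff K) ys)
          (map (contract K) xs ! i # map (contract K) ys)]) w)) \<in> filippov_ideal r Y"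
    using jacobi by (intro semi_bracket_jacobi map_contract_free_space) auto
  then show ?case
    unfolding 3 1 using 2 by (simp del: sum.lessThan_Suc cong: sum.cong_simp)
next
  case (bracket xs i v)
  have v: "v \<in> free_space (Suc r) (Y \<union> K)"
    using ideal_free_space[OF _ bracket(4)] by simp
  \<comment> \<open>Ideal elements have coefficient 0 at single letters, since relations only
    involve brackets.\<close>
  have "x_coeff K v = 0"
    using ideal_Letter[OF bracket(4)] by (simp add: x_coeff_def)
  then have "contract K (bracket (xs[i := v])) =
      semi_bracket ((map (x_coeff K) xs)[i := 0]) ((map (contract K) xs)[i := contract K v])"
    using contract_bracket[of "xs[i := v]" "Suc r" "Y \<union> K" K] set_update_free_space[OF bracket(2) v] bracket(1)
    by (simp add: map_update)
  moreover have "semi_bracket ((map (x_coeff K) xs)[i := 0]) ((map (contract K) xs)[i := contract K v])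
      \<in> filippov_ideal r Y"
    using bracket by (intro semi_bracket_ideal map_contract_free_space) auto
  ultimately show ?case
    by simp
next
  case zero
  then show ?case
    by (simp add: contract_zero filippov_ideal.zero)
next
  case (add u v)
  then show ?case
    using contract_add[OF ideal_free_space[OF _ add(1)] ideal_free_space[OF _ add(2)], of K]
    by (simp add: filippov_ideal.add)
next
  case (scale v c)
  then show ?case
    using contract_scale[OF ideal_free_space[OF _ scale(1)], of K c]
    by (simp add: filippov_ideal.scale)
qed

section \<open>Inserting a letter into every bracket\<close>

text \<open>Canonical words with one letter of \<open>K\<close> per bracket, always as its first
  entry. If \<open>K\<close> and \<open>Y\<close> are disjoint, no further entry is a letter of
  \<open>K\<close>.\<close>

inductive_set normal :: "nat \<Rightarrow> 'a set \<Rightarrow> 'a set \<Rightarrow> 'a word set" for r K Y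
  where
    Letter: "y \<in> Y \<Longrightarrow> Letter y \<in> normal r K Y"
  | Bracket: "a \<in> K \<Longrightarrow> length us = r \<Longrightarrow> (\<And>u. u \<in> set us \<Longrightarrow> u \<in> normal r K Y) \<Longrightarrow>
      Bracket (Letter a # us) \<in> normal r K Y"

primrec strip :: "'a word \<Rightarrow> 'a word"
  where
    "strip (Letter x) = Letter x"
  | "strip (Bracket ws) = Bracket (tl (map strip ws))"

lemma normal_Letter_iff: "Letter y \<in> normal r K Y \<longleftrightarrow> y \<in> Y"
  by (auto intro: normal.intros elim: normal.cases)

lemma normal_Bracket_iff:
  "Bracket ws \<in> normal r K Y \<longleftrightarrow>
    (\<exists>a us. ws = Letter a # us \<and> a \<in> K \<and> length us = r \<and> set us \<subseteq> normal r K Y)"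
proof
  assume "Bracket ws \<in> normal r K Y"
  then show "\<exists>a us. ws = Letter a # us \<and> a \<in> K \<and> length us = r \<and> set us \<subseteq> normal r K Y"
    by (cases rule: normal.cases) auto
qed (auto intro: normal.intros)

lemma normal_words: "u \<in> normal r K Y \<Longrightarrow> u \<in> words (Suc r) (Y \<union> K)"
  by (induction rule: normal.induct) (auto intro!: words.intros)

lemma strip_words: "u \<in> normal r K Y \<Longrightarrow> strip u \<in> words r Y"
  by (induction rule: normal.induct) (auto intro!: words.intros)

text \<open>As a map on basis words: \<open>w\<close> goes to the sum of all normal words whose
  stripping is \<open>w\<close>, that is, of all ways to insert letters of \<open>K\<close>, with
  repetition, in front of its brackets.\<close>

definition expand :: "nat \<Rightarrow> 'a set \<Rightarrow> 'a set \<Rightarrow> ('a word \<Rightarrow> complex) \<Rightarrow> 'a word \<Rightarrow> complex"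
  where "expand r K Y v = (\<lambda>u. if u \<in> normal r K Y then v (strip u) else 0)"

definition letter_sum :: "'a set \<Rightarrow> 'a word \<Rightarrow> complex"
  where "letter_sum K = (\<lambda>w. case w of Letter a \<Rightarrow> if a \<in> K then 1 else 0 | Bracket _ \<Rightarrow> 0)"

lemma letter_sum_free_space:
  assumes "finite K"
  shows "letter_sum K \<in> free_space n (Y \<union> K)"
proof -
  have "{w. letter_sum K w \<noteq> 0} \<subseteq> Letter ` K"
  proof
    fix w assume "w \<in> {w. letter_sum K w \<noteq> 0}"
    then show "w \<in> Letter ` K"
      by (cases w) (auto simp: letter_sum_def split: if_splits)
  qed
  then show ?thesis
    using assms unfolding free_space_def by (auto intro: finite_subset words.intros)
qed

lemma expand_linear:
  "expand r K Y (\<lambda>_. 0) = (\<lambda>_. 0)"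
  "expand r K Y (\<lambda>w. u w + v w) = (\<lambda>w. expand r K Y u w + expand r K Y v w)"
  "expand r K Y (\<lambda>w. u w - v w) = (\<lambda>w. expand r K Y u w - expand r K Y v w)"
  "expand r K Y (\<lambda>w. c * u w) = (\<lambda>w. c * expand r K Y u w)"
  "expand r K Y (\<lambda>w. \<Sum>i\<in>I. f i w) = (\<lambda>w. \<Sum>i\<in>I. expand r K Y (f i) w)"
  by (auto simp: expand_def)

text \<open>Inserting a letter of \<open>K\<close> in all possible ways is bracketing with the sum
  of these letters as additional first entry. So \<open>expand\<close> is a homomorphism for the
  operation obtained by fixing that entry.\<close>

lemma expand_bracket:
  assumes "length xs = r"
  shows "expand r K Y (bracket xs) = bracket (letter_sum K # map (expand r K Y) xs)"
proof
  fix u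
  show "expand r K Y (bracket xs) u = bracket (letter_sum K # map (expand r K Y) xs) u"
  proof (cases u)
    case (Bracket ws)
    show ?thesis
    proof (cases "\<exists>a us. ws = Letter a # us \<and> a \<in> K \<and> length us = r")
      case True
      then obtain a us where ws: "ws = Letter a # us" "a \<in> K" "length us = r"
        by blast
      have "bracket (letter_sum K # map (expand r K Y) xs) u = (\<Prod>i<r. expand r K Y (xs ! i) (us ! i))"
        using ws assms by (simp add: Bracket bracket_Bracket prod.lessThan_Suc_shift letter_sum_def del: prod.lessThan_Suc)
      also have "\<dots> = expand r K Y (bracket xs) u"
      proof (cases "set us \<subseteq> normal r K Y")
        case True
        then have "us ! i \<in> normal r K Y" if "i < r" for i
          using that ws(3) by auto
        then show ?thesis
          using True ws assms by (simp add: Bracket normal_Bracket_iff expand_def bracket_Bracket)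
      next
        case False
        then obtain i where "i < r" "us ! i \<notin> normal r K Y"
          using ws(3) by (metis in_set_conv_nth subsetI)
        then have "(\<Prod>i<r. expand r K Y (xs ! i) (us ! i)) = 0"
          by (intro prod_zero) (auto simp: expand_def)
        then show ?thesis
          using False ws by (simp add: Bracket normal_Bracket_iff expand_def)
      qed
      finally show ?thesis ..
    next
      case False
      have "bracket (letter_sum K # map (expand r K Y) xs) u = 0"
      proof (cases "length ws = Suc r")
        case True
        then obtain w us where ws: "ws = w # us" "length us = r"
          by (cases ws) auto
        then have "letter_sum K w = 0"
          using False by (auto simp: letter_sum_def split: word.splits)
        then show ?thesis
          using ws assms by (simp add: Bracket bracket_Bracket prod.lessThan_Suc_shift del: prod.lessThan_Suc)
      qed (simp add: Bracket bracket_Bracket assms)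
      moreover have "Bracket ws \<notin> normal r K Y"
        using False by (auto simp: normal_Bracket_iff)
      ultimately show ?thesis
        by (simp add: Bracket expand_def)
    qed
  qed (simp add: expand_def)
qed

lemma finite_strip_fiber:
  assumes "finite K"
  shows "finite {u \<in> normal r K Y. strip u = w}"
proof (induction w)
  case (Letter x)
  have "{u \<in> normal r K Y. strip u = Letter x} \<subseteq> {Letter x}"
    by (auto elim: normal.cases)
  then show ?case
    by (rule finite_subset) simp
next
  case (Bracket ws)
  define S where "S = (\<Union>w\<in>set ws. {u \<in> normal r K Y. strip u = w})"
  have "{u \<in> normal r K Y. strip u = Bracket ws} \<subseteq>
      (\<lambda>(a, us). Bracket (Letter a # us)) ` (K \<times> {us. set us \<subseteq> S \<and> length us = length ws})"
  proof
    fix u assume "u \<in> {u \<in> normal r K Y. strip u = Bracket ws}"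
    then obtain a us where u: "u = Bracket (Letter a # us)" "a \<in> K" "set us \<subseteq> normal r K Y"
      and ws: "ws = map strip us"
      by (cases u) (auto simp: normal_Bracket_iff)
    then have "set us \<subseteq> S"
      by (auto simp: S_def)
    then show "u \<in> (\<lambda>(a, us). Bracket (Letter a # us)) ` (K \<times> {us. set us \<subseteq> S \<and> length us = length ws})"
      using u ws by (intro image_eqI[of _ _ "(a, us)"]) auto
  qed
  moreover have "finite S"
    using Bracket by (simp add: S_def)
  ultimately show ?case
    by (rule finite_subset[OF _ finite_imageI[OF finite_cartesian_product[OF assms finite_lists_length_eq]]])
qed

lemma expand_free_space:
  assumes "finite K" "v \<in> free_space r Y"
  shows "expand r K Y v \<in> free_space (Suc r) (Y \<union> K)"
proof -
  have "{u. expand r K Y v u \<noteq> 0} \<subseteq> (\<Union>w\<in>{w. v w \<noteq> 0}. {u \<in> normal r K Y. strip u = w})"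
    by (auto simp: expand_def)
  moreover have "finite (\<Union>w\<in>{w. v w \<noteq> 0}. {u \<in> normal r K Y. strip u = w})"
    using assms(2) finite_strip_fiber[OF assms(1)] by (intro finite_UN_I) (auto simp: free_space_def)
  ultimately have "finite {u. expand r K Y v u \<noteq> 0}"
    by (rule finite_subset)
  moreover have "{u. expand r K Y v u \<noteq> 0} \<subseteq> words (Suc r) (Y \<union> K)"
    using normal_words by (auto simp: expand_def)
  ultimately show ?thesis
    unfolding free_space_def by blast
qed

text \<open>Fixing one entry \<open>x\<close> of a bracket of arity \<open>r + 1\<close> gives an
  operation that satisfies the relations of arity \<open>r\<close>. For the Jacobi identity, the
  derivation given by \<open>x\<close> and further entries kills \<open>x\<close> itself, because a
  bracket with \<open>x\<close> twice is zero.\<close>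

lemma expand_ideal:
  assumes K: "finite K" and r: "0 < r" and v: "v \<in> filippov_ideal r Y"
  shows "expand r K Y v \<in> filippov_ideal (Suc r) (Y \<union> K)"
  using v
proof (induction rule: filippov_ideal.induct)
  case (antisymmetry xs p)
  let ?F = "free_space (Suc r) (Y \<union> K)" and ?I = "filippov_ideal (Suc r) (Y \<union> K)"
  let ?e = "expand r K Y" and ?x = "letter_sum K"
  note I = lin_space_ideal[of "Suc r" "Y \<union> K"] and x = letter_sum_free_space[OF K, of "Suc r" Y]
  have "(\<lambda>w. bracket (?x # map ?e xs) w - of_int (sign p) * bracket (?x # permute_list p (map ?e xs)) w) \<in> ?I"
  proof (rule antisymmetry_from_swaps[OF I antisymmetry(3), where S = ?F])
    fix ys and i j :: nat
    assume ys: "length ys = r" "set ys \<subseteq> ?F" "i < j" "j < r"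
    have "(\<lambda>w. bracket (?x # ys) w + bracket ((?x # ys)[Suc i := (?x # ys) ! Suc j, Suc j := (?x # ys) ! Suc i]) w) \<in> ?I"
      using ys x by (intro ideal_swap) auto
    then show "(\<lambda>w. bracket (?x # ys) w + bracket (?x # ys[i := ys ! j, j := ys ! i]) w) \<in> ?I"
      by simp
  qed (use antisymmetry expand_free_space[OF K] in auto)
  then show ?case
    using antisymmetry by (simp add: expand_linear expand_bracket permute_list_map)
next
  case (jacobi xs ys)
  let ?F = "free_space (Suc r) (Y \<union> K)" and ?I = "filippov_ideal (Suc r) (Y \<union> K)"
  let ?e = "expand r K Y" and ?x = "letter_sum K"
  note I = lin_space_ideal[of "Suc r" "Y \<union> K"] and x = letter_sum_free_space[OF K, of "Suc r" Y]
  define xs' ys' where "xs' = map ?e xs" and "ys' = map ?e ys"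
  have xs': "length xs' = r" "set xs' \<subseteq> ?F" and ys': "length ys' = r - 1" "set ys' \<subseteq> ?F"
    using jacobi expand_free_space[OF K] by (auto simp: xs'_def ys'_def)
  have xi: "xs' ! i \<in> ?F" if "i < r" for i
    using that xs' by auto
  have swap: "(\<lambda>w. bracket (u # ?x # ys') w + bracket (?x # u # ys') w) \<in> ?I" if "u \<in> ?F" for u
    using ideal_swap[of "u # ?x # ys'" "Suc r" "Y \<union> K" 0 1] that x ys' r by simp
  define b where "b = bracket (?x # xs')"
  have b: "b \<in> ?F"
    unfolding b_def using x xs' by (intro bracket_free_space) auto
  have "(\<lambda>w. bracket (b # ?x # ys') w - (\<Sum>i<Suc r. bracket ((?x # xs')[i := bracket ((?x # xs') ! i # ?x # ys')]) w)) \<in> ?I"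
    unfolding b_def using x xs' ys' r by (intro filippov_ideal.jacobi) auto
  then have 1: "(\<lambda>w. bracket (b # ?x # ys') w - (bracket (bracket (?x # ?x # ys') # xs') w +
      (\<Sum>i<r. bracket (?x # xs'[i := bracket (xs' ! i # ?x # ys')]) w))) \<in> ?I"
    unfolding sum.lessThan_Suc_shift by simp
  \<comment> \<open>Swapping the two equal entries shows that twice this bracket lies in the
    ideal.\<close>
  have "(\<lambda>w. (1 / 2) * (bracket (?x # ?x # ys') w + bracket (?x # ?x # ys') w)) \<in> ?I"
    by (rule lin_space_scale[OF I swap[OF x]])
  then have "bracket (?x # ?x # ys') \<in> ?I"
    by simp
  then have 2: "bracket (bracket (?x # ?x # ys') # xs') \<in> ?I"
    using filippov_ideal.bracket[of "?x # xs'" "Suc r" "Y \<union> K" 0] x xs' by simp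
  have 3: "(\<lambda>w. \<Sum>i<r. bracket (?x # xs'[i := (\<lambda>w. bracket (xs' ! i # ?x # ys') w + bracket (?x # xs' ! i # ys') w)]) w) \<in> ?I"
  proof (intro lin_space_sum[OF I])
    fix i assume "i \<in> {..<r}"
    then show "bracket (?x # xs'[i := (\<lambda>w. bracket (xs' ! i # ?x # ys') w + bracket (?x # xs' ! i # ys') w)]) \<in> ?I"
      using filippov_ideal.bracket[of "?x # xs'" "Suc r" "Y \<union> K" "Suc i"] x xs' swap[OF xi] by simp
  qed
  \<comment> \<open>The swaps bring \<open>letter_sum K\<close> to the front of every bracket, and
    the term in which it occurs twice drops out.\<close>
  have "(\<lambda>w. (bracket (b # ?x # ys') w + bracket (?x # b # ys') w) -
      (bracket (b # ?x # ys') w - (bracket (bracket (?x # ?x # ys') # xs') w +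
        (\<Sum>i<r. bracket (?x # xs'[i := bracket (xs' ! i # ?x # ys')]) w))) -
      bracket (bracket (?x # ?x # ys') # xs') w -
      (\<Sum>i<r. bracket (?x # xs'[i := (\<lambda>w. bracket (xs' ! i # ?x # ys') w + bracket (?x # xs' ! i # ys') w)]) w)) \<in> ?I"
    by (intro lin_space_diff[OF I] swap b 1 2 3)
  moreover have "bracket (?x # xs'[i := (\<lambda>w. bracket (xs' ! i # ?x # ys') w + bracket (?x # xs' ! i # ys') w)]) w =
      bracket (?x # xs'[i := bracket (xs' ! i # ?x # ys')]) w + bracket (?x # xs'[i := bracket (?x # xs' ! i # ys')]) w"
    if "i < r" for i w
    using bracket_linear(2)[of "Suc i" "?x # xs'"] that xs' by simp
  ultimately have "(\<lambda>w. bracket (?x # b # ys') w - (\<Sum>i<r. bracket (?x # xs'[i := bracket (?x # xs' ! i # ys')]) w)) \<in> ?I"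
    by (simp add: sum.distrib)
  moreover have "?e (bracket (bracket xs # ys)) = bracket (?x # b # ys')"
    using jacobi r by (simp add: expand_bracket b_def xs'_def ys'_def)
  moreover have "?e (bracket (xs[i := bracket (xs ! i # ys)])) = bracket (?x # xs'[i := bracket (?x # xs' ! i # ys')])"
    if "i < r" for i
    using jacobi r that by (simp add: expand_bracket xs'_def ys'_def map_update)
  ultimately show ?case
    by (simp add: expand_linear)
next
  case (bracket xs i v)
  have "bracket ((letter_sum K # map (expand r K Y) xs)[Suc i := expand r K Y v]) \<in> filippov_ideal (Suc r) (Y \<union> K)"
    using bracket expand_free_space[OF K] letter_sum_free_space[OF K, of "Suc r" Y]
    by (intro filippov_ideal.bracket) auto
  then show ?case
    using bracket(1) by (simp add: expand_bracket map_update)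
qed (auto simp: expand_linear intro: filippov_ideal.intros)

text \<open>Substituting 0 for the letter \<open>a\<close> is an endomorphism of the algebra; on
  coefficients it erases the words that contain \<open>a\<close>.\<close>

lemma restrict_hom_ideal:
  assumes "v \<in> filippov_ideal n X"
  shows "(\<lambda>u. if a \<in> set (letters u) then 0 else v u) \<in> filippov_ideal n X"
proof (rule ideal_hom[where h = "\<lambda>v u. if a \<in> set (letters u) then 0 else v u", OF _ _ _ _ _ assms])
  fix u assume u: "u \<in> free_space n X"
  have sub: "{w. (if a \<in> set (letters w) then 0 else u w) \<noteq> 0} \<subseteq> {w. u w \<noteq> 0}"
    by auto
  have "finite {w. u w \<noteq> 0}" "{w. u w \<noteq> 0} \<subseteq> words n X"
    using u by (auto simp: free_space_def)
  then show "(\<lambda>w. if a \<in> set (letters w) then 0 else u w) \<in> free_space n X"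
    unfolding free_space_def using finite_subset[OF sub] subset_trans[OF sub] by simp
next
  fix xs :: "('a word \<Rightarrow> complex) list"
  show "(\<lambda>u. if a \<in> set (letters u) then 0 else bracket xs u) =
      bracket (map (\<lambda>v u. if a \<in> set (letters u) then 0 else v u) xs)"
  proof
    fix u
    show "(if a \<in> set (letters u) then 0 else bracket xs u) =
      bracket (map (\<lambda>v u. if a \<in> set (letters u) then 0 else v u) xs) u"
    proof (cases u)
      case (Bracket ws)
      show ?thesis
      proof (cases "length ws = length xs \<and> a \<in> set (letters u)")
        case True
        then obtain i where "i < length xs" "a \<in> set (letters (ws ! i))"
          unfolding Bracket by (auto simp: in_set_conv_nth) (metis in_set_conv_nth)
        then have "(\<Prod>i<length xs. (if a \<in> set (letters (ws ! i)) then 0 else (xs ! i) (ws ! i))) = 0"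
          by (intro prod_zero) auto
        then show ?thesis
          using True by (auto simp: Bracket bracket_Bracket)
      next
        case False
        show ?thesis
        proof (cases "length ws = length xs")
          case True
          then have "a \<notin> set (letters (ws ! i))" if "i < length xs" for i
            using False that by (auto simp: Bracket)
          then show ?thesis
            using False True by (auto simp: Bracket bracket_Bracket intro!: prod.cong)
        qed (auto simp: Bracket bracket_Bracket)
      qed
    qed simp
  qed
qed auto

text \<open>Subtracting the image under the substitution of 0 for \<open>a\<close> keeps exactly the
  words that contain \<open>a\<close>; this is repeated for each letter of \<open>K\<close>.\<close>

lemma covering_ideal:
  assumes "finite K" "v \<in> filippov_ideal n X"
  shows "(\<lambda>u. if K \<subseteq> set (letters u) then v u else 0) \<in> filippov_ideal n X"
  using assms
proof (induction K)
  case (insert a K)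
  let ?v = "\<lambda>u. if K \<subseteq> set (letters u) then v u else 0"
  have "(\<lambda>u. ?v u - (if a \<in> set (letters u) then 0 else ?v u)) \<in> filippov_ideal n X"
    using insert by (intro lin_space_diff[OF lin_space_ideal] restrict_hom_ideal) auto
  moreover have "(\<lambda>u. ?v u - (if a \<in> set (letters u) then 0 else ?v u)) =
      (\<lambda>u. if insert a K \<subseteq> set (letters u) then v u else 0)"
    by auto
  ultimately show ?case
    by simp
qed simp

section \<open>Multilinear words\<close>

primrec brackets :: "'a word \<Rightarrow> nat"
  where
    "brackets (Letter x) = 0"
  | "brackets (Bracket ws) = Suc (sum_list (map brackets ws))"

lemma letters_map_word: "letters (map_word f w) = map f (letters w)"
  by (induction w) (auto simp: map_concat comp_def intro!: arg_cong[of _ _ concat])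

lemma set_word_letters: "set_word w = set (letters w)"
  by (induction w) auto

lemma brackets_map_word: "brackets (map_word f w) = brackets w"
  by (induction w) (auto simp: comp_def intro!: arg_cong[of _ _ sum_list])

lemma map_word_words: "w \<in> words n X \<Longrightarrow> f ` X \<subseteq> X' \<Longrightarrow> map_word f w \<in> words n X'"
  by (induction rule: words.induct) (auto intro!: words.intros)

lemma words_Bracket_iff: "Bracket ws \<in> words n X \<longleftrightarrow> length ws = n \<and> set ws \<subseteq> words n X"
proof
  assume "Bracket ws \<in> words n X"
  then show "length ws = n \<and> set ws \<subseteq> words n X"
    by (cases rule: words.cases) auto
qed (auto intro: words.intros)

lemma words_Letter_iff: "Letter x \<in> words n X \<longleftrightarrow> x \<in> X"
  by (auto intro: words.intros elim: words.cases)

lemma map_word_cong_letters: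
  "(\<And>x. x \<in> set (letters w) \<Longrightarrow> f x = g x) \<Longrightarrow> map_word f w = map_word g w"
  by (rule word.map_cong0) (simp add: set_word_letters)

lemma map_word_ident_letters: "(\<And>x. x \<in> set (letters w) \<Longrightarrow> f x = x) \<Longrightarrow> map_word f w = w"
  using map_word_cong_letters[of w f id] by (simp add: word.map_id)

lemma length_letters: "w \<in> words (Suc r) X \<Longrightarrow> length (letters w) = brackets w * r + 1"
proof (induction rule: words.induct)
  case (2 ws)
  have "length (letters (Bracket ws)) = sum_list (map (\<lambda>w. length (letters w)) ws)"
    by (simp add: length_concat comp_def)
  also have "\<dots> = sum_list (map (\<lambda>w. brackets w * r + 1) ws)"
    using 2 by (intro arg_cong[of _ _ sum_list] map_cong) auto
  also have "\<dots> = sum_list (map brackets ws) * r + length ws"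
    unfolding sum_list_addf sum_list_mult_const by (simp add: sum_list_triv)
  finally show ?case
    using 2(1) by simp
qed simp

lemma finite_words:
  assumes "finite X"
  shows "finite {w \<in> words n X. brackets w \<le> k}"
proof (induction k)
  case 0
  have "{w \<in> words n X. brackets w \<le> 0} \<subseteq> Letter ` X"
    by (auto elim: words.cases)
  then show ?case
    using assms finite_subset by blast
next
  case (Suc k)
  let ?S = "{w \<in> words n X. brackets w \<le> k}"
  have "{w \<in> words n X. brackets w \<le> Suc k} \<subseteq>
      Letter ` X \<union> Bracket ` {ws. set ws \<subseteq> ?S \<and> length ws = n}"
  proof
    fix w assume "w \<in> {w \<in> words n X. brackets w \<le> Suc k}"
    then show "w \<in> Letter ` X \<union> Bracket ` {ws. set ws \<subseteq> ?S \<and> length ws = n}"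
    proof (cases w)
      case (Bracket ws)
      assume w: "w \<in> {w \<in> words n X. brackets w \<le> Suc k}"
      have "brackets u \<le> k" if "u \<in> set ws" for u
        using w that member_le_sum_list[of "brackets u" "map brackets ws"] by (auto simp: Bracket)
      then show ?thesis
        using w by (auto simp: Bracket words_Bracket_iff)
    qed (auto simp: words_Letter_iff)
  qed
  moreover have "finite (Letter ` X \<union> Bracket ` {ws. set ws \<subseteq> ?S \<and> length ws = n})"
    using assms Suc finite_lists_length_eq by (intro finite_UnI finite_imageI) auto
  ultimately show ?case
    by (rule finite_subset)
qed

text \<open>For \<open>n = 1\<close> the letters do not determine the number of brackets, so
  \<open>k\<close> is prescribed separately. This keeps the set finite and lets the convention for
  arity 1 be realized by words.\<close>

definition mwords :: "nat \<Rightarrow> nat \<Rightarrow> 'a set \<Rightarrow> 'a word set"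
  where "mwords n k X = {w \<in> words n X. distinct (letters w) \<and> set (letters w) = X \<and> brackets w = k}"

definition mspace :: "nat \<Rightarrow> nat \<Rightarrow> 'a set \<Rightarrow> ('a word \<Rightarrow> complex) set"
  where "mspace n k X = {v. \<forall>w. v w \<noteq> 0 \<longrightarrow> w \<in> mwords n k X}"

lemma finite_mwords: "finite X \<Longrightarrow> finite (mwords n k X)"
  by (rule finite_subset[OF _ finite_words[of X n k]]) (auto simp: mwords_def)

lemma lin_space_mspace: "lin_space (mspace n k X)"
  unfolding lin_space_def mspace_def by (auto, metis add.right_neutral)

lemma mspace_free_space: "finite X \<Longrightarrow> mspace n k X \<subseteq> free_space n X"
  unfolding free_space_def mspace_def
  by (auto intro: finite_subset[OF _ finite_mwords[of X n k]] simp: mwords_def)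

lemma delta_mspace: "w \<in> mwords n k X \<Longrightarrow> delta w \<in> mspace n k X"
  by (simp add: mspace_def delta_def)

lemma mspace_expansion:
  assumes "finite X" "v \<in> mspace n k X"
  shows "v = (\<lambda>u. \<Sum>w\<in>mwords n k X. v w * delta w u)"
proof
  fix u
  have "(\<Sum>w\<in>mwords n k X. v w * delta w u) = (\<Sum>w\<in>mwords n k X. if u = w then v w else 0)"
    by (intro sum.cong) (auto simp: delta_def)
  then show "v u = (\<Sum>w\<in>mwords n k X. v w * delta w u)"
    using assms finite_mwords[of X n k] by (auto simp: mspace_def)
qed

section \<open>Permuting the letters\<close>

lemma functorial_map_word: "functorial map_word"
  by (simp add: functorial_def word.map_id0 word.map_comp fun_eq_iff)

lemma pact_delta: "bij p \<Longrightarrow> pact map_word p (delta w) = delta (map_word p w)"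
  using functorial_cancel[OF functorial_map_word, of p]
  by (auto simp: pact_def delta_def fun_eq_iff)

lemma pact_bracket: "pact map_word p (bracket xs) = bracket (map (pact map_word p) xs)"
proof
  fix w
  show "pact map_word p (bracket xs) w = bracket (map (pact map_word p) xs) w"
    by (cases w) (auto simp: pact_def bracket_Bracket intro!: prod.cong)
qed

lemma pact_free_space:
  assumes p: "p permutes X" and v: "v \<in> free_space n X"
  shows "pact map_word p v \<in> free_space n X"
proof -
  have sub: "{w. pact map_word p v w \<noteq> 0} \<subseteq> map_word p ` {w. v w \<noteq> 0}"
    using functorial_cancel(1)[OF functorial_map_word permutes_bij[OF p]]
    by (auto simp: pact_def intro!: image_eqI[OF sym])
  moreover have "map_word p ` {w. v w \<noteq> 0} \<subseteq> words n X"
    using v permutes_image[OF p] by (auto simp: free_space_def intro: map_word_words)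
  ultimately show ?thesis
    using v finite_subset[OF sub] by (auto simp: free_space_def)
qed

lemma pact_ideal:
  assumes "p permutes X" "v \<in> filippov_ideal n X"
  shows "pact map_word p v \<in> filippov_ideal n X"
  using assms(2)
  by (rule ideal_hom[rotated -1]) (auto simp: pact_linear pact_bracket pact_free_space[OF assms(1)])

lemma symm_ideal:
  assumes "K \<subseteq> X" "v \<in> filippov_ideal n X"
  shows "symm map_word K v \<in> filippov_ideal n X"
  unfolding symm_def using assms
  by (intro lin_space_sum[OF lin_space_ideal] pact_ideal) (auto dest: permutes_subset)

section \<open>Words with two letters of a set in one bracket\<close>

definition is_letter_in :: "'a set \<Rightarrow> 'a word \<Rightarrow> bool"
  where "is_letter_in K w \<longleftrightarrow> (\<exists>a\<in>K. w = Letter a)"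

primrec twin :: "'a set \<Rightarrow> 'a word \<Rightarrow> bool"
  where
    "twin K (Letter x) \<longleftrightarrow> False"
  | "twin K (Bracket ws) \<longleftrightarrow> 2 \<le> length (filter (is_letter_in K) ws) \<or> True \<in> set (map (twin K) ws)"

definition count_in :: "'a set \<Rightarrow> 'a word \<Rightarrow> nat"
  where "count_in K w = length (filter (\<lambda>x. x \<in> K) (letters w))"

lemma count_in_Bracket: "count_in K (Bracket ws) = sum_list (map (count_in K) ws)"
  by (simp add: count_in_def[abs_def] filter_concat length_concat comp_def)

lemma sum_list_indicator: "sum_list (map (\<lambda>x. if P x then 1 else 0) xs) = length (filter P xs)"
  by (induction xs) auto

text \<open>Charge each occurrence of a letter of \<open>K\<close> to the bracket of which it is an
  entry: without twins every bracket is charged at most once. Only a word that is itself such a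
  letter has no bracket to charge.\<close>

lemma count_in_le:
  "\<not> twin K w \<Longrightarrow> count_in K w \<le> brackets w + (if is_letter_in K w then 1 else 0)"
proof (induction w)
  case (Letter x)
  then show ?case
    by (auto simp: count_in_def is_letter_in_def)
next
  case (Bracket ws)
  have "count_in K (Bracket ws) \<le> sum_list (map (\<lambda>w. brackets w + (if is_letter_in K w then 1 else 0)) ws)"
    unfolding count_in_Bracket using Bracket by (intro sum_list_mono) auto
  also have "\<dots> = sum_list (map brackets ws) + length (filter (is_letter_in K) ws)"
    by (simp only: sum_list_addf sum_list_indicator)
  finally show ?case
    using Bracket(2) by simp
qed

lemma sum_list_eq_pointwise:
  fixes f g :: "'a \<Rightarrow> nat"
  assumes "\<And>x. x \<in> set xs \<Longrightarrow> f x \<le> g x" "sum_list (map f xs) = sum_list (map g xs)" "x \<in> set xs"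
  shows "f x = g x"
  using assms
proof (induction xs)
  case (Cons y ys)
  have "f y \<le> g y" "sum_list (map f ys) \<le> sum_list (map g ys)"
    using Cons.prems(1) by (auto intro!: sum_list_mono)
  then have "f y = g y" "sum_list (map f ys) = sum_list (map g ys)"
    using Cons.prems(2) by auto
  then show ?case
    using Cons by auto
qed simp

text \<open>The equality case of \<open>count_in_le\<close>: every bracket is charged exactly once,
  and equality passes to the entries.\<close>

lemma count_in_eq:
  assumes "\<not> twin K (Bracket ws)" "count_in K (Bracket ws) = brackets (Bracket ws)"
  shows "length (filter (is_letter_in K) ws) = 1"
    and "\<And>w. w \<in> set ws \<Longrightarrow> \<not> is_letter_in K w \<Longrightarrow> count_in K w = brackets w"
proof -
  let ?g = "\<lambda>w. brackets w + (if is_letter_in K w then 1 else 0)"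
  have le: "count_in K w \<le> ?g w" if "w \<in> set ws" for w
    using that assms(1) by (intro count_in_le) auto
  have "sum_list (map (count_in K) ws) \<le> sum_list (map ?g ws)"
    by (intro sum_list_mono le)
  moreover have sum: "sum_list (map ?g ws) = sum_list (map brackets ws) + length (filter (is_letter_in K) ws)"
    by (simp only: sum_list_addf sum_list_indicator)
  ultimately show 1: "length (filter (is_letter_in K) ws) = 1"
    using assms by (simp add: count_in_Bracket)
  have "sum_list (map (count_in K) ws) = sum_list (map ?g ws)"
    using assms(2) 1 sum by (simp add: count_in_Bracket)
  then show "count_in K w = brackets w" if "w \<in> set ws" "\<not> is_letter_in K w" for w
    using sum_list_eq_pointwise[of ws "count_in K" ?g w] le that by simp
qed

lemma distinct_concat_disjoint:
  "distinct (concat xss) \<Longrightarrow> i < length xss \<Longrightarrow> j < length xss \<Longrightarrow> i \<noteq> j \<Longrightarrow>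
    set (xss ! i) \<inter> set (xss ! j) = {}"
proof (induction xss arbitrary: i j)
  case (Cons xs xss)
  have "set xs \<inter> set (xss ! j) = {}" if "j < length xss" for j
    using Cons.prems(1) nth_mem[OF that] by auto
  then show ?case
    using Cons by (cases i; cases j) auto
qed simp

lemma two_letters_in_bracket:
  assumes "2 \<le> length (filter P xs)"
  obtains i j where "i < length xs" "j < length xs" "i \<noteq> j" "P (xs ! i)" "P (xs ! j)"
proof -
  have "2 \<le> card {i. i < length xs \<and> P (xs ! i)}"
    using assms by (simp add: length_filter_conv_card)
  then have "\<not> card {i. i < length xs \<and> P (xs ! i)} \<le> Suc 0"
    by simp
  then show thesis
    using that by (subst (asm) card_le_Suc0_iff_eq) auto
qed

text \<open>Transposing two letters that are entries of one bracket swaps these entries, a change of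
  sign modulo the ideal. As the letters of \<open>w\<close> are distinct, nothing else moves; the
  claim that \<open>a\<close> and \<open>b\<close> occur in \<open>w\<close> serves to see this for
  the other entries of an outer bracket.\<close>

lemma twin_transposition:
  assumes "w \<in> words n X" "distinct (letters w)" "twin K w"
  shows "\<exists>a b. a \<noteq> b \<and> a \<in> K \<and> b \<in> K \<and> a \<in> set (letters w) \<and> b \<in> set (letters w) \<and>
    (\<lambda>u. delta w u + delta (map_word (Transposition.transpose a b) w) u) \<in> filippov_ideal n X"
  using assms
proof (induction rule: words.induct)
  case (2 ws)
  let ?\<tau> = "\<lambda>a b. map_word (Transposition.transpose a b)"
  have dist: "distinct (concat (map letters ws))"
    using 2(4) by simp
  have disj: "set (letters (ws ! i)) \<inter> set (letters (ws ! j)) = {}"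
    if "i < n" "j < n" "i \<noteq> j" for i j
    using distinct_concat_disjoint[OF dist, of i j] that 2(1) by simp
  have fixed: "?\<tau> a b (ws ! k) = ws ! k" if "a \<notin> set (letters (ws ! k))" "b \<notin> set (letters (ws ! k))" for a b k
    using that by (intro map_word_ident_letters) (auto simp: transpose_def)
  have delta: "set (map delta ws) \<subseteq> free_space n X" "length (map delta ws) = n"
    using 2(1,2) delta_free_space by auto
  show ?case
  proof (cases "2 \<le> length (filter (is_letter_in K) ws)")
    case True
    then obtain i j where ij: "i < n" "j < n" "i \<noteq> j" "is_letter_in K (ws ! i)" "is_letter_in K (ws ! j)"
      using two_letters_in_bracket 2(1) by metis
    then obtain a b where ab: "a \<in> K" "b \<in> K" "ws ! i = Letter a" "ws ! j = Letter b"
      by (auto simp: is_letter_in_def)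
    have "a \<noteq> b"
      using disj[OF ij(1-3)] ab by auto
    have "map (?\<tau> a b) ws = ws[i := ws ! j, j := ws ! i]"
    proof (rule nth_equalityI)
      fix k assume "k < length (map (?\<tau> a b) ws)"
      then have k: "k < n"
        using 2(1) by simp
      show "map (?\<tau> a b) ws ! k = ws[i := ws ! j, j := ws ! i] ! k"
      proof (cases "k = i \<or> k = j")
        case True
        then show ?thesis
          using k ij ab 2(1) by (auto simp: nth_list_update)
      next
        case False
        have "a \<notin> set (letters (ws ! k))" "b \<notin> set (letters (ws ! k))"
          using disj[of k i] disj[of k j] k ij ab False by auto
        then show ?thesis
          using fixed k False 2(1) by simp
      qed
    qed simp
    then have "delta (?\<tau> a b (Bracket ws)) = bracket ((map delta ws)[i := map delta ws ! j, j := map delta ws ! i])"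
      using ij 2(1) by (simp add: bracket_delta[symmetric] map_update)
    then have "(\<lambda>u. delta (Bracket ws) u + delta (?\<tau> a b (Bracket ws)) u) \<in> filippov_ideal n X"
      using ideal_swap[OF delta(2,1) ij(1-3)] by (simp add: bracket_delta)
    moreover have "a \<in> set (letters (Bracket ws))" "b \<in> set (letters (Bracket ws))"
      using ij ab 2(1) nth_mem[of i ws] nth_mem[of j ws] by force+
    ultimately show ?thesis
      using ab \<open>a \<noteq> b\<close> by blast
  next
    case False
    then obtain w where "w \<in> set ws" "twin K w"
      using 2(5) by auto
    then obtain i where i: "i < n" "twin K (ws ! i)"
      using 2(1) by (metis in_set_conv_nth)
    have "ws ! i \<in> set ws"
      using i 2(1) by simp
    moreover from this have "distinct (letters (ws ! i))"
      using dist by (simp add: distinct_concat_iff)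
    ultimately obtain a b where ab: "a \<noteq> b" "a \<in> K" "b \<in> K"
        "a \<in> set (letters (ws ! i))" "b \<in> set (letters (ws ! i))"
      and I: "(\<lambda>u. delta (ws ! i) u + delta (?\<tau> a b (ws ! i)) u) \<in> filippov_ideal n X"
      using 2(3) i(2) by blast
    have "map (?\<tau> a b) ws = ws[i := ?\<tau> a b (ws ! i)]"
    proof (rule nth_equalityI)
      fix k assume "k < length (map (?\<tau> a b) ws)"
      then have k: "k < n"
        using 2(1) by simp
      show "map (?\<tau> a b) ws ! k = ws[i := ?\<tau> a b (ws ! i)] ! k"
        using disj[of k i] k i ab fixed[of a k b] 2(1) by (cases "k = i") auto
    qed simp
    then have d1: "delta (?\<tau> a b (Bracket ws)) = bracket ((map delta ws)[i := delta (?\<tau> a b (ws ! i))])"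
      by (simp add: bracket_delta[symmetric] map_update)
    have d2: "delta (Bracket ws) = bracket ((map delta ws)[i := delta (ws ! i)])"
      using i 2(1) by (simp add: bracket_delta[symmetric] flip: map_update)
    have "(\<lambda>u. delta (Bracket ws) u + delta (?\<tau> a b (Bracket ws)) u) =
        bracket ((map delta ws)[i := \<lambda>u. delta (ws ! i) u + delta (?\<tau> a b (ws ! i)) u])"
      unfolding d1 d2 using i delta(2) by (intro ext bracket_linear(2)[symmetric]) simp
    then have "(\<lambda>u. delta (Bracket ws) u + delta (?\<tau> a b (Bracket ws)) u) \<in> filippov_ideal n X"
      using filippov_ideal.bracket[OF delta(2,1) i(1) I] by simp
    moreover have "a \<in> set (letters (Bracket ws))" "b \<in> set (letters (Bracket ws))"
      using ab \<open>ws ! i \<in> set ws\<close> by auto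
    ultimately show ?thesis
      using ab by blast
  qed
qed simp

text \<open>Symmetrization does not distinguish \<open>w\<close> from its image under the
  transposition, while the sum of both lies in the ideal; so twice the symmetrization does.\<close>

lemma symm_twin_ideal:
  assumes "w \<in> words n X" "distinct (letters w)" "twin K w" "K \<subseteq> X"
  shows "symm map_word K (delta w) \<in> filippov_ideal n X"
proof -
  obtain a b where ab: "a \<in> K" "b \<in> K"
    and I: "(\<lambda>u. delta w u + delta (map_word (Transposition.transpose a b) w) u) \<in> filippov_ideal n X"
    using twin_transposition[OF assms(1-3)] by blast
  have \<tau>: "Transposition.transpose a b permutes K"
    using ab by (rule permutes_swap_id)
  have "symm map_word K (delta (map_word (Transposition.transpose a b) w)) = symm map_word K (delta w)"
    using symm_pact[OF functorial_map_word \<tau>, of "delta w"] by (simp add: pact_delta permutes_bij[OF \<tau>])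
  then have "(\<lambda>u. symm map_word K (delta w) u + symm map_word K (delta w) u) \<in> filippov_ideal n X"
    using symm_ideal[OF assms(4) I] by (simp add: symm_linear)
  from lin_space_scale[OF lin_space_ideal this, of "1 / 2"] show ?thesis
    by simp
qed

text \<open>If no bracket had two letters of \<open>K\<close> as entries, there would be at most as many of them as brackets.\<close>

lemma symm_mspace_ideal:
  assumes X: "finite X" and K: "K \<subseteq> X" "card K = Suc k" and k: "0 < k" and v: "v \<in> mspace n k X"
  shows "symm map_word K v \<in> filippov_ideal n X"
proof -
  have "symm map_word K (delta w) \<in> filippov_ideal n X" if w: "w \<in> mwords n k X" for w
  proof (rule symm_twin_ideal)
    show "w \<in> words n X" "distinct (letters w)"
      using w by (auto simp: mwords_def)
    have "count_in K w = card (set (filter (\<lambda>x. x \<in> K) (letters w)))"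
      unfolding count_in_def using w by (intro distinct_card[symmetric]) (simp add: mwords_def)
    also have "set (filter (\<lambda>x. x \<in> K) (letters w)) = K"
      using w K by (auto simp: mwords_def)
    finally have "count_in K w = Suc k"
      using K by simp
    \<comment> \<open>A single letter has no bracket, whereas \<open>k\<close> is positive.\<close>
    moreover have "\<not> is_letter_in K w"
      using w k by (auto simp: is_letter_in_def mwords_def)
    ultimately show "twin K w"
      using count_in_le[of K w] w by (auto simp: mwords_def)
  qed (rule K)
  then have "(\<lambda>u. \<Sum>w\<in>mwords n k X. v w * symm map_word K (delta w) u) \<in> filippov_ideal n X"
    by (intro lin_space_lincomb[OF lin_space_ideal])
  then show ?thesis
    by (subst mspace_expansion[OF X v]) (simp add: symm_linear)
qed

section \<open>Words with exactly one letter of a set in every bracket\<close>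

lemma bracket_zero_slot: "i < length xs \<Longrightarrow> xs ! i = (\<lambda>_. 0) \<Longrightarrow> bracket xs w = 0"
  using bracket_linear(1)[of i xs w] by (metis list_update_id)

text \<open>Two entries that are multiples of \<open>x\<close> make the bracket vanish.\<close>

lemma semi_bracket_two_zero_slots:
  assumes "length cs = length us" "i < length us" "j < length us" "i \<noteq> j"
    and "us ! i = (\<lambda>_. 0)" "us ! j = (\<lambda>_. 0)"
  shows "semi_bracket cs us = (\<lambda>_. 0)"
proof -
  obtain c cs' u us' where cons: "cs = c # cs'" "us = u # us'"
    using assms by (cases cs; cases us) auto
  have zero: "bracket us' w = 0 \<and> bracket (us'[l := u]) w = 0" if l: "l < length us'" for l w
  proof (cases "i = 0 \<or> j = 0")
    case True
    then have "u = (\<lambda>_. 0)" "\<exists>k<length us'. us' ! k = (\<lambda>_. 0)"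
      using assms cons by (cases i; cases j; auto)+
    then show ?thesis
      using bracket_zero_slot[of l "us'[l := u]"] l bracket_zero_slot by auto
  next
    case False
    then obtain i' j' where ij: "i' < length us'" "j' < length us'" "i' \<noteq> j'"
        "us' ! i' = (\<lambda>_. 0)" "us' ! j' = (\<lambda>_. 0)"
      using assms cons by (cases i; cases j) auto
    obtain k where "k < length us'" "us' ! k = (\<lambda>_. 0)" "k \<noteq> l"
      using ij by metis
    then show ?thesis
      using bracket_zero_slot[of k "us'[l := u]"] bracket_zero_slot[of k us'] by simp
  qed
  have "0 < length us'"
    using assms cons by auto
  then have "bracket us' w = 0" for w
    using zero by blast
  then show ?thesis
    using zero by (simp add: cons)
qed

lemma x_coeff_delta_Bracket [simp]: "x_coeff K (delta (Bracket ws)) = 0"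
  by (simp add: x_coeff_def delta_def)

lemma x_coeff_delta_Letter: "finite K \<Longrightarrow> x_coeff K (delta (Letter a)) = (if a \<in> K then 1 else 0)"
  by (simp add: x_coeff_def delta_def)

text \<open>Two letters of \<open>K\<close> in one bracket both become \<open>x\<close>. A zero
  entry deeper inside propagates outwards, as it also has no \<open>x\<close>-component.\<close>

lemma contract_word_twin: "twin K w \<Longrightarrow> contract_word K w = (\<lambda>_. 0)"
proof (induction w)
  case (Bracket ws)
  show ?case
  proof (cases "2 \<le> length (filter (is_letter_in K) ws)")
    case True
    then obtain i j where "i < length ws" "j < length ws" "i \<noteq> j" "is_letter_in K (ws ! i)" "is_letter_in K (ws ! j)"
      by (rule two_letters_in_bracket)
    then show ?thesis
      unfolding contract_word.simps
      by (intro semi_bracket_two_zero_slots[of _ _ i j]) (auto simp: is_letter_in_def)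
  next
    case False
    then obtain w where "w \<in> set ws" "twin K w"
      using Bracket.prems by auto
    then obtain i where i: "i < length ws" "twin K (ws ! i)"
      by (metis in_set_conv_nth)
    let ?cs = "map (\<lambda>w. x_coeff K (delta w)) ws" and ?us = "map (contract_word K) ws"
    have "contract_word K (ws ! i) = (\<lambda>_. 0)"
      using Bracket.IH[of "ws ! i"] i by simp
    then have us: "?us[i := \<lambda>_. 0] = ?us"
      using i by (metis length_map list_update_id nth_map)
    have "x_coeff K (delta (ws ! i)) = 0"
      using i(2) by (cases "ws ! i") auto
    then have cs: "?cs[i := 0] = ?cs"
      using i by (metis (mono_tags, lifting) length_map list_update_id nth_map)
    show ?thesis
      using semi_bracket_linear(1)[of ?cs ?us i] i(1) unfolding us cs by auto
  qed
qed simp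

text \<open>The entries are exchanged one at a time, through lists that begin like \<open>ys\<close>
  and end like \<open>xs\<close>.\<close>

lemma ideal_congruence:
  assumes len: "length xs = n" "length ys = n" and free: "set xs \<subseteq> free_space n X" "set ys \<subseteq> free_space n X"
    and eq: "\<And>i. i < n \<Longrightarrow> (\<lambda>w. (xs ! i) w - (ys ! i) w) \<in> filippov_ideal n X"
  shows "(\<lambda>w. bracket xs w - bracket ys w) \<in> filippov_ideal n X"
proof -
  note I = lin_space_ideal[of n X]
  have "(\<lambda>w. bracket xs w - bracket (take j ys @ drop j xs) w) \<in> filippov_ideal n X" if "j \<le> n" for j
    using that
  proof (induction j)
    case 0
    then show ?case
      using lin_space_zero[OF I] by simp
  next
    case (Suc j)
    define L where "L = take j ys @ drop j xs"
    have L: "length L = n" "set L \<subseteq> free_space n X"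
      using len free Suc.prems set_take_subset[of j ys] set_drop_subset[of j xs] by (auto simp: L_def)
    have L1: "L = L[j := xs ! j]"
      using len Suc.prems by (intro nth_equalityI) (auto simp: L_def nth_append nth_list_update)
    have L2: "take (Suc j) ys @ drop (Suc j) xs = L[j := ys ! j]"
      using len Suc.prems
      by (intro nth_equalityI) (auto simp: L_def nth_append nth_list_update min_def less_Suc_eq)
    have "bracket (L[j := \<lambda>w. (xs ! j) w - (ys ! j) w]) \<in> filippov_ideal n X"
      using Suc.prems by (intro filippov_ideal.bracket L eq) auto
    moreover have "bracket (L[j := \<lambda>w. (xs ! j) w - (ys ! j) w]) =
        (\<lambda>w. bracket L w - bracket (take (Suc j) ys @ drop (Suc j) xs) w)"
    proof
      fix w
      have "bracket (L[j := \<lambda>w. (xs ! j) w - (ys ! j) w]) w = bracket (L[j := xs ! j]) w - bracket (L[j := ys ! j]) w"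
        using L Suc.prems by (intro bracket_linear) auto
      then show "bracket (L[j := \<lambda>w. (xs ! j) w - (ys ! j) w]) w =
          bracket L w - bracket (take (Suc j) ys @ drop (Suc j) xs) w"
        using L1 L2 by simp
    qed
    ultimately have "(\<lambda>w. bracket L w - bracket (take (Suc j) ys @ drop (Suc j) xs) w) \<in> filippov_ideal n X"
      by simp
    from lin_space_add[OF I Suc.IH[folded L_def] this] Suc.prems show ?case
      by simp
  qed
  from this[of n] show ?thesis
    using len by simp
qed

lemma bracket_scaled:
  assumes "length us = r"
  shows "bracket (map (\<lambda>j w. e j * f j w) [0..<r]) = (\<lambda>w. (\<Prod>j<r. e j) * bracket (map f [0..<r]) w)"
proof
  fix w
  show "bracket (map (\<lambda>j w. e j * f j w) [0..<r]) w = (\<Prod>j<r. e j) * bracket (map f [0..<r]) w"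
    by (cases w) (auto simp: bracket_Bracket prod.distrib)
qed

text \<open>Moving the letter of \<open>K\<close> to the front costs the same sign in the ideal and in
  \<^const>\<open>semi_bracket\<close>.\<close>

lemma letter_to_front:
  assumes ws: "Bracket ws \<in> words (Suc r) X" and K: "finite K"
    and one: "length (filter (is_letter_in K) ws) = 1"
  obtains a us \<epsilon> where "a \<in> K" "mset ws = add_mset (Letter a) (mset us)" "length us = r" "\<epsilon> * \<epsilon> = (1::complex)"
    "\<And>u. u \<in> set us \<Longrightarrow> \<not> is_letter_in K u"
    "(\<lambda>w. delta (Bracket ws) w - \<epsilon> * delta (Bracket (Letter a # us)) w) \<in> filippov_ideal (Suc r) X"
    "contract_word K (Bracket ws) = (\<lambda>w. \<epsilon> * bracket (map (contract_word K) us) w)"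
proof -
  let ?I = "filippov_ideal (Suc r) X"
  obtain v vs where wsv: "ws = v # vs" "length vs = r"
    using ws by (cases ws) (auto simp: words_Bracket_iff)
  have x: "x_coeff K (delta u) = (if is_letter_in K u then 1 else 0)" for u
    using K by (cases u) (auto simp: is_letter_in_def x_coeff_delta_Letter)
  have sb: "contract_word K (Bracket ws) = (\<lambda>w. (if is_letter_in K v then 1 else 0) * bracket (map (contract_word K) vs) w -
      (\<Sum>i<r. (if is_letter_in K (vs ! i) then 1 else 0) *
        bracket ((map (contract_word K) vs)[i := contract_word K v]) w))"
    using wsv by (simp add: x)
  show thesis
  proof (cases "is_letter_in K v")
    case True
    then obtain a where a: "a \<in> K" "v = Letter a"
      by (auto simp: is_letter_in_def)
    have no: "\<not> is_letter_in K u" if "u \<in> set vs" for u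
      using one True that by (auto simp: wsv filter_empty_conv)
    then have "(\<Sum>i<r. (if is_letter_in K (vs ! i) then 1 else 0) *
        bracket ((map (contract_word K) vs)[i := contract_word K v]) w) = 0" for w
      using wsv by (intro sum.neutral) auto
    then have contr: "contract_word K (Bracket ws) = (\<lambda>w. 1 * bracket (map (contract_word K) vs) w)"
      unfolding sb using True by simp
    show thesis
    proof (rule that[of a vs 1])
      show "(\<lambda>w. delta (Bracket ws) w - 1 * delta (Bracket (Letter a # vs)) w) \<in> ?I"
        using a wsv lin_space_zero[OF lin_space_ideal] by simp
    qed (use a no wsv contr in \<open>simp_all del: contract_word.simps\<close>)
  next
    case False
    then have "length (filter (is_letter_in K) vs) = 1"
      using one wsv by simp
    then obtain j where j: "j < r" "is_letter_in K (vs ! j)"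
      and uniq: "\<And>i. i < r \<Longrightarrow> is_letter_in K (vs ! i) \<Longrightarrow> i = j"
    proof -
      have "card {i. i < r \<and> is_letter_in K (vs ! i)} = 1"
        using \<open>length (filter (is_letter_in K) vs) = 1\<close> wsv by (simp add: length_filter_conv_card)
      then obtain j where "{i. i < r \<and> is_letter_in K (vs ! i)} = {j}"
        by (auto simp: card_1_singleton_iff)
      then show ?thesis
        by (intro that[of j]) auto
    qed
    obtain a where a: "a \<in> K" "vs ! j = Letter a"
      using j by (auto simp: is_letter_in_def)
    \<comment> \<open>The first entry and the letter of \<open>K\<close> in slot \<open>j\<close> of
      the tail change places, which costs one sign.\<close>
    define us where "us = vs[j := v]"
    have us: "length us = r"
      using wsv by (simp add: us_def)
    have no: "\<not> is_letter_in K u" if u_us: "u \<in> set us" for u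
    proof
      assume u: "is_letter_in K u"
      obtain i where i: "i < r" "u = us ! i"
        using u_us us by (metis in_set_conv_nth)
      have "u = (if i = j then v else vs ! i)"
        using i wsv by (simp add: us_def nth_list_update)
      then show False
        using u False uniq[OF i(1)] by (metis (full_types))
    qed
    have "vs ! j \<in># mset vs"
      using j(1) wsv(2) by simp
    then have "add_mset (Letter a) (mset vs - {#Letter a#}) = mset vs"
      unfolding a(2) by (rule insert_DiffM)
    then have "mset ws = add_mset (Letter a) (mset us)"
      using j(1) wsv a(2) by (simp add: us_def mset_update add_mset_commute[of "Letter a" v])
    moreover have "(\<lambda>w. delta (Bracket ws) w - (-1) * delta (Bracket (Letter a # us)) w) \<in> ?I"
    proof -
      let ?ds = "map delta ws"
      have "set ?ds \<subseteq> free_space (Suc r) X" "length ?ds = Suc r"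
        using ws delta_free_space by (auto simp: words_Bracket_iff)
      then have "(\<lambda>w. bracket ?ds w + bracket (?ds[0 := ?ds ! Suc j, Suc j := ?ds ! 0]) w) \<in> ?I"
        using j by (intro ideal_swap) auto
      moreover have "?ds[0 := ?ds ! Suc j, Suc j := ?ds ! 0] = map delta (Letter a # us)"
        using j wsv a by (simp add: us_def map_update)
      ultimately show ?thesis
        by (simp only: bracket_delta) simp
    qed
    moreover have "contract_word K (Bracket ws) = (\<lambda>w. (-1) * bracket (map (contract_word K) us) w)"
    proof
      fix w
      have "(\<Sum>i<r. (if is_letter_in K (vs ! i) then 1 else 0) *
          bracket ((map (contract_word K) vs)[i := contract_word K v]) w) =
        (\<Sum>i<r. if i = j then bracket ((map (contract_word K) vs)[i := contract_word K v]) w else 0)"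
      proof (rule sum.cong)
        show "(if is_letter_in K (vs ! i) then 1 else 0) * b = (if i = j then b else 0)"
          if "i \<in> {..<r}" for i and b :: complex
        proof (cases "i = j")
          case True
          show ?thesis
            using j(2) by (simp add: True)
        next
          case False
          then have "\<not> is_letter_in K (vs ! i)"
            using uniq that by blast
          then show ?thesis
            using False by simp
        qed
      qed simp
      also have "\<dots> = bracket (map (contract_word K) us) w"
        using j(1) by (simp add: us_def map_update)
      finally show "contract_word K (Bracket ws) w = (-1) * bracket (map (contract_word K) us) w"
        unfolding sb using False by simp
    qed
    moreover have "(-1) * (-1) = (1 :: complex)"
      by simp
    ultimately show thesis
      using a(1) us no by (intro that[of a us "-1"])
  qed
qed

text \<open>Every bracket contains exactly one letter of \<open>K\<close> as an entry, by
  \<open>count_in_eq\<close>, and it is moved to the front, recursively. The accumulated sign is the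
  same modulo the ideal and after contraction, which is what allows both to be compared.\<close>

lemma straighten:
  assumes "w \<in> words (Suc r) (Y \<union> K)" "finite K"
    and "\<not> twin K w" "\<not> is_letter_in K w" "count_in K w = brackets w"
  shows "\<exists>\<epsilon> u. \<epsilon> * \<epsilon> = (1::complex) \<and> u \<in> normal r K Y \<and> mset (letters u) = mset (letters w) \<and>
    (\<lambda>v. delta w v - \<epsilon> * delta u v) \<in> filippov_ideal (Suc r) (Y \<union> K) \<and>
    contract_word K w = (\<lambda>v. \<epsilon> * delta (strip u) v)"
  using assms(1,3-)
proof (induction w rule: word.induct)
  case (Letter x)
  then have "x \<in> Y" "x \<notin> K"
    by (auto simp: words_Letter_iff is_letter_in_def)
  then show ?case
    using lin_space_zero[OF lin_space_ideal]
    by (intro exI[of _ 1] exI[of _ "Letter x"]) (auto intro: normal.intros)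
next
  case (Bracket ws)
  let ?X = "Y \<union> K"
  let ?I = "filippov_ideal (Suc r) ?X"
  note I = lin_space_ideal[of "Suc r" ?X]
  note count = count_in_eq[OF Bracket.prems(2,4)]
  obtain a us \<epsilon> where a: "a \<in> K" and ms: "mset ws = add_mset (Letter a) (mset us)"
    and us: "length us = r" and \<epsilon>: "\<epsilon> * \<epsilon> = (1::complex)"
    and no: "\<And>u. u \<in> set us \<Longrightarrow> \<not> is_letter_in K u"
    and front: "(\<lambda>w. delta (Bracket ws) w - \<epsilon> * delta (Bracket (Letter a # us)) w) \<in> ?I"
    and contr: "contract_word K (Bracket ws) = (\<lambda>w. \<epsilon> * bracket (map (contract_word K) us) w)"
    using letter_to_front[OF Bracket.prems(1) assms(2) count(1)] by blast
  have sub: "set us \<subseteq> set ws"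
    using ms by (metis set_mset_add_mset_insert set_mset_mset subset_insertI)
  have "\<exists>\<epsilon> u. \<epsilon> * \<epsilon> = (1::complex) \<and> u \<in> normal r K Y \<and> mset (letters u) = mset (letters (us ! j)) \<and>
    (\<lambda>v. delta (us ! j) v - \<epsilon> * delta u v) \<in> ?I \<and>
    contract_word K (us ! j) = (\<lambda>v. \<epsilon> * delta (strip u) v)" if "j < r" for j
  proof -
    have j: "us ! j \<in> set us" "us ! j \<in> set ws"
      using that us sub by auto
    show ?thesis
      using Bracket.prems(1,2) j no[OF j(1)] count(2)[OF j(2)]
      by (intro Bracket.IH) (auto simp: words_Bracket_iff)
  qed
  then have "\<forall>j\<in>{..<r}. \<exists>e u. e * e = (1::complex) \<and> u \<in> normal r K Y \<and>
      mset (letters u) = mset (letters (us ! j)) \<and>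
      (\<lambda>v. delta (us ! j) v - e * delta u v) \<in> ?I \<and>
      contract_word K (us ! j) = (\<lambda>v. e * delta (strip u) v)"
    by blast
  from bchoice[OF this] obtain e where "\<forall>j\<in>{..<r}. \<exists>u. e j * e j = (1::complex) \<and> u \<in> normal r K Y \<and>
      mset (letters u) = mset (letters (us ! j)) \<and>
      (\<lambda>v. delta (us ! j) v - e j * delta u v) \<in> ?I \<and>
      contract_word K (us ! j) = (\<lambda>v. e j * delta (strip u) v)" ..
  from bchoice[OF this] obtain u where "\<forall>j\<in>{..<r}. e j * e j = (1::complex) \<and> u j \<in> normal r K Y \<and>
      mset (letters (u j)) = mset (letters (us ! j)) \<and>
      (\<lambda>v. delta (us ! j) v - e j * delta (u j) v) \<in> ?I \<and>
      contract_word K (us ! j) = (\<lambda>v. e j * delta (strip (u j)) v)" ..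
  then have eu: "\<And>j. j < r \<Longrightarrow> e j * e j = (1::complex) \<and> u j \<in> normal r K Y \<and>
      mset (letters (u j)) = mset (letters (us ! j)) \<and>
      (\<lambda>v. delta (us ! j) v - e j * delta (u j) v) \<in> ?I \<and>
      contract_word K (us ! j) = (\<lambda>v. e j * delta (strip (u j)) v)"
    by blast
  define us' where "us' = map u [0..<r]"
  \<comment> \<open>By multilinearity, the signs of the entries multiply.\<close>
  define E where "E = (\<Prod>j<r. e j)"
  have E: "E * E = 1"
    unfolding E_def prod.distrib[symmetric] using eu by simp
  have normal: "Bracket (Letter a # us') \<in> normal r K Y"
    using a eu by (auto simp: normal_Bracket_iff us'_def)
  have "mset (letters (Bracket (Letter a # us'))) = mset (letters (Bracket ws))"
  proof -
    have "map (mset \<circ> letters) us' = map (mset \<circ> letters) us"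
      using eu us by (intro nth_equalityI) (auto simp: us'_def)
    then have "mset (concat (map letters us')) = mset (concat (map letters us))"
      by (simp add: mset_concat comp_def)
    moreover have "mset (concat (map letters ws)) = mset (letters (Letter a)) + mset (concat (map letters us))"
    proof -
      have "mset (concat (map letters xs)) = \<Sum>\<^sub># (image_mset (mset \<circ> letters) (mset xs))" for xs :: "'a word list"
        by (simp add: mset_concat comp_def flip: sum_mset_sum_list)
      then show ?thesis
        by (simp add: ms)
    qed
    ultimately show ?thesis
      by simp
  qed
  moreover have "(\<lambda>w. delta (Bracket ws) w - (\<epsilon> * E) * delta (Bracket (Letter a # us')) w) \<in> ?I"
  proof -
    let ?xs = "delta (Letter a) # map delta us"
    let ?ys = "delta (Letter a) # map (\<lambda>j v. e j * delta (u j) v) [0..<r]"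
    have free: "delta (us ! j) \<in> free_space (Suc r) ?X" "delta (u j) \<in> free_space (Suc r) ?X" if "j < r" for j
    proof -
      have "us ! j \<in> set ws"
        using that sub us nth_mem by blast
      then have "us ! j \<in> words (Suc r) ?X"
        using Bracket.prems(1) by (auto simp: words_Bracket_iff)
      then show "delta (us ! j) \<in> free_space (Suc r) ?X"
        by (rule delta_free_space)
      have "u j \<in> words (Suc r) ?X"
        using eu[OF that] normal_words by (metis sup_commute)
      then show "delta (u j) \<in> free_space (Suc r) ?X"
        by (rule delta_free_space)
    qed
    have a_free: "delta (Letter a) \<in> free_space (Suc r) ?X"
      using a by (intro delta_free_space words.intros) auto
    have "(\<lambda>w. bracket ?xs w - bracket ?ys w) \<in> ?I"
    proof (rule ideal_congruence)
      show "set ?xs \<subseteq> free_space (Suc r) ?X"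
      proof -
        have "delta z \<in> free_space (Suc r) ?X" if "z \<in> set us" for z
          using that free(1) us by (metis in_set_conv_nth)
        then show ?thesis
          using a_free by auto
      qed
      show "set ?ys \<subseteq> free_space (Suc r) ?X"
      proof -
        have "(\<lambda>v. e j * delta (u j) v) \<in> free_space (Suc r) ?X" if "j < r" for j
          by (rule lin_space_scale[OF lin_space_free_space free(2)[OF that]])
        then show ?thesis
          using a_free by auto
      qed
      show "(\<lambda>w. (?xs ! i) w - (?ys ! i) w) \<in> ?I" if "i < Suc r" for i
        using that eu us lin_space_zero[OF I] by (cases i) auto
    qed (use us in auto)
    moreover have "bracket ?xs = delta (Bracket (Letter a # us))"
      by (simp add: bracket_delta[symmetric])
    moreover have "bracket ?ys = (\<lambda>w. E * delta (Bracket (Letter a # us')) w)"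
    proof
      fix w
      show "bracket ?ys w = E * delta (Bracket (Letter a # us')) w"
        unfolding bracket_delta[symmetric] us'_def E_def
        by (cases w) (auto simp: bracket_Bracket prod.lessThan_Suc_shift prod.distrib simp del: prod.lessThan_Suc)
    qed
    ultimately have "(\<lambda>w. \<epsilon> * (delta (Bracket (Letter a # us)) w - E * delta (Bracket (Letter a # us')) w)) \<in> ?I"
      using lin_space_scale[OF I] by metis
    from lin_space_add[OF I front this] show ?thesis
      by (simp add: algebra_simps)
  qed
  moreover have "contract_word K (Bracket ws) = (\<lambda>w. (\<epsilon> * E) * delta (strip (Bracket (Letter a # us'))) w)"
  proof -
    have "map (contract_word K) us = map (\<lambda>j v. e j * delta (strip (u j)) v) [0..<r]"
      using us eu by (intro nth_equalityI) auto
    then have "bracket (map (contract_word K) us) =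
        (\<lambda>w. E * bracket (map (\<lambda>j. delta (strip (u j))) [0..<r]) w)"
      using bracket_scaled[OF us, of e "\<lambda>j. delta (strip (u j))"] by (simp add: E_def)
    moreover have "bracket (map (\<lambda>j. delta (strip (u j))) [0..<r]) = delta (Bracket (map strip us'))"
      by (simp add: bracket_delta[symmetric] us'_def comp_def)
    ultimately show ?thesis
      unfolding contr by (simp add: mult.assoc)
  qed
  moreover have "(\<epsilon> * E) * (\<epsilon> * E) = 1"
    using \<epsilon> E by (metis mult.left_commute mult.assoc mult_1)
  ultimately show ?case
    using normal by blast
qed

lemma letters_normal:
  assumes "u \<in> normal r K Y" "Y \<inter> K = {}"
  shows "letters (strip u) = filter (\<lambda>x. x \<notin> K) (letters u)" "brackets (strip u) = brackets u"
  using assms(1)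
proof (induction rule: normal.induct)
  case (Bracket a us)
  {
    case 1
    show ?case
      using Bracket by (auto simp: filter_concat comp_def intro!: arg_cong[of _ _ concat])
  next
    case 2
    show ?case
      using Bracket by (auto simp: comp_def intro!: arg_cong[of _ _ sum_list])
  }
qed (use assms(2) in auto)

text \<open>In a normal bracket only the first entry has an \<open>x\<close>-component, so just the
  leading term of \<open>semi_bracket\<close> survives, with coefficient 1.\<close>

lemma contract_word_normal:
  assumes K: "finite K" and Y: "Y \<inter> K = {}"
  shows "u \<in> normal r K Y \<Longrightarrow> contract_word K u = delta (strip u)"
proof (induction rule: normal.induct)
  case (Letter y)
  then show ?case
    using Y by auto
next
  case (Bracket a us)
  have "x_coeff K (delta u) = 0" if "u \<in> set us" for u
    using Bracket(3)[OF that] that K Y by (cases rule: normal.cases) (auto simp: x_coeff_delta_Letter)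
  then have "contract_word K (Bracket (Letter a # us)) = bracket (map (contract_word K) us)"
    using Bracket(1,2) by (simp add: x_coeff_delta_Letter[OF K])
  also have "map (contract_word K) us = map delta (map strip us)"
    using Bracket(4) by simp
  also have "bracket (map delta (map strip us)) = delta (strip (Bracket (Letter a # us)))"
    unfolding bracket_delta by simp
  finally show ?case .
qed

text \<open>\<open>expand\<close> may use a letter of \<open>K\<close> several times. In a word with
  \<open>k\<close> brackets and for \<open>k\<close> letters in \<open>K\<close>, asking that all of
  \<open>K\<close> occur leaves the labellings that use each letter once.\<close>

definition lift :: "nat \<Rightarrow> 'a set \<Rightarrow> 'a set \<Rightarrow> ('a word \<Rightarrow> complex) \<Rightarrow> 'a word \<Rightarrow> complex"
  where "lift r K Y v = (\<lambda>u. if K \<subseteq> set (letters u) then expand r K Y v u else 0)"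

lemma lift_linear:
  "lift r K Y (\<lambda>_. 0) = (\<lambda>_. 0)"
  "lift r K Y (\<lambda>w. c * u w) = (\<lambda>w. c * lift r K Y u w)"
  "lift r K Y (\<lambda>w. \<Sum>i\<in>I. f i w) = (\<lambda>w. \<Sum>i\<in>I. lift r K Y (f i) w)"
  by (auto simp: lift_def expand_linear)

lemma lift_ideal:
  "finite K \<Longrightarrow> 0 < r \<Longrightarrow> v \<in> filippov_ideal r Y \<Longrightarrow> lift r K Y v \<in> filippov_ideal (Suc r) (Y \<union> K)"
  unfolding lift_def by (intro covering_ideal expand_ideal)

lemma normal_map_word:
  assumes p: "\<And>y. y \<in> Y \<Longrightarrow> p y = y" "\<And>a. a \<in> K \<Longrightarrow> p a \<in> K" and "u \<in> normal r K Y"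
  shows "map_word p u \<in> normal r K Y" "strip (map_word p u) = strip u"
  using assms(3)
proof (induction rule: normal.induct)
  case (Bracket a us)
  {
    case 1
    show ?case
      using Bracket p by (auto simp: normal_Bracket_iff)
  next
    case 2
    show ?case
      using Bracket by simp
  }
qed (use p in \<open>auto simp: normal_Letter_iff\<close>)

lemma normal_rel_word:
  assumes "u \<in> normal r K Y" "v \<in> normal r K Y" "strip u = strip v"
  shows "rel_word (\<lambda>x y. (x = y \<and> x \<in> Y) \<or> (x \<in> K \<and> y \<in> K)) u v"
  using assms
proof (induction arbitrary: v rule: normal.induct)
  case (Letter y)
  then have "v = Letter y"
    by (cases v) auto
  then show ?case
    using Letter by simp
next
  case (Bracket a us)
  then obtain b vs where v: "v = Bracket (Letter b # vs)" "b \<in> K" "set vs \<subseteq> normal r K Y" "map strip us = map strip vs"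
    by (cases v) (auto simp: normal_Bracket_iff)
  then have len: "length us = length vs"
    by (metis length_map)
  have st: "strip (us ! i) = strip (vs ! i)" if "i < length us" for i
    using v(4) len that by (metis nth_map)
  have "rel_word (\<lambda>x y. (x = y \<and> x \<in> Y) \<or> (x \<in> K \<and> y \<in> K)) (us ! i) (vs ! i)" if "i < length us" for i
  proof (rule Bracket.IH[OF nth_mem[OF that]])
    show "vs ! i \<in> normal r K Y"
      using v(3) len that nth_mem by fastforce
  qed (use st that in auto)
  then have "list_all2 (rel_word (\<lambda>x y. (x = y \<and> x \<in> Y) \<or> (x \<in> K \<and> y \<in> K))) us vs"
    using len by (simp add: list_all2_conv_all_nth)
  then show ?case
    using Bracket.hyps v by simp
qed

text \<open>Normal words with the same stripping have the same shape and agree except for their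
  labels from \<open>K\<close>; the permutation is read off from corresponding labels.\<close>

lemma normal_orbit:
  assumes u: "u \<in> normal r K Y" "distinct (letters u)" and v: "v \<in> normal r K Y" "K \<subseteq> set (letters v)"
    and eq: "strip u = strip v" and K: "finite K" "Y \<inter> K = {}"
  obtains p where "p permutes K" "map_word p u = v"
proof -
  let ?R = "\<lambda>x y. (x = y \<and> x \<in> Y) \<or> (x \<in> K \<and> y \<in> K)"
  \<comment> \<open>\<open>z\<close> carries pairs of corresponding labels. Since the letters of
    \<open>u\<close> are distinct, the pairs form the graph of a function \<open>f\<close>.\<close>
  obtain z where z: "set_word z \<subseteq> {(x, y). ?R x y}" "map_word fst z = u" "map_word snd z = v"
    using normal_rel_word[OF u(1) v(1) eq] unfolding word.in_rel by auto
  have dist: "distinct (map fst (letters z))"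
    using u(2) z(2) by (auto simp: letters_map_word)
  define f where "f x = (SOME y. (x, y) \<in> set (letters z))" for x
  have f: "f x = y" if "(x, y) \<in> set (letters z)" for x y
  proof -
    have "(x, f x) \<in> set (letters z)"
      unfolding f_def using that by (rule someI)
    then show ?thesis
      using dist that by (metis eq_key_imp_eq_value)
  qed
  have R: "?R x (f x)" if x: "x \<in> set (letters u)" for x
  proof -
    obtain y where "(x, y) \<in> set (letters z)"
      using x z(2) by (force simp: letters_map_word)
    then show ?thesis
      using f z(1) by (auto simp: set_word_letters)
  qed
  have "map_word f u = v"
  proof -
    have "map_word (f \<circ> fst) z = map_word snd z"
      using f by (intro map_word_cong_letters) auto
    then show ?thesis
      using z(2,3) by (simp add: word.map_comp flip: z(2))
  qed
  then have lv: "letters v = map f (letters u)"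
    by (auto simp: letters_map_word)
  define p where "p x = (if x \<in> K then f x else x)" for x
  \<comment> \<open>Letters of \<open>Y\<close> are kept by \<open>f\<close>, so those of
    \<open>K\<close> in \<open>v\<close> can only come from letters of \<open>K\<close> in
    \<open>u\<close>. By finiteness \<open>u\<close> contains all of \<open>K\<close> and
    \<open>f\<close> permutes it.\<close>
  have fK: "K \<subseteq> f ` (K \<inter> set (letters u))"
  proof
    fix b assume b: "b \<in> K"
    then obtain x where x: "x \<in> set (letters u)" "f x = b"
      using v(2) lv by auto
    then have "x \<in> K"
      using R[OF x(1)] b K(2) by auto
    then show "b \<in> f ` (K \<inter> set (letters u))"
      using x by blast
  qed
  have card: "card K \<le> card (K \<inter> set (letters u))"
    using K(1) by (intro order_trans[OF card_mono[OF _ fK] card_image_le]) auto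
  then have Ku: "K \<inter> set (letters u) = K"
    using K(1) by (intro card_seteq) auto
  have sub: "f ` K \<subseteq> K"
    using R Ku K(2) by blast
  then have "f ` K = K"
    using fK Ku by auto
  then have "bij_betw f K K"
    using K(1) by (simp add: bij_betw_def eq_card_imp_inj_on)
  then have "bij_betw p K K"
    by (rule bij_betw_cong[THEN iffD1, rotated]) (simp add: p_def)
  then have "p permutes K"
    by (rule bij_imp_permutes) (simp add: p_def)
  moreover have "map_word p u = map_word f u"
  proof (rule map_word_cong_letters)
    fix x assume "x \<in> set (letters u)"
    then show "p x = f x"
      using R[of x] K(2) by (auto simp: p_def)
  qed
  ultimately show thesis
    using that \<open>map_word f u = v\<close> by simp
qed

text \<open>Both sides are the indicator function of the orbit of \<open>u\<close>. The orbit is the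
  set of all labellings by \<open>normal_orbit\<close>, and different permutations give different
  words because every letter of \<open>K\<close> occurs in \<open>u\<close>.\<close>

lemma lift_delta_strip:
  fixes K Y :: "nat set"
  assumes u: "u \<in> normal r K Y" "distinct (letters u)" "K \<subseteq> set (letters u)" and K: "finite K" "Y \<inter> K = {}"
  shows "lift r K Y (delta (strip u)) = symm map_word K (delta u)"
proof
  fix v
  have perm: "map_word p u \<in> normal r K Y" "strip (map_word p u) = strip u" "K \<subseteq> set (letters (map_word p u))"
    if p: "p permutes K" for p
  proof -
    have "p y = y" if "y \<in> Y" for y
      using p K(2) that by (metis disjoint_iff permutes_not_in)
    then show "map_word p u \<in> normal r K Y" "strip (map_word p u) = strip u"
      using normal_map_word[OF _ _ u(1), of p] permutes_in_image[OF p] by auto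
    have "p ` K \<subseteq> p ` set (letters u)"
      using u(3) by (rule image_mono)
    then show "K \<subseteq> set (letters (map_word p u))"
      by (simp add: letters_map_word permutes_image[OF p])
  qed
  have inj: "p = q" if "p permutes K" "q permutes K" "map_word p u = map_word q u" for p q
  proof
    fix x
    have "map p (letters u) = map q (letters u)"
      using that(3) by (metis letters_map_word)
    then have "\<forall>x\<in>set (letters u). p x = q x"
      by simp
    then show "p x = q x"
      using u(3) permutes_not_in[OF that(1)] permutes_not_in[OF that(2)] by (cases "x \<in> K") auto
  qed
  have "symm map_word K (delta u) v = (\<Sum>p | p permutes K. delta (map_word p u) v)"
    unfolding symm_def by (intro sum.cong) (auto simp: pact_delta permutes_bij)
  also have "\<dots> = (if \<exists>p. p permutes K \<and> map_word p u = v then 1 else 0)"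
  proof (cases "\<exists>p. p permutes K \<and> map_word p u = v")
    case True
    then obtain p where p: "p permutes K" "map_word p u = v"
      by blast
    then have "(\<Sum>q | q permutes K. delta (map_word q u) v) = (\<Sum>q | q permutes K. if q = p then 1 else 0)"
      using inj by (intro sum.cong) (auto simp: delta_def)
    then show ?thesis
      using p finite_permutations[OF K(1)] by auto
  qed (auto simp: delta_def intro!: sum.neutral)
  also have "\<dots> = lift r K Y (delta (strip u)) v"
  proof (cases "\<exists>p. p permutes K \<and> map_word p u = v")
    case True
    then show ?thesis
      using perm by (auto simp: lift_def expand_def delta_def)
  next
    case False
    have "\<not> (v \<in> normal r K Y \<and> K \<subseteq> set (letters v) \<and> strip v = strip u)"
    proof
      assume "v \<in> normal r K Y \<and> K \<subseteq> set (letters v) \<and> strip v = strip u"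
      then show False
        using normal_orbit[OF u(1,2), of v] K False by metis
    qed
    then show ?thesis
      using False by (auto simp: lift_def expand_def delta_def)
  qed
  finally show "lift r K Y (delta (strip u)) v = symm map_word K (delta u) v" ..
qed

text \<open>The labels are used up in reading order: the outermost bracket takes the first, and each
  entry as many of the rest as it has brackets.\<close>

lemma labelling_exists:
  assumes "w \<in> words r Y" "length as = brackets w" "set as \<subseteq> K" "Y \<inter> K = {}"
  shows "\<exists>u\<in>normal r K Y. strip u = w \<and> filter (\<lambda>x. x \<in> K) (letters u) = as"
  using assms(1-3)
proof (induction w arbitrary: as rule: word.induct)
  case (Letter x)
  then show ?case
    using assms(4) by (intro bexI[of _ "Letter x"]) (auto simp: words_Letter_iff normal_Letter_iff)
next
  case (Bracket ws)
  then obtain a bs where as: "as = a # bs" "length bs = sum_list (map brackets ws)"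
    by (cases as) auto
  have "\<exists>us. set us \<subseteq> normal r K Y \<and> map strip us = ws' \<and> concat (map (\<lambda>u. filter (\<lambda>x. x \<in> K) (letters u)) us) = bs'"
    if "set ws' \<subseteq> set ws" "length bs' = sum_list (map brackets ws')" "set bs' \<subseteq> K" for ws' bs'
    using that
  proof (induction ws' arbitrary: bs')
    case Nil
    then show ?case
      by simp
  next
    case (Cons w ws')
    have w: "w \<in> set ws" "w \<in> words r Y"
      using Cons.prems(1) Bracket.prems(1) by (auto simp: words_Bracket_iff)
    let ?b = "take (brackets w) bs'" and ?c = "drop (brackets w) bs'"
    have "length ?b = brackets w" "set ?b \<subseteq> K"
      using Cons.prems by (auto dest: in_set_takeD)
    then obtain u where u: "u \<in> normal r K Y" "strip u = w" "filter (\<lambda>x. x \<in> K) (letters u) = ?b"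
      using Bracket.IH[OF w] by blast
    have "length ?c = sum_list (map brackets ws')" "set ?c \<subseteq> K"
      using Cons.prems by (auto dest: in_set_dropD)
    then obtain us where "set us \<subseteq> normal r K Y" "map strip us = ws'"
      "concat (map (\<lambda>u. filter (\<lambda>x. x \<in> K) (letters u)) us) = ?c"
      using Cons.IH[OF set_subset_Cons[THEN order_trans, OF Cons.prems(1)]] by blast
    then show ?case
      using u by (intro exI[of _ "u # us"]) (simp only: list.map concat.simps list.set insert_subset append_take_drop_id simp_thms)
  qed
  from this[of ws bs] obtain us where us: "set us \<subseteq> normal r K Y" "map strip us = ws"
    "concat (map (\<lambda>u. filter (\<lambda>x. x \<in> K) (letters u)) us) = bs"
    using as Bracket.prems(3) by auto
  have "length us = r"
    using us(2) Bracket.prems(1) by (metis length_map words_Bracket_iff)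
  then show ?case
    using us as Bracket.prems(3)
    by (intro bexI[of _ "Bracket (Letter a # us)"]) (auto simp: normal_Bracket_iff filter_concat comp_def)
qed

section \<open>Multilinear parts of contraction and lifting\<close>

lemma mwords_map_word: "p permutes X \<Longrightarrow> w \<in> mwords n k X \<Longrightarrow> map_word p w \<in> mwords n k X"
  using map_word_words[of w n X p X]
  by (simp add: mwords_def letters_map_word brackets_map_word distinct_map permutes_image permutes_inj_on)

lemma symm_delta: "symm map_word K (delta w) = (\<lambda>u. \<Sum>p | p permutes K. delta (map_word p w) u)"
  unfolding symm_def by (intro ext sum.cong) (auto simp: pact_delta permutes_bij)

lemma contract_lincomb:
  assumes "\<And>i. i \<in> I \<Longrightarrow> f i \<in> free_space n X"
  shows "contract K (\<lambda>u. \<Sum>i\<in>I. c i * f i u) = (\<lambda>u. \<Sum>i\<in>I. c i * contract K (f i) u)"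
proof -
  have "contract K (\<lambda>u. \<Sum>i\<in>I. c i * f i u) = (\<lambda>u. \<Sum>i\<in>I. contract K (\<lambda>u. c i * f i u) u)"
    using assms lin_space_scale[OF lin_space_free_space] by (intro contract_sum) blast
  also have "\<dots> = (\<lambda>u. \<Sum>i\<in>I. c i * contract K (f i) u)"
    by (intro ext sum.cong refl) (simp add: contract_scale[OF assms])
  finally show ?thesis .
qed

lemma strip_mwords:
  assumes u: "u \<in> normal r K Y" "u \<in> mwords n k (Y \<union> K)" and Y: "Y \<inter> K = {}"
  shows "strip u \<in> mwords r k Y"
  using strip_words[OF u(1)] letters_normal[OF u(1) Y] u(2) Y by (auto simp: mwords_def)

text \<open>Multilinearity survives straightening since the multiset of letters does; for positive
  \<open>r\<close> the number of brackets is recovered from the number of letters.\<close>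

lemma straighten_mwords:
  assumes w: "w \<in> mwords (Suc r) k (Y \<union> K)" and K: "finite K" "card K = k" and twin: "\<not> twin K w"
    and r: "0 < r"
  obtains \<epsilon> u where "u \<in> normal r K Y" "u \<in> mwords (Suc r) k (Y \<union> K)"
    "(\<lambda>v. delta w v - \<epsilon> * delta u v) \<in> filippov_ideal (Suc r) (Y \<union> K)"
    "contract_word K w = (\<lambda>v. \<epsilon> * delta (strip u) v)"
proof -
  have ww: "w \<in> words (Suc r) (Y \<union> K)" "distinct (letters w)" "set (letters w) = Y \<union> K" "brackets w = k"
    using w by (auto simp: mwords_def)
  have "\<not> is_letter_in K w"
    using ww(4) K by (auto simp: is_letter_in_def)
  moreover have "count_in K w = card (set (filter (\<lambda>x. x \<in> K) (letters w)))"
    unfolding count_in_def using ww(2) by (intro distinct_card[symmetric]) simp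
  moreover have "set (filter (\<lambda>x. x \<in> K) (letters w)) = K"
    using ww(3) by auto
  ultimately obtain \<epsilon> u where u: "u \<in> normal r K Y" "mset (letters u) = mset (letters w)"
    and "(\<lambda>v. delta w v - \<epsilon> * delta u v) \<in> filippov_ideal (Suc r) (Y \<union> K)"
      "contract_word K w = (\<lambda>v. \<epsilon> * delta (strip u) v)"
    using straighten[OF ww(1) K(1) twin] ww(4) K(2) by auto
  moreover have "u \<in> mwords (Suc r) k (Y \<union> K)"
  proof -
    have "u \<in> words (Suc r) (Y \<union> K)"
      using u(1) by (rule normal_words)
    moreover from this have "brackets u * r + 1 = brackets w * r + 1"
      using length_letters ww(1) u(2) by (metis size_mset)
    ultimately show ?thesis
      using u(2) ww r mset_eq_setD[OF u(2)] mset_eq_imp_distinct_iff[OF u(2)] by (simp add: mwords_def)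
  qed
  ultimately show thesis
    using that by blast
qed

lemma contract_word_mspace:
  assumes w: "w \<in> mwords (Suc r) k (Y \<union> K)" and K: "finite K" "card K = k" "Y \<inter> K = {}" and r: "0 < r"
  shows "contract_word K w \<in> mspace r k Y"
proof (cases "twin K w")
  case True
  then show ?thesis
    using lin_space_zero[OF lin_space_mspace] by (simp add: contract_word_twin)
next
  case False
  then show ?thesis
    using straighten_mwords[OF w K(1,2) False r] strip_mwords K(3) lin_space_scale[OF lin_space_mspace]
      delta_mspace by metis
qed

text \<open>If some bracket has two letters of \<open>K\<close>, the symmetrization is in the ideal
  and the contraction is zero. Otherwise straighten \<open>w\<close> to a normal word with a sign,
  which enters both sides alike, and use \<open>lift_delta_strip\<close>.\<close>

lemma symm_delta_lift:
  fixes K Y :: "nat set"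
  assumes w: "w \<in> mwords (Suc r) k (Y \<union> K)" and K: "finite K" "card K = k" "Y \<inter> K = {}" and r: "0 < r"
  shows "(\<lambda>u. symm map_word K (delta w) u - lift r K Y (contract_word K w) u) \<in> filippov_ideal (Suc r) (Y \<union> K)"
proof (cases "twin K w")
  case True
  then show ?thesis
    using symm_twin_ideal[of w "Suc r" "Y \<union> K" K] w by (simp add: contract_word_twin lift_linear mwords_def)
next
  case False
  then obtain \<epsilon> u where u: "u \<in> normal r K Y" "u \<in> mwords (Suc r) k (Y \<union> K)"
    and I: "(\<lambda>v. delta w v - \<epsilon> * delta u v) \<in> filippov_ideal (Suc r) (Y \<union> K)"
    and c: "contract_word K w = (\<lambda>v. \<epsilon> * delta (strip u) v)"
    using straighten_mwords[OF w K(1,2) _ r] by blast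
  have "lift r K Y (delta (strip u)) = symm map_word K (delta u)"
    using u(2) by (intro lift_delta_strip u K) (auto simp: mwords_def)
  then have "lift r K Y (contract_word K w) = (\<lambda>v. \<epsilon> * symm map_word K (delta u) v)"
    by (simp add: c lift_linear)
  then show ?thesis
    using symm_ideal[OF _ I, of K] by (simp add: symm_linear)
qed

lemma distinct_filter_partition:
  "distinct (filter P xs) \<Longrightarrow> distinct (filter (\<lambda>x. \<not> P x) xs) \<Longrightarrow> distinct xs"
  by (induction xs) (auto split: if_splits)

text \<open>Any one labelling of \<open>w\<close> generates the lift by symmetrization; the labels
  are taken in increasing order.\<close>

lemma lift_delta:
  fixes K Y :: "nat set"
  assumes w: "w \<in> mwords r k Y" and K: "finite K" "card K = k" "Y \<inter> K = {}"
  obtains u where "u \<in> normal r K Y" "u \<in> mwords (Suc r) k (Y \<union> K)" "strip u = w"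
    "lift r K Y (delta w) = symm map_word K (delta u)"
proof -
  have ww: "w \<in> words r Y" "distinct (letters w)" "set (letters w) = Y" "brackets w = k"
    using w by (auto simp: mwords_def)
  obtain u where u: "u \<in> normal r K Y" "strip u = w" "filter (\<lambda>x. x \<in> K) (letters u) = sorted_list_of_set K"
    using labelling_exists[OF ww(1), of "sorted_list_of_set K" K] K ww(4) by (metis length_sorted_list_of_set order_refl set_sorted_list_of_set)
  have l: "filter (\<lambda>x. x \<notin> K) (letters u) = letters w" "brackets u = k"
    using letters_normal[OF u(1) K(3)] u(2) ww(4) by auto
  have "distinct (filter (\<lambda>x. x \<in> K) (letters u))"
    unfolding u(3) by simp
  then have "distinct (letters u)"
    using distinct_filter_partition[of "\<lambda>x. x \<in> K" "letters u"] l(1) ww(2) by simp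
  moreover have "set (letters u) = Y \<union> K"
  proof -
    have "set (letters u) = set (filter (\<lambda>x. x \<in> K) (letters u)) \<union> set (filter (\<lambda>x. x \<notin> K) (letters u))"
      by auto
    then show ?thesis
      unfolding u(3) l(1) using K(1) ww(3) by auto
  qed
  ultimately have "u \<in> mwords (Suc r) k (Y \<union> K)" "lift r K Y (delta w) = symm map_word K (delta u)"
    using u normal_words[OF u(1)] l(2) lift_delta_strip[OF u(1) _ _ K(1,3)] by (auto simp: mwords_def)
  then show thesis
    using that u by blast
qed

lemma lift_delta_mspace:
  fixes K Y :: "nat set"
  assumes w: "w \<in> mwords r k Y" and K: "finite K" "card K = k" "Y \<inter> K = {}"
  shows "lift r K Y (delta w) \<in> mspace (Suc r) k (Y \<union> K)"
proof -
  obtain u where u: "u \<in> mwords (Suc r) k (Y \<union> K)" "lift r K Y (delta w) = symm map_word K (delta u)"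
    using lift_delta[OF assms] by metis
  show ?thesis
    unfolding u(2) symm_delta using u(1)
    by (intro lin_space_sum[OF lin_space_mspace] delta_mspace mwords_map_word) (auto intro: permutes_subset)
qed

text \<open>Each of the \<open>k!\<close> labelled words contracts back to \<open>w\<close>.\<close>

lemma contract_lift_delta:
  fixes K Y :: "nat set"
  assumes w: "w \<in> mwords r k Y" and K: "finite K" "card K = k" "Y \<inter> K = {}"
  shows "contract K (lift r K Y (delta w)) = (\<lambda>v. fact k * delta w v)"
proof -
  obtain u where u: "u \<in> normal r K Y" "strip u = w" "lift r K Y (delta w) = symm map_word K (delta u)"
    using lift_delta[OF assms] by metis
  have perm: "map_word p u \<in> normal r K Y" "strip (map_word p u) = w" if p: "p permutes K" for p
  proof -
    have "p y = y" if "y \<in> Y" for y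
      using p K(3) that by (metis disjoint_iff permutes_not_in)
    then show "map_word p u \<in> normal r K Y" "strip (map_word p u) = w"
      using normal_map_word[OF _ _ u(1), of p] permutes_in_image[OF p] u(2) by auto
  qed
  have "contract K (symm map_word K (delta u)) = (\<lambda>v. \<Sum>p | p permutes K. contract K (delta (map_word p u)) v)"
    unfolding symm_delta using perm(1) by (intro contract_sum[where n = "Suc r" and X = "Y \<union> K"] delta_free_space normal_words) auto
  also have "\<dots> = (\<lambda>v. \<Sum>p | p permutes K. delta w v)"
    using contract_word_normal[OF K(1,3) perm(1)] perm(2) by (intro ext sum.cong) (simp_all add: contract_delta)
  also have "\<dots> = (\<lambda>v. fact k * delta w v)"
    using K by (simp add: card_permutations)
  finally show ?thesis
    by (simp add: u(3))
qed

text \<open>A permutation of \<open>Y\<close> fixes the letters of \<open>K\<close>, hence commutes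
  with sending them to \<open>x\<close>.\<close>

lemma contract_word_map_word:
  assumes q: "q permutes Y" "Y \<inter> K = {}"
  shows "contract_word K (map_word q w) = pact map_word q (contract_word K w)"
proof -
  have fixed: "q a = a" if "a \<in> K" for a
    using q that by (metis disjoint_iff permutes_not_in)
  have qK: "q a \<in> K \<longleftrightarrow> a \<in> K" for a
    using fixed permutes_inj[OF q(1)] by (metis injD)
  have x: "x_coeff K (delta (map_word q w)) = x_coeff K (delta w)" for w
  proof (cases w)
    case (Letter a)
    have "(if b = q a then 1 else 0 :: complex) = (if b = a then 1 else 0)" if "b \<in> K" for b
      using fixed qK that by metis
    then show ?thesis
      by (simp add: Letter x_coeff_def delta_def cong: sum.cong)
  qed simp
  have sb: "pact map_word q (semi_bracket cs us) = semi_bracket cs (map (pact map_word q) us)" for cs us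
    by (cases cs; cases us) (auto simp: pact_linear pact_bracket map_update)
  show ?thesis
  proof (induction w)
    case (Letter a)
    then show ?case
      using qK by (simp add: pact_linear pact_delta permutes_bij[OF q(1)])
  next
    case (Bracket ws)
    then have "map (\<lambda>w. contract_word K (map_word q w)) ws = map (\<lambda>w. pact map_word q (contract_word K w)) ws"
      by simp
    then show ?case
      by (simp only: contract_word.simps word.map list.map_comp comp_def x sb)
  qed
qed

section \<open>Linear extension to the multilinear spaces\<close>

context
  fixes r k :: nat and K Y :: "nat set"
  assumes r: "0 < r" and K: "finite K" "card K = k" and Y: "finite Y" "Y \<inter> K = {}"
begin

lemma contract_mspace_eq:
  assumes "v \<in> mspace (Suc r) k (Y \<union> K)"
  shows "contract K v = (\<lambda>u. \<Sum>w\<in>mwords (Suc r) k (Y \<union> K). v w * contract_word K w u)"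
  using assms finite_mwords[of "Y \<union> K"] K Y by (intro ext contract_eq_sum) (auto simp: mspace_def)

lemma contract_mspace:
  assumes "v \<in> mspace (Suc r) k (Y \<union> K)"
  shows "contract K v \<in> mspace r k Y"
  unfolding contract_mspace_eq[OF assms] using K Y r
  by (intro lin_space_lincomb[OF lin_space_mspace] contract_word_mspace)

lemma contract_pact:
  assumes q: "q permutes Y" and v: "v \<in> mspace (Suc r) k (Y \<union> K)"
  shows "contract K (pact map_word q v) = pact map_word q (contract K v)"
proof -
  let ?M = "mwords (Suc r) k (Y \<union> K)"
  have XY: "finite (Y \<union> K)"
    using K Y by simp
  have qX: "q permutes (Y \<union> K)"
    using q by (rule permutes_subset) simp
  have "pact map_word q v = pact map_word q (\<lambda>u. \<Sum>w\<in>?M. v w * delta w u)"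
    using mspace_expansion[OF XY v] by simp
  also have "\<dots> = (\<lambda>u. \<Sum>w\<in>?M. v w * delta (map_word q w) u)"
    by (simp add: pact_linear pact_delta permutes_bij[OF q])
  finally have "contract K (pact map_word q v) = (\<lambda>u. \<Sum>w\<in>?M. v w * contract K (delta (map_word q w)) u)"
    using mwords_map_word[OF qX] delta_mspace mspace_free_space[OF XY]
    by (subst contract_lincomb[symmetric]) (blast, simp)
  also have "\<dots> = pact map_word q (contract K v)"
    by (simp add: contract_mspace_eq[OF v] contract_delta contract_word_map_word[OF q Y(2)] pact_linear)
  finally show ?thesis .
qed

lemma lift_mspace_eq:
  assumes "v \<in> mspace r k Y"
  shows "lift r K Y v = (\<lambda>u. \<Sum>w\<in>mwords r k Y. v w * lift r K Y (delta w) u)"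
  by (subst mspace_expansion[OF Y(1) assms]) (simp only: lift_linear)

lemma lift_mspace:
  assumes "v \<in> mspace r k Y"
  shows "lift r K Y v \<in> mspace (Suc r) k (Y \<union> K)"
  unfolding lift_mspace_eq[OF assms]
  by (intro lin_space_lincomb[OF lin_space_mspace] lift_delta_mspace K Y)

lemma contract_lift:
  assumes "v \<in> mspace r k Y"
  shows "contract K (lift r K Y v) = (\<lambda>u. fact k * v u)"
proof -
  have "contract K (lift r K Y v) = (\<lambda>u. \<Sum>w\<in>mwords r k Y. v w * (fact k * delta w u))"
    unfolding lift_mspace_eq[OF assms]
  proof (subst contract_lincomb)
    show "lift r K Y (delta w) \<in> free_space (Suc r) (Y \<union> K)" if "w \<in> mwords r k Y" for w
      using lift_delta_mspace[OF that K Y(2)] mspace_free_space[of "Y \<union> K"] K Y by blast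
  qed (auto simp: contract_lift_delta K Y intro!: sum.cong)
  also have "\<dots> = (\<lambda>u. fact k * (\<Sum>w\<in>mwords r k Y. v w * delta w u))"
    by (simp add: sum_distrib_left mult.left_commute)
  also have "\<dots> = (\<lambda>u. fact k * v u)"
    using mspace_expansion[OF Y(1) assms] by (metis (mono_tags, lifting))
  finally show ?thesis .
qed

lemma lift_invariant:
  assumes "v \<in> mspace r k Y" "p permutes K"
  shows "pact map_word p (lift r K Y v) = lift r K Y v"
proof -
  have "pact map_word p (lift r K Y (delta w)) = lift r K Y (delta w)" if "w \<in> mwords r k Y" for w
    using lift_delta[OF that K Y(2)] pact_symm[OF functorial_map_word assms(2)] by metis
  then show ?thesis
    unfolding lift_mspace_eq[OF assms(1)] by (simp add: pact_linear)
qed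

text \<open>On invariants of \<open>K\<close> the symmetrization is multiplication by
  \<open>k!\<close>, so there lifting inverts contraction up to this factor.\<close>

lemma symm_lift_contract:
  assumes v: "v \<in> mspace (Suc r) k (Y \<union> K)"
  shows "(\<lambda>u. symm map_word K v u - lift r K Y (contract K v) u) \<in> filippov_ideal (Suc r) (Y \<union> K)"
proof -
  let ?M = "mwords (Suc r) k (Y \<union> K)"
  have XY: "finite (Y \<union> K)"
    using K Y by simp
  have "(\<lambda>u. \<Sum>w\<in>?M. v w * (symm map_word K (delta w) u - lift r K Y (contract_word K w) u)) \<in>
      filippov_ideal (Suc r) (Y \<union> K)"
    by (intro lin_space_lincomb[OF lin_space_ideal] symm_delta_lift[where k = k] K Y r)
  moreover have "symm map_word K v = (\<lambda>u. \<Sum>w\<in>?M. v w * symm map_word K (delta w) u)"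
    by (subst mspace_expansion[OF XY v]) (simp add: symm_linear)
  ultimately show ?thesis
    by (simp add: contract_mspace_eq[OF v] lift_linear right_diff_distrib sum_subtractf)
qed

end

section \<open>Quotients as orthogonal complements\<close>

lemma orth_unique:
  assumes U': "rep_space m a P U'" and U: "rep_space m a P U"
    and "v \<in> orth P U U'" "w \<in> orth P U U'" "(\<lambda>b. v b - w b) \<in> U'"
  shows "v = w"
proof -
  have "lin_space (orth P U U')"
    using rep_space_orth[OF U U'] by (simp add: rep_space_def)
  then have "(\<lambda>b. v b - w b) = (\<lambda>_. 0)"
    using orth_disjoint[OF U' assms(5)] lin_space_diff assms(3,4) by blast
  then show ?thesis
    by (simp add: fun_eq_iff)
qed

text \<open>\<open>\<Lambda>\<close> is, up to the factor \<open>c\<close> and modulo the subspaces, the inverse of \<open>\<Psi>\<close> on invariants.\<close>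

lemma sym_iso_fixed_quotient:
  fixes \<Psi> :: "('a \<Rightarrow> complex) \<Rightarrow> 'b \<Rightarrow> complex"
  assumes km: "k \<le> m" and M: "rep_space m a P M" and N: "rep_space m a P N" "N \<subseteq> M"
    and M': "rep_space (m - k) a' P' M'" and N': "rep_space (m - k) a' P' N'" "N' \<subseteq> M'"
    and \<Psi>: "\<And>v. v \<in> M \<Longrightarrow> \<Psi> v \<in> M'"
    and \<Psi>_add: "\<And>u v. u \<in> M \<Longrightarrow> v \<in> M \<Longrightarrow> \<Psi> (\<lambda>b. u b + v b) = (\<lambda>b. \<Psi> u b + \<Psi> v b)"
    and \<Psi>_scale: "\<And>c v. v \<in> M \<Longrightarrow> \<Psi> (\<lambda>b. c * v b) = (\<lambda>b. c * \<Psi> v b)"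
    and \<Psi>_act: "\<And>p v. p permutes {1..m - k} \<Longrightarrow> v \<in> M \<Longrightarrow> \<Psi> (pact a p v) = pact a' p (\<Psi> v)"
    and \<Psi>_N: "\<And>v. v \<in> N \<Longrightarrow> \<Psi> v \<in> N'"
    and \<Lambda>: "\<And>v. v \<in> M' \<Longrightarrow> \<Lambda> v \<in> fixed_space a {m - k + 1..m} M"
    and \<Lambda>_N: "\<And>v. v \<in> N' \<Longrightarrow> \<Lambda> v \<in> N"
    and c: "c \<noteq> 0" and \<Psi>\<Lambda>: "\<And>v. v \<in> M' \<Longrightarrow> \<Psi> (\<Lambda> v) = (\<lambda>b. c * v b)"
    and \<Lambda>\<Psi>: "\<And>v. v \<in> fixed_space a {m - k + 1..m} M \<Longrightarrow> (\<lambda>b. c * v b - \<Lambda> (\<Psi> v) b) \<in> N"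
  shows "sym_iso (m - k) (fun_rep a (fixed_space a {m - k + 1..m} (orth P M N))) (fun_rep a' (orth P' M' N'))"
proof -
  let ?K = "{m - k + 1..m}"
  let ?O = "orth P M N" and ?O' = "orth P' M' N'"
  let ?W = "fixed_space a ?K ?O"
  have W: "rep_space (m - k) a P ?W"
    using rep_space_fixed_space[OF rep_space_orth[OF M N(1)] km] .
  have O': "rep_space (m - k) a' P' ?O'"
    by (rule rep_space_orth[OF M' N'(1)])
  have lin: "lin_space M" "lin_space N" "lin_space M'" "lin_space N'" "lin_space ?O'" "lin_space ?W" "lin_space ?O"
    using M N(1) M' N'(1) O' W rep_space_orth[OF M N(1)] by (auto simp: rep_space_def)
  have WM: "v \<in> M" "v \<in> ?O" "v \<in> fixed_space a ?K M" if "v \<in> ?W" for v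
    using that by (auto simp: fixed_space_def orth_def)
  \<comment> \<open>The representative orthogonal to \<open>N'\<close> of the class of
    \<open>\<Psi> v\<close>; by \<open>f_eq\<close> it is unique, which yields linearity and
    equivariance.\<close>
  define f where "f v = (SOME w. w \<in> ?O' \<and> (\<lambda>b. \<Psi> v b - w b) \<in> N')" for v
  have f: "f v \<in> ?O'" "(\<lambda>b. \<Psi> v b - f v b) \<in> N'" if v: "v \<in> M" for v
  proof -
    obtain x w where "x \<in> N'" "w \<in> ?O'" "\<Psi> v = (\<lambda>b. x b + w b)"
      using orth_decomposition[OF M' N' \<Psi>[OF v]] by blast
    then have "\<exists>w. w \<in> ?O' \<and> (\<lambda>b. \<Psi> v b - w b) \<in> N'"
      by (intro exI[of _ w]) simp
    from someI_ex[OF this] show "f v \<in> ?O'" "(\<lambda>b. \<Psi> v b - f v b) \<in> N'"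
      unfolding f_def by blast+
  qed
  have f_eq: "f v = w" if "v \<in> M" "w \<in> ?O'" "(\<lambda>b. \<Psi> v b - w b) \<in> N'" for v w
    using orth_unique[OF N'(1) M' f(1)[OF that(1)] that(2)] lin_space_diff[OF lin(4) that(3) f(2)[OF that(1)]]
    by simp
  have inj: "u = v" if u: "u \<in> ?W" and v: "v \<in> ?W" and eq: "f u = f v" for u v
  proof -
    define d where "d = (\<lambda>b. u b - v b)"
    have d: "d \<in> ?W"
      unfolding d_def using u v by (rule lin_space_diff[OF lin(6)])
    have "\<Psi> d = (\<lambda>b. \<Psi> u b - \<Psi> v b)"
      using \<Psi>_add[of u "\<lambda>b. (-1) * v b"] \<Psi>_scale[of v "-1"] lin_space_scale[OF lin(1), of v "-1"] WM u v
      by (simp add: d_def)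
    then have "\<Psi> d \<in> N'"
      using lin_space_diff[OF lin(4) f(2)[OF WM(1)[OF u]] f(2)[OF WM(1)[OF v]]] eq by simp
    \<comment> \<open>The sum of \<open>c * d - \<Lambda> (\<Psi> d)\<close> and
      \<open>\<Lambda> (\<Psi> d)\<close>, both in \<open>N\<close>.\<close>
    then have "(\<lambda>b. c * d b) \<in> N"
      using lin_space_add[OF lin(2) \<Lambda>\<Psi>[OF WM(3)[OF d]] \<Lambda>_N[of "\<Psi> d"]] by simp
    then have "d \<in> N"
      using lin_space_scale[OF lin(2), of "\<lambda>b. c * d b" "inverse c"] c
      by (simp add: mult.assoc[symmetric])
    then show ?thesis
      using orth_unique[OF N(1) M WM(2)[OF u] WM(2)[OF v]] by (simp add: d_def)
  qed
  have surj: "\<exists>v\<in>?W. f v = w" if w: "w \<in> ?O'" for w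
  proof -
    have wM: "w \<in> M'"
      using w by (simp add: orth_def)
    \<comment> \<open>An invariant preimage of \<open>w\<close> under \<open>\<Psi>\<close>. Its
      component \<open>y\<close> orthogonal to \<open>N\<close> is again invariant, by uniqueness of
      such representatives, and has the same class because \<open>\<Psi>\<close> maps
      \<open>N\<close> into \<open>N'\<close>.\<close>
    define x where "x = (\<lambda>b. inverse c * \<Lambda> w b)"
    have \<Lambda>w: "\<Lambda> w \<in> M" "\<And>q. q permutes ?K \<Longrightarrow> pact a q (\<Lambda> w) = \<Lambda> w"
      using \<Lambda>[OF wM] by (auto simp: fixed_space_def)
    then have x: "x \<in> M" "\<And>q. q permutes ?K \<Longrightarrow> pact a q x = x"
      using lin_space_scale[OF lin(1)] by (auto simp: x_def pact_linear)
    have \<Psi>x: "\<Psi> x = w"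
      using \<Psi>_scale[OF \<Lambda>w(1)] \<Psi>\<Lambda>[OF wM] c by (simp add: x_def mult.assoc[symmetric])
    obtain z y where zy: "z \<in> N" "y \<in> ?O" "x = (\<lambda>b. z b + y b)"
      using orth_decomposition[OF M N x(1)] by metis
    have "pact a q y = y" if q: "q permutes ?K" for q
    proof (rule orth_unique[OF N(1) M])
      have q': "q permutes {1..m}"
        using q by (rule permutes_subset) auto
      show "pact a q y \<in> ?O"
        using rep_space_pact[OF rep_space_orth[OF M N(1)] q' zy(2)] .
      have "y = (\<lambda>b. x b - z b)"
        using zy(3) by (simp add: fun_eq_iff)
      then have "(\<lambda>b. pact a q y b - y b) = (\<lambda>b. z b - pact a q z b)"
        using x(2)[OF q] by (simp add: pact_linear)
      then show "(\<lambda>b. pact a q y b - y b) \<in> N"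
        using lin_space_diff[OF lin(2) zy(1) rep_space_pact[OF N(1) q' zy(1)]] by simp
    qed (rule zy(2))
    then have y: "y \<in> ?W"
      using zy(2) by (simp add: fixed_space_def)
    have "\<Psi> x = (\<lambda>b. \<Psi> z b + \<Psi> y b)"
      unfolding zy(3) using zy(1) N(2) WM(1)[OF y] by (intro \<Psi>_add) auto
    then have "(\<lambda>b. \<Psi> y b - w b) = (\<lambda>b. (-1) * \<Psi> z b)"
      using \<Psi>x by (auto simp: fun_eq_iff)
    then have "f y = w"
      using lin_space_scale[OF lin(4) \<Psi>_N[OF zy(1)], of "-1"] by (intro f_eq WM(1)[OF y] w) simp
    then show ?thesis
      using y by blast
  qed
  show ?thesis
  proof (rule sym_isoI[where f = f], unfold fun_rep_sel)
    show "sym_module (m - k) (fun_rep a ?W)"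
      by (rule rep_space_sym_module[OF W])
    show "bij_betw f ?W ?O'"
      unfolding bij_betw_def inj_on_def using inj surj f(1)[OF WM(1)] by blast
    have "\<Psi> (\<lambda>_. 0) = (\<lambda>_. 0)"
      using \<Psi>_scale[of "\<lambda>_. 0" 0] lin_space_zero[OF lin(1)] by simp
    then show "f (\<lambda>_. 0) = (\<lambda>_. 0)"
      using lin_space_zero[OF lin(1)] lin_space_zero[OF lin(4)] lin_space_zero[OF lin(5)] by (intro f_eq) simp_all
  next
    fix u v assume u: "u \<in> ?W" and v: "v \<in> ?W"
    show "f (\<lambda>b. u b + v b) = (\<lambda>b. f u b + f v b)"
    proof (rule f_eq)
      show "(\<lambda>b. u b + v b) \<in> M"
        using WM u v lin_space_add[OF lin(1)] by blast
      show "(\<lambda>b. f u b + f v b) \<in> ?O'"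
        using f(1) WM u v lin_space_add[OF lin(5)] by blast
      have "(\<lambda>b. (\<Psi> u b - f u b) + (\<Psi> v b - f v b)) \<in> N'"
        using f(2) WM u v by (intro lin_space_add[OF lin(4)]) blast+
      then show "(\<lambda>b. \<Psi> (\<lambda>b. u b + v b) b - (f u b + f v b)) \<in> N'"
        using \<Psi>_add WM u v by (simp add: algebra_simps)
    qed
  next
    fix e v assume v: "v \<in> ?W"
    show "f (\<lambda>b. e * v b) = (\<lambda>b. e * f v b)"
    proof (rule f_eq)
      show "(\<lambda>b. e * v b) \<in> M"
        using WM v lin_space_scale[OF lin(1)] by blast
      show "(\<lambda>b. e * f v b) \<in> ?O'"
        using f(1) WM v lin_space_scale[OF lin(5)] by blast
      show "(\<lambda>b. \<Psi> (\<lambda>b. e * v b) b - e * f v b) \<in> N'"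
        using \<Psi>_scale WM v lin_space_scale[OF lin(4) f(2), of v e] by (simp add: algebra_simps)
    qed
  next
    fix p v assume p: "p permutes {1..m - k}" and v: "v \<in> ?W"
    show "f (pact a p v) = pact a' p (f v)"
    proof (rule f_eq)
      show "pact a p v \<in> M"
        using WM(1) rep_space_pact[OF W p v] by blast
      show "pact a' p (f v) \<in> ?O'"
        using f(1)[OF WM(1)[OF v]] by (rule rep_space_pact[OF O' p])
      show "(\<lambda>b. \<Psi> (pact a p v) b - pact a' p (f v) b) \<in> N'"
        using rep_space_pact[OF N'(1) p f(2)[OF WM(1)[OF v]]] \<Psi>_act[OF p WM(1)[OF v]]
        by (simp add: pact_linear)
    qed
  qed
qed

section \<open>The multilinear component\<close>

declare One_nat_def [simp del]

lemma rep_space_mspace: "rep_space m map_word (mwords n k {1..m}) (mspace n k {1..m})"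
proof -
  have "map_word (inv' p) w \<in> mwords n k {1..m} \<Longrightarrow> w \<in> mwords n k {1..m}" if "p permutes {1..m}" for p w
    using mwords_map_word[OF that, of "map_word (inv' p) w" n k]
      functorial_cancel[OF functorial_map_word permutes_bij[OF that]] by simp
  then show ?thesis
    using mwords_map_word functorial_map_word finite_mwords[of "{1..m}" n k] lin_space_mspace[of n k "{1..m}"]
    by (auto simp: rep_space_def supported_def mspace_def pact_def)
qed

definition multilinear_ideal :: "nat \<Rightarrow> nat \<Rightarrow> nat set \<Rightarrow> (nat word \<Rightarrow> complex) set"
  where "multilinear_ideal n k X = filippov_ideal n X \<inter> mspace n k X"

lemma rep_space_multilinear_ideal:
  "rep_space m map_word (mwords n k {1..m}) (multilinear_ideal n k {1..m})"
proof -
  have "lin_space (multilinear_ideal n k {1..m})"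
    using lin_space_ideal[of n "{1..m}"] lin_space_mspace[of n k "{1..m}"]
    by (simp add: multilinear_ideal_def lin_space_def)
  then show ?thesis
    using rep_space_mspace[of m n k] pact_ideal[of _ "{1..m}" _ n]
    by (auto simp: rep_space_def supported_def multilinear_ideal_def)
qed

text \<open>The classes of multilinear elements modulo the ideal, each represented by its element
  orthogonal to the multilinear relations; this places the module among functions on a finite
  set.\<close>

definition rho_space :: "nat \<Rightarrow> nat \<Rightarrow> nat \<Rightarrow> (nat word \<Rightarrow> complex) set"
  where "rho_space m n k = orth (mwords n k {1..m}) (mspace n k {1..m}) (multilinear_ideal n k {1..m})"

lemma rep_space_rho_space: "rep_space m map_word (mwords n k {1..m}) (rho_space m n k)"
  unfolding rho_space_def by (intro rep_space_orth rep_space_mspace rep_space_multilinear_ideal)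

lemma multilinear_ideal_subset: "multilinear_ideal n k X \<subseteq> mspace n k X"
  by (simp add: multilinear_ideal_def)

text \<open>The symmetrization lies in the ideal by \<open>symm_mspace_ideal\<close>, and also in
  the complement of its multilinear part.\<close>

lemma rho_space_symm_eq_0:
  assumes A: "A \<subseteq> {1..m}" "card A = Suc k" and k: "0 < k" and u: "u \<in> rho_space m n k"
  shows "symm map_word A u = (\<lambda>_. 0)"
proof (rule orth_disjoint[OF rep_space_multilinear_ideal])
  show "symm map_word A u \<in> orth (mwords n k {1..m}) (mspace n k {1..m}) (multilinear_ideal n k {1..m})"
    using symm_in_space[OF rep_space_rho_space A(1) u] by (simp add: rho_space_def)
  then show "symm map_word A u \<in> multilinear_ideal n k {1..m}"
    using symm_mspace_ideal[OF _ A k, of u n] u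
    by (auto simp: multilinear_ideal_def rho_space_def orth_def)
qed

text \<open>Here \<open>m - k = k * (r - 1) + 1\<close> is the number of letters for arity
  \<open>r\<close>. The case \<open>r = 1\<close> is covered as well, with words in unary brackets
  on one letter.\<close>

lemma sym_iso_rho_space_contract:
  assumes r: "0 < r" and m: "m = k * r + 1"
  shows "sym_iso (m - k) (fun_rep map_word (fixed_space map_word {m - k + 1..m} (rho_space m (Suc r) k)))
    (fun_rep map_word (rho_space (m - k) r k))"
proof -
  define K where "K = {m - k + 1..m}"
  define Y where "Y = {1..m - k}"
  have km: "k \<le> m"
    using r m by (cases r) auto
  have X: "{1..m} = Y \<union> K"
    using km by (auto simp: Y_def K_def)
  have K: "finite K" "card K = k" and Y: "finite Y" "Y \<inter> K = {}"
    using km by (auto simp: Y_def K_def)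
  note ctx = r K Y
  show ?thesis
    unfolding rho_space_def
  proof (rule sym_iso_fixed_quotient[where \<Psi> = "contract K" and \<Lambda> = "lift r K Y" and c = "fact k"])
    fix u v c p
    let ?M = "mspace (Suc r) k {1..m}"
    let ?M' = "mspace r k {1..m - k}"
    have free: "?M \<subseteq> free_space (Suc r) {1..m}"
      by (rule mspace_free_space) simp
    show "contract K v \<in> ?M'" if "v \<in> ?M"
      using contract_mspace[OF ctx] that by (simp add: X Y_def)
    show "contract K (\<lambda>b. u b + v b) = (\<lambda>b. contract K u b + contract K v b)" if "u \<in> ?M" "v \<in> ?M"
      using that free by (intro contract_add) auto
    show "contract K (\<lambda>b. c * v b) = (\<lambda>b. c * contract K v b)" if "v \<in> ?M"
      using that free by (intro contract_scale) auto
    show "contract K (pact map_word p v) = pact map_word p (contract K v)"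
      if "p permutes {1..m - k}" "v \<in> ?M"
      using contract_pact[OF ctx] that by (simp add: X Y_def)
    show "contract K v \<in> multilinear_ideal r k {1..m - k}" if "v \<in> multilinear_ideal (Suc r) k {1..m}"
      using that contract_mspace[OF ctx] contract_ideal[of v r Y K] by (simp add: multilinear_ideal_def X Y_def)
    show lift: "lift r K Y v \<in> fixed_space map_word {m - k + 1..m} ?M" if "v \<in> ?M'"
      using lift_mspace[OF ctx] lift_invariant[OF ctx] that
      by (simp add: fixed_space_def X Y_def flip: K_def)
    show "lift r K Y v \<in> multilinear_ideal (Suc r) k {1..m}" if "v \<in> multilinear_ideal r k {1..m - k}"
      using that lift_mspace[OF ctx] lift_ideal[OF K(1) r, of v Y] by (simp add: multilinear_ideal_def X flip: Y_def)
    show "contract K (lift r K Y v) = (\<lambda>b. fact k * v b)" if "v \<in> ?M'"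
      using contract_lift[OF ctx] that by (simp add: Y_def)
    show "(\<lambda>b. fact k * v b - lift r K Y (contract K v) b) \<in> multilinear_ideal (Suc r) k {1..m}"
      if v: "v \<in> fixed_space map_word {m - k + 1..m} ?M"
    proof -
      have vM: "v \<in> mspace (Suc r) k (Y \<union> K)" "\<And>p. p permutes K \<Longrightarrow> pact map_word p v = v"
        using v by (simp_all add: fixed_space_def X flip: K_def)
      have "symm map_word K v = (\<lambda>b. fact k * v b)"
        using symm_invariant[of K map_word v, OF K(1) vM(2)] K(2) by simp
      moreover have "(\<lambda>b. fact k * v b - lift r K Y (contract K v) b) \<in> mspace (Suc r) k (Y \<union> K)"
        using vM(1) lift_mspace[OF ctx contract_mspace[OF ctx]]
        by (intro lin_space_diff[OF lin_space_mspace] lin_space_scale[OF lin_space_mspace])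
      ultimately show ?thesis
        using symm_lift_contract[OF ctx vM(1)] by (simp add: multilinear_ideal_def X)
    qed
  qed (use km in \<open>simp_all add: rep_space_mspace rep_space_multilinear_ideal multilinear_ideal_subset\<close>)
qed

text \<open>For arity at least 2 the number of letters determines the number of brackets, by
  \<open>length_letters\<close>.\<close>

lemma multilinear_space_eq_mspace:
  assumes "0 < r"
  shows "multilinear_space (Suc r) {1..k * r + 1} = mspace (Suc r) k {1..k * r + 1}"
proof -
  have "brackets w = k" if "w \<in> words (Suc r) {1..k * r + 1}" "distinct (letters w)"
    "set (letters w) = {1..k * r + 1}" for w
    using length_letters[OF that(1)] distinct_card[OF that(2)] that(3) assms by simp
  then have "v \<in> mspace (Suc r) k {1..k * r + 1}" if "v \<in> multilinear_space (Suc r) {1..k * r + 1}" for v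
    using that by (auto simp: multilinear_space_def mspace_def mwords_def free_space_def)
  moreover have "v \<in> multilinear_space (Suc r) {1..k * r + 1}" if "v \<in> mspace (Suc r) k {1..k * r + 1}" for v
    using that mspace_free_space[of "{1..k * r + 1}" "Suc r" k]
    by (auto simp: multilinear_space_def mspace_def mwords_def)
  ultimately show ?thesis
    by blast
qed

section \<open>Cosets of the ideal\<close>

lemma coset_iff: "x \<in> I +>\<^bsub>fun_rep a C\<^esub> v \<longleftrightarrow> (\<lambda>b. x b - v b) \<in> I"
proof
  assume "(\<lambda>b. x b - v b) \<in> I"
  then show "x \<in> I +>\<^bsub>fun_rep a C\<^esub> v"
    by (force simp: a_r_coset_def' fun_rep_sel)
qed (auto simp: a_r_coset_def' fun_rep_sel)

lemma coset_eq_iff: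
  assumes I: "lin_space I"
  shows "I +>\<^bsub>fun_rep a C\<^esub> u = I +>\<^bsub>fun_rep a C\<^esub> v \<longleftrightarrow> (\<lambda>b. u b - v b) \<in> I"
proof
  assume "I +>\<^bsub>fun_rep a C\<^esub> u = I +>\<^bsub>fun_rep a C\<^esub> v"
  then have "u \<in> I +>\<^bsub>fun_rep a C\<^esub> u \<longleftrightarrow> u \<in> I +>\<^bsub>fun_rep a C\<^esub> v"
    by simp
  then show "(\<lambda>b. u b - v b) \<in> I"
    using lin_space_zero[OF I] by (simp add: coset_iff)
next
  assume uv: "(\<lambda>b. u b - v b) \<in> I"
  have "(\<lambda>b. x b - u b) \<in> I \<longleftrightarrow> (\<lambda>b. x b - v b) \<in> I" for x
    using lin_space_add[OF I _ uv, of "\<lambda>b. x b - u b"] lin_space_diff[OF I _ uv, of "\<lambda>b. x b - v b"]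
    by auto
  then show "I +>\<^bsub>fun_rep a C\<^esub> u = I +>\<^bsub>fun_rep a C\<^esub> v"
    by (simp add: set_eq_iff coset_iff)
qed

lemma coset_add:
  assumes I: "lin_space I"
  shows "(I +>\<^bsub>fun_rep a C\<^esub> u) <+>\<^bsub>fun_rep a C\<^esub> (I +>\<^bsub>fun_rep a C\<^esub> v) = I +>\<^bsub>fun_rep a C\<^esub> (\<lambda>b. u b + v b)"
proof (rule Set.set_eqI)
  fix z
  have "z \<in> (I +>\<^bsub>fun_rep a C\<^esub> u) <+>\<^bsub>fun_rep a C\<^esub> (I +>\<^bsub>fun_rep a C\<^esub> v) \<longleftrightarrow>
      (\<exists>x y. (\<lambda>b. x b - u b) \<in> I \<and> (\<lambda>b. y b - v b) \<in> I \<and> z = (\<lambda>b. x b + y b))" (is "_ \<longleftrightarrow> ?P")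
    by (simp add: set_add_def' fun_rep_sel Bex_def coset_iff)
  also have "\<dots> \<longleftrightarrow> (\<lambda>b. z b - (u b + v b)) \<in> I"
  proof
    assume ?P
    then obtain x y where xy: "(\<lambda>b. x b - u b) \<in> I" "(\<lambda>b. y b - v b) \<in> I" "z = (\<lambda>b. x b + y b)"
      by blast
    show "(\<lambda>b. z b - (u b + v b)) \<in> I"
      using lin_space_add[OF I xy(1,2)] by (simp add: xy(3) algebra_simps)
  next
    assume "(\<lambda>b. z b - (u b + v b)) \<in> I"
    then show ?P
      using lin_space_zero[OF I] by (intro exI[of _ "\<lambda>b. z b - v b"] exI[of _ v]) (simp add: algebra_simps)
  qed
  finally show "z \<in> (I +>\<^bsub>fun_rep a C\<^esub> u) <+>\<^bsub>fun_rep a C\<^esub> (I +>\<^bsub>fun_rep a C\<^esub> v) \<longleftrightarrow>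
      z \<in> I +>\<^bsub>fun_rep a C\<^esub> (\<lambda>b. u b + v b)"
    by (simp add: coset_iff)
qed

text \<open>All multiples of representatives lie in one coset, so the union that defines scalar
  multiplication is that coset; taking whole cosets makes this right for the scalar 0 too.\<close>

lemma coset_scale:
  assumes I: "lin_space I"
  shows "(\<Union>x\<in>I +>\<^bsub>fun_rep a C\<^esub> v. I +>\<^bsub>fun_rep a C\<^esub> (\<lambda>b. c * x b)) = I +>\<^bsub>fun_rep a C\<^esub> (\<lambda>b. c * v b)"
proof -
  have eq: "I +>\<^bsub>fun_rep a C\<^esub> (\<lambda>b. c * x b) = I +>\<^bsub>fun_rep a C\<^esub> (\<lambda>b. c * v b)"
    if "x \<in> I +>\<^bsub>fun_rep a C\<^esub> v" for x
    using lin_space_scale[OF I, of "\<lambda>b. x b - v b" c] that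
    by (simp add: coset_eq_iff[OF I] coset_iff right_diff_distrib)
  moreover have "v \<in> I +>\<^bsub>fun_rep a C\<^esub> v"
    using lin_space_zero[OF I] by (simp add: coset_iff)
  ultimately show ?thesis
    by blast
qed

lemma coset_pact:
  assumes I: "pact a p ` I = I"
  shows "pact a p ` (I +>\<^bsub>fun_rep a C\<^esub> v) = I +>\<^bsub>fun_rep a C\<^esub> pact a p v"
proof (intro subset_antisym subsetI)
  fix z assume "z \<in> pact a p ` (I +>\<^bsub>fun_rep a C\<^esub> v)"
  then obtain x where x: "(\<lambda>b. x b - v b) \<in> I" "z = pact a p x"
    by (auto simp: coset_iff)
  then have "pact a p (\<lambda>b. x b - v b) \<in> I"
    using I by blast
  then show "z \<in> I +>\<^bsub>fun_rep a C\<^esub> pact a p v"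
    by (simp add: coset_iff x(2) pact_linear)
next
  fix z assume "z \<in> I +>\<^bsub>fun_rep a C\<^esub> pact a p v"
  then obtain i where i: "i \<in> I" "(\<lambda>b. z b - pact a p v b) = pact a p i"
    using I by (auto simp: coset_iff)
  have "z = pact a p (\<lambda>b. i b + v b)"
    by (simp add: pact_linear flip: i(2))
  moreover have "(\<lambda>b. i b + v b) \<in> I +>\<^bsub>fun_rep a C\<^esub> v"
    using i(1) by (simp add: coset_iff)
  ultimately show "z \<in> pact a p ` (I +>\<^bsub>fun_rep a C\<^esub> v)"
    by blast
qed

text \<open>Every class of a multilinear element contains exactly one element orthogonal to the
  multilinear relations.\<close>

lemma is_rho_rho_space:
  assumes r: "0 < r"
  shows "is_rho (Suc r) k (fun_rep map_word (rho_space (k * r + 1) (Suc r) k))"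
proof -
  let ?X = "{1..k * r + 1}" and ?V = "rho_space (k * r + 1) (Suc r) k"
  define I where "I = filippov_ideal (Suc r) ?X"
  define C where "C = free_space (Suc r) ?X"
  let ?F = "fun_rep map_word C :: (nat word \<Rightarrow> complex) sym_rep"
  have lin: "lin_space I"
    by (simp add: I_def lin_space_ideal)
  have comp: "multilinear_component (Suc r) ?X =
      rep_quotient ?F I \<lparr>carrier := {I +>\<^bsub>?F\<^esub> v | v. v \<in> mspace (Suc r) k ?X}\<rparr>"
    by (simp only: multilinear_component_def free_filippov_def multilinear_space_eq_mspace[OF r] I_def C_def)
  note sel = comp rep_quotient_def fun_rep_sel
  have V: "u \<in> mspace (Suc r) k ?X" "u \<in> C" if "u \<in> ?V" for u
    using that mspace_free_space[of ?X "Suc r" k] by (auto simp: rho_space_def orth_def C_def)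
  have "sym_iso (k * r + 1) (fun_rep map_word ?V) (multilinear_component (Suc r) ?X)"
  proof (rule sym_isoI[where f = "\<lambda>v. I +>\<^bsub>?F\<^esub> v"])
    show "sym_module (k * r + 1) (fun_rep map_word ?V)"
      by (rule rep_space_sym_module[OF rep_space_rho_space])
    have "inj_on (\<lambda>v. I +>\<^bsub>?F\<^esub> v) ?V"
    proof (rule inj_onI)
      fix u v assume u: "u \<in> ?V" and v: "v \<in> ?V" and "I +>\<^bsub>?F\<^esub> u = I +>\<^bsub>?F\<^esub> v"
      then have "(\<lambda>b. u b - v b) \<in> I"
        by (simp add: coset_eq_iff[OF lin])
      \<comment> \<open>The difference of two multilinear elements is multilinear, so a congruence
        between them is a multilinear relation.\<close>
      then have "(\<lambda>b. u b - v b) \<in> multilinear_ideal (Suc r) k ?X"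
        using lin_space_diff[OF lin_space_mspace V(1)[OF u] V(1)[OF v]]
        by (simp add: multilinear_ideal_def I_def)
      then show "u = v"
        using u v unfolding rho_space_def
        by (intro orth_unique[OF rep_space_multilinear_ideal rep_space_mspace])
    qed
    moreover have "\<exists>u\<in>?V. I +>\<^bsub>?F\<^esub> u = I +>\<^bsub>?F\<^esub> v" if v: "v \<in> mspace (Suc r) k ?X" for v
    proof -
      obtain x w where xw: "x \<in> multilinear_ideal (Suc r) k ?X" "w \<in> ?V" "v = (\<lambda>b. x b + w b)"
        using orth_decomposition[OF rep_space_mspace rep_space_multilinear_ideal multilinear_ideal_subset v]
        by (auto simp: rho_space_def)
      then have "x \<in> I"
        by (simp add: multilinear_ideal_def I_def)
      then have "I +>\<^bsub>?F\<^esub> v = I +>\<^bsub>?F\<^esub> w"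
        by (simp add: coset_eq_iff[OF lin] xw(3))
      then show ?thesis
        using xw(2) by metis
    qed
    ultimately show "bij_betw (\<lambda>v. I +>\<^bsub>?F\<^esub> v) (carrier (fun_rep map_word ?V))
        (carrier (multilinear_component (Suc r) ?X))"
      using V(1) unfolding sel bij_betw_def by (auto simp: image_iff, metis)
    show "I +>\<^bsub>?F\<^esub> \<zero>\<^bsub>fun_rep map_word ?V\<^esub> = \<zero>\<^bsub>multilinear_component (Suc r) ?X\<^esub>"
      by (auto simp: sel coset_iff)
  next
    fix u v :: "nat word \<Rightarrow> complex"
    show "I +>\<^bsub>?F\<^esub> (u \<oplus>\<^bsub>fun_rep map_word ?V\<^esub> v) =
      (I +>\<^bsub>?F\<^esub> u) \<oplus>\<^bsub>multilinear_component (Suc r) ?X\<^esub> (I +>\<^bsub>?F\<^esub> v)"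
      by (simp add: sel coset_add[OF lin])
  next
    fix c and v :: "nat word \<Rightarrow> complex"
    show "I +>\<^bsub>?F\<^esub> (c \<odot>\<^bsub>fun_rep map_word ?V\<^esub> v) =
      c \<odot>\<^bsub>multilinear_component (Suc r) ?X\<^esub> (I +>\<^bsub>?F\<^esub> v)"
      by (simp add: sel coset_scale[OF lin])
  next
    fix p v assume p: "p permutes ?X"
    have "pact map_word p ` I = I"
    proof
      show "pact map_word p ` I \<subseteq> I"
        using pact_ideal[OF p] by (auto simp: I_def)
      show "I \<subseteq> pact map_word p ` I"
      proof
        fix i assume "i \<in> I"
        then have "pact map_word (inv' p) i \<in> I"
          using pact_ideal[OF permutes_inv[OF p]] by (simp add: I_def)
        then show "i \<in> pact map_word p ` I"
          using pact_inv(1)[OF functorial_map_word permutes_bij[OF p], of i] by (metis image_eqI)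
      qed
    qed
    then show "I +>\<^bsub>?F\<^esub> act (fun_rep map_word ?V) p v =
      act (multilinear_component (Suc r) ?X) p (I +>\<^bsub>?F\<^esub> v)"
      by (simp add: sel coset_pact)
  qed
  then show ?thesis
    using r by (simp add: is_rho_def num_letters_def)
qed

section \<open>The case \<open>n = 1\<close>\<close>

text \<open>For a unary bracket the only permutation is the identity and the two sides of the Jacobi
  identity coincide, so there are no relations.\<close>

lemma filippov_ideal_1: "filippov_ideal 1 X = {\<lambda>_. 0}"
proof -
  have "v = (\<lambda>_. 0)" if "v \<in> filippov_ideal 1 X" for v
    using that
  proof (induction rule: filippov_ideal.induct)
    case (antisymmetry xs p)
    have "{..<1} = {0::nat}"
      by auto
    then have "p = id"
      using antisymmetry(3) by (simp add: permutes_sing)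
    then show ?case
      by (simp add: sign_id)
  next
    case (jacobi xs ys)
    then show ?case
      by (cases xs) (auto simp: fun_eq_iff)
  next
    case (bracket xs i v)
    then show ?case
      unfolding bracket.IH by (intro ext bracket_linear) simp
  qed simp_all
  then show ?thesis
    using filippov_ideal.zero by blast
qed

lemma mwords_1: "mwords 1 k {a} = {((\<lambda>w. Bracket [w]) ^^ k) (Letter a)}"
proof -
  have "w = ((\<lambda>w. Bracket [w]) ^^ brackets w) (Letter a)" if "w \<in> words 1 {a}" for w
    using that
  proof (induction rule: words.induct)
    case (2 ws)
    then show ?case
      by (cases ws) auto
  qed simp
  moreover have "((\<lambda>w. Bracket [w]) ^^ k) (Letter a) \<in> mwords 1 k {a}"
    by (induction k) (auto simp: mwords_def intro!: words.intros)
  ultimately show ?thesis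
    by (auto simp: mwords_def)
qed

lemma specht_space_1: "specht_space [1] = {\<lambda>T. if T = [{1}] then c else 0 |c. True}"
proof -
  let ?t = "\<lambda>x. if x = (0, 0) then 1 else undefined :: nat"
  have t: "?t \<in> tableaux [1]" "tabloid [1] ?t = [{1}]"
  proof -
    have "cells [1] = {(0, 0)}"
      by (auto simp: cells_def)
    then show "?t \<in> tableaux [1]"
      by (auto simp: tableaux_def bij_betw_def extensional_def)
  qed (auto simp: tabloid_def)
  have supp: "T = [{1}]" if T: "T \<in> tabs [1] {1..sum_list [1]}" for T
  proof -
    obtain A T' where "T = A # T'" "A \<subseteq> {1}" "card A = 1" "T' \<in> tabs [] ({1} - A)"
      using T by auto
    moreover from this have "A = {1}"
      by (auto elim!: card_1_singletonE)
    ultimately show ?thesis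
      by simp
  qed
  have v: "v T = (if T = [{1}] then v [{1}] else 0)" if "v \<in> specht_space [1]" for v T
  proof (cases "T = [{1}]")
    case False
    then have "v T = 0"
      using supp that rep_space_specht[of "[1]"] unfolding rep_space_def supported_def by blast
    then show ?thesis
      using False by simp
  qed simp
  have "(\<lambda>T. if T = [{1}] then c else 0) \<in> specht_space [1]" for c
  proof -
    have P: "polytabloid [1] ?t \<in> specht_space [1]"
      by (rule polytabloid_in_specht_space[OF t(1)])
    have "polytabloid [1] ?t T = (if T = [{1}] then 1 else 0)" for T
      using v[OF P, of T] polytabloid_self[OF t(1)] t(2) by simp
    then have "(\<lambda>T. if T = [{1}] then c else 0) = (\<lambda>T. c * polytabloid [1] ?t T)"
      by auto
    then show ?thesis
      using lin_space_scale[OF lin_space_specht P] by simp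
  qed
  moreover have "v = (\<lambda>T. if T = [{1}] then v [{1}] else 0)" if "v \<in> specht_space [1]" for v
    using v[OF that] by (intro ext)
  ultimately show ?thesis
    by blast
qed

text \<open>Without relations, the module is the line spanned by the \<open>k\<close>-fold nested
  unary bracket of the only letter; so the words reproduce the convention for arity 1.\<close>

lemma is_rho_1: "is_rho 1 k (fun_rep map_word (rho_space 1 1 k))"
proof -
  let ?V = "rho_space 1 1 k"
  define w where "w = ((\<lambda>w. Bracket [w]) ^^ k) (Letter (1::nat))"
  have V: "?V = {\<lambda>u. if u = w then c else 0 |c. True}"
  proof -
    have "?V = mspace 1 k {1}"
      using filippov_ideal_1[of "{1::nat}"] lin_space_zero[OF lin_space_mspace[of 1 k "{1::nat}"]]
      by (auto simp: rho_space_def orth_def multilinear_ideal_def ip_linear)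
    also have "\<dots> = {\<lambda>u. if u = w then c else 0 |c. True}"
      unfolding mspace_def mwords_1 w_def[symmetric] by (auto simp: fun_eq_iff)
    finally show ?thesis .
  qed
  have "sym_iso 1 (fun_rep map_word ?V) (specht [1])"
    unfolding specht_eq
  proof (rule sym_isoI[where f = "\<lambda>v T. if T = [{1}] then v w else 0"], unfold fun_rep_sel)
    show "sym_module 1 (fun_rep map_word ?V)"
      by (rule rep_space_sym_module[OF rep_space_rho_space])
    show "bij_betw (\<lambda>v T. if T = [{1}] then v w else 0) ?V (specht_space [1])"
      unfolding bij_betw_def
    proof
      show "inj_on (\<lambda>v T. if T = [{1}] then v w else 0) ?V"
      proof (rule inj_onI)
        fix u v assume "u \<in> ?V" "v \<in> ?V"
          and eq: "(\<lambda>T. if T = [{1}] then u w else 0) = (\<lambda>T. if T = [{1}] then v w else 0)"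
        then show "u = v"
          using fun_cong[OF eq, of "[{1}]"] by (auto simp: V)
      qed
      show "(\<lambda>v T. if T = [{1}] then v w else 0) ` ?V = specht_space [1]"
        unfolding specht_space_1 V by (force simp: image_def)
    qed
  next
    fix p and v :: "nat word \<Rightarrow> complex" assume "p permutes {1..1::nat}"
    then have "p = id"
      by (simp add: permutes_sing)
    show "(\<lambda>T. if T = [{1}] then pact map_word p v w else 0) =
        pact (\<lambda>p. map (image p)) p (\<lambda>T. if T = [{1}] then v w else 0)"
      unfolding \<open>p = id\<close> pact_id[OF functorial_map_word] pact_id[OF functorial_map_image] ..
  qed auto
  then show ?thesis
    by (simp add: is_rho_def num_letters_def)
qed

lemma sym_iso_specht_single: "sym_iso m (specht_sum [l]) (specht l)" if m: "sum_list l = m"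
proof (rule sym_isoI[where f = "\<lambda>x. x 0"])
  show "sym_module m (specht_sum [l])"
    using m by (intro sym_module_specht_sum) simp
  show "bij_betw (\<lambda>x. x 0) (carrier (specht_sum [l])) (carrier (specht l))"
    unfolding bij_betw_def specht_eq fun_rep_sel
  proof
    show "inj_on (\<lambda>x. x 0) (carrier (specht_sum [l]))"
      by (rule inj_onI) (auto simp: carrier_specht_sum_iff fun_eq_iff, metis neq0_conv)
    have "\<exists>x\<in>carrier (specht_sum [l]). y = x 0" if "y \<in> specht_space l" for y
      using that by (intro bexI[of _ "\<lambda>i. if i = 0 then y else undefined"]) (auto simp: carrier_specht_sum_iff)
    then show "(\<lambda>x. x 0) ` carrier (specht_sum [l]) = specht_space l"
      by (auto simp: carrier_specht_sum_iff image_iff)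
  qed
qed (simp_all add: specht_sum_apply specht_eq fun_rep_sel)

lemma is_rho_iso: "is_rho n k V \<Longrightarrow> sym_iso (num_letters n k) W V \<Longrightarrow> is_rho n k W"
  by (auto simp: is_rho_def intro: sym_iso_trans split: if_splits)

theorem theorem1p5:
  fixes n k :: nat
  assumes "n \<ge> 1" and "k \<ge> 1"
  shows "\<exists>(B :: specht_sum_rep) (C :: specht_sum_rep) ls.
    is_beta n k B \<and>
    decomposition (k * (n - 1) + 1) C ls \<and> (\<forall>l\<in>set ls. hd l \<le> k - 1) \<and>
    is_rho n k (rep_sum2 B C)"
proof (cases "n = 1")
  case True
  have one: "sym_iso 1 (specht_sum [[1]]) (specht [1])"
    by (rule sym_iso_specht_single) simp
  \<comment> \<open>For \<open>n = 1\<close> the first summand is everything, and the second is the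
    zero module with empty decomposition.\<close>
  have "sym_iso 1 (rep_sum2 (specht_sum [[1]]) (specht_sum [])) (specht_sum [[1]])"
    using sym_iso_specht_sum_append[of "[[1]]" "[]" 1] by simp
  then have "is_rho n k (rep_sum2 (specht_sum [[1]]) (specht_sum []))"
    using sym_iso_trans[OF _ one] True by (simp add: is_rho_def num_letters_def)
  moreover have "is_beta n k (specht_sum [[1]])" "decomposition (k * (n - 1) + 1) (specht_sum []) []"
    using True one sym_iso_refl[OF sym_module_specht_sum[of "[]" 1]]
    by (simp_all add: is_beta_def num_letters_def decomposition_def)
  ultimately show ?thesis
    by (metis empty_iff list.set(1))
next
  case False
  then obtain r where n: "n = Suc r" and r: "0 < r"
    using assms(1) by (cases n) auto
  define m where "m = k * r + 1"
  let ?K = "{m - k + 1..m}"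
  have km: "k \<le> m"
    using r by (cases r) (auto simp: m_def)
  have mk: "m - k = num_letters r k"
    using r by (cases r) (auto simp: m_def num_letters_def)
  \<comment> \<open>The concrete model is valid for every arity \<open>r\<close>, by the convention
    if \<open>r = 1\<close> and as a quotient otherwise.\<close>
  have rho: "is_rho r k (fun_rep map_word (rho_space (m - k) r k))"
  proof (cases "r = 1")
    case True
    then show ?thesis
      using is_rho_1 by (simp add: m_def)
  next
    case False
    then obtain s where "r = Suc s" "0 < s"
      using r by (cases r) auto
    then show ?thesis
      using is_rho_rho_space[of s k] by (simp add: m_def)
  qed
  obtain ls where ls: "decomposition (m - k) (fun_rep map_word (rho_space (m - k) r k)) ls"
    using decomposition_exists[OF rep_space_rho_space] by blast
  \<comment> \<open>The decomposition of the module of arity \<open>r\<close> is reused for the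
    invariants of \<open>K\<close>, so that the rows below the new first row are literally those of
    \<open>ls\<close>.\<close>
  have dec: "decomposition (m - k) (fun_rep map_word (fixed_space map_word ?K (rho_space m n k))) ls"
    using decomposition_iso[OF ls sym_iso_rho_space_contract[OF r m_def]] by (simp add: n)
  obtain ls' where ls': "\<forall>l\<in>set ls. partition_of m (k # l)" "\<forall>l\<in>set ls'. partition_of m l \<and> hd l \<le> k - 1"
    and iso: "sym_iso m (fun_rep map_word (rho_space m n k))
      (rep_sum2 (specht_sum (map ((#) k) ls)) (specht_sum ls'))"
  proof (rule decomposition_row_removal[OF rep_space_rho_space[of m n k] assms(2) km _ dec])
    show "symm map_word A u = (\<lambda>_. 0)" if "A \<subseteq> {1..m}" "card A = Suc k" "u \<in> rho_space m n k" for A u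
      using rho_space_symm_eq_0[OF that(1,2) _ that(3)] assms(2) by simp
  qed
  have "sym_iso (m - k) (specht_sum ls) (fun_rep map_word (rho_space (m - k) r k))"
    using ls by (simp add: decomposition_def sym_iso_sym[of "m - k" _ "specht_sum ls"])
  then have "is_rho r k (specht_sum ls)"
    by (intro is_rho_iso[OF rho]) (simp only: mk[symmetric])
  moreover have "\<forall>l\<in>set ls. partition_of (num_letters r k) l"
    using ls by (simp add: decomposition_def mk)
  moreover have "decomposition m (specht_sum (map ((#) k) ls)) (map ((#) k) ls)" "decomposition m (specht_sum ls') ls'"
    using ls' by (auto simp: decomposition_def partition_of_def intro!: sym_iso_refl sym_module_specht_sum)
  moreover have "is_rho n k (rep_sum2 (specht_sum (map ((#) k) ls)) (specht_sum ls'))"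
    using is_rho_iso[OF is_rho_rho_space[OF r, of k]] sym_iso_sym[OF iso] by (simp add: n m_def num_letters_def)
  ultimately have "is_beta n k (specht_sum (map ((#) k) ls))" "decomposition (k * (n - 1) + 1) (specht_sum ls') ls'"
    "is_rho n k (rep_sum2 (specht_sum (map ((#) k) ls)) (specht_sum ls'))"
    using r by (auto simp: is_beta_def num_letters_def n m_def)
  then show ?thesis
    using ls'(2) by blast
qed

end
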